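(* Let $\Bbbk$ be a field of characteristic zero and let $A=T(V)/(R)$ be a Koszul Artin-Schelter regular algebra over $\Bbbk$ of global dimension $d\ge 2$, with Nakayama automorphism $\xi$. Let $w$ be a nonzero element of $\bigcap_{i=0}^{d-2}V^{\otimes i}\otimes R\otimes V^{\otimes d-2-i}$. Then: (i) $A\cong A(w)$; (ii) $A[z;\xi]\cong A(\widehat{w})$, where $\widehat{w}\in (V\oplus\Bbbk z)^{\otimes d+1}$ is the superpotential $$\widehat{w}=\sum_{i=0}^d(-1)^i\tau_{d+1}^i\,(1\otimes\xi|_V^{\otimes i}\otimes 1^{\otimes d-i})(z\otimes w).$$
   Context: A quadratic algebra is $A=T(V)/(R)$ with $V$ finite dimensional and $R\subseteq V\otimes V$; it is Koszul if ${}_A\Bbbk$ has a graded projective resolution whose $n$-th term is generated in degree $n$ for all $n\ge0$. A connected graded algebra $A$ is AS-regular of global dimension $d$ if it has global dimension $d<\infty$, $\underline{\mathrm{Ext}}^i_A(\Bbbk,A)=0$ for $i\ne d$ and $\dim\underline{\mathrm{Ext}}^d_A(\Bbbk,A)=1$ (graded Ext). For $A$ Koszul AS-regular of global dimension $d$, the Nakayama automorphism $\xi$ is the graded automorphism with $\mathrm{Ext}^d_{A^e}(A,A\otimes A)\cong A_\xi(d)$ as graded $A$-bimodules, where $A^e=A\otimes A^{op}$, $A_\xi$ is $A$ with right action twisted by $\xi$ ($m*a=m\xi(a)$), and $A(d)_k=A_{d+k}$. In this case $\bigcap_{i=0}^{d-2}V^{\otimes i}\otimes R\otimes V^{\otimes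 d-2-i}$ is one-dimensional. $A[z;\xi]$ is the skew polynomial algebra with $za=\xi(a)z$, $z$ in degree 1. For a vector space $W$ let $\tau:W\otimes W\to W\otimes W$ be the flip. For $m\ge2$ set $\tau_m^0=1^{\otimes m}$ and $\tau_m^k=(1^{\otimes k-1}\otimes\tau\otimes1^{\otimes m-k-1})\tau_m^{k-1}$ for $1\le k\le m-1$ (so $\tau^k_m$ moves the first tensor factor to position $k+1$). Given a linear bijection $\sigma$ of $W$, $u\in W^{\otimes m}$ is a twisted superpotential of degree $m$ with respect to $\sigma$ if $u=(-1)^{m-1}\tau_m^{m-1}(\sigma\otimes1^{\otimes m-1})(u)$, and a superpotential if $\sigma=\mathrm{id}$. The element $w$ is a twisted superpotential of degree $d$ with respect to $\xi|_V$, and $\widehat w$ is a superpotential of degree $d+1$ (with $W=V\oplus\Bbbk z$). For a twisted superpotential $u\in W^{\otimes m}$ and $\Psi\in (W^* )^{\otimes k}$, $k\le m$, put $\partial_\Psi(u)=(1^{\otimes m-k}\otimes\Psi)(u)\in W^{\otimes m-k}$. The (quadratic) derivation quotient algebra of $u$ is $A(u)=T(W)/(\partial_\Psi(u):\Psi\in(W^* )^{\otimes m-2})$. *)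

theory Defs
  imports Complex_Main "HOL-Algebra.QuotRing" "HOL-Algebra.Module" "HOL-Algebra.Generated_Groups"
begin

section \<open>Graded algebras and graded modules\<close>

text \<open>
  One record type serves two purposes. A graded algebra over the field \<open>'k\<close> is a record of type
  \<open>('k, 'a) graded_module\<close> in which all ring operations are used and \<open>smult\<close> is the action of \<open>'k\<close>.
  A graded left module over a graded algebra with elements of type \<open>'a\<close> is a record of type
  \<open>('a, 'm) graded_module\<close> in which, as in \<^theory>\<open>HOL-Algebra.Module\<close>, the fields \<open>mult\<close> and \<open>one\<close>
  are irrelevant. In both cases \<open>homog M n\<close> is the homogeneous component of degree \<open>n\<close>.
  A right module over \<open>A\<close> is a left module over \<open>opp A\<close>.
\<close>

record ('r, 'm) graded_module = "('r, 'm) module" +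
  homog :: "int \<Rightarrow> 'm set"

definition opp :: "('k, 'a) graded_module \<Rightarrow> ('k, 'a) graded_module" where
  "opp A = A\<lparr>mult := (\<lambda>x y. y \<otimes>\<^bsub>A\<^esub> x)\<rparr>"

definition graded_alg_hom ::
  "('k, 'a) graded_module \<Rightarrow> ('k, 'b) graded_module \<Rightarrow> ('a \<Rightarrow> 'b) set" where
  "graded_alg_hom A B = {h \<in> ring_hom A B.
     (\<forall>c. \<forall>x\<in>carrier A. h (c \<odot>\<^bsub>A\<^esub> x) = c \<odot>\<^bsub>B\<^esub> h x) \<and>
     (\<forall>n. h ` homog A n \<subseteq> homog B n)}"

definition graded_alg_iso ::
  "('k, 'a) graded_module \<Rightarrow> ('k, 'b) graded_module \<Rightarrow> ('a \<Rightarrow> 'b) set" where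
  "graded_alg_iso A B = {h \<in> graded_alg_hom A B.
     h \<in> ring_iso A B \<and> (\<forall>n. h ` homog A n = homog B n)}"

text \<open>Cosets of \<open>I\<close> are added and multiplied as in \<^const>\<open>FactRing\<close>.\<close>

definition quot_alg :: "('k, 'a) graded_module \<Rightarrow> 'a set \<Rightarrow> ('k, 'a set) graded_module" where
  "quot_alg A I =
    \<lparr>carrier = carrier (A Quot I), mult = mult (A Quot I), one = one (A Quot I),
     zero = zero (A Quot I), add = add (A Quot I),
     smult = (\<lambda>c X. \<Union>x\<in>X. I +>\<^bsub>A\<^esub> (c \<odot>\<^bsub>A\<^esub> x)),
     homog = (\<lambda>n. (\<lambda>x. I +>\<^bsub>A\<^esub> x) ` homog A n)\<rparr>"

text \<open>For submodules \<open>B \<subseteq> Z\<close> of \<open>M\<close>, the graded module \<open>Z/B\<close>.\<close>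

definition subquotient ::
  "('r, 'm) graded_module \<Rightarrow> 'm set \<Rightarrow> 'm set \<Rightarrow> ('r, 'm set) graded_module" where
  "subquotient M Z B =
    \<lparr>carrier = (\<lambda>z. B +>\<^bsub>M\<^esub> z) ` Z, mult = undefined, one = undefined,
     zero = B, add = set_add M,
     smult = (\<lambda>a X. \<Union>x\<in>X. B +>\<^bsub>M\<^esub> (a \<odot>\<^bsub>M\<^esub> x)),
     homog = (\<lambda>n. (\<lambda>z. B +>\<^bsub>M\<^esub> z) ` (Z \<inter> homog M n))\<rparr>"

text \<open>The locale \<open>module\<close> of \<^theory>\<open>HOL-Algebra.Module\<close> requires a commutative ring.\<close>

locale left_module = R?: ring R + M?: abelian_group M
  for R :: "('a, 'r) ring_scheme" (structure) and M :: "('a, 'm, 'z) module_scheme" (structure) +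
  assumes smult_closed:
      "\<lbrakk>a \<in> carrier R; x \<in> carrier M\<rbrakk> \<Longrightarrow> a \<odot>\<^bsub>M\<^esub> x \<in> carrier M"
    and smult_l_distr:
      "\<lbrakk>a \<in> carrier R; b \<in> carrier R; x \<in> carrier M\<rbrakk> \<Longrightarrow>
        (a \<oplus>\<^bsub>R\<^esub> b) \<odot>\<^bsub>M\<^esub> x = a \<odot>\<^bsub>M\<^esub> x \<oplus>\<^bsub>M\<^esub> b \<odot>\<^bsub>M\<^esub> x"
    and smult_r_distr:
      "\<lbrakk>a \<in> carrier R; x \<in> carrier M; y \<in> carrier M\<rbrakk> \<Longrightarrow>
        a \<odot>\<^bsub>M\<^esub> (x \<oplus>\<^bsub>M\<^esub> y) = a \<odot>\<^bsub>M\<^esub> x \<oplus>\<^bsub>M\<^esub> a \<odot>\<^bsub>M\<^esub> y"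
    and smult_assoc1:
      "\<lbrakk>a \<in> carrier R; b \<in> carrier R; x \<in> carrier M\<rbrakk> \<Longrightarrow>
        (a \<otimes>\<^bsub>R\<^esub> b) \<odot>\<^bsub>M\<^esub> x = a \<odot>\<^bsub>M\<^esub> (b \<odot>\<^bsub>M\<^esub> x)"
    and smult_one:
      "x \<in> carrier M \<Longrightarrow> \<one>\<^bsub>R\<^esub> \<odot>\<^bsub>M\<^esub> x = x"

locale graded_left_module = left_module A M
  for A :: "('k, 'a) graded_module" (structure) and M :: "('a, 'm) graded_module" (structure) +
  assumes homog_subgroup: "subgroup (homog M n) (add_monoid M)"
    and homog_smult: "\<lbrakk>a \<in> homog A i; x \<in> homog M j\<rbrakk> \<Longrightarrow> a \<odot>\<^bsub>M\<^esub> x \<in> homog M (i + j)"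
    and homog_direct_sum:
      "x \<in> carrier M \<Longrightarrow>
        \<exists>!f. (\<forall>n. f n \<in> homog M n) \<and> finite {n. f n \<noteq> \<zero>\<^bsub>M\<^esub>} \<and>
             x = (\<Oplus>\<^bsub>M\<^esub>n\<in>{n. f n \<noteq> \<zero>\<^bsub>M\<^esub>}. f n)"

definition lin_maps ::
  "('a, 'r) ring_scheme \<Rightarrow> ('a, 'm, 'y) module_scheme \<Rightarrow> ('a, 'n, 'z) module_scheme \<Rightarrow> ('m \<Rightarrow> 'n) set"
  where
  "lin_maps A M N = {f \<in> carrier M \<rightarrow> carrier N.
     (\<forall>x\<in>carrier M. \<forall>y\<in>carrier M. f (x \<oplus>\<^bsub>M\<^esub> y) = f x \<oplus>\<^bsub>N\<^esub> f y) \<and>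
     (\<forall>a\<in>carrier A. \<forall>x\<in>carrier M. f (a \<odot>\<^bsub>M\<^esub> x) = a \<odot>\<^bsub>N\<^esub> f x)}"

definition graded_maps ::
  "('k, 'a) graded_module \<Rightarrow> ('a, 'm) graded_module \<Rightarrow> ('a, 'n) graded_module \<Rightarrow> ('m \<Rightarrow> 'n) set"
  where
  "graded_maps A M N = {f \<in> lin_maps A M N. \<forall>n. f ` homog M n \<subseteq> homog N n}"

definition generated_in_degree ::
  "('k, 'a) graded_module \<Rightarrow> ('a, 'm) graded_module \<Rightarrow> int \<Rightarrow> bool" where
  "generated_in_degree A M n \<longleftrightarrow>
     (\<forall>N. submodule N A M \<and> homog M n \<subseteq> N \<longrightarrow> N = carrier M)"


section \<open>Projective resolutions and global dimension\<close>

text \<open>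
  HOL formulas cannot quantify over types, so the modules that are quantified over (test modules for
  projectivity, terms of resolutions, modules tested for global dimension) have carriers contained in
  the type \<open>nat \<Rightarrow> 'a\<close>, where \<open>'a\<close> is the type of elements of the ring. This is no restriction:
  up to isomorphism these are all modules of cardinality at most that of \<open>nat \<Rightarrow> 'a\<close>. If the ring is
  nonzero this cardinal is infinite and at least that of the ring, so the class contains
  all cyclic modules and is closed under submodules, quotients and free covers. Hence the lifting
  property below is projectivity, every member of the class (and every module isomorphic to one) has a
  projective resolution in it, and by Auslander's theorem (the global dimension is the supremum of the
  projective dimensions of the cyclic modules) the number defined below is the left global dimension.
\<close>

definition projective :: "('a, 'r) ring_scheme \<Rightarrow> ('a, 'p, 'z) module_scheme \<Rightarrow> bool" where
  "projective A P \<longleftrightarrow> left_module A P \<and>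
     (\<forall>(M :: ('a, nat \<Rightarrow> 'a) module) (N :: ('a, nat \<Rightarrow> 'a) module).
        \<forall>g\<in>lin_maps A M N. \<forall>f\<in>lin_maps A P N.
          left_module A M \<and> left_module A N \<and> g ` carrier M = carrier N \<longrightarrow>
          (\<exists>h\<in>lin_maps A P M. \<forall>x\<in>carrier P. g (h x) = f x))"

text \<open>\<open>\<dots> \<rightarrow> P 2 \<rightarrow> P 1 \<rightarrow> P 0 \<rightarrow> M \<rightarrow> 0\<close>, where \<open>\<delta> n : P (n + 1) \<rightarrow> P n\<close> and \<open>\<epsilon> : P 0 \<rightarrow> M\<close>.\<close>

definition exact_resolution ::
  "('a, 'm, 'y) module_scheme \<Rightarrow> (nat \<Rightarrow> ('a, 'p, 'z) module_scheme) \<Rightarrow>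
   (nat \<Rightarrow> 'p \<Rightarrow> 'p) \<Rightarrow> ('p \<Rightarrow> 'm) \<Rightarrow> bool" where
  "exact_resolution M P \<delta> \<epsilon> \<longleftrightarrow>
     \<epsilon> ` carrier (P 0) = carrier M \<and>
     {x \<in> carrier (P 0). \<epsilon> x = \<zero>\<^bsub>M\<^esub>} = \<delta> 0 ` carrier (P 1) \<and>
     (\<forall>n. {x \<in> carrier (P (Suc n)). \<delta> n x = \<zero>\<^bsub>P n\<^esub>} = \<delta> (Suc n) ` carrier (P (Suc (Suc n))))"

definition projective_resolution ::
  "('a, 'r) ring_scheme \<Rightarrow> ('a, 'm, 'y) module_scheme \<Rightarrow> (nat \<Rightarrow> ('a, nat \<Rightarrow> 'a, 'z) module_scheme) \<Rightarrow>
   (nat \<Rightarrow> (nat \<Rightarrow> 'a) \<Rightarrow> (nat \<Rightarrow> 'a)) \<Rightarrow> ((nat \<Rightarrow> 'a) \<Rightarrow> 'm) \<Rightarrow> bool" where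
  "projective_resolution A M P \<delta> \<epsilon> \<longleftrightarrow>
     (\<forall>n. projective A (P n)) \<and> (\<forall>n. \<delta> n \<in> lin_maps A (P (Suc n)) (P n)) \<and>
     \<epsilon> \<in> lin_maps A (P 0) M \<and> exact_resolution M P \<delta> \<epsilon>"

text \<open>A graded module is projective as a graded module iff it is projective as a module.\<close>

definition graded_projective_resolution ::
  "('k, 'a) graded_module \<Rightarrow> ('a, 'm) graded_module \<Rightarrow> (nat \<Rightarrow> ('a, nat \<Rightarrow> 'a) graded_module) \<Rightarrow>
   (nat \<Rightarrow> (nat \<Rightarrow> 'a) \<Rightarrow> (nat \<Rightarrow> 'a)) \<Rightarrow> ((nat \<Rightarrow> 'a) \<Rightarrow> 'm) \<Rightarrow> bool" where
  "graded_projective_resolution A M P \<delta> \<epsilon> \<longleftrightarrow>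
     projective_resolution A M P \<delta> \<epsilon> \<and> (\<forall>n. graded_left_module A (P n)) \<and>
     (\<forall>n. \<delta> n \<in> graded_maps A (P (Suc n)) (P n)) \<and> \<epsilon> \<in> graded_maps A (P 0) M"

definition proj_dim_le ::
  "('a, 'r) ring_scheme \<Rightarrow> ('a, 'm, 'z) module_scheme \<Rightarrow> nat \<Rightarrow> bool" where
  "proj_dim_le A M d \<longleftrightarrow>
     (\<exists>(P :: nat \<Rightarrow> ('a, nat \<Rightarrow> 'a) module) \<delta> \<epsilon>.
        projective_resolution A M P \<delta> \<epsilon> \<and> (\<forall>n>d. carrier (P n) = {\<zero>\<^bsub>P n\<^esub>}))"

definition has_global_dim :: "('a, 'r) ring_scheme \<Rightarrow> nat \<Rightarrow> bool" where
  "has_global_dim A d \<longleftrightarrow>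
     (\<forall>M :: ('a, nat \<Rightarrow> 'a) module. left_module A M \<longrightarrow> proj_dim_le A M d) \<and>
     (\<forall>e<d. \<exists>M :: ('a, nat \<Rightarrow> 'a) module. left_module A M \<and> \<not> proj_dim_le A M e)"


section \<open>Graded Ext, Koszul and AS-regular algebras\<close>

text \<open>
  The graded \<open>Hom\<^sub>A(P, A)\<close>: the finite sums of homogeneous \<open>A\<close>-linear maps, with right
  \<open>A\<close>-action \<open>(f a)(x) = f(x) a\<close>. Maps are made extensional so that equality of maps is equality on
  the carrier.
\<close>

definition hom_deg ::
  "('k, 'a) graded_module \<Rightarrow> ('a, 'p) graded_module \<Rightarrow> int \<Rightarrow> ('p \<Rightarrow> 'a) set" where
  "hom_deg A P j = {f \<in> carrier P \<rightarrow>\<^sub>E carrier A.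
     (\<forall>x\<in>carrier P. \<forall>y\<in>carrier P. f (x \<oplus>\<^bsub>P\<^esub> y) = f x \<oplus>\<^bsub>A\<^esub> f y) \<and>
     (\<forall>a\<in>carrier A. \<forall>x\<in>carrier P. f (a \<odot>\<^bsub>P\<^esub> x) = a \<otimes>\<^bsub>A\<^esub> f x) \<and>
     (\<forall>n. f ` homog P n \<subseteq> homog A (n + j))}"

definition dual ::
  "('k, 'a) graded_module \<Rightarrow> ('a, 'p) graded_module \<Rightarrow> ('a, 'p \<Rightarrow> 'a) graded_module" where
  "dual A P =
    \<lparr>carrier = {\<lambda>x\<in>carrier P. \<Oplus>\<^bsub>A\<^esub>j\<in>S. F j x | S F. finite S \<and> (\<forall>j\<in>S. F j \<in> hom_deg A P j)},
     mult = undefined, one = undefined,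
     zero = (\<lambda>x\<in>carrier P. \<zero>\<^bsub>A\<^esub>),
     add = (\<lambda>f g. \<lambda>x\<in>carrier P. f x \<oplus>\<^bsub>A\<^esub> g x),
     smult = (\<lambda>a f. \<lambda>x\<in>carrier P. f x \<otimes>\<^bsub>A\<^esub> a),
     homog = hom_deg A P\<rparr>"

text \<open>
  If \<open>P, \<delta>\<close> is a graded projective resolution of \<open>M\<close>, then \<open>Ext A P \<delta> i\<close> is the graded right
  \<open>A\<close>-module \<open>Ext\<^sup>i\<^sub>A(M, A)\<close>. Up to isomorphism it does not depend on the resolution; below,
  statements about Ext are required for all resolutions.
\<close>

definition cocycles ::
  "('k, 'a) graded_module \<Rightarrow> (nat \<Rightarrow> ('a, 'p) graded_module) \<Rightarrow> (nat \<Rightarrow> 'p \<Rightarrow> 'p) \<Rightarrow> nat \<Rightarrow> ('p \<Rightarrow> 'a) set"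
  where
  "cocycles A P \<delta> i = {f \<in> carrier (dual A (P i)). \<forall>x\<in>carrier (P (Suc i)). f (\<delta> i x) = \<zero>\<^bsub>A\<^esub>}"

fun coboundaries ::
  "('k, 'a) graded_module \<Rightarrow> (nat \<Rightarrow> ('a, 'p) graded_module) \<Rightarrow> (nat \<Rightarrow> 'p \<Rightarrow> 'p) \<Rightarrow> nat \<Rightarrow> ('p \<Rightarrow> 'a) set"
  where
  "coboundaries A P \<delta> 0 = {\<zero>\<^bsub>dual A (P 0)\<^esub>}"
| "coboundaries A P \<delta> (Suc i) = (\<lambda>g. \<lambda>x\<in>carrier (P (Suc i)). g (\<delta> i x)) ` carrier (dual A (P i))"

definition Ext ::
  "('k, 'a) graded_module \<Rightarrow> (nat \<Rightarrow> ('a, 'p) graded_module) \<Rightarrow> (nat \<Rightarrow> 'p \<Rightarrow> 'p) \<Rightarrow> nat \<Rightarrow>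
   ('a, ('p \<Rightarrow> 'a) set) graded_module" where
  "Ext A P \<delta> i = subquotient (dual A (P i)) (cocycles A P \<delta> i) (coboundaries A P \<delta> i)"

text \<open>The trivial left module \<open>'k = A/A\<^sub>>\<^sub>0\<close> of a connected graded algebra, in degree 0.\<close>

definition augmentation :: "('k::field, 'a) graded_module \<Rightarrow> 'a \<Rightarrow> 'k" where
  "augmentation A a = (THE c. a \<ominus>\<^bsub>A\<^esub> (c \<odot>\<^bsub>A\<^esub> \<one>\<^bsub>A\<^esub>) \<in> Idl\<^bsub>A\<^esub> (\<Union>n\<in>{0<..}. homog A n))"

definition trivial_module :: "('k::field, 'a) graded_module \<Rightarrow> ('a, 'k) graded_module" where
  "trivial_module A =
    \<lparr>carrier = UNIV, mult = undefined, one = undefined, zero = 0, add = (+),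
     smult = (\<lambda>a c. augmentation A a * c),
     homog = (\<lambda>n. if n = 0 then UNIV else {0})\<rparr>"

definition koszul :: "('k::field, 'a) graded_module \<Rightarrow> bool" where
  "koszul A \<longleftrightarrow>
     (\<exists>P \<delta> \<epsilon>. graded_projective_resolution A (trivial_module A) P \<delta> \<epsilon> \<and>
              (\<forall>n. generated_in_degree A (P n) (int n)))"

text \<open>\<open>'k\<close> acts on an \<open>A\<close>-module through \<open>'k \<rightarrow> A\<close>.\<close>

definition one_dimensional ::
  "('k::field, 'a) graded_module \<Rightarrow> ('a, 'm) graded_module \<Rightarrow> bool" where
  "one_dimensional A M \<longleftrightarrow>
     (\<exists>e\<in>carrier M. e \<noteq> \<zero>\<^bsub>M\<^esub> \<and> (\<forall>x\<in>carrier M. \<exists>c::'k. x = (c \<odot>\<^bsub>A\<^esub> \<one>\<^bsub>A\<^esub>) \<odot>\<^bsub>M\<^esub> e))"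

definition AS_regular :: "('k::field, 'a) graded_module \<Rightarrow> nat \<Rightarrow> bool" where
  "AS_regular A d \<longleftrightarrow> has_global_dim A d \<and>
     (\<forall>P \<delta> \<epsilon>. graded_projective_resolution A (trivial_module A) P \<delta> \<epsilon> \<longrightarrow>
        (\<forall>i. i \<noteq> d \<longrightarrow> carrier (Ext A P \<delta> i) = {\<zero>\<^bsub>Ext A P \<delta> i\<^esub>}) \<and>
        one_dimensional A (Ext A P \<delta> d))"


section \<open>The enveloping algebra and the Nakayama automorphism\<close>

definition sgl :: "'i \<Rightarrow> 'i \<Rightarrow> 'k::field" where
  "sgl p = (\<lambda>q. if q = p then 1 else 0)"

text \<open>
  The tensor product of two algebras: the algebra with basis the symbols \<open>(a, b)\<close> (\<open>a \<in> A\<close>, \<open>b \<in> B\<close>)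
  and product \<open>(a, b)(a', b') = (a a', b b')\<close>, modulo the bilinearity relations.
\<close>

definition pre_tensor ::
  "('k::field, 'a) graded_module \<Rightarrow> ('k, 'b) graded_module \<Rightarrow> ('k, 'a \<times> 'b \<Rightarrow> 'k) graded_module" where
  "pre_tensor A B =
    \<lparr>carrier = {f. finite {p. f p \<noteq> 0} \<and> {p. f p \<noteq> 0} \<subseteq> carrier A \<times> carrier B},
     mult = (\<lambda>f g p. \<Sum>(q, r) \<in> {(q, r). f q \<noteq> 0 \<and> g r \<noteq> 0 \<and>
                 p = (fst q \<otimes>\<^bsub>A\<^esub> fst r, snd q \<otimes>\<^bsub>B\<^esub> snd r)}. f q * g r),
     one = sgl (\<one>\<^bsub>A\<^esub>, \<one>\<^bsub>B\<^esub>),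
     zero = (\<lambda>_. 0), add = (\<lambda>f g p. f p + g p),
     smult = (\<lambda>c f p. c * f p),
     homog = (\<lambda>n. {f. finite {p. f p \<noteq> 0} \<and>
                      {p. f p \<noteq> 0} \<subseteq> (\<Union>i. homog A i \<times> homog B (n - i))})\<rparr>"

definition bilinear_relations ::
  "('k::field, 'a) graded_module \<Rightarrow> ('k, 'b) graded_module \<Rightarrow> ('a \<times> 'b \<Rightarrow> 'k) set" where
  "bilinear_relations A B =
     {\<lambda>p. sgl (a \<oplus>\<^bsub>A\<^esub> a', b) p - sgl (a, b) p - sgl (a', b) p
        | a a' b. a \<in> carrier A \<and> a' \<in> carrier A \<and> b \<in> carrier B} \<union>
     {\<lambda>p. sgl (a, b \<oplus>\<^bsub>B\<^esub> b') p - sgl (a, b) p - sgl (a, b') p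
        | a b b'. a \<in> carrier A \<and> b \<in> carrier B \<and> b' \<in> carrier B} \<union>
     {\<lambda>p. sgl (c \<odot>\<^bsub>A\<^esub> a, b) p - c * sgl (a, b) p | c a b. a \<in> carrier A \<and> b \<in> carrier B} \<union>
     {\<lambda>p. sgl (a, c \<odot>\<^bsub>B\<^esub> b) p - c * sgl (a, b) p | c a b. a \<in> carrier A \<and> b \<in> carrier B}"

definition bilinear_ideal ::
  "('k::field, 'a) graded_module \<Rightarrow> ('k, 'b) graded_module \<Rightarrow> ('a \<times> 'b \<Rightarrow> 'k) set" where
  "bilinear_ideal A B = Idl\<^bsub>pre_tensor A B\<^esub> (bilinear_relations A B)"

definition tensor_alg ::
  "('k::field, 'a) graded_module \<Rightarrow> ('k, 'b) graded_module \<Rightarrow> ('k, ('a \<times> 'b \<Rightarrow> 'k) set) graded_module"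
  where
  "tensor_alg A B = quot_alg (pre_tensor A B) (bilinear_ideal A B)"

definition pure_tensor ::
  "('k::field, 'a) graded_module \<Rightarrow> ('k, 'b) graded_module \<Rightarrow> 'a \<Rightarrow> 'b \<Rightarrow> ('a \<times> 'b \<Rightarrow> 'k) set" where
  "pure_tensor A B a b = bilinear_ideal A B +>\<^bsub>pre_tensor A B\<^esub> sgl (a, b)"

definition env :: "('k::field, 'a) graded_module \<Rightarrow> ('k, ('a \<times> 'a \<Rightarrow> 'k) set) graded_module" where
  "env A = tensor_alg A (opp A)"

text \<open>
  \<open>A\<close> as a left \<open>A\<^sup>e\<close>-module: \<open>(a \<otimes> b) m = a m b\<close>. The action of a class in \<open>A\<^sup>e\<close> is computed from
  any representative \<open>\<Sum> c\<^sub>a\<^sub>b (a, b)\<close>, on which it does not depend.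
\<close>

definition env_regular ::
  "('k::field, 'a) graded_module \<Rightarrow> (('a \<times> 'a \<Rightarrow> 'k) set, 'a) graded_module" where
  "env_regular A =
    \<lparr>carrier = carrier A, mult = mult A, one = one A, zero = zero A, add = add A,
     smult = (\<lambda>X m. let f = (SOME f. f \<in> X) in
               \<Oplus>\<^bsub>A\<^esub>p\<in>{p. f p \<noteq> 0}. f p \<odot>\<^bsub>A\<^esub> (fst p \<otimes>\<^bsub>A\<^esub> m \<otimes>\<^bsub>A\<^esub> snd p)),
     homog = homog A\<rparr>"

text \<open>Graded bimodules: the left action is \<open>smult\<close>, the right action \<open>ract M x a\<close> is \<open>x \<cdot> a\<close>.\<close>

record ('a, 'm) graded_bimodule = "('a, 'm) graded_module" +
  ract :: "'m \<Rightarrow> 'a \<Rightarrow> 'm"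

definition graded_bimodule_iso ::
  "('k, 'a) graded_module \<Rightarrow> ('a, 'm) graded_bimodule \<Rightarrow> ('a, 'n) graded_bimodule \<Rightarrow> ('m \<Rightarrow> 'n) set"
  where
  "graded_bimodule_iso A M N = {h. bij_betw h (carrier M) (carrier N) \<and>
     (\<forall>x\<in>carrier M. \<forall>y\<in>carrier M. h (x \<oplus>\<^bsub>M\<^esub> y) = h x \<oplus>\<^bsub>N\<^esub> h y) \<and>
     (\<forall>a\<in>carrier A. \<forall>x\<in>carrier M. h (a \<odot>\<^bsub>M\<^esub> x) = a \<odot>\<^bsub>N\<^esub> h x) \<and>
     (\<forall>a\<in>carrier A. \<forall>x\<in>carrier M. h (ract M x a) = ract N (h x) a) \<and>
     (\<forall>n. h ` homog M n = homog N n)}"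

text \<open>
  A right \<open>A\<^sup>e\<close>-module, i.e. a left \<open>opp (env A)\<close>-module \<open>E\<close>, as an \<open>A\<close>-bimodule:
  \<open>a \<cdot> x \<cdot> b = x (b \<otimes> a)\<close>. For \<open>E = A\<^sup>e\<close> this is the inner structure
  \<open>a \<cdot> (p \<otimes> q) \<cdot> b = p b \<otimes> a q\<close> on \<open>A \<otimes> A\<close>, which commutes with the left \<open>A\<^sup>e\<close>-module
  structure \<open>(a \<otimes> b)(p \<otimes> q) = a p \<otimes> q b\<close>.
\<close>

definition bimodule_of ::
  "('k::field, 'a) graded_module \<Rightarrow> (('a \<times> 'a \<Rightarrow> 'k) set, 'm) graded_module \<Rightarrow> ('a, 'm) graded_bimodule"
  where
  "bimodule_of A E =
    \<lparr>carrier = carrier E, mult = mult E, one = one E, zero = zero E, add = add E,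
     smult = (\<lambda>a x. pure_tensor A (opp A) \<one>\<^bsub>A\<^esub> a \<odot>\<^bsub>E\<^esub> x),
     homog = homog E,
     ract = (\<lambda>x b. pure_tensor A (opp A) b \<one>\<^bsub>A\<^esub> \<odot>\<^bsub>E\<^esub> x)\<rparr>"

text \<open>The bimodule \<open>A\<^sub>\<xi>(d)\<close>.\<close>

definition twisted_shift ::
  "('k, 'a) graded_module \<Rightarrow> ('a \<Rightarrow> 'a) \<Rightarrow> int \<Rightarrow> ('a, 'a) graded_bimodule" where
  "twisted_shift A \<xi> d =
    \<lparr>carrier = carrier A, mult = mult A, one = one A, zero = zero A, add = add A,
     smult = (\<lambda>a x. a \<otimes>\<^bsub>A\<^esub> x),
     homog = (\<lambda>n. homog A (d + n)),
     ract = (\<lambda>x b. x \<otimes>\<^bsub>A\<^esub> \<xi> b)\<rparr>"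

definition nakayama_automorphism ::
  "('k::field, 'a) graded_module \<Rightarrow> nat \<Rightarrow> ('a \<Rightarrow> 'a) \<Rightarrow> bool" where
  "nakayama_automorphism A d \<xi> \<longleftrightarrow> \<xi> \<in> graded_alg_iso A A \<and>
     (\<forall>P \<delta> \<epsilon>. graded_projective_resolution (env A) (env_regular A) P \<delta> \<epsilon> \<longrightarrow>
        graded_bimodule_iso A (bimodule_of A (Ext (env A) P \<delta> d)) (twisted_shift A \<xi> (int d)) \<noteq> {})"


section \<open>Skew polynomial algebras\<close>

text \<open>
  \<open>A[z; \<xi>]\<close> with \<open>z a = \<xi>(a) z\<close> and \<open>z\<close> in degree 1; the function \<open>f\<close> stands for \<open>\<Sum>\<^sub>i f\<^sub>i z\<^sup>i\<close>, so
  \<open>(a z\<^sup>i)(b z\<^sup>j) = a \<xi>\<^sup>i(b) z\<^sup>i\<^sup>+\<^sup>j\<close>.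
\<close>

definition skew_poly ::
  "('k, 'a) graded_module \<Rightarrow> ('a \<Rightarrow> 'a) \<Rightarrow> ('k, nat \<Rightarrow> 'a) graded_module" where
  "skew_poly A \<xi> =
    \<lparr>carrier = {f. (\<forall>i. f i \<in> carrier A) \<and> finite {i. f i \<noteq> \<zero>\<^bsub>A\<^esub>}},
     mult = (\<lambda>f g n. \<Oplus>\<^bsub>A\<^esub>i\<in>{..n}. f i \<otimes>\<^bsub>A\<^esub> (\<xi> ^^ i) (g (n - i))),
     one = (\<lambda>i. if i = 0 then \<one>\<^bsub>A\<^esub> else \<zero>\<^bsub>A\<^esub>),
     zero = (\<lambda>_. \<zero>\<^bsub>A\<^esub>), add = (\<lambda>f g i. f i \<oplus>\<^bsub>A\<^esub> g i),
     smult = (\<lambda>c f i. c \<odot>\<^bsub>A\<^esub> f i),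
     homog = (\<lambda>n. {f. (\<forall>i. f i \<in> homog A (n - int i)) \<and> finite {i. f i \<noteq> \<zero>\<^bsub>A\<^esub>}})\<rparr>"


section \<open>Tensor algebras and quadratic algebras\<close>

text \<open>
  A finite-dimensional space \<open>V\<close> with chosen basis \<open>(x\<^sub>i)\<close> indexed by the finite type \<open>'n\<close> is
  \<open>'n \<Rightarrow> 'k\<close>, and \<open>T(V)\<close> has the words in the \<open>x\<^sub>i\<close> as basis: an element of \<open>T(V)\<close> is the finitely
  supported function giving the coefficient of each word \<open>x\<^sub>i\<^sub>1 \<otimes> \<dots> \<otimes> x\<^sub>i\<^sub>m\<close>.
\<close>

definition tensors :: "nat \<Rightarrow> ('n::finite list \<Rightarrow> 'k::field) set" where
  "tensors m = {u. \<forall>s. length s \<noteq> m \<longrightarrow> u s = 0}"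

definition tensor_algebra :: "('k::field, 'n::finite list \<Rightarrow> 'k) graded_module" where
  "tensor_algebra =
    \<lparr>carrier = {f. finite {s. f s \<noteq> 0}},
     mult = (\<lambda>f g s. \<Sum>i\<le>length s. f (take i s) * g (drop i s)),
     one = sgl [],
     zero = (\<lambda>_. 0), add = (\<lambda>f g s. f s + g s),
     smult = (\<lambda>c f s. c * f s),
     homog = (\<lambda>n. if n < 0 then {\<lambda>_. 0} else tensors (nat n))\<rparr>"

definition quadratic_relations :: "('n::finite list \<Rightarrow> 'k::field) set \<Rightarrow> bool" where
  "quadratic_relations R \<longleftrightarrow> R \<subseteq> tensors 2 \<and> (\<lambda>_. 0) \<in> R \<and>
     (\<forall>f\<in>R. \<forall>g\<in>R. (\<lambda>s. f s + g s) \<in> R) \<and> (\<forall>c. \<forall>f\<in>R. (\<lambda>s. c * f s) \<in> R)"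

definition presented_alg ::
  "('n::finite list \<Rightarrow> 'k::field) set \<Rightarrow> ('k, ('n list \<Rightarrow> 'k) set) graded_module" where
  "presented_alg R = quot_alg tensor_algebra (Idl\<^bsub>tensor_algebra\<^esub> R)"

text \<open>
  \<open>V\<^sup>\<otimes>\<^sup>i \<otimes> R \<otimes> V\<^sup>\<otimes>\<^sup>j\<close>, spanned by the products \<open>p \<otimes> r \<otimes> q\<close>; the set of these products is closed
  under scalars, so additive generation suffices.
\<close>

definition relation_slot ::
  "('n::finite list \<Rightarrow> 'k::field) set \<Rightarrow> nat \<Rightarrow> nat \<Rightarrow> ('n list \<Rightarrow> 'k) set" where
  "relation_slot R i j = generate (add_monoid tensor_algebra)
     {p \<otimes>\<^bsub>tensor_algebra\<^esub> r \<otimes>\<^bsub>tensor_algebra\<^esub> q | p r q. p \<in> tensors i \<and> r \<in> R \<and> q \<in> tensors j}"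

definition vec_tensor :: "('n::finite \<Rightarrow> 'k::field) \<Rightarrow> 'n list \<Rightarrow> 'k" where
  "vec_tensor v s = (case s of [i] \<Rightarrow> v i | _ \<Rightarrow> 0)"

text \<open>The restriction to \<open>V = A\<^sub>1\<close> of a graded endomorphism \<open>\<xi>\<close> of \<open>A = T(V)/(R)\<close>, \<open>R \<subseteq> V \<otimes> V\<close>.\<close>

definition restrict_V ::
  "('n::finite list \<Rightarrow> 'k::field) set \<Rightarrow> (('n list \<Rightarrow> 'k) set \<Rightarrow> ('n list \<Rightarrow> 'k) set) \<Rightarrow>
   ('n \<Rightarrow> 'k) \<Rightarrow> ('n \<Rightarrow> 'k)" where
  "restrict_V R \<xi> v = (THE u.
     \<xi> (Idl\<^bsub>tensor_algebra\<^esub> R +>\<^bsub>tensor_algebra\<^esub> vec_tensor v) =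
        Idl\<^bsub>tensor_algebra\<^esub> R +>\<^bsub>tensor_algebra\<^esub> vec_tensor u)"


section \<open>Twisted superpotentials and derivation quotient algebras\<close>

text \<open>\<open>f\<^sub>1 \<otimes> \<dots> \<otimes> f\<^sub>m\<close> on \<open>W\<^sup>\<otimes>\<^sup>m\<close>, where \<open>f (sgl j) i\<close> is the \<open>(i, j)\<close> entry of the matrix of \<open>f\<close>.\<close>

definition tensor_map ::
  "(('n::finite \<Rightarrow> 'k::field) \<Rightarrow> ('n \<Rightarrow> 'k)) list \<Rightarrow> ('n list \<Rightarrow> 'k) \<Rightarrow> 'n list \<Rightarrow> 'k" where
  "tensor_map fs u s =
     (if length s = length fs
      then \<Sum>t | length t = length fs. (\<Prod>k<length fs. (fs ! k) (sgl (t ! k)) (s ! k)) * u t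
      else 0)"

text \<open>\<open>1\<^sup>\<otimes>\<^sup>k\<^sup>-\<^sup>1 \<otimes> \<tau> \<otimes> 1\<^sup>\<otimes>\<^sup>m\<^sup>-\<^sup>k\<^sup>-\<^sup>1\<close> on \<open>W\<^sup>\<otimes>\<^sup>m\<close> for any \<open>m > k\<close>, where \<open>k \<ge> 1\<close>.\<close>

definition flip_at :: "nat \<Rightarrow> ('n::finite list \<Rightarrow> 'k::field) \<Rightarrow> 'n list \<Rightarrow> 'k" where
  "flip_at k u s = (if k < length s then u (s[k - 1 := s ! k, k := s ! (k - 1)]) else u s)"

text \<open>\<open>\<tau>\<^sub>m\<^sup>k\<close> on \<open>W\<^sup>\<otimes>\<^sup>m\<close> for any \<open>m > k\<close>.\<close>

fun tau :: "nat \<Rightarrow> ('n::finite list \<Rightarrow> 'k::field) \<Rightarrow> 'n list \<Rightarrow> 'k" where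
  "tau 0 u = u"
| "tau (Suc k) u = flip_at (Suc k) (tau k u)"

definition twisted_superpotential ::
  "nat \<Rightarrow> (('n::finite \<Rightarrow> 'k::field) \<Rightarrow> ('n \<Rightarrow> 'k)) \<Rightarrow> ('n list \<Rightarrow> 'k) \<Rightarrow> bool" where
  "twisted_superpotential m \<sigma> u \<longleftrightarrow> u \<in> tensors m \<and>
     u = (\<lambda>s. (-1) ^ (m - 1) * tau (m - 1) (tensor_map (\<sigma> # replicate (m - 1) id) u) s)"

abbreviation superpotential :: "nat \<Rightarrow> ('n::finite list \<Rightarrow> 'k::field) \<Rightarrow> bool" where
  "superpotential m \<equiv> twisted_superpotential m id"

text \<open>
  \<open>\<partial>\<^sub>\<Psi>(u) = (1 \<otimes> \<Psi>)(u)\<close> for \<open>\<Psi> \<in> (W\<^sup>*)\<^sup>\<otimes>\<^sup>k\<close>, the latter given by its coordinates \<open>\<Psi> \<in> tensors k\<close>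
  with respect to the dual basis.
\<close>

definition contract ::
  "nat \<Rightarrow> ('n::finite list \<Rightarrow> 'k::field) \<Rightarrow> ('n list \<Rightarrow> 'k) \<Rightarrow> 'n list \<Rightarrow> 'k" where
  "contract k \<Psi> u s = (\<Sum>t | length t = k. \<Psi> t * u (s @ t))"

definition derivation_quotient ::
  "nat \<Rightarrow> ('n::finite list \<Rightarrow> 'k::field) \<Rightarrow> ('k, ('n list \<Rightarrow> 'k) set) graded_module" where
  "derivation_quotient m u = presented_alg {contract (m - 2) \<Psi> u | \<Psi>. \<Psi> \<in> tensors (m - 2)}"

text \<open>
  \<open>W = V \<oplus> 'k z\<close> has basis indexed by \<open>'n option\<close>, with \<open>z\<close> at the index \<open>None\<close>; \<open>embed_W\<close> is the inclusion
  \<open>T(V) \<subseteq> T(W)\<close>, and \<open>extend_W \<sigma>\<close> is \<open>\<sigma>\<close> on \<open>V\<close> and fixes \<open>z\<close>. In \<open>w_hat\<close> the factors \<open>\<sigma>\<close> act on tensor factors in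
  \<open>V\<close> only, so the value of the extension at \<open>z\<close> plays no role.
\<close>

definition embed_W :: "('n::finite list \<Rightarrow> 'k::field) \<Rightarrow> 'n option list \<Rightarrow> 'k" where
  "embed_W u s = (if None \<in> set s then 0 else u (map the s))"

definition extend_W ::
  "(('n::finite \<Rightarrow> 'k::field) \<Rightarrow> ('n \<Rightarrow> 'k)) \<Rightarrow> ('n option \<Rightarrow> 'k) \<Rightarrow> ('n option \<Rightarrow> 'k)" where
  "extend_W \<sigma> v = (\<lambda>x. case x of None \<Rightarrow> v None | Some i \<Rightarrow> \<sigma> (\<lambda>j. v (Some j)) i)"

definition w_hat ::
  "nat \<Rightarrow> (('n::finite \<Rightarrow> 'k::field) \<Rightarrow> ('n \<Rightarrow> 'k)) \<Rightarrow> ('n list \<Rightarrow> 'k) \<Rightarrow> 'n option list \<Rightarrow> 'k" where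
  "w_hat d \<sigma> w s = (\<Sum>i=0..d. (-1) ^ i *
     tau i (tensor_map (id # replicate i (extend_W \<sigma>) @ replicate (d - i) id)
              (sgl [None] \<otimes>\<^bsub>tensor_algebra\<^esub> embed_W w)) s)"

end

theory Submission imports Defs begin

text \<open>Let \<open>W n\<close> be the intersection of the \<open>V\<^sup>i \<otimes> R \<otimes> V\<^sup>j\<close> with \<open>i + j + 2 = n\<close>. Comparing with the given linear
 resolution shows that the Koszul complex with terms \<open>A \<otimes> W n\<close> resolves the trivial module. AS-regularity then gives
 \<open>W (d + 1) = 0\<close> and \<open>dim W d = 1\<close>, and the vanishing of \<open>Ext\<close> below degree \<open>d\<close> forces the contractions of \<open>w\<close> to
 exhaust \<open>V\<close> and \<open>R\<close>; this is (i). Computing \<open>Ext\<close> over \<open>A\<^sup>e\<close> from the bimodule Koszul complex identifies \<open>\<xi>\<close> on \<open>V\<close>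
 by comparing the expansions of \<open>w\<close> in \<open>V \<otimes> W (d - 1)\<close> and \<open>W (d - 1) \<otimes> V\<close>, which is the twisted superpotential
 property. Finally the contractions of \<open>w_hat\<close> span \<open>R\<close> together with the relations \<open>z v - \<xi>(v) z\<close>, and these
 present \<open>A[z; \<xi>]\<close> by normal ordering.\<close>

section \<open>Tensor algebras\<close>

text \<open>Koszulity supplies a linear resolution with unknown terms, whereas AS-regularity and the
  Nakayama automorphism are statements about all graded projective resolutions of the trivial module
  and of A over \<open>env A\<close>. Nothing can be computed until explicit resolutions are
  available, which is why the exactness of two Koszul complexes takes up so much of the work. Their
  differentials have entries of degree one. Hence coboundaries have zero augmentation, and their
  components of degree one depend only on scalars; this turns homological statements into linear
  algebra in V. One-dimensionality of \<open>Ext\<close> in degree d gives both that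
  \<open>W d\<close> is a line and that contractions of w span V; vanishing in degree d - 1 gives R.
  As R is recovered as a set of tensors, (i) is an equality of quotients.
  \<open>A \<otimes> A\<close> is a quotient of the space on symbols (a, b). Upper bounds for it
  come from the relations, but exactness also needs lower bounds, and these are obtained from
  bilinear functionals built out of coordinates on A. Likewise in (ii) the relations allow normal
  ordering, and the harder half is that they imply nothing more.\<close>

abbreviation TT :: "('k::field, 'n::finite list \<Rightarrow> 'k) graded_module" where
 "TT \<equiv> tensor_algebra"

abbreviation TT_elems ("\<T>") where "\<T> \<equiv> carrier TT"
abbreviation TT_mult (infixl "\<star>" 70) where "f \<star> g \<equiv> mult TT f g"

lemma TT_simps [simp]:
 "zero TT = (\<lambda>_. 0)" "one TT = sgl []" "add TT = (\<lambda>f g s. f s + g s)"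
 "smult TT = (\<lambda>c f s. c * f s)"
 by (simp_all add: tensor_algebra_def)

text \<open>Over a finite alphabet only finitely many words have bounded length. A length bound
  passes through sums and products by simple arithmetic, more directly than finiteness of the
  support.\<close>

lemma TT_carrier_iff:
 fixes u :: "'n::finite list \<Rightarrow> 'k::field"
 shows "u \<in> \<T> \<longleftrightarrow> (\<exists>N. \<forall>s. length s > N \<longrightarrow> u s = 0)"
proof
 assume "u \<in> \<T>"
 then have f: "finite {s. u s \<noteq> 0}" by (simp add: tensor_algebra_def)
 have "\<forall>s. length s > Max (insert 0 (length ` {s. u s \<noteq> 0})) \<longrightarrow> u s = 0"
  using f by (metis (mono_tags, lifting) Max_ge finite.insertI finite_imageI image_eqI insertCI leD mem_Collect_eq)
 then show "\<exists>N. \<forall>s. length s > N \<longrightarrow> u s = 0" ..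
next
 assume "\<exists>N. \<forall>s. length s > N \<longrightarrow> u s = 0"
 then obtain N where "\<forall>s. length s > N \<longrightarrow> u s = 0" ..
 then have "{s. u s \<noteq> 0} \<subseteq> {s. set s \<subseteq> UNIV \<and> length s \<le> N}" by (auto simp: not_less[symmetric])
 then have "finite {s. u s \<noteq> 0}" by (rule finite_subset) (rule finite_lists_length_le, simp)
 then show "u \<in> \<T>" by (simp add: tensor_algebra_def)
qed

lemma finite_words [simp]: "finite {s :: 'n::finite list. length s = n}"
 using finite_lists_length_eq[of "UNIV :: 'n set" n] by simp

lemma finite_words_le [simp]: "finite {s :: 'n::finite list. length s \<le> n}"
 using finite_lists_length_le[of "UNIV :: 'n set" n] by simp

lemma TT_mult_Nil: "(f \<star> g) [] = f [] * g []"
 by (simp add: tensor_algebra_def)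

text \<open>Splitting off the first letter turns the sum over cut positions into a recursion on the
  word; associativity and the unit laws below rest on it.\<close>

lemma TT_mult_Cons: "(f \<star> g) (x # s) = f [] * g (x # s) + ((\<lambda>t. f (x # t)) \<star> g) s"
proof -
 have "(\<Sum>i\<le>Suc (length s). f (take i (x # s)) * g (drop i (x # s))) =
   f [] * g (x # s) + (\<Sum>i\<le>length s. f (x # take i s) * g (drop i s))"
  by (subst sum.atMost_Suc_shift) simp
 then show ?thesis by (simp add: tensor_algebra_def)
qed

lemma TT_mult_linear:
 "((\<lambda>t. f t + f' t) \<star> g) s = (f \<star> g) s + (f' \<star> g) s"
 "((\<lambda>t. c * f t) \<star> g) s = c * (f \<star> g) s"
 "(f \<star> (\<lambda>t. g t + g' t)) s = (f \<star> g) s + (f \<star> g') s"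
 "(f \<star> (\<lambda>t. c * g t)) s = c * (f \<star> g) s"
 "((\<lambda>t. 0) \<star> g) s = 0" "(f \<star> (\<lambda>t. 0)) s = 0"
 by (simp_all add: tensor_algebra_def distrib_left distrib_right sum.distrib sum_distrib_left mult.left_commute mult.assoc)

lemma TT_mult_assoc: "(f \<star> g) \<star> h = f \<star> (g \<star> h)"
proof
 fix s show "((f \<star> g) \<star> h) s = (f \<star> (g \<star> h)) s"
  by (induction s arbitrary: f g)
   (simp_all add: TT_mult_Nil TT_mult_Cons TT_mult_linear distrib_left mult.assoc add.assoc)
qed

lemma TT_one_mult: "sgl [] \<star> f = f"
proof
 fix s show "(sgl [] \<star> f) s = f s"
  by (cases s) (simp_all add: TT_mult_Nil TT_mult_Cons sgl_def TT_mult_linear)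
qed

lemma TT_mult_one: "f \<star> sgl [] = f"
proof
 fix s show "(f \<star> sgl []) s = f s"
  by (induction s arbitrary: f) (simp_all add: TT_mult_Nil TT_mult_Cons, simp_all add: sgl_def)
qed

lemma TT_mult_long:
 assumes "\<And>s. length s > N \<Longrightarrow> f s = 0" "\<And>s. length s > M \<Longrightarrow> g s = 0" "length s > N + M"
 shows "(f \<star> g) s = 0"
proof -
 have "f (take i s) * g (drop i s) = 0" if "i \<le> length s" for i
  using assms(1)[of "take i s"] assms(2)[of "drop i s"] assms(3) that by (cases "i > N") auto
 then have "(\<Sum>i\<le>length s. f (take i s) * g (drop i s)) = 0" by (intro sum.neutral) blast
 then show ?thesis by (simp add: tensor_algebra_def)
qed

lemma TT_closed:
 "(\<lambda>_. 0) \<in> \<T>" "sgl p \<in> \<T>"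
 "f \<in> \<T> \<Longrightarrow> g \<in> \<T> \<Longrightarrow> (\<lambda>s. f s + g s) \<in> \<T>"
 "f \<in> \<T> \<Longrightarrow> (\<lambda>s. c * f s) \<in> \<T>"
 "f \<in> \<T> \<Longrightarrow> (\<lambda>s. - f s) \<in> \<T>"
 "f \<in> \<T> \<Longrightarrow> g \<in> \<T> \<Longrightarrow> (\<lambda>s. f s - g s) \<in> \<T>"
 "f \<in> \<T> \<Longrightarrow> g \<in> \<T> \<Longrightarrow> f \<star> g \<in> \<T>"
proof -
 show "(\<lambda>_. 0) \<in> \<T>" by (auto simp: TT_carrier_iff)
 show "sgl p \<in> \<T>" unfolding TT_carrier_iff sgl_def
  by (rule exI[of _ "length p"]) auto
 assume f: "f \<in> \<T>"
 then obtain N where N: "\<forall>s. length s > N \<longrightarrow> f s = 0" by (auto simp: TT_carrier_iff)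
 then show "(\<lambda>s. c * f s) \<in> \<T>" "(\<lambda>s. - f s) \<in> \<T>" by (auto simp: TT_carrier_iff)
 assume "g \<in> \<T>"
 then obtain M where M: "\<forall>s. length s > M \<longrightarrow> g s = 0" by (auto simp: TT_carrier_iff)
 show "(\<lambda>s. f s + g s) \<in> \<T>" "(\<lambda>s. f s - g s) \<in> \<T>" unfolding TT_carrier_iff
  using N M by (auto intro!: exI[of _ "max N M"])
 show "f \<star> g \<in> \<T>" unfolding TT_carrier_iff
  using TT_mult_long[of N f M g] N M by (intro exI[of _ "N + M"]) blast
qed

lemma TT_sum_closed:
 "finite F \<Longrightarrow> (\<And>i. i \<in> F \<Longrightarrow> f i \<in> \<T>) \<Longrightarrow> (\<lambda>s. \<Sum>i\<in>F. f i s) \<in> \<T>"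
 by (induction F rule: finite_induct) (simp_all add: TT_closed)

lemma tensors_TT: "u \<in> tensors n \<Longrightarrow> u \<in> \<T>"
 unfolding TT_carrier_iff tensors_def by (auto intro!: exI[of _ n])

lemma TT_ring: "ring (TT :: ('k::field, 'n::finite list \<Rightarrow> 'k) graded_module)"
proof (rule ringI)
 show "abelian_group (TT :: ('k, 'n list \<Rightarrow> 'k) graded_module)"
 proof (rule abelian_groupI)
  fix x y z :: "'n list \<Rightarrow> 'k" assume x: "x \<in> \<T>"
  then show "\<exists>y\<in>carrier TT. y \<oplus>\<^bsub>TT\<^esub> x = \<zero>\<^bsub>TT\<^esub>"
   by (intro bexI[of _ "\<lambda>s. - x s"]) (auto simp: TT_closed)
  show "x \<oplus>\<^bsub>TT\<^esub> y = y \<oplus>\<^bsub>TT\<^esub> x" by (simp add: add.commute)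
  show "x \<oplus>\<^bsub>TT\<^esub> y \<oplus>\<^bsub>TT\<^esub> z = x \<oplus>\<^bsub>TT\<^esub> (y \<oplus>\<^bsub>TT\<^esub> z)" by (simp add: add.assoc)
 qed (simp_all add: TT_closed)
 show "monoid (TT :: ('k, 'n list \<Rightarrow> 'k) graded_module)"
  by (rule monoidI) (auto simp: TT_closed TT_mult_assoc TT_one_mult TT_mult_one)
qed (auto simp: TT_mult_linear intro!: ext)

lemma TT_minus: "a \<in> \<T> \<Longrightarrow> \<ominus>\<^bsub>TT\<^esub> a = (\<lambda>s. - a s)"
proof -
 assume a: "a \<in> \<T>"
 interpret ring TT by (rule TT_ring)
 show ?thesis by (rule minus_equality) (use a in \<open>auto simp: TT_closed\<close>)
qed

lemma sgl_Cons_mult: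
 fixes u :: "'n::finite list \<Rightarrow> 'k::field"
 shows "(sgl [x] \<star> u) (y # s) = (if x = y then u s else 0)"
proof -
 have "(\<lambda>t. sgl [x] (y # t)) = (if x = y then sgl [] else (\<lambda>_. 0 :: 'k))"
  by (auto simp: sgl_def fun_eq_iff)
 moreover have "sgl [x] [] = (0 :: 'k)" by (simp add: sgl_def)
 ultimately show ?thesis by (simp add: TT_mult_Cons TT_one_mult TT_mult_linear)
qed

lemma sgl_Cons_mult_Nil: "(sgl [x] \<star> u) [] = 0"
 by (simp add: TT_mult_Nil sgl_def)

lemma sgl_mult_sgl:
 "sgl p \<star> sgl q = (sgl (p @ q) :: 'n::finite list \<Rightarrow> 'k::field)"
proof (induction p)
 case (Cons x p)
 have *: "(sgl (x # t) :: 'n list \<Rightarrow> 'k) = sgl [x] \<star> sgl t" for t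
 proof
  fix s show "sgl (x # t) s = (sgl [x] \<star> sgl t :: 'n list \<Rightarrow> 'k) s"
   by (cases s) (auto simp: sgl_Cons_mult sgl_Cons_mult_Nil, auto simp: sgl_def)
 qed
 have "(sgl (x # p) \<star> sgl q :: 'n list \<Rightarrow> 'k) = sgl [x] \<star> (sgl p \<star> sgl q)"
  by (subst *) (rule TT_mult_assoc)
 then show ?case using Cons *[of "p @ q"] by simp
qed (simp add: TT_one_mult)

lemma vec_tensor_mult: "(vec_tensor v \<star> u) s = (case s of [] \<Rightarrow> 0 | x # t \<Rightarrow> v x * u t)"
proof (cases s)
 case (Cons x t)
 have "(\<lambda>t. vec_tensor v (x # t)) = (\<lambda>t. v x * sgl [] t)"
  by (auto simp: vec_tensor_def sgl_def fun_eq_iff split: list.splits)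
 then show ?thesis using Cons by (simp add: TT_mult_Cons TT_mult_linear TT_one_mult)
  (simp add: vec_tensor_def)
qed (simp add: TT_mult_Nil vec_tensor_def)

text \<open>For homogeneous factors only the cut after m letters contributes to the product.\<close>

lemma mult_tensors:
 assumes "u \<in> tensors m" "v \<in> tensors n"
 shows "u \<star> v \<in> tensors (m + n)"
  and "length p = m \<Longrightarrow> (u \<star> v) (p @ q) = u p * v q"
proof -
 have z: "u (take i s) * v (drop i s) = 0" if "i \<le> length s" "i \<noteq> m \<or> length s \<noteq> m + n" for i s
  using assms that unfolding tensors_def by (cases "length (take i s) = m") auto
 then show "u \<star> v \<in> tensors (m + n)"
  by (auto simp: tensor_algebra_def tensors_def intro!: sum.neutral)
 assume p: "length p = m"
 have "(\<Sum>i\<le>length (p @ q). u (take i (p @ q)) * v (drop i (p @ q))) =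
   (\<Sum>i\<le>length (p @ q). if i = m then u p * v q else 0)"
  using p z[of _ "p @ q"] by (intro sum.cong) auto
 also have "\<dots> = u p * v q" using p by simp
 finally show "(u \<star> v) (p @ q) = u p * v q" by (simp add: tensor_algebra_def)
qed

lemma sgl_expand:
 assumes "finite F" "\<And>s. s \<notin> F \<Longrightarrow> u s = 0"
 shows "u = (\<lambda>s. \<Sum>t\<in>F. u t * sgl t s)"
proof
 fix s show "u s = (\<Sum>t\<in>F. u t * sgl t s)"
  using assms by (cases "s \<in> F") (auto simp: sgl_def if_distrib cong: if_cong)
qed

lemma TT_induct [consumes 1, case_names zero sgl add]:
 assumes u: "u \<in> \<T>" and z: "P (\<lambda>_. 0)" and s: "\<And>c p. P (\<lambda>s. c * sgl p s)"
  and a: "\<And>u v. u \<in> \<T> \<Longrightarrow> v \<in> \<T> \<Longrightarrow> P u \<Longrightarrow> P v \<Longrightarrow> P (\<lambda>s. u s + v s)"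
 shows "P u"
proof -
 have "finite F \<Longrightarrow> P (\<lambda>s. \<Sum>t\<in>F. u t * sgl t s)" for F
 proof (induction F rule: finite_induct)
  case (insert t F)
  have "P (\<lambda>x. u t * sgl t x + (\<Sum>t\<in>F. u t * sgl t x))"
   by (rule a[OF _ _ s insert.IH]; intro TT_closed TT_sum_closed insert.hyps)
  then show ?case using insert.hyps by simp
 qed (simp add: z)
 moreover have f: "finite {s. u s \<noteq> 0}" using u by (simp add: tensor_algebra_def)
 moreover have "u = (\<lambda>s. \<Sum>t\<in>{s. u s \<noteq> 0}. u t * sgl t s)" by (rule sgl_expand[OF f]) simp
 ultimately show ?thesis by metis
qed

section \<open>Subspaces of function spaces and their dual bases\<close>

definition subsp :: "('i \<Rightarrow> 'k::field) set \<Rightarrow> bool" where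
 "subsp U \<longleftrightarrow> (\<lambda>_. 0) \<in> U \<and> (\<forall>u\<in>U. \<forall>v\<in>U. (\<lambda>s. u s + v s) \<in> U) \<and> (\<forall>c. \<forall>u\<in>U. (\<lambda>s. c * u s) \<in> U)"

lemma subsp_sum:
 assumes "subsp U" "\<And>i. i \<in> F \<Longrightarrow> f i \<in> U"
 shows "(\<lambda>s. \<Sum>i\<in>F. f i s) \<in> U"
 using assms by (induction F rule: infinite_finite_induct) (auto simp: subsp_def)

lemma subsp_diff: "subsp U \<Longrightarrow> u \<in> U \<Longrightarrow> v \<in> U \<Longrightarrow> (\<lambda>s. u s - v s) \<in> U"
proof -
 assume U: "subsp U" "u \<in> U" "v \<in> U"
 then have a: "\<And>v. v \<in> U \<Longrightarrow> (\<lambda>s. u s + v s) \<in> U" and c: "\<And>c. (\<lambda>s. c * v s) \<in> U"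
  unfolding subsp_def by blast+
 show ?thesis using a[OF c[of "-1"]] by simp
qed

text \<open>\<open>b\<close> is a basis of U and the \<open>\<Psi> i\<close> are its coordinate
  functionals, given as coefficient vectors on F. They are thereby defined on all functions on F,
  not only on U, so that summing the values of \<open>\<Psi> i\<close> times \<open>b i\<close>
  projects the whole space onto U.\<close>

definition dual_basis ::
 "'i set \<Rightarrow> ('i \<Rightarrow> 'k::field) set \<Rightarrow> nat \<Rightarrow> (nat \<Rightarrow> 'i \<Rightarrow> 'k) \<Rightarrow> (nat \<Rightarrow> 'i \<Rightarrow> 'k) \<Rightarrow> bool" where
 "dual_basis F U m b \<Psi> \<longleftrightarrow> (\<forall>i<m. b i \<in> U) \<and> (\<forall>i<m. \<forall>s. s \<notin> F \<longrightarrow> \<Psi> i s = 0) \<and>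
   (\<forall>i<m. \<forall>j<m. (\<Sum>s\<in>F. \<Psi> i s * b j s) = (if i = j then 1 else 0)) \<and>
   (\<forall>u\<in>U. \<forall>s. u s = (\<Sum>i<m. (\<Sum>t\<in>F. \<Psi> i t * u t) * b i s))"

text \<open>Gaussian elimination, one coordinate at a time: the subspace of vectors vanishing at the
  new coordinate s is handled by induction, and at most one further basis vector, with value 1 at s,
  has to be added.\<close>

lemma dual_basis_exists:
 assumes "finite F" "subsp U" "\<And>u s. u \<in> U \<Longrightarrow> s \<notin> F \<Longrightarrow> u s = 0"
 shows "\<exists>m b \<Psi>. dual_basis F U m b \<Psi>"
 using assms
proof (induction F arbitrary: U rule: finite_induct)
 case empty
 then have "dual_basis {} U 0 b \<Psi>" for b \<Psi> by (auto simp: dual_basis_def)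
 then show ?case by blast
next
 case (insert s F)
 let ?U = "{u \<in> U. u s = 0}"
 have "subsp ?U" using insert.prems(1) by (auto simp: subsp_def)
 moreover have "u t = 0" if "u \<in> ?U" "t \<notin> F" for u t
  using insert.prems(2)[of u t] that by (cases "t = s") auto
 ultimately obtain m b \<Psi> where db: "dual_basis F ?U m b \<Psi>"
  using insert.IH[of ?U] by blast
 then have b: "\<And>i. i < m \<Longrightarrow> b i \<in> U" "\<And>i. i < m \<Longrightarrow> b i s = 0"
  and \<Psi>: "\<And>i t. i < m \<Longrightarrow> t \<notin> F \<Longrightarrow> \<Psi> i t = 0"
  and d: "\<And>i j. i < m \<Longrightarrow> j < m \<Longrightarrow> (\<Sum>t\<in>F. \<Psi> i t * b j t) = (if i = j then 1 else 0)"
  and e: "\<And>u t. u \<in> U \<Longrightarrow> u s = 0 \<Longrightarrow> u t = (\<Sum>i<m. (\<Sum>r\<in>F. \<Psi> i r * u r) * b i t)"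
  by (auto simp: dual_basis_def)
 have \<Psi>s: "i < m \<Longrightarrow> \<Psi> i s = 0" for i using \<Psi> insert.hyps by blast
 show ?case
 proof (cases "\<forall>u\<in>U. u s = 0")
  case True
  have "dual_basis (insert s F) U m b \<Psi>" unfolding dual_basis_def
  proof (intro conjI allI ballI impI)
   fix u t assume "u \<in> U"
   then show "u t = (\<Sum>i<m. (\<Sum>t\<in>insert s F. \<Psi> i t * u t) * b i t)"
    using e[of u t] True insert.hyps \<Psi>s by simp
  next
   fix i t assume "i < m" "t \<notin> insert s F"
   then show "\<Psi> i t = 0" using \<Psi> by simp
  qed (use b d \<Psi>s insert.hyps in \<open>simp_all\<close>)
  then show ?thesis by blast
 next
  case False
  then obtain u1 where u1: "u1 \<in> U" "u1 s \<noteq> 0" by blast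
  define u0 where "u0 = (\<lambda>t. inverse (u1 s) * u1 t)"
  have u0: "u0 \<in> U" "u0 s = 1" using u1 insert.prems(1) by (auto simp: u0_def subsp_def)
  define c where "c = (\<lambda>i. \<Sum>t\<in>F. \<Psi> i t * u0 t)"
  \<comment> \<open>The new basis vector is corrected so that the old functionals kill it; the new
    functional, evaluation at s, kills the old basis because that vanishes at s.\<close>
  define bm where "bm = (\<lambda>t. u0 t - (\<Sum>i<m. c i * b i t))"
  have "(\<lambda>t. \<Sum>i<m. c i * b i t) \<in> U"
   by (rule subsp_sum[OF insert.prems(1)]) (use b insert.prems(1) in \<open>auto simp: subsp_def\<close>)
  then have bmU: "bm \<in> U" unfolding bm_def by (intro subsp_diff insert.prems(1) u0)
  have bms: "bm s = 1" using u0 b by (simp add: bm_def)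
  have \<Psi>bm: "(\<Sum>t\<in>F. \<Psi> i t * bm t) = 0" if "i < m" for i
  proof -
   have "(\<Sum>t\<in>F. \<Psi> i t * bm t) = c i - (\<Sum>t\<in>F. \<Sum>j<m. c j * (\<Psi> i t * b j t))"
    by (simp add: bm_def c_def algebra_simps sum_subtractf sum_distrib_left)
   also have "(\<Sum>t\<in>F. \<Sum>j<m. c j * (\<Psi> i t * b j t)) = (\<Sum>j<m. c j * (\<Sum>t\<in>F. \<Psi> i t * b j t))"
    by (subst sum.swap) (simp add: sum_distrib_left)
   also have "\<dots> = (\<Sum>j<m. if j = i then c j else 0)" using that d by (intro sum.cong) auto
   also have "\<dots> = c i" using that by simp
   finally show ?thesis by simp
  qed
  let ?b = "\<lambda>i. if i < m then b i else bm" and ?\<Psi> = "\<lambda>i. if i < m then \<Psi> i else sgl s"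
  have sF: "(\<Sum>t\<in>F. sgl s t * g t) = 0" for g :: "'a \<Rightarrow> 'b"
   using insert.hyps by (intro sum.neutral) (auto simp: sgl_def)
  have ss: "sgl s s = (1::'b)" by (simp add: sgl_def)
  have "dual_basis (insert s F) U (Suc m) ?b ?\<Psi>" unfolding dual_basis_def
  proof (intro conjI allI ballI impI)
   fix i j assume "i < Suc m" "j < Suc m"
   then show "(\<Sum>t\<in>insert s F. ?\<Psi> i t * ?b j t) = (if i = j then 1 else 0)"
    using insert.hyps d b \<Psi>s bms \<Psi>bm sF ss by (auto simp: less_Suc_eq)
  next
   fix u t assume u: "u \<in> U"
   let ?u = "\<lambda>t. u t - u s * bm t"
   have "?u \<in> U" "?u s = 0" using u bmU bms insert.prems(1)
    by (auto intro!: subsp_diff simp: subsp_def)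
   then have "?u t = (\<Sum>i<m. (\<Sum>r\<in>F. \<Psi> i r * ?u r) * b i t)" by (rule e)
   also have "\<dots> = (\<Sum>i<m. (\<Sum>r\<in>F. \<Psi> i r * u r) * b i t)"
   proof (intro sum.cong refl, goal_cases)
    case (1 i)
    have "(\<Sum>r\<in>F. \<Psi> i r * ?u r) = (\<Sum>r\<in>F. \<Psi> i r * u r) - u s * (\<Sum>r\<in>F. \<Psi> i r * bm r)"
     by (simp add: algebra_simps sum_subtractf sum_distrib_left)
    then show ?case using 1 \<Psi>bm by simp
   qed
   finally show "u t = (\<Sum>i<Suc m. (\<Sum>r\<in>insert s F. ?\<Psi> i r * u r) * ?b i t)"
    using insert.hyps \<Psi>s sF ss by simp (simp add: algebra_simps)
  next
   fix i assume "i < Suc m" then show "?b i \<in> U" using b bmU by simp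
  next
   fix i t assume "i < Suc m" "t \<notin> insert s F"
   then show "?\<Psi> i t = 0" using \<Psi> by (simp add: sgl_def)
  qed
  then show ?thesis by blast
 qed
qed

section \<open>Graded groups and modules\<close>

lemma (in abelian_monoid) finsum_superset:
 assumes "finite B" "A \<subseteq> B" "\<And>i. i \<in> B - A \<Longrightarrow> f i = \<zero>" "\<And>i. i \<in> B \<Longrightarrow> f i \<in> carrier G"
 shows "(\<Oplus>i\<in>A. f i) = (\<Oplus>i\<in>B. f i)"
 using assms by (intro add.finprod_mono_neutral_cong_left) auto

lemma (in abelian_monoid) finsum_single:
 assumes "finite B" "i \<in> B" "\<And>j. j \<in> B \<Longrightarrow> j \<noteq> i \<Longrightarrow> f j = \<zero>" "f i \<in> carrier G"
 shows "(\<Oplus>j\<in>B. f j) = f i"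
proof -
 have "(\<Oplus>j\<in>{i}. f j) = (\<Oplus>j\<in>B. f j)"
  by (rule finsum_superset) (use assms zero_closed in \<open>auto, metis\<close>)
 then show ?thesis using assms by simp
qed

section \<open>Additive and linear maps\<close>

locale add_map = M: abelian_group M + N: abelian_group N
 for M :: "('m, 'x) ring_scheme" and N :: "('n, 'y) ring_scheme" +
 fixes h :: "'m \<Rightarrow> 'n"
 assumes closed: "x \<in> carrier M \<Longrightarrow> h x \<in> carrier N"
  and add: "x \<in> carrier M \<Longrightarrow> y \<in> carrier M \<Longrightarrow> h (x \<oplus>\<^bsub>M\<^esub> y) = h x \<oplus>\<^bsub>N\<^esub> h y"
begin

lemma zero: "h \<zero>\<^bsub>M\<^esub> = \<zero>\<^bsub>N\<^esub>"
proof -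
 have "h \<zero>\<^bsub>M\<^esub> \<oplus>\<^bsub>N\<^esub> h \<zero>\<^bsub>M\<^esub> = h \<zero>\<^bsub>M\<^esub>" using add[of "\<zero>\<^bsub>M\<^esub>" "\<zero>\<^bsub>M\<^esub>"] by simp
 then show ?thesis using closed[of "\<zero>\<^bsub>M\<^esub>"] by (metis M.zero_closed N.add.r_cancel_one')
qed

lemma minus: "x \<in> carrier M \<Longrightarrow> h (\<ominus>\<^bsub>M\<^esub> x) = \<ominus>\<^bsub>N\<^esub> h x"
 using add[of "\<ominus>\<^bsub>M\<^esub> x" x] zero closed
 by (metis M.add.inv_closed M.l_neg N.minus_equality)

lemma diff: "x \<in> carrier M \<Longrightarrow> y \<in> carrier M \<Longrightarrow> h (x \<ominus>\<^bsub>M\<^esub> y) = h x \<ominus>\<^bsub>N\<^esub> h y"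
 by (simp add: a_minus_def add minus)

lemma finsum: "finite F \<Longrightarrow> (\<And>i. i \<in> F \<Longrightarrow> f i \<in> carrier M) \<Longrightarrow>
  h (\<Oplus>\<^bsub>M\<^esub>i\<in>F. f i) = (\<Oplus>\<^bsub>N\<^esub>i\<in>F. h (f i))"
 by (induction F rule: finite_induct) (simp_all add: zero add closed Pi_def)

end

lemma add_mapI:
 assumes "abelian_group M" "abelian_group N" "\<And>x. x \<in> carrier M \<Longrightarrow> h x \<in> carrier N"
  "\<And>x y. x \<in> carrier M \<Longrightarrow> y \<in> carrier M \<Longrightarrow> h (x \<oplus>\<^bsub>M\<^esub> y) = h x \<oplus>\<^bsub>N\<^esub> h y"
 shows "add_map M N h"
 using assms by (simp add: add_map_def add_map_axioms_def)

context left_module begin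

lemma smult_add_map_r: "a \<in> carrier R \<Longrightarrow> add_map M M (\<lambda>x. a \<odot>\<^bsub>M\<^esub> x)"
 by (rule add_mapI) (auto simp: smult_closed smult_r_distr M.abelian_group_axioms)

lemma smult_add_map_l: "x \<in> carrier M \<Longrightarrow> add_map R M (\<lambda>a. a \<odot>\<^bsub>M\<^esub> x)"
 by (rule add_mapI) (auto simp: smult_closed smult_l_distr M.abelian_group_axioms R.abelian_group_axioms)

lemmas smult_r_zero = add_map.zero[OF smult_add_map_r]
lemmas smult_l_zero = add_map.zero[OF smult_add_map_l]
lemmas smult_r_finsum = add_map.finsum[OF smult_add_map_r]
lemmas smult_l_finsum = add_map.finsum[OF smult_add_map_l]
lemmas smult_r_minus = add_map.minus[OF smult_add_map_r]
lemmas smult_l_minus = add_map.minus[OF smult_add_map_l]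

end

lemma left_moduleD:
 assumes "left_module S M" shows "abelian_group M" "ring S"
 using assms by (auto simp: left_module_def)

lemma lin_mapsD:
 assumes "f \<in> lin_maps A M N"
 shows "x \<in> carrier M \<Longrightarrow> f x \<in> carrier N"
  "x \<in> carrier M \<Longrightarrow> y \<in> carrier M \<Longrightarrow> f (x \<oplus>\<^bsub>M\<^esub> y) = f x \<oplus>\<^bsub>N\<^esub> f y"
  "a \<in> carrier A \<Longrightarrow> x \<in> carrier M \<Longrightarrow> f (a \<odot>\<^bsub>M\<^esub> x) = a \<odot>\<^bsub>N\<^esub> f x"
 using assms by (auto simp: lin_maps_def)

lemma lin_mapsI:
 assumes "\<And>x. x \<in> carrier M \<Longrightarrow> f x \<in> carrier N"
  "\<And>x y. x \<in> carrier M \<Longrightarrow> y \<in> carrier M \<Longrightarrow> f (x \<oplus>\<^bsub>M\<^esub> y) = f x \<oplus>\<^bsub>N\<^esub> f y"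
  "\<And>a x. a \<in> carrier A \<Longrightarrow> x \<in> carrier M \<Longrightarrow> f (a \<odot>\<^bsub>M\<^esub> x) = a \<odot>\<^bsub>N\<^esub> f x"
 shows "f \<in> lin_maps A M N"
 using assms by (auto simp: lin_maps_def)

lemma lin_maps_add_map:
 assumes "left_module A M" "left_module A N" "f \<in> lin_maps A M N"
 shows "add_map M N f"
 by (rule add_mapI) (auto intro: left_moduleD assms lin_mapsD[OF assms(3)])

lemma lin_maps_comp:
 "f \<in> lin_maps A M N \<Longrightarrow> g \<in> lin_maps A N K \<Longrightarrow> (\<lambda>x. g (f x)) \<in> lin_maps A M K"
 by (rule lin_mapsI) (auto simp: lin_mapsD)

lemma lin_maps_diff:
 assumes "left_module A M" "left_module A N" "f \<in> lin_maps A M N" "g \<in> lin_maps A M N"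
 shows "(\<lambda>x. f x \<ominus>\<^bsub>N\<^esub> g x) \<in> lin_maps A M N"
proof -
 interpret N: left_module A N by fact
 note f = lin_mapsD[OF assms(3)] and g = lin_mapsD[OF assms(4)]
 show ?thesis
 proof (rule lin_mapsI)
  fix x y assume "x \<in> carrier M" "y \<in> carrier M"
  then show "f (x \<oplus>\<^bsub>M\<^esub> y) \<ominus>\<^bsub>N\<^esub> g (x \<oplus>\<^bsub>M\<^esub> y) = f x \<ominus>\<^bsub>N\<^esub> g x \<oplus>\<^bsub>N\<^esub> (f y \<ominus>\<^bsub>N\<^esub> g y)"
   by (simp add: f g a_minus_def N.minus_add N.M.a_ac)
 qed (auto simp: f g a_minus_def N.smult_r_minus N.smult_r_distr)
qed

lemma lin_maps_cong_module:
 assumes "carrier M' = carrier M" "add M' = add M" "smult M' = smult M"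
  "carrier N' = carrier N" "add N' = add N" "smult N' = smult N"
 shows "lin_maps A M' N' = lin_maps A M N"
 using assms by (simp add: lin_maps_def)

lemma abelian_group_cong:
 assumes "abelian_group M" "carrier M' = carrier M" "add M' = add M" "zero M' = zero M"
 shows "abelian_group M'"
proof -
 interpret abelian_group M by fact
 show ?thesis by (rule abelian_groupI) (auto simp: assms a_ac l_neg intro!: bexI[of _ "\<ominus>\<^bsub>M\<^esub> _"])
qed

lemma left_module_cong:
 assumes "left_module A M" "carrier M' = carrier M" "add M' = add M" "zero M' = zero M"
  "smult M' = smult M"
 shows "left_module A M'"
proof -
 interpret left_module A M by fact
 show ?thesis unfolding left_module_def left_module_axioms_def
  using abelian_group_cong[OF M.abelian_group_axioms assms(2-4)] R.ring_axioms
  by (simp add: assms smult_closed smult_l_distr smult_r_distr smult_assoc1 smult_one)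
qed

lemma ring_cong:
 assumes "ring M" "carrier M' = carrier M" "add M' = add M" "zero M' = zero M"
  "mult M' = mult M" "one M' = one M"
 shows "ring M'"
proof -
 interpret ring M by fact
 have "monoid M'" by (rule monoidI) (auto simp: assms m_assoc)
 then show ?thesis
  by (intro ringI abelian_group_cong[OF abelian_group_axioms assms(2-4)])
   (auto simp: assms l_distr r_distr)
qed

lemma submodule_left_module:
 assumes "left_module A M" "N \<subseteq> carrier M" "\<zero>\<^bsub>M\<^esub> \<in> N"
  "\<And>x y. x \<in> N \<Longrightarrow> y \<in> N \<Longrightarrow> x \<oplus>\<^bsub>M\<^esub> y \<in> N" "\<And>a x. a \<in> carrier A \<Longrightarrow> x \<in> N \<Longrightarrow> a \<odot>\<^bsub>M\<^esub> x \<in> N"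
  "carrier M' = N" "add M' = add M" "zero M' = zero M" "smult M' = smult M"
 shows "left_module A M'"
proof -
 interpret left_module A M by fact
 have neg: "\<exists>y\<in>N. y \<oplus>\<^bsub>M\<^esub> x = \<zero>\<^bsub>M\<^esub>" if "x \<in> N" for x
 proof (rule bexI)
  show "(\<ominus>\<^bsub>A\<^esub> \<one>\<^bsub>A\<^esub>) \<odot>\<^bsub>M\<^esub> x \<in> N" using assms(5) that by simp
  show "(\<ominus>\<^bsub>A\<^esub> \<one>\<^bsub>A\<^esub>) \<odot>\<^bsub>M\<^esub> x \<oplus>\<^bsub>M\<^esub> x = \<zero>\<^bsub>M\<^esub>"
   using that assms(2) by (simp add: subsetD smult_l_minus smult_one M.l_neg)
 qed
 have "abelian_group M'"
  by (rule abelian_groupI) (use assms neg in \<open>auto simp: subsetD M.a_ac\<close>)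
 then show ?thesis unfolding left_module_def left_module_axioms_def
  using R.ring_axioms assms
  by (simp add: subsetD smult_l_distr smult_r_distr smult_assoc1 smult_one)
qed

text \<open>Projectivity is tested on surjections between records without further fields. Replacing
  D by the image of g and dropping extra fields makes it usable for graded modules and for maps g
  whose image merely contains the image of f.\<close>

lemma proj_lift:
 fixes C :: "('a, nat \<Rightarrow> 'a, 'y) module_scheme" and D :: "('a, nat \<Rightarrow> 'a, 'z) module_scheme"
 assumes P: "projective A P" and C: "left_module A C" and D: "left_module A D"
  and g: "g \<in> lin_maps A C D" and f: "f \<in> lin_maps A P D"
  and onto: "\<And>x. x \<in> carrier P \<Longrightarrow> f x \<in> g ` carrier C"
 shows "\<exists>h\<in>lin_maps A P C. \<forall>x\<in>carrier P. g (h x) = f x"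
proof -
 interpret C: left_module A C by fact
 interpret D: left_module A D by fact
 interpret g: add_map C D g by (rule lin_maps_add_map) fact+
 note gD = lin_mapsD[OF g] and fD = lin_mapsD[OF f]
 define C' :: "('a, nat \<Rightarrow> 'a) module" where
  "C' = \<lparr>carrier = carrier C, mult = undefined, one = undefined, zero = zero C, add = add C, smult = smult C\<rparr>"
 define D' :: "('a, nat \<Rightarrow> 'a) module" where
  "D' = \<lparr>carrier = g ` carrier C, mult = undefined, one = undefined, zero = zero D, add = add D, smult = smult D\<rparr>"
 have 1: "left_module A C'" by (rule left_module_cong[OF C]) (simp_all add: C'_def)
 have 2: "left_module A D'"
 proof (rule submodule_left_module[OF D])
  show "\<zero>\<^bsub>D\<^esub> \<in> g ` carrier C" using g.zero C.M.zero_closed by (metis imageI)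
  show "x \<oplus>\<^bsub>D\<^esub> y \<in> g ` carrier C" if "x \<in> g ` carrier C" "y \<in> g ` carrier C" for x y
   using that by (auto simp: gD(2)[symmetric])
  show "a \<odot>\<^bsub>D\<^esub> x \<in> g ` carrier C" if "a \<in> carrier A" "x \<in> g ` carrier C" for a x
   using that by (auto simp: gD(3)[symmetric] C.smult_closed)
 qed (auto simp: D'_def gD)
 have 3: "g \<in> lin_maps A C' D'" by (rule lin_mapsI) (auto simp: C'_def D'_def gD)
 have 4: "f \<in> lin_maps A P D'" by (rule lin_mapsI) (auto simp: D'_def fD onto)
 have "\<exists>h\<in>lin_maps A P C'. \<forall>x\<in>carrier P. g (h x) = f x"
  using P 1 2 3 4 unfolding projective_def by (auto simp: C'_def D'_def)
 moreover have "lin_maps A P C' = lin_maps A P C" by (rule lin_maps_cong_module) (simp_all add: C'_def)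
 ultimately show ?thesis by simp
qed

text \<open>The grading is carried by its projections \<open>cmp n\<close>, which are additive and
  can be pushed through maps and sums; \<open>direct_sum\<close> and
  \<open>graded_group_exists\<close> translate to and from the unique decompositions in
  \<open>graded_left_module\<close>.\<close>

locale graded_group = abelian_group M for M (structure) +
 fixes H :: "int \<Rightarrow> 'a set" and cmp :: "int \<Rightarrow> 'a \<Rightarrow> 'a"
 assumes H_sub: "x \<in> H n \<Longrightarrow> x \<in> carrier M"
  and cmp_H: "x \<in> carrier M \<Longrightarrow> cmp n x \<in> H n"
  and cmp_add: "x \<in> carrier M \<Longrightarrow> y \<in> carrier M \<Longrightarrow> cmp n (x \<oplus> y) = cmp n x \<oplus> cmp n y"
  and cmp_same: "x \<in> H n \<Longrightarrow> cmp n x = x"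
  and cmp_other: "x \<in> H n \<Longrightarrow> m \<noteq> n \<Longrightarrow> cmp m x = \<zero>"
  and cmp_sum: "x \<in> carrier M \<Longrightarrow>
    \<exists>N. finite N \<and> (\<forall>n. n \<notin> N \<longrightarrow> cmp n x = \<zero>) \<and> x = (\<Oplus>n\<in>N. cmp n x)"
begin

lemma cmp_closed [simp]: "x \<in> carrier M \<Longrightarrow> cmp n x \<in> carrier M"
 using H_sub cmp_H by blast

lemma cmp_add_map: "add_map M M (cmp n)"
 by (rule add_mapI) (auto simp: abelian_group_axioms cmp_add)

lemmas cmp_zero [simp] = add_map.zero[OF cmp_add_map]
lemmas cmp_minus = add_map.minus[OF cmp_add_map]
lemmas cmp_finsum = add_map.finsum[OF cmp_add_map]

lemma H_zero: "\<zero> \<in> H n" using cmp_H[of \<zero> n] by simp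

lemma H_add: "x \<in> H n \<Longrightarrow> y \<in> H n \<Longrightarrow> x \<oplus> y \<in> H n"
 using cmp_H[of "x \<oplus> y" n] H_sub[of x n] H_sub[of y n] by (simp add: cmp_add cmp_same)

lemma H_minus: "x \<in> H n \<Longrightarrow> \<ominus> x \<in> H n"
 using cmp_H[of "\<ominus> x" n] H_sub[of x n] by (simp add: cmp_minus cmp_same)

lemma H_finsum: "finite F \<Longrightarrow> (\<And>i. i \<in> F \<Longrightarrow> f i \<in> H n) \<Longrightarrow> (\<Oplus>i\<in>F. f i) \<in> H n"
proof (induction F rule: finite_induct)
 case (insert x F)
 then have "f x \<in> carrier M" "f \<in> F \<rightarrow> carrier M" using H_sub by blast+
 then show ?case using insert by (simp add: H_add)
qed (simp add: H_zero)

lemma H_subgroup: "subgroup (H n) (add_monoid M)"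
proof (rule subgroup.intro)
 fix x assume "x \<in> H n"
 then show "inv\<^bsub>add_monoid M\<^esub> x \<in> H n" using H_minus[of x n] by (simp add: a_inv_def)
qed (auto simp: H_sub H_add H_zero)

lemma cmp_sum_superset:
 assumes x: "x \<in> carrier M" and B: "finite B" "\<And>n. n \<notin> B \<Longrightarrow> cmp n x = \<zero>"
 shows "x = (\<Oplus>n\<in>B. cmp n x)"
proof -
 obtain N where N: "finite N" "\<And>n. n \<notin> N \<Longrightarrow> cmp n x = \<zero>" "x = (\<Oplus>n\<in>N. cmp n x)"
  using cmp_sum[OF x] by blast
 have "(\<Oplus>n\<in>N. cmp n x) = (\<Oplus>n\<in>N \<union> B. cmp n x)"
  using x N B by (intro finsum_superset) auto
 also have "\<dots> = (\<Oplus>n\<in>B. cmp n x)"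
  using x N B by (intro finsum_superset[symmetric]) auto
 finally show ?thesis using N(3) by simp
qed

lemma cmp_decomp:
 assumes "finite N" "\<And>n. n \<in> N \<Longrightarrow> f n \<in> H n"
 shows "cmp m (\<Oplus>n\<in>N. f n) = (if m \<in> N then f m else \<zero>)"
proof -
 have "cmp m (\<Oplus>n\<in>N. f n) = (\<Oplus>n\<in>N. cmp m (f n))"
  using assms by (intro cmp_finsum) (auto intro: H_sub)
 also have "\<dots> = (if m \<in> N then f m else \<zero>)"
 proof (cases "m \<in> N")
  case True
  then have "(\<Oplus>n\<in>N. cmp m (f n)) = cmp m (f m)"
   using assms by (intro finsum_single) (auto intro: H_sub cmp_other cmp_closed)
  then show ?thesis using True assms cmp_same by auto
 next
  case False
  then have "(\<Oplus>n\<in>N. cmp m (f n)) = (\<Oplus>n\<in>N. \<zero>)"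
   using assms by (intro finsum_cong') (auto intro: cmp_other)
  then show ?thesis using False by simp
 qed
 finally show ?thesis .
qed

lemma direct_sum:
 assumes x: "x \<in> carrier M"
 shows "\<exists>!f. (\<forall>n. f n \<in> H n) \<and> finite {n. f n \<noteq> \<zero>} \<and> x = (\<Oplus>n\<in>{n. f n \<noteq> \<zero>}. f n)"
proof (rule ex1I[of _ "\<lambda>n. cmp n x"])
 obtain N where N: "finite N" "\<And>n. n \<notin> N \<Longrightarrow> cmp n x = \<zero>" using cmp_sum[OF x] by blast
 have "{n. cmp n x \<noteq> \<zero>} \<subseteq> N" using N(2) by blast
 then have f: "finite {n. cmp n x \<noteq> \<zero>}" using N(1) by (rule finite_subset)
 show "(\<forall>n. cmp n x \<in> H n) \<and> finite {n. cmp n x \<noteq> \<zero>} \<and> x = (\<Oplus>n\<in>{n. cmp n x \<noteq> \<zero>}. cmp n x)"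
  by (intro conjI allI cmp_H x f cmp_sum_superset) simp
next
 fix f assume f: "(\<forall>n. f n \<in> H n) \<and> finite {n. f n \<noteq> \<zero>} \<and> x = (\<Oplus>n\<in>{n. f n \<noteq> \<zero>}. f n)"
 show "f = (\<lambda>n. cmp n x)"
 proof
  fix m
  have "cmp m x = cmp m (\<Oplus>n\<in>{n. f n \<noteq> \<zero>}. f n)" using f by metis
  also have "\<dots> = (if m \<in> {n. f n \<noteq> \<zero>} then f m else \<zero>)" by (rule cmp_decomp) (use f in auto)
  finally show "f m = cmp m x" by auto
 qed
qed

end

text \<open>The n-th projection picks the n-th term of the unique decomposition. Uniqueness, with
  supports enlarged to a common finite set, makes it additive.\<close>

lemma (in graded_left_module) graded_group_exists: "\<exists>cmp. graded_group M (homog M) cmp"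
proof -
 let ?P = "\<lambda>x f. (\<forall>n. f n \<in> homog M n) \<and> finite {n. f n \<noteq> \<zero>\<^bsub>M\<^esub>} \<and> x = (\<Oplus>\<^bsub>M\<^esub>n\<in>{n. f n \<noteq> \<zero>\<^bsub>M\<^esub>}. f n)"
 define cmp where "cmp = (\<lambda>n x. (THE f. ?P x f) n)"
 have P: "?P x (\<lambda>n. cmp n x)" if "x \<in> carrier M" for x
  unfolding cmp_def by (rule theI'[OF homog_direct_sum[OF that]])
 have uni: "cmp n x = f n" if x: "x \<in> carrier M" and f: "\<And>n. f n \<in> homog M n" "finite N"
  "\<And>n. n \<notin> N \<Longrightarrow> f n = \<zero>\<^bsub>M\<^esub>" "x = (\<Oplus>\<^bsub>M\<^esub>n\<in>N. f n)" for x f N n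
 proof -
  have sub: "homog M n \<subseteq> carrier M" for n using subgroup.subset[OF homog_subgroup[of n]] by simp
  have s: "{n. f n \<noteq> \<zero>\<^bsub>M\<^esub>} \<subseteq> N" using f(3) by auto
  have "(\<Oplus>\<^bsub>M\<^esub>n\<in>{n. f n \<noteq> \<zero>\<^bsub>M\<^esub>}. f n) = (\<Oplus>\<^bsub>M\<^esub>n\<in>N. f n)"
   using f sub s by (intro M.finsum_superset) auto
  then have "?P x f" using f s finite_subset[OF s] by simp
  then have "(THE f. ?P x f) = f" by (rule the1_equality[OF homog_direct_sum[OF x]])
  then show ?thesis by (simp only: cmp_def)
 qed
 have sub: "x \<in> homog M n \<Longrightarrow> x \<in> carrier M" for x n
  using subgroup.subset[OF homog_subgroup[of n]] by auto
 have z: "\<zero>\<^bsub>M\<^esub> \<in> homog M n" for n using subgroup.one_closed[OF homog_subgroup[of n]] by simp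
 have a: "x \<in> homog M n \<Longrightarrow> y \<in> homog M n \<Longrightarrow> x \<oplus>\<^bsub>M\<^esub> y \<in> homog M n" for x y n
  using subgroup.m_closed[OF homog_subgroup[of n]] by simp
 have "graded_group M (homog M) cmp"
 proof
  fix x n assume x: "x \<in> homog M n"
  have "cmp m x = (if m = n then x else \<zero>\<^bsub>M\<^esub>)" for m
   using x sub z by (intro uni[of x "\<lambda>m. if m = n then x else \<zero>\<^bsub>M\<^esub>" "{n}"]) auto
  then show "cmp n x = x" "m \<noteq> n \<Longrightarrow> cmp m x = \<zero>\<^bsub>M\<^esub>" for m by auto
 next
  fix x y n assume xy: "x \<in> carrier M" "y \<in> carrier M"
  note Px = P[OF xy(1)] and Py = P[OF xy(2)]
  let ?N = "{n. cmp n x \<noteq> \<zero>\<^bsub>M\<^esub>} \<union> {n. cmp n y \<noteq> \<zero>\<^bsub>M\<^esub>}"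
  have 1: "(\<Oplus>\<^bsub>M\<^esub>n\<in>{n. cmp n x \<noteq> \<zero>\<^bsub>M\<^esub>}. cmp n x) = (\<Oplus>\<^bsub>M\<^esub>n\<in>?N. cmp n x)"
   using conjunct1[OF Px] conjunct1[OF conjunct2[OF Px]] conjunct1[OF conjunct2[OF Py]] sub
   by (intro M.finsum_superset) auto
  have 2: "(\<Oplus>\<^bsub>M\<^esub>n\<in>{n. cmp n y \<noteq> \<zero>\<^bsub>M\<^esub>}. cmp n y) = (\<Oplus>\<^bsub>M\<^esub>n\<in>?N. cmp n y)"
   using conjunct1[OF Py] conjunct1[OF conjunct2[OF Px]] conjunct1[OF conjunct2[OF Py]] sub
   by (intro M.finsum_superset) auto
  have 3: "(\<Oplus>\<^bsub>M\<^esub>n\<in>?N. cmp n x \<oplus>\<^bsub>M\<^esub> cmp n y) = (\<Oplus>\<^bsub>M\<^esub>n\<in>?N. cmp n x) \<oplus>\<^bsub>M\<^esub> (\<Oplus>\<^bsub>M\<^esub>n\<in>?N. cmp n y)"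
   using conjunct1[OF Px] conjunct1[OF Py] sub by (intro M.finsum_addf) auto
  have "x \<oplus>\<^bsub>M\<^esub> y = (\<Oplus>\<^bsub>M\<^esub>n\<in>?N. cmp n x \<oplus>\<^bsub>M\<^esub> cmp n y)"
   unfolding 3 by (rule arg_cong2[where f = "add M"])
    (rule trans[OF conjunct2[OF conjunct2[OF Px]] 1] trans[OF conjunct2[OF conjunct2[OF Py]] 2])+
  moreover have "cmp n x \<oplus>\<^bsub>M\<^esub> cmp n y \<in> homog M n" for n using Px Py a by blast
  moreover have "finite ?N" using Px Py by blast
  moreover have "x \<oplus>\<^bsub>M\<^esub> y \<in> carrier M" using xy by simp
  ultimately show "cmp n (x \<oplus>\<^bsub>M\<^esub> y) = cmp n x \<oplus>\<^bsub>M\<^esub> cmp n y"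
   by (intro uni[of "x \<oplus>\<^bsub>M\<^esub> y" "\<lambda>n. cmp n x \<oplus>\<^bsub>M\<^esub> cmp n y" ?N]; blast?) auto
 qed (use P sub in blast)+
 then show ?thesis by blast
qed

text \<open>Applying f to the decomposition of x gives the decomposition of \<open>f x\<close>,
  shifted by i. With i = 0 this serves differentials, with other i multiplication by a homogeneous
  element.\<close>

lemma deg_map_cmp:
 assumes "graded_group M HM cM" "graded_group N HN cN" "add_map M N f"
  and deg: "\<And>n x. x \<in> HM n \<Longrightarrow> f x \<in> HN (n + i)" and x: "x \<in> carrier M"
 shows "cN (n + i) (f x) = f (cM n x)"
proof -
 interpret M: graded_group M HM cM by fact
 interpret N: graded_group N HN cN by fact
 interpret f: add_map M N f by fact
 obtain B where B: "finite B" "\<And>n. n \<notin> B \<Longrightarrow> cM n x = \<zero>\<^bsub>M\<^esub>" "x = (\<Oplus>\<^bsub>M\<^esub>n\<in>B. cM n x)"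
  using M.cmp_sum[OF x] by blast
 let ?g = "\<lambda>m. f (cM (m - i) x)"
 have "f x = (\<Oplus>\<^bsub>N\<^esub>n\<in>B. f (cM n x))" by (subst B(3), subst f.finsum) (use B(1) x in auto)
 also have "\<dots> = (\<Oplus>\<^bsub>N\<^esub>m\<in>(\<lambda>n. n + i) ` B. ?g m)"
  by (subst N.finsum_reindex) (auto simp: inj_on_def f.closed x)
 finally have e: "f x = \<dots>" .
 have "cN (n + i) (f x) = (if n + i \<in> (\<lambda>n. n + i) ` B then ?g (n + i) else \<zero>\<^bsub>N\<^esub>)"
  unfolding e by (rule N.cmp_decomp) (use B(1) deg[OF M.cmp_H[OF x]] in auto)
 also have "\<dots> = f (cM n x)" using B(2)[of n] f.zero by (cases "n \<in> B") auto
 finally show ?thesis .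
qed

section \<open>Graded rings and graded lifting\<close>

locale graded_ring = ring S + graded_group S "homog S" cmp
 for S :: "('k::field, 's) graded_module" (structure) and cmp +
 assumes homog_mult: "a \<in> homog S i \<Longrightarrow> b \<in> homog S j \<Longrightarrow> a \<otimes> b \<in> homog S (i + j)"
  and one_homog: "\<one> \<in> homog S 0"

lemma graded_mapsD:
 assumes "f \<in> graded_maps A M N"
 shows "f \<in> lin_maps A M N" "x \<in> homog M n \<Longrightarrow> f x \<in> homog N n"
 using assms by (auto simp: graded_maps_def)

text \<open>Take any linear lift h and keep only its degree-preserving part, the sum of the maps
  \<open>cC n \<circ> h \<circ> cP n\<close>. Linearity survives because it can be checked on
  homogeneous scalars and elements, and the result still lifts f since f and g preserve
  degrees.\<close>

lemma graded_lift:
 fixes C :: "('s, nat \<Rightarrow> 's) graded_module" and D :: "('s, nat \<Rightarrow> 's) graded_module"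
 assumes S: "graded_ring S cmpS" and P: "graded_left_module S P" "projective S P"
  and C: "graded_left_module S C" and D: "graded_left_module S D"
  and g: "g \<in> graded_maps S C D" and f: "f \<in> graded_maps S P D"
  and onto: "\<And>x. x \<in> carrier P \<Longrightarrow> f x \<in> g ` carrier C"
 shows "\<exists>h\<in>graded_maps S P C. \<forall>x\<in>carrier P. g (h x) = f x"
proof -
 interpret S: graded_ring S cmpS by fact
 interpret P: graded_left_module S P by fact
 interpret C: graded_left_module S C by fact
 interpret D: graded_left_module S D by fact
 obtain cP where cP: "graded_group P (homog P) cP" using P.graded_group_exists ..
 obtain cC where cC: "graded_group C (homog C) cC" using C.graded_group_exists ..
 obtain cD where cD: "graded_group D (homog D) cD" using D.graded_group_exists ..
 interpret gP: graded_group P "homog P" cP by fact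
 interpret gC: graded_group C "homog C" cC by fact
 interpret gD: graded_group D "homog D" cD by fact
 have lm: "left_module S P" "left_module S C" "left_module S D" by unfold_locales
 obtain h where h: "h \<in> lin_maps S P C" and gh: "\<And>x. x \<in> carrier P \<Longrightarrow> g (h x) = f x"
  using proj_lift[OF P(2) lm(2,3) graded_mapsD(1)[OF g] graded_mapsD(1)[OF f] onto] by blast
 interpret h: add_map P C h by (rule lin_maps_add_map[OF lm(1,2) h])
 interpret g: add_map C D g by (rule lin_maps_add_map[OF lm(2,3) graded_mapsD(1)[OF g]])
 interpret f: add_map P D f by (rule lin_maps_add_map[OF lm(1,3) graded_mapsD(1)[OF f]])
 define k where "k = (\<lambda>n x. cC n (h (cP n x)))"
 define h' where "h' = (\<lambda>x. \<Oplus>\<^bsub>C\<^esub>n\<in>{n. cP n x \<noteq> \<zero>\<^bsub>P\<^esub>}. k n x)"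
 have k: "k n x \<in> carrier C" "k n x \<in> homog C n" "cP n x = \<zero>\<^bsub>P\<^esub> \<Longrightarrow> k n x = \<zero>\<^bsub>C\<^esub>"
  if "x \<in> carrier P" for n x using that by (auto simp: k_def h.closed h.zero gC.cmp_H)
 have fin: "finite {n. cP n x \<noteq> \<zero>\<^bsub>P\<^esub>}" if x: "x \<in> carrier P" for x
 proof -
  obtain N where N: "finite N" "\<And>n. n \<notin> N \<Longrightarrow> cP n x = \<zero>\<^bsub>P\<^esub>" using gP.cmp_sum[OF x] by blast
  have "{n. cP n x \<noteq> \<zero>\<^bsub>P\<^esub>} \<subseteq> N" using N(2) by blast
  then show ?thesis using N(1) by (rule finite_subset)
 qed
 have h': "h' x = (\<Oplus>\<^bsub>C\<^esub>n\<in>B. k n x)" if "x \<in> carrier P" "finite B" "{n. cP n x \<noteq> \<zero>\<^bsub>P\<^esub>} \<subseteq> B" for x B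
  unfolding h'_def using that k by (intro C.M.finsum_superset) auto
 have h'_closed: "h' x \<in> carrier C" if "x \<in> carrier P" for x
  unfolding h'_def using k that by (intro C.M.finsum_closed) auto
 have h'_add: "h' (x \<oplus>\<^bsub>P\<^esub> y) = h' x \<oplus>\<^bsub>C\<^esub> h' y" if xy: "x \<in> carrier P" "y \<in> carrier P" for x y
 proof -
  let ?B = "{n. cP n x \<noteq> \<zero>\<^bsub>P\<^esub>} \<union> {n. cP n y \<noteq> \<zero>\<^bsub>P\<^esub>}"
  have "h' (x \<oplus>\<^bsub>P\<^esub> y) = (\<Oplus>\<^bsub>C\<^esub>n\<in>?B. k n (x \<oplus>\<^bsub>P\<^esub> y))"
   using xy fin by (intro h') (auto simp: gP.cmp_add)
  also have "\<dots> = (\<Oplus>\<^bsub>C\<^esub>n\<in>?B. k n x \<oplus>\<^bsub>C\<^esub> k n y)"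
   using xy k by (intro C.M.finsum_cong') (auto simp: k_def gP.cmp_add h.add gC.cmp_add h.closed)
  also have "\<dots> = h' x \<oplus>\<^bsub>C\<^esub> h' y"
   using xy k fin by (subst C.M.finsum_addf) (auto simp: h'[of _ ?B])
  finally show ?thesis .
 qed
 have h'_map: "add_map P C h'"
  by (rule add_mapI) (auto simp: h'_closed h'_add P.M.abelian_group_axioms C.M.abelian_group_axioms)
 interpret h': add_map P C h' by (rule h'_map)
 have h'_homog: "h' x = cC n (h x)" if x: "x \<in> homog P n" for x n
 proof -
  have xP: "x \<in> carrier P" using x gP.H_sub by blast
  have "h' x = (\<Oplus>\<^bsub>C\<^esub>m\<in>{n}. k m x)" using x xP gP.cmp_other by (intro h') auto
  then show ?thesis using x xP k gP.cmp_same by (simp add: k_def h.closed)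
 qed
 have smh: "h' (a \<odot>\<^bsub>P\<^esub> x) = a \<odot>\<^bsub>C\<^esub> h' x" if a: "a \<in> homog S i" and x: "x \<in> homog P j" for a x i j
 proof -
  have aS: "a \<in> carrier S" and xP: "x \<in> carrier P" using a x S.H_sub gP.H_sub by blast+
  have "h' (a \<odot>\<^bsub>P\<^esub> x) = cC (i + j) (h (a \<odot>\<^bsub>P\<^esub> x))" by (rule h'_homog) (rule P.homog_smult[OF a x])
  also have "\<dots> = cC (j + i) (a \<odot>\<^bsub>C\<^esub> h x)" using lin_mapsD(3)[OF h aS xP] by (simp add: add.commute)
  also have "\<dots> = a \<odot>\<^bsub>C\<^esub> cC j (h x)"
   by (rule deg_map_cmp[OF cC cC C.smult_add_map_r[OF aS]])
    (use C.homog_smult[OF a] h.closed xP in \<open>auto simp: add.commute\<close>)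
  also have "\<dots> = a \<odot>\<^bsub>C\<^esub> h' x" using h'_homog[OF x] by simp
  finally show ?thesis .
 qed
 have smh2: "h' (a \<odot>\<^bsub>P\<^esub> x) = a \<odot>\<^bsub>C\<^esub> h' x" if a: "a \<in> homog S i" and x: "x \<in> carrier P" for a x i
 proof -
  have aS: "a \<in> carrier S" using a S.H_sub by blast
  obtain N where N: "finite N" "x = (\<Oplus>\<^bsub>P\<^esub>n\<in>N. cP n x)" using gP.cmp_sum[OF x] by blast
  have "h' (a \<odot>\<^bsub>P\<^esub> x) = h' (\<Oplus>\<^bsub>P\<^esub>n\<in>N. a \<odot>\<^bsub>P\<^esub> cP n x)"
   by (subst N(2), subst P.smult_r_finsum) (use aS N(1) x in auto)
  also have "\<dots> = (\<Oplus>\<^bsub>C\<^esub>n\<in>N. h' (a \<odot>\<^bsub>P\<^esub> cP n x))"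
   by (rule h'.finsum) (use N(1) x aS in \<open>auto simp: P.smult_closed\<close>)
  also have "\<dots> = (\<Oplus>\<^bsub>C\<^esub>n\<in>N. a \<odot>\<^bsub>C\<^esub> h' (cP n x))"
   using smh[OF a gP.cmp_H[OF x]] x aS by (intro C.M.finsum_cong') (auto simp: h'_closed C.smult_closed)
  also have "\<dots> = a \<odot>\<^bsub>C\<^esub> (\<Oplus>\<^bsub>C\<^esub>n\<in>N. h' (cP n x))"
   by (rule C.smult_r_finsum[symmetric]) (use aS N(1) x h'_closed in auto)
  also have "(\<Oplus>\<^bsub>C\<^esub>n\<in>N. h' (cP n x)) = h' x"
   by (subst (2) N(2), rule h'.finsum[symmetric]) (use N(1) x in auto)
  finally show ?thesis .
 qed
 have sm: "h' (a \<odot>\<^bsub>P\<^esub> x) = a \<odot>\<^bsub>C\<^esub> h' x" if a: "a \<in> carrier S" and x: "x \<in> carrier P" for a x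
 proof -
  obtain N where N: "finite N" "a = (\<Oplus>\<^bsub>S\<^esub>n\<in>N. cmpS n a)" using S.cmp_sum[OF a] by blast
  have "h' (a \<odot>\<^bsub>P\<^esub> x) = h' (\<Oplus>\<^bsub>P\<^esub>n\<in>N. cmpS n a \<odot>\<^bsub>P\<^esub> x)"
   by (subst N(2), subst P.smult_l_finsum) (use a N(1) x in auto)
  also have "\<dots> = (\<Oplus>\<^bsub>C\<^esub>n\<in>N. h' (cmpS n a \<odot>\<^bsub>P\<^esub> x))"
   by (rule h'.finsum) (use N(1) x a in \<open>auto simp: P.smult_closed\<close>)
  also have "\<dots> = (\<Oplus>\<^bsub>C\<^esub>n\<in>N. cmpS n a \<odot>\<^bsub>C\<^esub> h' x)"
   using smh2[OF S.cmp_H[OF a] x] a x by (intro C.M.finsum_cong') (auto simp: h'_closed C.smult_closed)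
  also have "\<dots> = a \<odot>\<^bsub>C\<^esub> h' x"
   by (subst (2) N(2), rule C.smult_l_finsum[symmetric]) (use a N(1) x h'_closed in auto)
  finally show ?thesis .
 qed
 have gr: "h' \<in> graded_maps S P C"
  unfolding graded_maps_def
  by (auto intro!: lin_mapsI simp: h'_closed h'_add sm h'_homog gC.cmp_H h.closed gP.H_sub)
 have "g (h' x) = f x" if x: "x \<in> carrier P" for x
 proof -
  obtain N where N: "finite N" "x = (\<Oplus>\<^bsub>P\<^esub>n\<in>N. cP n x)" using gP.cmp_sum[OF x] by blast
  have gk: "g (h' (cP n x)) = f (cP n x)" for n
  proof -
   have "g (h' (cP n x)) = g (cC n (h (cP n x)))" using h'_homog[OF gP.cmp_H[OF x]] by simp
   also have "\<dots> = cD (n + 0) (g (h (cP n x)))"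
    by (rule deg_map_cmp[OF cC cD, symmetric])
     (use g.add_map_axioms graded_mapsD(2)[OF g] h.closed x in auto)
   also have "\<dots> = cD n (f (cP n x))" using gh x by simp
   also have "\<dots> = f (cP n x)"
    using gD.cmp_same[OF graded_mapsD(2)[OF f gP.cmp_H[OF x]]] by simp
   finally show ?thesis .
  qed
  have "g (h' x) = g (\<Oplus>\<^bsub>C\<^esub>n\<in>N. h' (cP n x))" by (subst N(2), subst h'.finsum) (use N(1) x in auto)
  also have "\<dots> = (\<Oplus>\<^bsub>D\<^esub>n\<in>N. g (h' (cP n x)))" by (rule g.finsum) (use N(1) x h'_closed in auto)
  also have "\<dots> = (\<Oplus>\<^bsub>D\<^esub>n\<in>N. f (cP n x))" unfolding gk ..
  also have "\<dots> = f x" by (subst (2) N(2), rule f.finsum[symmetric]) (use N(1) x in auto)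
  finally show ?thesis .
 qed
 then show ?thesis using gr by blast
qed

section \<open>Free modules\<close>

definition free_mod :: "('k, 's) graded_module \<Rightarrow> nat \<Rightarrow> int \<Rightarrow> ('s, nat \<Rightarrow> 's) graded_module" where
 "free_mod S m c =
  \<lparr>carrier = {x. (\<forall>i<m. x i \<in> carrier S) \<and> (\<forall>i\<ge>m. x i = \<zero>\<^bsub>S\<^esub>)}, mult = undefined, one = undefined,
   zero = (\<lambda>_. \<zero>\<^bsub>S\<^esub>), add = (\<lambda>x y i. x i \<oplus>\<^bsub>S\<^esub> y i), smult = (\<lambda>a x i. a \<otimes>\<^bsub>S\<^esub> x i),
   homog = (\<lambda>n. {x. (\<forall>i<m. x i \<in> homog S (n - c)) \<and> (\<forall>i\<ge>m. x i = \<zero>\<^bsub>S\<^esub>)})\<rparr>"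

lemma free_mod_simps [simp]:
 "zero (free_mod S m c) = (\<lambda>_. \<zero>\<^bsub>S\<^esub>)" "add (free_mod S m c) = (\<lambda>x y i. x i \<oplus>\<^bsub>S\<^esub> y i)"
 "smult (free_mod S m c) = (\<lambda>a x i. a \<otimes>\<^bsub>S\<^esub> x i)"
 by (simp_all add: free_mod_def)

lemma free_carrier: "x \<in> carrier (free_mod S m c) \<longleftrightarrow> (\<forall>i<m. x i \<in> carrier S) \<and> (\<forall>i\<ge>m. x i = \<zero>\<^bsub>S\<^esub>)"
 by (simp add: free_mod_def)

lemma free_homog: "x \<in> homog (free_mod S m c) n \<longleftrightarrow> (\<forall>i<m. x i \<in> homog S (n - c)) \<and> (\<forall>i\<ge>m. x i = \<zero>\<^bsub>S\<^esub>)"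
 by (simp add: free_mod_def)

definition fe :: "('k, 's) graded_module \<Rightarrow> nat \<Rightarrow> nat \<Rightarrow> 's" where
 "fe S j i = (if i = j then \<one>\<^bsub>S\<^esub> else \<zero>\<^bsub>S\<^esub>)"

text \<open>As a function of x this is the linear map out of a free module that sends the i-th basis
  element to \<open>y i\<close>; all differentials below have this form.\<close>

definition lcomb :: "nat \<Rightarrow> ('s, 'm, 'x) module_scheme \<Rightarrow> (nat \<Rightarrow> 'm) \<Rightarrow> (nat \<Rightarrow> 's) \<Rightarrow> 'm" where
 "lcomb m M y x = (\<Oplus>\<^bsub>M\<^esub>i\<in>{..<m}. x i \<odot>\<^bsub>M\<^esub> y i)"

lemma free_coord: "ring S \<Longrightarrow> x \<in> carrier (free_mod S m c) \<Longrightarrow> x i \<in> carrier S"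
 by (cases "i < m") (auto simp: free_carrier ring.ring_simprules)

lemma free_left_module:
 assumes "ring S" shows "left_module S (free_mod S m c)"
proof -
 interpret ring S by fact
 note fc = free_coord[OF assms]
 have "abelian_group (free_mod S m c)"
 proof (rule abelian_groupI)
  fix x assume "x \<in> carrier (free_mod S m c)"
  then show "\<exists>y\<in>carrier (free_mod S m c). y \<oplus>\<^bsub>free_mod S m c\<^esub> x = \<zero>\<^bsub>free_mod S m c\<^esub>"
   using fc[of x m c] by (intro bexI[of _ "\<lambda>i. \<ominus>\<^bsub>S\<^esub> x i"]) (auto simp: l_neg free_carrier)
 qed (use fc in \<open>auto simp: a_ac free_carrier intro!: ext\<close>)
 then show ?thesis unfolding left_module_def left_module_axioms_def
  using assms by (auto simp: fc free_carrier l_distr r_distr m_assoc intro!: ext)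
qed

context
 fixes S :: "('k, 's) graded_module" (structure)
 assumes S: "ring S"
begin

interpretation ring S by (rule S)
interpretation F: left_module S "free_mod S m c" for m c by (rule free_left_module[OF S])

lemma fe_carrier: "j < m \<Longrightarrow> fe S j \<in> carrier (free_mod S m c)"
 by (auto simp: fe_def free_carrier)

lemma free_finsum:
 assumes "finite F" "\<And>i. i \<in> F \<Longrightarrow> f i \<in> carrier (free_mod S m c)"
 shows "(\<Oplus>\<^bsub>free_mod S m c\<^esub>i\<in>F. f i) = (\<lambda>j. \<Oplus>i\<in>F. f i j)"
 using assms
proof (induction F rule: finite_induct)
 case (insert i F)
 then have "(\<Oplus>\<^bsub>free_mod S m c\<^esub>i\<in>insert i F. f i) = f i \<oplus>\<^bsub>free_mod S m c\<^esub> (\<Oplus>\<^bsub>free_mod S m c\<^esub>i\<in>F. f i)"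
  by (intro F.M.finsum_insert) auto
 moreover have "(\<Oplus>i\<in>insert i F. f i j) = f i j \<oplus> (\<Oplus>i\<in>F. f i j)" for j
  using insert by (intro finsum_insert) (auto intro: free_coord[OF S])
 ultimately show ?case using insert by auto
qed (simp add: F.M.finsum_empty)

lemma free_expand:
 assumes "x \<in> carrier (free_mod S m c)"
 shows "x = (\<Oplus>\<^bsub>free_mod S m c\<^esub>i\<in>{..<m}. x i \<odot>\<^bsub>free_mod S m c\<^esub> fe S i)"
proof -
 have "(\<Oplus>\<^bsub>free_mod S m c\<^esub>i\<in>{..<m}. x i \<odot>\<^bsub>free_mod S m c\<^esub> fe S i) = (\<lambda>j. \<Oplus>i\<in>{..<m}. x i \<otimes> fe S i j)"
  using assms by (subst free_finsum)
   (auto intro: F.smult_closed[simplified] fe_carrier free_coord[OF S])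
 also have "\<dots> = x"
 proof
  fix j show "(\<Oplus>i\<in>{..<m}. x i \<otimes> fe S i j) = x j"
  proof (cases "j < m")
   case True
   then have "(\<Oplus>i\<in>{..<m}. x i \<otimes> fe S i j) = x j \<otimes> fe S j j"
    using free_coord[OF S assms] by (intro finsum_single) (auto simp: fe_def)
   then show ?thesis using free_coord[OF S assms] by (simp add: fe_def)
  next
   case False
   then have "(\<Oplus>i\<in>{..<m}. x i \<otimes> fe S i j) = (\<Oplus>i\<in>{..<m}. \<zero>)"
    using free_coord[OF S assms] by (intro finsum_cong') (auto simp: fe_def)
   then show ?thesis using assms False by (simp add: free_carrier)
  qed
 qed
 finally show ?thesis ..
qed

lemma lin_free_eq:
 assumes "left_module S M" "f \<in> lin_maps S (free_mod S m c) M" "x \<in> carrier (free_mod S m c)"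
 shows "f x = lcomb m M (\<lambda>i. f (fe S i)) x"
proof -
 interpret f: add_map "free_mod S m c" M f
  by (rule lin_maps_add_map[OF F.left_module_axioms assms(1,2)])
 have c: "x i \<odot>\<^bsub>free_mod S m c\<^esub> fe S i \<in> carrier (free_mod S m c)" if "i < m" for i
  using F.smult_closed fe_carrier[OF that] free_coord[OF S assms(3)] by blast
 have "f x = f (\<Oplus>\<^bsub>free_mod S m c\<^esub>i\<in>{..<m}. x i \<odot>\<^bsub>free_mod S m c\<^esub> fe S i)"
  by (subst free_expand[OF assms(3)]) (rule refl)
 also have "\<dots> = (\<Oplus>\<^bsub>M\<^esub>i\<in>{..<m}. f (x i \<odot>\<^bsub>free_mod S m c\<^esub> fe S i))"
  by (rule f.finsum) (use c in auto)
 also have "\<dots> = lcomb m M (\<lambda>i. f (fe S i)) x"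
  unfolding lcomb_def
  using lin_mapsD[OF assms(2)] free_coord[OF S assms(3)] fe_carrier c
  by (intro f.N.finsum_cong') (auto simp del: free_mod_simps, metis)
 finally show ?thesis .
qed

lemma lcomb_lin:
 assumes M: "left_module S M" and y: "\<And>i. i < m \<Longrightarrow> y i \<in> carrier M"
 shows "lcomb m M y \<in> lin_maps S (free_mod S m c) M"
proof -
 interpret M: left_module S M by fact
 note fc = free_coord[OF S]
 show ?thesis unfolding lcomb_def
 proof (rule lin_mapsI)
  fix u v assume u: "u \<in> carrier (free_mod S m c)" and v: "v \<in> carrier (free_mod S m c)"
  show "(\<Oplus>\<^bsub>M\<^esub>i\<in>{..<m}. (u \<oplus>\<^bsub>free_mod S m c\<^esub> v) i \<odot>\<^bsub>M\<^esub> y i) =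
    (\<Oplus>\<^bsub>M\<^esub>i\<in>{..<m}. u i \<odot>\<^bsub>M\<^esub> y i) \<oplus>\<^bsub>M\<^esub> (\<Oplus>\<^bsub>M\<^esub>i\<in>{..<m}. v i \<odot>\<^bsub>M\<^esub> y i)"
   using y fc[OF u] fc[OF v]
   by (subst M.finsum_addf[symmetric]) (auto intro!: M.finsum_cong' M.smult_closed simp: M.smult_l_distr)
 next
  fix a u assume a: "a \<in> carrier S" and u: "u \<in> carrier (free_mod S m c)"
  show "(\<Oplus>\<^bsub>M\<^esub>i\<in>{..<m}. (a \<odot>\<^bsub>free_mod S m c\<^esub> u) i \<odot>\<^bsub>M\<^esub> y i) = a \<odot>\<^bsub>M\<^esub> (\<Oplus>\<^bsub>M\<^esub>i\<in>{..<m}. u i \<odot>\<^bsub>M\<^esub> y i)"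
   using y fc[OF u] a
   by (subst M.smult_r_finsum) (auto intro!: M.finsum_cong' M.smult_closed simp: M.smult_assoc1)
 qed (use y fc in \<open>auto intro!: M.finsum_closed M.smult_closed\<close>)
qed

lemma lcomb_fe:
 assumes M: "left_module S M" and y: "\<And>i. i < m \<Longrightarrow> y i \<in> carrier M" and j: "j < m"
 shows "lcomb m M y (fe S j) = y j"
proof -
 interpret M: left_module S M by fact
 have "lcomb m M y (fe S j) = fe S j j \<odot>\<^bsub>M\<^esub> y j" unfolding lcomb_def
  by (rule M.finsum_single) (use y j M.smult_l_zero in \<open>auto simp: fe_def M.smult_one\<close>)
 then show ?thesis using y[OF j] by (simp add: fe_def M.smult_one)
qed

lemma free_lin_ext:
 assumes "left_module S M" "f \<in> lin_maps S (free_mod S m c) M" "g \<in> lin_maps S (free_mod S m c) M"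
  "\<And>i. i < m \<Longrightarrow> f (fe S i) = g (fe S i)" "x \<in> carrier (free_mod S m c)"
 shows "f x = g x"
proof -
 interpret M: left_module S M by fact
 show ?thesis
  unfolding lin_free_eq[OF assms(1,2,5)] lin_free_eq[OF assms(1,3,5)] lcomb_def
  using assms(4) lin_mapsD[OF assms(3)] fe_carrier free_coord[OF S assms(5)]
  by (intro M.finsum_cong') (auto intro!: M.smult_closed)
qed

lemma free_lift:
 assumes "left_module S C" "left_module S D" "g \<in> lin_maps S C D" "f \<in> lin_maps S (free_mod S m c) D"
  "\<And>i. i < m \<Longrightarrow> y i \<in> carrier C" "\<And>i. i < m \<Longrightarrow> g (y i) = f (fe S i)"
  "x \<in> carrier (free_mod S m c)"
 shows "g (lcomb m C y x) = f x"
proof (rule free_lin_ext[OF assms(2) lin_maps_comp[OF lcomb_lin assms(3)] assms(4) _ assms(7)])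
 fix i assume "i < m"
 then show "g (lcomb m C y (fe S i)) = f (fe S i)"
  using assms(6) by (subst lcomb_fe[OF assms(1,5)]) auto
qed (use assms in auto)

end

lemma free_projective:
 fixes S :: "('k, 's) graded_module"
 assumes S: "ring S"
 shows "projective S (free_mod S m c)"
 unfolding projective_def
proof (intro conjI allI ballI impI free_left_module[OF S])
 fix M :: "('s, nat \<Rightarrow> 's) module" and N :: "('s, nat \<Rightarrow> 's) module" and g f
 assume g: "g \<in> lin_maps S M N" and f: "f \<in> lin_maps S (free_mod S m c) N"
  and *: "left_module S M \<and> left_module S N \<and> g ` carrier M = carrier N"
 have "\<exists>y. y \<in> carrier M \<and> g y = f (fe S i)" if "i < m" for i
  using lin_mapsD(1)[OF f fe_carrier[OF S that]] * by (metis imageE)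
 then obtain y where y: "\<And>i. i < m \<Longrightarrow> y i \<in> carrier M \<and> g (y i) = f (fe S i)" by metis
 show "\<exists>h\<in>lin_maps S (free_mod S m c) M. \<forall>x\<in>carrier (free_mod S m c). g (h x) = f x"
 proof (intro bexI ballI)
  show "lcomb m M y \<in> lin_maps S (free_mod S m c) M"
   by (rule lcomb_lin[OF S]) (use * y in auto)
  show "g (lcomb m M y x) = f x" if "x \<in> carrier (free_mod S m c)" for x
   by (rule free_lift[OF S _ _ g f]) (use * y that in auto)
 qed
qed

context graded_ring begin

interpretation F: left_module S "free_mod S m c" for m c by (rule free_left_module[OF ring_axioms])

lemma free_graded_group:
 "graded_group (free_mod S m c) (homog (free_mod S m c)) (\<lambda>n x i. cmp (n - c) (x i))"
proof
 note fc = free_coord[OF ring_axioms]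
 fix x n assume x: "x \<in> homog (free_mod S m c) n"
 then show "x \<in> carrier (free_mod S m c)" by (auto simp: free_homog free_carrier H_sub)
 show "(\<lambda>i. cmp (n - c) (x i)) = x"
 proof
  fix i show "cmp (n - c) (x i) = x i" using x by (cases "i < m") (auto simp: free_homog cmp_same)
 qed
 show "(\<lambda>i. cmp (k - c) (x i)) = \<zero>\<^bsub>free_mod S m c\<^esub>" if "k \<noteq> n" for k
 proof
  fix i show "cmp (k - c) (x i) = \<zero>\<^bsub>free_mod S m c\<^esub> i"
   using x that cmp_other[of "x i" "n - c" "k - c"] by (cases "i < m") (auto simp: free_homog)
 qed
next
 note fc = free_coord[OF ring_axioms]
 fix x n assume x: "x \<in> carrier (free_mod S m c)"
 then show "(\<lambda>i. cmp (n - c) (x i)) \<in> homog (free_mod S m c) n"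
  by (auto simp: free_homog free_carrier cmp_H)
 have "\<forall>i. \<exists>N. finite N \<and> (\<forall>n. n \<notin> N \<longrightarrow> cmp n (x i) = \<zero>)" using cmp_sum[OF fc[OF x]] by blast
 then obtain N where N: "\<And>i. finite (N i)" "\<And>i n. n \<notin> N i \<Longrightarrow> cmp n (x i) = \<zero>" by metis
 let ?B = "\<Union>i<m. (\<lambda>n. n + c) ` N i"
 have z: "cmp (n - c) (x i) = \<zero>" if "n \<notin> ?B" for n i
 proof (cases "i < m")
  case True
  have "n \<in> ?B" if "n - c \<in> N i" using that True by (auto intro!: bexI[of _ i] image_eqI[of _ _ "n - c"])
  then have "n - c \<notin> N i" using that by blast
  then show ?thesis by (rule N)
 qed (use x in \<open>simp add: free_carrier\<close>)
 have hc: "(\<lambda>i. cmp (n - c) (x i)) \<in> carrier (free_mod S m c)" for n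
  using x by (auto simp: free_carrier)
 have "x = (\<Oplus>\<^bsub>free_mod S m c\<^esub>n\<in>?B. (\<lambda>i. cmp (n - c) (x i)))"
 proof (subst free_finsum[OF ring_axioms], goal_cases)
  case 3
  show ?case
  proof
   fix i
   have fB: "finite ?B" using N by auto
   have "x i = (\<Oplus>k\<in>(\<lambda>n. n - c) ` ?B. cmp k (x i))"
   proof (rule cmp_sum_superset[OF fc[OF x]])
    fix k assume "k \<notin> (\<lambda>n. n - c) ` ?B"
    then have "k + c \<notin> ?B" by (metis add_diff_cancel_right' imageI)
    then show "cmp k (x i) = \<zero>" using z[of "k + c" i] by simp
   qed (use fB in auto)
   also have "\<dots> = (\<Oplus>n\<in>?B. cmp (n - c) (x i))"
    by (subst finsum_reindex) (auto simp: inj_on_def fc[OF x])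
   finally show "x i = (\<Oplus>n\<in>?B. cmp (n - c) (x i))" .
  qed
 qed (use N hc in auto)
 then show "\<exists>N. finite N \<and> (\<forall>n. n \<notin> N \<longrightarrow> (\<lambda>i. cmp (n - c) (x i)) = \<zero>\<^bsub>free_mod S m c\<^esub>) \<and>
   x = (\<Oplus>\<^bsub>free_mod S m c\<^esub>n\<in>N. (\<lambda>i. cmp (n - c) (x i)))"
  using N z by (intro exI[of _ ?B] conjI) (auto simp del: UN_iff)
qed (auto simp: free_coord[OF ring_axioms] cmp_add)

lemma free_graded: "graded_left_module S (free_mod S m c)"
proof -
 interpret G: graded_group "free_mod S m c" "homog (free_mod S m c)" "\<lambda>n x i. cmp (n - c) (x i)"
  by (rule free_graded_group)
 show ?thesis unfolding graded_left_module_def graded_left_module_axioms_def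
 proof (intro conjI allI impI F.left_module_axioms G.H_subgroup G.direct_sum)
  fix a i x j assume "a \<in> homog S i" "x \<in> homog (free_mod S m c) j"
  then show "a \<odot>\<^bsub>free_mod S m c\<^esub> x \<in> homog (free_mod S m c) (i + j)"
   using homog_mult[of a i _ "j - c"] H_sub[of a i] by (auto simp: free_homog diff_add_eq add_diff_eq)
 qed
qed

lemma fe_homog: "j < m \<Longrightarrow> fe S j \<in> homog (free_mod S m c) c"
 by (auto simp: free_homog fe_def one_homog H_zero)

lemma lcomb_graded:
 assumes M: "graded_left_module S M" and y: "\<And>i. i < m \<Longrightarrow> y i \<in> homog M c"
 shows "lcomb m M y \<in> graded_maps S (free_mod S m c) M"
proof -
 interpret M: graded_left_module S M by fact
 obtain cM where "graded_group M (homog M) cM" using M.graded_group_exists ..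
 then interpret gM: graded_group M "homog M" cM .
 have "lcomb m M y x \<in> homog M n" if "x \<in> homog (free_mod S m c) n" for x n
  unfolding lcomb_def
  by (rule gM.H_finsum) (use that y M.homog_smult[of _ "n - c" _ c] in \<open>auto simp: free_homog\<close>)
 then show ?thesis unfolding graded_maps_def
  using lcomb_lin[OF ring_axioms M.left_module_axioms] y gM.H_sub by blast
qed

end

section \<open>Quotients of tensor algebras\<close>

definition dg :: "nat \<Rightarrow> ('n::finite list \<Rightarrow> 'k::field) \<Rightarrow> 'n list \<Rightarrow> 'k" where
 "dg n u s = (if length s = n then u s else 0)"

lemma dg_tensors: "dg n u \<in> tensors n"
 by (simp add: dg_def tensors_def)

lemma dg_TT: "dg n u \<in> \<T>"
 by (rule tensors_TT[OF dg_tensors])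

lemma dg_same: "u \<in> tensors n \<Longrightarrow> dg n u = u"
 by (auto simp: dg_def tensors_def)

lemma dg_other: "u \<in> tensors n \<Longrightarrow> m \<noteq> n \<Longrightarrow> dg m u = (\<lambda>_. 0)"
 by (auto simp: dg_def tensors_def)

lemma dg_linear:
 "dg n (\<lambda>s. u s + v s) = (\<lambda>s. dg n u s + dg n v s)" "dg n (\<lambda>s. c * u s) = (\<lambda>s. c * dg n u s)"
 "dg n (\<lambda>s. u s - v s) = (\<lambda>s. dg n u s - dg n v s)" "dg n (\<lambda>s. 0) = (\<lambda>s. 0)"
 by (auto simp: dg_def)

lemma dg_sum: "u \<in> \<T> \<Longrightarrow> \<exists>N. \<forall>M\<ge>N. u = (\<lambda>s. \<Sum>n\<le>M. dg n u s)"
proof -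
 assume "u \<in> \<T>"
 then obtain N where N: "\<forall>s. length s > N \<longrightarrow> u s = 0" by (auto simp: TT_carrier_iff)
 have "u s = (\<Sum>n\<le>M. dg n u s)" if "M \<ge> N" for M s
  using N that by (cases "length s \<le> M") (auto simp: dg_def)
 then show ?thesis by blast
qed

lemma dg_mult: "dg n (v \<star> u) = (\<lambda>s. \<Sum>i\<le>n. (dg i v \<star> dg (n - i) u) s)"
proof
 fix s show "dg n (v \<star> u) s = (\<Sum>i\<le>n. (dg i v \<star> dg (n - i) u) s)"
 proof (cases "length s = n")
  case True
  have "(dg i v \<star> dg (n - i) u) s = v (take i s) * u (drop i s)" if "i \<le> n" for i
   using mult_tensors(2)[OF dg_tensors dg_tensors, of "take i s" i v "n - i" u "drop i s"] True that
   by (simp add: dg_def)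
  then show ?thesis using True by (simp add: dg_def) (simp add: tensor_algebra_def)
 next
  case False
  have "(dg i v \<star> dg (n - i) u) s = 0" if "i \<le> n" for i
   using mult_tensors(1)[OF dg_tensors dg_tensors, of i v "n - i" u] False that
   by (simp add: tensors_def)
  then show ?thesis using False by (simp add: dg_def)
 qed
qed

lemma tensors_subsp: "subsp (tensors n :: ('n::finite list \<Rightarrow> 'k::field) set)"
 by (simp add: subsp_def tensors_def)

text \<open>Kept apart from the quadratic case because it is instantiated twice: with R, and later
  with the contractions of \<open>w_hat\<close>, about which at that stage only containment in the
  tensor algebra is recorded.\<close>

locale pres =
 fixes X :: "('n::finite list \<Rightarrow> 'k::field) set"
 assumes X_sub: "X \<subseteq> \<T>"
begin

abbreviation A :: "('k, ('n list \<Rightarrow> 'k) set) graded_module" where "A \<equiv> presented_alg X"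

definition I :: "('n list \<Rightarrow> 'k) set" where "I = Idl\<^bsub>TT\<^esub> X"

definition cls :: "('n list \<Rightarrow> 'k) \<Rightarrow> ('n list \<Rightarrow> 'k) set" where "cls u = I +>\<^bsub>TT\<^esub> u"

lemma I_ideal: "ideal I TT"
 unfolding I_def by (rule ring.genideal_ideal[OF TT_ring X_sub])

interpretation I: ideal I TT by (rule I_ideal)

lemma I_sub: "u \<in> I \<Longrightarrow> u \<in> \<T>" using I.Icarr by blast
lemma X_I: "u \<in> X \<Longrightarrow> u \<in> I"
 unfolding I_def using ring.genideal_self[OF TT_ring X_sub] by blast
lemma I_min: "ideal J TT \<Longrightarrow> X \<subseteq> J \<Longrightarrow> I \<subseteq> J"
 unfolding I_def by (rule ring.genideal_minimal[OF TT_ring])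
lemma I_lmult: "u \<in> I \<Longrightarrow> v \<in> \<T> \<Longrightarrow> v \<star> u \<in> I" by (rule I.I_l_closed)
lemma I_rmult: "u \<in> I \<Longrightarrow> v \<in> \<T> \<Longrightarrow> u \<star> v \<in> I" by (rule I.I_r_closed)

lemma I_subsp: "subsp I"
proof -
 have "(\<lambda>s. c * u s) \<in> I" if "u \<in> I" for c u
 proof -
  have "(\<lambda>s. c * sgl [] s) \<star> u \<in> I" using that by (intro I_lmult TT_closed)
  moreover have "(\<lambda>s. c * sgl [] s) \<star> u = (\<lambda>s. c * u s)"
   by (rule ext) (simp add: TT_mult_linear TT_one_mult)
  ultimately show ?thesis by simp
 qed
 moreover note additive_subgroup.zero_closed[OF I.is_additive_subgroup]
  additive_subgroup.a_closed[OF I.is_additive_subgroup]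
 ultimately show ?thesis by (simp add: subsp_def)
qed

lemma I_zero: "(\<lambda>_. 0) \<in> I" and I_add: "u \<in> I \<Longrightarrow> v \<in> I \<Longrightarrow> (\<lambda>s. u s + v s) \<in> I"
 and I_smult: "u \<in> I \<Longrightarrow> (\<lambda>s. c * u s) \<in> I"
 using I_subsp by (auto simp: subsp_def)

lemma cls_iff: "v \<in> cls u \<longleftrightarrow> (\<lambda>s. v s - u s) \<in> I"
proof
 assume "v \<in> cls u"
 then obtain h where "h \<in> I" "v = (\<lambda>s. h s + u s)" by (auto simp: cls_def a_r_coset_def')
 then show "(\<lambda>s. v s - u s) \<in> I" by simp
next
 assume "(\<lambda>s. v s - u s) \<in> I"
 moreover have "v = (\<lambda>s. (v s - u s) + u s)" by simp
 ultimately show "v \<in> cls u" unfolding cls_def a_r_coset_def' by fastforce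
qed

lemma cls_eq: "cls u = cls v \<longleftrightarrow> (\<lambda>s. u s - v s) \<in> I"
proof
 assume "cls u = cls v"
 moreover have "u \<in> cls u" by (simp add: cls_iff I_zero)
 ultimately show "(\<lambda>s. u s - v s) \<in> I" by (simp add: cls_iff)
next
 assume uv: "(\<lambda>s. u s - v s) \<in> I"
 have "(\<lambda>s. x s - u s) \<in> I \<longleftrightarrow> (\<lambda>s. x s - v s) \<in> I" for x
  using I_add[OF _ uv, of "\<lambda>s. x s - u s"] subsp_diff[OF I_subsp _ uv, of "\<lambda>s. x s - v s"] by auto
 then show "cls u = cls v" by (auto simp: cls_iff)
qed

lemma A_carrier: "carrier A = cls ` \<T>"
 by (auto simp: presented_alg_def quot_alg_def FactRing_def A_RCOSETS_def' cls_def I_def)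

lemma cls_closed: "u \<in> \<T> \<Longrightarrow> cls u \<in> carrier A"
 by (simp add: A_carrier)

lemma cls_hom:
 "u \<in> \<T> \<Longrightarrow> v \<in> \<T> \<Longrightarrow> cls u \<otimes>\<^bsub>A\<^esub> cls v = cls (u \<star> v)"
 "u \<in> \<T> \<Longrightarrow> v \<in> \<T> \<Longrightarrow> cls u \<oplus>\<^bsub>A\<^esub> cls v = cls (\<lambda>s. u s + v s)"
 "\<one>\<^bsub>A\<^esub> = cls (sgl [])" "\<zero>\<^bsub>A\<^esub> = cls (\<lambda>_. 0)"
proof -
 note h = I.rcos_ring_hom
 have f: "mult A = mult (TT Quot I)" "add A = add (TT Quot I)" "one A = one (TT Quot I)"
  "zero A = zero (TT Quot I)"
  by (simp_all add: presented_alg_def quot_alg_def I_def)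
 show "u \<in> \<T> \<Longrightarrow> v \<in> \<T> \<Longrightarrow> cls u \<otimes>\<^bsub>A\<^esub> cls v = cls (u \<star> v)"
  "u \<in> \<T> \<Longrightarrow> v \<in> \<T> \<Longrightarrow> cls u \<oplus>\<^bsub>A\<^esub> cls v = cls (\<lambda>s. u s + v s)"
  "\<one>\<^bsub>A\<^esub> = cls (sgl [])"
  using ring_hom_mult[OF h] ring_hom_add[OF h] ring_hom_one[OF h] by (auto simp: cls_def f)
 have "\<zero>\<^bsub>A\<^esub> = I" by (simp add: f FactRing_def)
 also have "I = cls (\<lambda>_. 0)" by (auto simp: cls_iff)
 finally show "\<zero>\<^bsub>A\<^esub> = cls (\<lambda>_. 0)" .
qed

lemma A_ring: "ring A"
 by (rule ring_cong[OF I.quotient_is_ring]) (simp_all add: presented_alg_def quot_alg_def I_def)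

sublocale A: ring A by (rule A_ring)

text \<open>The scalar action on cosets is a union over representatives. All its members coincide,
  as I is closed under scalars, and the union is not empty.\<close>

lemma cls_smult: "c \<odot>\<^bsub>A\<^esub> cls u = cls (\<lambda>s. c * u s)"
proof -
 have 1: "cls (\<lambda>s. c * x s) = cls (\<lambda>s. c * u s)" if "x \<in> cls u" for x
  using that I_smult[of "\<lambda>s. x s - u s" c] by (simp add: cls_eq cls_iff right_diff_distrib)
 have "u \<in> cls u" by (simp add: cls_iff I_zero)
 then have "cls u \<noteq> {}" by blast
 then have "(\<Union>x\<in>cls u. cls (\<lambda>s. c * x s)) = cls (\<lambda>s. c * u s)" by (rule SUP_eq_const) (rule 1)
 then show ?thesis by (simp add: presented_alg_def quot_alg_def cls_def I_def)
qed

lemma homog_A: "homog A n = cls ` homog TT n"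
 by (simp add: presented_alg_def quot_alg_def cls_def I_def)

lemma homog_TT: "homog TT n = (if n < 0 then {\<lambda>_. 0} else tensors (nat n))"
 by (simp add: tensor_algebra_def)

lemma homog_A_nat: "homog A (int n) = cls ` tensors n"
 by (simp add: homog_A homog_TT)

lemma A_cases: assumes "Y \<in> carrier A" obtains u where "u \<in> \<T>" "Y = cls u"
 using assms by (auto simp: A_carrier)

lemma smult_A:
 "Y \<in> carrier A \<Longrightarrow> c \<odot>\<^bsub>A\<^esub> Y \<in> carrier A"
 "Y \<in> carrier A \<Longrightarrow> Z \<in> carrier A \<Longrightarrow> c \<odot>\<^bsub>A\<^esub> (Y \<oplus>\<^bsub>A\<^esub> Z) = c \<odot>\<^bsub>A\<^esub> Y \<oplus>\<^bsub>A\<^esub> c \<odot>\<^bsub>A\<^esub> Z"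
 "Y \<in> carrier A \<Longrightarrow> (c + c') \<odot>\<^bsub>A\<^esub> Y = c \<odot>\<^bsub>A\<^esub> Y \<oplus>\<^bsub>A\<^esub> c' \<odot>\<^bsub>A\<^esub> Y"
 "Y \<in> carrier A \<Longrightarrow> (c * c') \<odot>\<^bsub>A\<^esub> Y = c \<odot>\<^bsub>A\<^esub> (c' \<odot>\<^bsub>A\<^esub> Y)"
 "Y \<in> carrier A \<Longrightarrow> 1 \<odot>\<^bsub>A\<^esub> Y = Y"
 "Y \<in> carrier A \<Longrightarrow> 0 \<odot>\<^bsub>A\<^esub> Y = \<zero>\<^bsub>A\<^esub>"
 "Y \<in> carrier A \<Longrightarrow> Z \<in> carrier A \<Longrightarrow> (c \<odot>\<^bsub>A\<^esub> Y) \<otimes>\<^bsub>A\<^esub> Z = c \<odot>\<^bsub>A\<^esub> (Y \<otimes>\<^bsub>A\<^esub> Z)"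
 "Y \<in> carrier A \<Longrightarrow> Z \<in> carrier A \<Longrightarrow> Y \<otimes>\<^bsub>A\<^esub> (c \<odot>\<^bsub>A\<^esub> Z) = c \<odot>\<^bsub>A\<^esub> (Y \<otimes>\<^bsub>A\<^esub> Z)"
proof -
 have m: "(\<lambda>s. c * f s) \<star> g = (\<lambda>s. c * (f \<star> g) s)"
  "f \<star> (\<lambda>s. c * g s) = (\<lambda>s. c * (f \<star> g) s)" for f g :: "'n list \<Rightarrow> 'k"
  by (rule ext, simp add: TT_mult_linear)+
 note ss = cls_closed cls_hom cls_smult TT_closed m algebra_simps
 show "Y \<in> carrier A \<Longrightarrow> c \<odot>\<^bsub>A\<^esub> Y \<in> carrier A"
  "Y \<in> carrier A \<Longrightarrow> Z \<in> carrier A \<Longrightarrow> c \<odot>\<^bsub>A\<^esub> (Y \<oplus>\<^bsub>A\<^esub> Z) = c \<odot>\<^bsub>A\<^esub> Y \<oplus>\<^bsub>A\<^esub> c \<odot>\<^bsub>A\<^esub> Z"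
  "Y \<in> carrier A \<Longrightarrow> (c + c') \<odot>\<^bsub>A\<^esub> Y = c \<odot>\<^bsub>A\<^esub> Y \<oplus>\<^bsub>A\<^esub> c' \<odot>\<^bsub>A\<^esub> Y"
  "Y \<in> carrier A \<Longrightarrow> (c * c') \<odot>\<^bsub>A\<^esub> Y = c \<odot>\<^bsub>A\<^esub> (c' \<odot>\<^bsub>A\<^esub> Y)"
  "Y \<in> carrier A \<Longrightarrow> 1 \<odot>\<^bsub>A\<^esub> Y = Y"
  "Y \<in> carrier A \<Longrightarrow> 0 \<odot>\<^bsub>A\<^esub> Y = \<zero>\<^bsub>A\<^esub>"
  by (elim A_cases; simp add: ss)+
 show "Y \<in> carrier A \<Longrightarrow> Z \<in> carrier A \<Longrightarrow> (c \<odot>\<^bsub>A\<^esub> Y) \<otimes>\<^bsub>A\<^esub> Z = c \<odot>\<^bsub>A\<^esub> (Y \<otimes>\<^bsub>A\<^esub> Z)"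
  "Y \<in> carrier A \<Longrightarrow> Z \<in> carrier A \<Longrightarrow> Y \<otimes>\<^bsub>A\<^esub> (c \<odot>\<^bsub>A\<^esub> Z) = c \<odot>\<^bsub>A\<^esub> (Y \<otimes>\<^bsub>A\<^esub> Z)"
  by (elim A_cases; simp add: ss)+
qed

lemma smult_A_zero: "c \<odot>\<^bsub>A\<^esub> \<zero>\<^bsub>A\<^esub> = \<zero>\<^bsub>A\<^esub>"
 by (simp add: cls_hom cls_smult)

lemma smult_A_minus: "Y \<in> carrier A \<Longrightarrow> (- 1) \<odot>\<^bsub>A\<^esub> Y = \<ominus>\<^bsub>A\<^esub> Y"
proof -
 assume Y: "Y \<in> carrier A"
 have "(- 1) \<odot>\<^bsub>A\<^esub> Y \<oplus>\<^bsub>A\<^esub> Y = \<zero>\<^bsub>A\<^esub>" using Y smult_A(3)[of Y "-1" 1] by (simp add: smult_A)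
 then show ?thesis using Y by (metis A.minus_equality smult_A(1))
qed

lemma cls_finsum:
 assumes "finite F" "\<And>i. i \<in> F \<Longrightarrow> u i \<in> \<T>"
 shows "(\<Oplus>\<^bsub>A\<^esub>i\<in>F. cls (u i)) = cls (\<lambda>s. \<Sum>i\<in>F. u i s)"
 using assms
proof (induction F rule: finite_induct)
 case (insert x F)
 then have "(\<Oplus>\<^bsub>A\<^esub>i\<in>insert x F. cls (u i)) = cls (u x) \<oplus>\<^bsub>A\<^esub> (\<Oplus>\<^bsub>A\<^esub>i\<in>F. cls (u i))"
  by (intro A.finsum_insert) (auto simp: cls_closed)
 then show ?case using insert by (simp add: cls_hom TT_sum_closed)
qed (simp add: cls_hom)

end

section \<open>Quadratic algebras: homogeneity of the ideal, normal forms, grading\<close>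

locale quad =
 fixes R :: "('n::finite list \<Rightarrow> 'k::field) set"
 assumes R: "quadratic_relations R"
begin

lemma R_tensors: "R \<subseteq> tensors 2" and R_subsp: "subsp R"
 using R by (auto simp: quadratic_relations_def subsp_def)

sublocale pres R
 by unfold_locales (use R_tensors tensors_TT in blast)

abbreviation A_elems ("\<A>") where "\<A> \<equiv> carrier A"
abbreviation A_mult (infixl "\<cdot>" 70) where "a \<cdot> b \<equiv> mult A a b"
abbreviation A_add (infixl "+\<^sub>A" 65) where "a +\<^sub>A b \<equiv> add A a b"
abbreviation A_smult (infixl "*\<^sub>A" 70) where "c *\<^sub>A b \<equiv> smult A c b"
abbreviation A_zero ("0\<^sub>A") where "0\<^sub>A \<equiv> zero A"
abbreviation A_one ("1\<^sub>A") where "1\<^sub>A \<equiv> one A"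

text \<open>The tensors without terms of length below 2 and with quadratic part in R form an ideal
  containing R, hence containing I. So V embeds in A, and I meets the tensors of degree 2 exactly in
  R.\<close>

lemma I_low: "u \<in> I \<Longrightarrow> length s < 2 \<Longrightarrow> u s = 0"
 and I_two: "u \<in> I \<Longrightarrow> dg 2 u \<in> R"
proof -
 let ?J = "{u \<in> carrier TT. (\<forall>s. length s < 2 \<longrightarrow> u s = 0) \<and> dg 2 u \<in> R}"
 have two: "dg 2 (v \<star> u) = (\<lambda>s. v [] * dg 2 u s)" "dg 2 (u \<star> v) = (\<lambda>s. v [] * dg 2 u s)"
  if "\<forall>s. length s < 2 \<longrightarrow> u s = 0" for u v :: "'n list \<Rightarrow> 'k"
 proof -
  show "dg 2 (v \<star> u) = (\<lambda>s. v [] * dg 2 u s)"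
   using that by (auto simp: dg_def tensor_algebra_def fun_eq_iff eval_nat_numeral)
  show "dg 2 (u \<star> v) = (\<lambda>s. v [] * dg 2 u s)"
   using that by (auto simp: dg_def tensor_algebra_def fun_eq_iff eval_nat_numeral)
 qed
 have low: "(v \<star> u) s = 0" "(u \<star> v) s = 0"
  if "\<forall>s. length s < 2 \<longrightarrow> u s = 0" "length s < 2" for u v :: "'n list \<Rightarrow> 'k" and s
  using that by (auto simp: tensor_algebra_def)
 have "ideal ?J TT"
 proof (rule idealI[OF TT_ring])
  show "subgroup ?J (add_monoid TT)"
  proof (rule subgroup.intro)
   fix x assume x: "x \<in> ?J"
   have "inv\<^bsub>add_monoid TT\<^esub> x = (\<lambda>s. - x s)"
    using TT_minus[of x] x by (simp add: a_inv_def)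
   moreover have "(\<lambda>s. (-1) * dg 2 x s) \<in> R" using x R_subsp unfolding subsp_def by blast
   ultimately show "inv\<^bsub>add_monoid TT\<^esub> x \<in> ?J"
    using x dg_linear(2)[of 2 "-1" x] by (simp add: TT_closed)
  qed (use R_subsp in \<open>auto simp: TT_closed dg_linear subsp_def\<close>)
  fix u v :: "'n list \<Rightarrow> 'k" assume "u \<in> ?J" "v \<in> \<T>"
  then show "v \<star> u \<in> ?J" "u \<star> v \<in> ?J"
   using R_subsp by (auto simp: two low TT_closed subsp_def)
 qed
 moreover have "R \<subseteq> ?J"
  using R_tensors X_sub by (auto simp: dg_same) (auto simp: tensors_def)
 ultimately have "I \<subseteq> ?J" by (rule I_min)
 then show "u \<in> I \<Longrightarrow> length s < 2 \<Longrightarrow> u s = 0" "u \<in> I \<Longrightarrow> dg 2 u \<in> R" by auto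
qed

text \<open>I is a homogeneous ideal: the elements all of whose components lie in I form an ideal
  that contains the homogeneous generators.\<close>

lemma I_dg: "u \<in> I \<Longrightarrow> dg n u \<in> I"
 for u :: "'n list \<Rightarrow> 'k"
proof -
 let ?J = "{u \<in> I. \<forall>n. dg n u \<in> I}"
 have "ideal ?J TT"
 proof (rule idealI[OF TT_ring])
  show "subgroup ?J (add_monoid TT)"
  proof (rule subgroup.intro)
   fix x assume x: "x \<in> ?J"
   have "inv\<^bsub>add_monoid TT\<^esub> x = (\<lambda>s. (-1) * x s)"
    using TT_minus[of x] x I_sub by (simp add: a_inv_def)
   then show "inv\<^bsub>add_monoid TT\<^esub> x \<in> ?J"
    using x I_smult by (simp only: dg_linear mem_Collect_eq) blast
  qed (auto simp: I_sub I_zero I_add dg_linear)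
  fix u v :: "'n list \<Rightarrow> 'k" assume u: "u \<in> ?J" and v: "v \<in> \<T>"
  have "dg n (v \<star> u) \<in> I" "dg n (u \<star> v) \<in> I" for n
   unfolding dg_mult using u
   by (auto intro!: subsp_sum[OF I_subsp, of "{..n}" "\<lambda>i. dg i v \<star> dg (n - i) u"] I_lmult dg_TT)
    (auto intro!: subsp_sum[OF I_subsp, of "{..n}" "\<lambda>i. dg i u \<star> dg (n - i) v"] I_rmult dg_TT)
  then show "v \<star> u \<in> ?J" "u \<star> v \<in> ?J" using u v I_lmult I_rmult by auto
 qed
 moreover have "R \<subseteq> ?J"
 proof
  fix u assume u: "u \<in> R"
  then have "u \<in> tensors 2" using R_tensors by blast
  then have "dg n u = (if n = 2 then u else (\<lambda>_. 0))" for n using dg_same dg_other by auto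
  then show "u \<in> ?J" using X_I[OF u] I_zero by simp
 qed
 ultimately have "I \<subseteq> ?J" by (rule I_min)
 then show "u \<in> I \<Longrightarrow> dg n u \<in> I" by auto
qed

lemma I_tensors2: "I \<inter> tensors 2 = R"
proof
 show "I \<inter> tensors 2 \<subseteq> R"
 proof
  fix u assume "u \<in> I \<inter> tensors 2"
  then show "u \<in> R" using I_two[of u] dg_same[of u 2] by simp
 qed
qed (use X_I R_tensors in auto)

definition nfd :: "nat \<Rightarrow> nat \<times> (nat \<Rightarrow> 'n list \<Rightarrow> 'k) \<times> (nat \<Rightarrow> 'n list \<Rightarrow> 'k)" where
 "nfd n = (SOME (m, b, \<Psi>). dual_basis {s. length s = n} (I \<inter> tensors n) m b \<Psi>)"

text \<open>A linear normal form: a section of \<open>T(V) \<rightarrow> A\<close> obtained degreewise by projecting along a basis of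
 \<^term>\<open>I \<inter> tensors n\<close>. It provides coordinates \<open>co\<close> on \<open>A\<close>.\<close>

definition nf :: "('n list \<Rightarrow> 'k) \<Rightarrow> 'n list \<Rightarrow> 'k" where
 "nf u s = u s - (let n = length s in case nfd n of (m, b, \<Psi>) \<Rightarrow>
   \<Sum>i<m. (\<Sum>t | length t = n. \<Psi> i t * u t) * b i s)"

lemma nfd: "nfd n = (m, b, \<Psi>) \<Longrightarrow> dual_basis {s. length s = n} (I \<inter> tensors n) m b \<Psi>"
proof -
 have "subsp (I \<inter> tensors n)" using I_subsp tensors_subsp[of n] by (auto simp: subsp_def)
 then have "\<exists>m b \<Psi>. dual_basis {s. length s = n} (I \<inter> tensors n) m b \<Psi>"
  by (intro dual_basis_exists) (auto simp: tensors_def)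
 then have "\<exists>x. case x of (m, b, \<Psi>) \<Rightarrow> dual_basis {s. length s = n} (I \<inter> tensors n) m b \<Psi>" by auto
 then show "nfd n = (m, b, \<Psi>) \<Longrightarrow> dual_basis {s. length s = n} (I \<inter> tensors n) m b \<Psi>"
  unfolding nfd_def by (metis (mono_tags, lifting) case_prodD someI_ex)
qed

lemma nf_linear: "nf (\<lambda>s. u s + v s) s = nf u s + nf v s" "nf (\<lambda>s. c * u s) s = c * nf u s"
 "nf (\<lambda>s. u s - v s) s = nf u s - nf v s" "nf (\<lambda>_. 0) s = 0"
 by (auto simp: nf_def Let_def algebra_simps sum.distrib sum_subtractf sum_distrib_left split: prod.splits)

lemma nf_local: "(\<And>t. length t = length s \<Longrightarrow> u t = v t) \<Longrightarrow> nf u s = nf v s"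
proof -
 assume a: "\<And>t. length t = length s \<Longrightarrow> u t = v t"
 then have "(\<Sum>t | length t = length s. \<Psi> t * u t) = (\<Sum>t | length t = length s. \<Psi> t * v t)" for \<Psi>
  by (intro sum.cong) auto
 then show ?thesis using a by (simp add: nf_def Let_def)
qed

lemma nf_diff_I: "u \<in> \<T> \<Longrightarrow> (\<lambda>s. u s - nf u s) \<in> I"
proof -
 assume u: "u \<in> \<T>"
 have d: "(\<lambda>s. dg n u s - nf (dg n u) s) \<in> I" for n
 proof -
  obtain m b \<Psi> where n: "nfd n = (m, b, \<Psi>)" by (cases "nfd n") auto
  note db = nfd[OF n]
  have "(\<lambda>s. dg n u s - nf (dg n u) s) = (\<lambda>s. \<Sum>i<m. (\<Sum>t | length t = n. \<Psi> i t * dg n u t) * b i s)"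
  proof
   fix s show "dg n u s - nf (dg n u) s = (\<Sum>i<m. (\<Sum>t | length t = n. \<Psi> i t * dg n u t) * b i s)"
   proof (cases "length s = n")
    case True then show ?thesis using n by (simp add: nf_def)
   next
    case False
    then have "b i s = 0" if "i < m" for i
     using db that by (auto simp: dual_basis_def tensors_def)
    moreover have "nf (dg n u) s = nf (\<lambda>_. 0) s" by (rule nf_local) (use False in \<open>simp add: dg_def\<close>)
    ultimately show ?thesis using False by (simp add: nf_linear dg_def)
   qed
  qed
  also have "\<dots> \<in> I"
   using db by (intro subsp_sum[OF I_subsp]) (auto simp: dual_basis_def I_smult)
  finally show ?thesis .
 qed
 obtain N where "u = (\<lambda>s. \<Sum>n\<le>N. dg n u s)" using dg_sum[OF u] by blast
 then have a: "(\<Sum>n\<le>N. dg n u s) = u s" for s by (rule fun_cong[symmetric])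
 have b: "(\<Sum>n\<le>N. nf (dg n u) s) = nf u s" for s
 proof -
  have "(\<Sum>n\<le>N. nf (dg n u) s) = nf (\<lambda>t. \<Sum>n\<le>N. dg n u t) s"
   by (induction N) (simp_all add: nf_linear)
  then show ?thesis by (simp add: a)
 qed
 have "(\<lambda>s. \<Sum>n\<le>N. dg n u s - nf (dg n u) s) \<in> I" by (rule subsp_sum[OF I_subsp]) (rule d)
 then show ?thesis by (simp add: sum_subtractf a b)
qed

lemma nf_I: "u \<in> I \<Longrightarrow> nf u s = 0"
proof -
 assume u: "u \<in> I"
 let ?n = "length s"
 obtain m b \<Psi> where n: "nfd ?n = (m, b, \<Psi>)" by (cases "nfd ?n") auto
 have "nf u s = nf (dg ?n u) s" by (rule nf_local) (simp add: dg_def)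
 moreover have "dg ?n u \<in> I \<inter> tensors ?n" using I_dg[OF u] dg_tensors by blast
 ultimately show ?thesis using nfd[OF n] n by (simp add: nf_def dual_basis_def)
qed

lemma nf_TT: "u \<in> \<T> \<Longrightarrow> nf u \<in> \<T>"
 using TT_closed(6)[of u "\<lambda>s. u s - nf u s"] I_sub[OF nf_diff_I, of u] by simp

text \<open>The choice of representative is immaterial, because \<open>nf\<close> vanishes on I;
  \<open>co\<close> is a linear injection of A into the tensor algebra that respects
  degrees.\<close>

definition co :: "('n list \<Rightarrow> 'k) set \<Rightarrow> 'n list \<Rightarrow> 'k" where
 "co Y = nf (SOME u. u \<in> \<T> \<and> cls u = Y)"

lemma co_cls: "u \<in> \<T> \<Longrightarrow> co (cls u) = nf u"
proof -
 assume u: "u \<in> \<T>"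
 let ?v = "SOME v. v \<in> \<T> \<and> cls v = cls u"
 have "?v \<in> \<T> \<and> cls ?v = cls u" by (rule someI[of _ u]) (use u in auto)
 then have "(\<lambda>s. ?v s - u s) \<in> I" by (simp add: cls_eq)
 then show ?thesis using nf_I[of "\<lambda>s. ?v s - u s"] by (auto simp: co_def nf_linear)
qed

lemma co_TT: "Y \<in> \<A> \<Longrightarrow> co Y \<in> \<T>"
 by (auto simp: A_carrier co_cls nf_TT)

lemma cls_co: "Y \<in> \<A> \<Longrightarrow> cls (co Y) = Y"
proof (erule A_cases)
 fix u assume u: "u \<in> \<T>" "Y = cls u"
 have "cls u = cls (nf u)" using nf_diff_I[OF u(1)] cls_eq[of u "nf u"] by simp
 moreover have "co Y = nf u" using u by (simp add: co_cls)
 ultimately show ?thesis using u by simp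
qed

lemma co_inj: "Y \<in> \<A> \<Longrightarrow> Z \<in> \<A> \<Longrightarrow> (\<And>s. co Y s = co Z s) \<Longrightarrow> Y = Z"
 by (metis cls_co ext)

lemma co_linear:
 "Y \<in> \<A> \<Longrightarrow> Z \<in> \<A> \<Longrightarrow> co (Y +\<^sub>A Z) s = co Y s + co Z s"
 "Y \<in> \<A> \<Longrightarrow> co (c *\<^sub>A Y) s = c * co Y s"
 "co 0\<^sub>A s = 0"
 by (auto simp: A_carrier cls_hom cls_smult co_cls TT_closed nf_linear)

lemma co_finsum:
 "finite F \<Longrightarrow> (\<And>i. i \<in> F \<Longrightarrow> f i \<in> \<A>) \<Longrightarrow> co (\<Oplus>\<^bsub>A\<^esub>i\<in>F. f i) s = (\<Sum>i\<in>F. co (f i) s)"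
proof (induction F rule: finite_induct)
 case (insert x F)
 then have "(\<Oplus>\<^bsub>A\<^esub>i\<in>insert x F. f i) = f x +\<^sub>A (\<Oplus>\<^bsub>A\<^esub>i\<in>F. f i)" by (intro A.finsum_insert) auto
 then show ?case using insert by (simp add: co_linear)
qed (simp add: co_linear)

definition cmp :: "int \<Rightarrow> ('n list \<Rightarrow> 'k) set \<Rightarrow> ('n list \<Rightarrow> 'k) set" where
 "cmp n Y = (if n < 0 then 0\<^sub>A else cls (dg (nat n) (co Y)))"

lemma nf_dg: "nf (dg n u) = dg n (nf u)"
proof
 fix s show "nf (dg n u) s = dg n (nf u) s"
 proof (cases "length s = n")
  case True then have "nf (dg n u) s = nf u s" by (intro nf_local) (simp add: dg_def)
  then show ?thesis using True by (simp add: dg_def)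
 next
  case False then have "nf (dg n u) s = nf (\<lambda>_. 0) s" by (intro nf_local) (simp add: dg_def)
  then show ?thesis using False by (simp add: dg_def nf_linear)
 qed
qed

lemma cmp_cls: "u \<in> \<T> \<Longrightarrow> cmp n (cls u) = (if n < 0 then 0\<^sub>A else cls (dg (nat n) u))"
 using I_dg[OF nf_diff_I, of u "nat n"] cls_eq[of "dg (nat n) u" "dg (nat n) (nf u)"]
 by (simp add: cmp_def co_cls dg_linear)

lemma homog_A_cases:
 assumes "Y \<in> homog A n"
 obtains "n < 0" "Y = 0\<^sub>A" | u where "n \<ge> 0" "u \<in> tensors (nat n)" "Y = cls u"
 using assms by (auto simp: homog_A homog_TT cls_hom split: if_splits)

sublocale G: graded_ring A cmp
proof
 fix Y n assume Y: "Y \<in> homog A n"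
 then show "Y \<in> \<A>" by (cases rule: homog_A_cases) (auto simp: cls_closed tensors_TT)
 show "cmp n Y = Y"
  using Y by (cases rule: homog_A_cases) (simp_all add: cmp_cls tensors_TT dg_same cmp_def[of n "0\<^sub>A"])
 show "cmp m Y = 0\<^sub>A" if "m \<noteq> n" for m
  using Y
 proof (cases rule: homog_A_cases)
  case 1
  then show ?thesis by (simp add: cls_hom(4) cmp_cls TT_closed dg_linear)
 next
  case (2 u)
  then show ?thesis using that dg_other[of u "nat n" "nat m"]
   by (auto simp: cmp_cls tensors_TT cls_hom)
 qed
next
 fix Y n assume Y: "Y \<in> \<A>"
 show "cmp n Y \<in> homog A n"
  by (auto simp: cmp_def homog_A homog_TT cls_hom dg_tensors)
 obtain u where u: "u \<in> \<T>" "Y = cls u" using Y by (rule A_cases)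
 obtain N where N: "u = (\<lambda>s. \<Sum>n\<le>N. dg n u s)" "\<forall>s. length s > N \<longrightarrow> u s = 0"
 proof -
  obtain N1 where N1: "\<forall>M\<ge>N1. u = (\<lambda>s. \<Sum>n\<le>M. dg n u s)" using dg_sum[OF u(1)] by blast
  obtain N2 where N2: "\<forall>s. length s > N2 \<longrightarrow> u s = 0" using u(1) by (auto simp: TT_carrier_iff)
  show thesis by (rule that[of "max N1 N2"]) (use N1 N2 in auto)
 qed
 have z: "cmp n Y = 0\<^sub>A" if "n \<notin> int ` {..N}" for n
 proof (cases "n < 0")
  case False
  have "nat n \<notin> {..N}"
  proof
   assume "nat n \<in> {..N}"
   then have "int (nat n) \<in> int ` {..N}" by (rule imageI)
   then show False using that False by simp
  qed
  then have "dg (nat n) u = (\<lambda>_. 0)" using N(2) by (auto simp: dg_def fun_eq_iff)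
  then show ?thesis using u False by (simp add: cmp_cls cls_hom)
 qed (simp add: cmp_def)
 have "(\<Oplus>\<^bsub>A\<^esub>n\<in>int ` {..N}. cmp n Y) = (\<Oplus>\<^bsub>A\<^esub>n\<in>{..N}. cls (dg n u))"
  by (subst A.finsum_reindex) (auto simp: u cmp_cls cls_closed dg_TT intro!: A.finsum_cong')
 also have "\<dots> = cls (\<lambda>s. \<Sum>n\<le>N. dg n u s)" by (rule cls_finsum) (auto simp: dg_TT)
 also have "\<dots> = Y" using N(1) u(2) by simp
 finally show "\<exists>N. finite N \<and> (\<forall>n. n \<notin> N \<longrightarrow> cmp n Y = 0\<^sub>A) \<and> Y = (\<Oplus>\<^bsub>A\<^esub>n\<in>N. cmp n Y)"
  using z by (intro exI[of _ "int ` {..N}"]) simp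
next
 fix Y Z n assume "Y \<in> \<A>" "Z \<in> \<A>"
 then show "cmp n (Y +\<^sub>A Z) = cmp n Y +\<^sub>A cmp n Z"
  by (auto simp: A_carrier cls_hom cmp_cls TT_closed dg_linear dg_TT)
next
 fix Y Z i j assume Y: "Y \<in> homog A i" and Z: "Z \<in> homog A j"
 have YZ: "Y \<in> \<A>" "Z \<in> \<A>"
  using Y Z by (auto elim!: homog_A_cases simp: cls_closed tensors_TT)
 have z: "0\<^sub>A \<in> homog A n" for n by (auto simp: homog_A homog_TT cls_hom tensors_def)
 show "Y \<cdot> Z \<in> homog A (i + j)"
  using Y
 proof (cases rule: homog_A_cases)
  case (2 u)
  note u = 2
  show ?thesis using Z
  proof (cases rule: homog_A_cases)
   case (2 v)
   then have "u \<star> v \<in> tensors (nat (i + j))"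
    using mult_tensors(1)[OF u(2) 2(2)] u(1) by (simp add: nat_add_distrib)
   then show ?thesis using u 2 by (auto simp: cls_hom tensors_TT homog_A homog_TT)
  qed (use YZ z in simp)
 qed (use YZ z in simp)
next
 show "1\<^sub>A \<in> homog A 0" by (auto simp: homog_A homog_TT cls_hom tensors_def sgl_def)
qed

lemma co_homog: "Y \<in> homog A n \<Longrightarrow> int (length s) \<noteq> n \<Longrightarrow> co Y s = 0"
proof (erule homog_A_cases)
 fix u assume u: "int (length s) \<noteq> n" "n \<ge> 0" "u \<in> tensors (nat n)" "Y = cls u"
 have "nf u s = dg (nat n) (nf u) s" using nf_dg[of "nat n" u] u by (simp add: dg_same)
 then show ?thesis using u by (auto simp: co_cls tensors_TT dg_def split: if_splits)
qed (simp add: co_linear)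

lemma co_low: "u \<in> \<T> \<Longrightarrow> length s < 2 \<Longrightarrow> nf u s = u s"
 using I_low[OF nf_diff_I, of u s] by simp

lemma homog_neg: "n < 0 \<Longrightarrow> homog A n = {0\<^sub>A}"
 by (simp add: homog_A homog_TT cls_hom)

lemma homog_A_0: "Y \<in> homog A 0 \<longleftrightarrow> (\<exists>c. Y = c *\<^sub>A 1\<^sub>A)"
proof
 assume "Y \<in> homog A 0"
 then obtain u where u: "u \<in> tensors 0" "Y = cls u" by (auto elim: homog_A_cases)
 have "u = (\<lambda>s. u [] * sgl [] s)" using u(1) by (auto simp: tensors_def sgl_def)
 then show "\<exists>c. Y = c *\<^sub>A 1\<^sub>A" using u by (metis cls_hom(3) cls_smult)
next
 assume "\<exists>c. Y = c *\<^sub>A 1\<^sub>A"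
 then show "Y \<in> homog A 0" by (auto simp: homog_A homog_TT cls_hom cls_smult tensors_def sgl_def)
qed

lemma vec_tensor_tensors: "vec_tensor v \<in> tensors (Suc 0)"
 by (auto simp: tensors_def vec_tensor_def split: list.splits)

lemma homog_A_1: "Y \<in> homog A 1 \<longleftrightarrow> (\<exists>v. Y = cls (vec_tensor v))"
proof
 assume "Y \<in> homog A 1"
 then obtain u where u: "u \<in> tensors (Suc 0)" "Y = cls u" by (auto elim: homog_A_cases)
 have "u = vec_tensor (\<lambda>x. u [x])"
  using u(1) by (auto simp: tensors_def vec_tensor_def fun_eq_iff split: list.splits)
 then show "\<exists>v. Y = cls (vec_tensor v)" using u by metis
next
 assume "\<exists>v. Y = cls (vec_tensor v)"
 then show "Y \<in> homog A 1" using vec_tensor_tensors by (auto simp: homog_A homog_TT)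
qed

lemma cls_vec_eq: "cls (vec_tensor v) = cls (vec_tensor v') \<longleftrightarrow> v = v'"
proof
 assume "cls (vec_tensor v) = cls (vec_tensor v')"
 then have "(\<lambda>s. vec_tensor v s - vec_tensor v' s) \<in> I" by (simp add: cls_eq)
 then have "vec_tensor v [x] - vec_tensor v' [x] = 0" for x using I_low by fastforce
 then show "v = v'" by (simp add: vec_tensor_def fun_eq_iff)
qed simp

lemma scal_eq: "c *\<^sub>A 1\<^sub>A = c' *\<^sub>A 1\<^sub>A \<longleftrightarrow> c = c'"
proof
 assume "c *\<^sub>A 1\<^sub>A = c' *\<^sub>A 1\<^sub>A"
 then have *: "(\<lambda>s. c * sgl [] s - c' * sgl [] s) \<in> I" by (simp add: cls_hom cls_smult cls_eq)
 show "c = c'" using I_low[OF *, of "[]"] by (simp add: sgl_def)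
qed simp

end

section \<open>Comparison of complexes\<close>

text \<open>Position 0 of a sequence is the resolved module itself and there every element counts as
  a cycle, so that exactness at 0 is surjectivity of the augmentation.\<close>

definition cyc :: "(nat \<Rightarrow> ('s, 'm, 'x) module_scheme) \<Rightarrow> (nat \<Rightarrow> 'm \<Rightarrow> 'm) \<Rightarrow> nat \<Rightarrow> 'm set" where
 "cyc X d j = (case j of 0 \<Rightarrow> carrier (X 0) | Suc i \<Rightarrow> {x \<in> carrier (X (Suc i)). d i x = \<zero>\<^bsub>X i\<^esub>})"

lemma cyc_simps [simp]: "cyc X d 0 = carrier (X 0)"
 "x \<in> cyc X d (Suc i) \<longleftrightarrow> x \<in> carrier (X (Suc i)) \<and> d i x = \<zero>\<^bsub>X i\<^esub>"
 by (simp_all add: cyc_def)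

lemma cyc_carrier: "x \<in> cyc X d j \<Longrightarrow> x \<in> carrier (X j)"
 by (cases j) auto

lemma (in abelian_group) diff_zero_eq:
 assumes "x \<in> carrier G" "y \<in> carrier G" "x \<ominus> y = \<zero>" shows "x = y"
 using minus_equality[of x "\<ominus> y"] assms by (simp add: a_minus_def)

lemma lin_maps_id: "(\<lambda>x. x) \<in> lin_maps A M M"
 by (rule lin_mapsI) auto

text \<open>\<open>X 0\<close> is the module to be resolved and \<open>X (Suc j)\<close> is free on
  generators of degree j. \<open>low\<close> demands exactness at \<open>X j\<close> only in degree
  j, where the generators of the next term live, and \<open>inj\<close> demands injectivity of the
  differential on generators: the part of exactness of a linear complex that can be verified by
  linear algebra on tensors.\<close>

locale free_complex = graded_ring S cmp
 for S :: "('k::field, 's) graded_module" (structure) and cmp +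
 fixes X :: "nat \<Rightarrow> ('s, nat \<Rightarrow> 's) graded_module" and d :: "nat \<Rightarrow> (nat \<Rightarrow> 's) \<Rightarrow> nat \<Rightarrow> 's"
  and m :: "nat \<Rightarrow> nat"
 assumes X_graded: "graded_left_module S (X j)"
  and X_free: "X (Suc j) = free_mod S (m j) (int j)"
  and d_graded: "d j \<in> graded_maps S (X (Suc j)) (X j)"
  and d_cyc: "x \<in> carrier (X (Suc j)) \<Longrightarrow> d j x \<in> cyc X d j"
  and low: "x \<in> homog (X j) (int j) \<Longrightarrow> x \<in> cyc X d j \<Longrightarrow> x \<in> d j ` carrier (X (Suc j))"
  and inj: "x \<in> homog (X (Suc j)) (int j) \<Longrightarrow> d j x = \<zero>\<^bsub>X j\<^esub> \<Longrightarrow> x = \<zero>\<^bsub>X (Suc j)\<^esub>"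
begin

lemma X_left: "left_module S (X j)"
 using X_graded[of j] by (simp add: graded_left_module_def)

lemma d_lin: "d j \<in> lin_maps S (X (Suc j)) (X j)"
 using d_graded by (rule graded_mapsD)

lemma d_add_map: "add_map (X (Suc j)) (X j) (d j)"
 by (rule lin_maps_add_map[OF X_left X_left d_lin])

lemma X_homog_carrier: "x \<in> homog (X j) n \<Longrightarrow> x \<in> carrier (X j)"
proof -
 interpret graded_left_module S "X j" by (rule X_graded)
 show "x \<in> homog (X j) n \<Longrightarrow> x \<in> carrier (X j)"
  using subgroup.subset[OF homog_subgroup[of n]] by auto
qed

text \<open>Every chain map built here is determined in the generating degree, where the differentials are
 injective; hence lifts in both directions compose to the identity without any homotopy.\<close>

theorem koszul_exact:
 assumes Y_graded: "\<And>j. graded_left_module S (Y j)"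
  and e_graded: "\<And>j. e j \<in> graded_maps S (Y (Suc j)) (Y j)"
  and Y_exact: "\<And>j. cyc Y e j = e j ` carrier (Y (Suc j))"
  and Y_proj: "\<And>j. projective S (Y (Suc j))"
  and Y_gen: "\<And>j. generated_in_degree S (Y (Suc j)) (int j)"
  and Y0: "Y 0 = X 0"
 shows "cyc X d j = d j ` carrier (X (Suc j))"
proof -
 have Y_left: "left_module S (Y j)" for j
  using Y_graded[of j] by (simp add: graded_left_module_def)
 have e_lin: "e j \<in> lin_maps S (Y (Suc j)) (Y j)" for j using e_graded by (rule graded_mapsD)
 \<comment> \<open>At each stage X is a retract of the given resolution, by maps that carry cycles
   to cycles; this is enough to transport exactness.\<close>
 define good where "good = (\<lambda>j. \<exists>f\<in>graded_maps S (X j) (Y j). \<exists>g\<in>graded_maps S (Y j) (X j).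
  (\<forall>x\<in>carrier (X j). g (f x) = x) \<and> (\<forall>x\<in>cyc X d j. f x \<in> cyc Y e j) \<and>
  (\<forall>x\<in>cyc Y e j. g x \<in> cyc X d j))"
 have ex: "cyc X d j = d j ` carrier (X (Suc j))" if good: "good j" for j
 proof
  from good[unfolded good_def] obtain f where f: "f \<in> graded_maps S (X j) (Y j)" and *: "\<exists>g\<in>graded_maps S (Y j) (X j).
  (\<forall>x\<in>carrier (X j). g (f x) = x) \<and> (\<forall>x\<in>cyc X d j. f x \<in> cyc Y e j) \<and> (\<forall>x\<in>cyc Y e j. g x \<in> cyc X d j)"
   by (rule bexE)
  from * obtain g where g: "g \<in> graded_maps S (Y j) (X j)" and **: "(\<forall>x\<in>carrier (X j). g (f x) = x) \<and>
  (\<forall>x\<in>cyc X d j. f x \<in> cyc Y e j) \<and> (\<forall>x\<in>cyc Y e j. g x \<in> cyc X d j)"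
   by (rule bexE)
  have gf: "g (f x) = x" if "x \<in> carrier (X j)" for x using ** that by simp
  have fc: "f x \<in> cyc Y e j" if "x \<in> cyc X d j" for x using ** that by simp
  have gc: "g x \<in> cyc X d j" if "x \<in> cyc Y e j" for x using ** that by simp
  interpret Y: left_module S "Y (Suc j)" by (rule Y_left)
  interpret X1: left_module S "X (Suc j)" by (rule X_left)
  interpret e: add_map "Y (Suc j)" "Y j" "e j" by (rule lin_maps_add_map[OF Y_left Y_left e_lin])
  interpret d: add_map "X (Suc j)" "X j" "d j" by (rule d_add_map)
  interpret g: add_map "Y j" "X j" g
   by (rule lin_maps_add_map[OF Y_left X_left graded_mapsD(1)[OF g]])
  \<comment> \<open>The elements whose image in X is a boundary form a submodule. By
    \<open>low\<close> it contains the generating degree, so by linearity of the resolution Y it is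
    everything.\<close>
  let ?N = "{y \<in> carrier (Y (Suc j)). g (e j y) \<in> d j ` carrier (X (Suc j))}"
  have "submodule ?N S (Y (Suc j))"
  proof
   show "\<one>\<^bsub>add_monoid (Y (Suc j))\<^esub> \<in> ?N"
    using d.zero e.zero g.zero by (auto intro!: image_eqI[of _ _ "\<zero>\<^bsub>X (Suc j)\<^esub>"])
   fix x assume x: "x \<in> ?N"
   then obtain u where u: "u \<in> carrier (X (Suc j))" "g (e j x) = d j u" by auto
   have "inv\<^bsub>add_monoid (Y (Suc j))\<^esub> x = \<ominus>\<^bsub>Y (Suc j)\<^esub> x" by (simp add: a_inv_def)
   then show "inv\<^bsub>add_monoid (Y (Suc j))\<^esub> x \<in> ?N"
    using x u d.minus[OF u(1)] by (auto simp: e.minus g.minus e.closed intro!: image_eqI[of _ _ "\<ominus>\<^bsub>X (Suc j)\<^esub> u"])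
  next
   fix x y assume x: "x \<in> ?N" and y: "y \<in> ?N"
   obtain u v where u: "u \<in> carrier (X (Suc j))" "g (e j x) = d j u"
    and v: "v \<in> carrier (X (Suc j))" "g (e j y) = d j v" using x y by auto
   show "x \<otimes>\<^bsub>add_monoid (Y (Suc j))\<^esub> y \<in> ?N"
    using x y u v by (auto simp: e.add g.add e.closed d.add[symmetric])
  next
   fix a x assume a: "a \<in> carrier S" and x: "x \<in> ?N"
   obtain u where u: "u \<in> carrier (X (Suc j))" "g (e j x) = d j u" using x by auto
   have "g (e j (a \<odot>\<^bsub>Y (Suc j)\<^esub> x)) = d j (a \<odot>\<^bsub>X (Suc j)\<^esub> u)"
    using a x u by (simp add: lin_mapsD(3)[OF e_lin] lin_mapsD(3)[OF graded_mapsD(1)[OF g]]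
      e.closed lin_mapsD(3)[OF d_lin])
   then show "a \<odot>\<^bsub>Y (Suc j)\<^esub> x \<in> ?N" using a x u by (auto simp: Y.smult_closed X1.smult_closed)
  qed auto
  moreover have "homog (Y (Suc j)) (int j) \<subseteq> ?N"
  proof
   fix y assume y: "y \<in> homog (Y (Suc j)) (int j)"
   interpret GY: graded_left_module S "Y (Suc j)" by (rule Y_graded)
   have yc: "y \<in> carrier (Y (Suc j))"
    using y subgroup.subset[OF GY.homog_subgroup[of "int j"]] by auto
   have "e j y \<in> homog (Y j) (int j)" using graded_mapsD(2)[OF e_graded y] .
   then have "g (e j y) \<in> homog (X j) (int j)" by (rule graded_mapsD(2)[OF g])
   moreover have "e j y \<in> cyc Y e j" using Y_exact yc by blast
   ultimately show "y \<in> ?N" using low gc yc by blast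
  qed
  ultimately have N: "?N = carrier (Y (Suc j))"
   using Y_gen[of j] unfolding generated_in_degree_def by blast
  show "cyc X d j \<subseteq> d j ` carrier (X (Suc j))"
  proof
   fix z assume z: "z \<in> cyc X d j"
   then have "f z \<in> e j ` carrier (Y (Suc j))" using fc Y_exact by blast
   then obtain y where y: "y \<in> carrier (Y (Suc j))" "f z = e j y" by auto
   then have "g (f z) \<in> d j ` carrier (X (Suc j))" using N by auto
   then show "z \<in> d j ` carrier (X (Suc j))" using gf[OF cyc_carrier[OF z]] by simp
  qed
  show "d j ` carrier (X (Suc j)) \<subseteq> cyc X d j" using d_cyc by blast
 qed
 have "good j" for j
 proof (induction j)
  case 0
  have "(\<lambda>x. x) \<in> graded_maps S (X 0) (X 0)" by (auto simp: graded_maps_def lin_maps_id)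
  then have id: "(\<lambda>x. x) \<in> graded_maps S (X 0) (Y 0)" "(\<lambda>x. x) \<in> graded_maps S (Y 0) (X 0)"
   by (simp_all add: Y0)
  show ?case unfolding good_def by (intro bexI[OF _ id(1)] bexI[OF _ id(2)]) (simp add: Y0)
 next
  case (Suc j)
  from Suc[unfolded good_def] obtain f where f: "f \<in> graded_maps S (X j) (Y j)" and *: "\<exists>g\<in>graded_maps S (Y j) (X j).
  (\<forall>x\<in>carrier (X j). g (f x) = x) \<and> (\<forall>x\<in>cyc X d j. f x \<in> cyc Y e j) \<and> (\<forall>x\<in>cyc Y e j. g x \<in> cyc X d j)"
   by (rule bexE)
  from * obtain g where g: "g \<in> graded_maps S (Y j) (X j)" and **: "(\<forall>x\<in>carrier (X j). g (f x) = x) \<and>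
  (\<forall>x\<in>cyc X d j. f x \<in> cyc Y e j) \<and> (\<forall>x\<in>cyc Y e j. g x \<in> cyc X d j)"
   by (rule bexE)
  have gf: "g (f x) = x" if "x \<in> carrier (X j)" for x using ** that by simp
  have fc: "f x \<in> cyc Y e j" if "x \<in> cyc X d j" for x using ** that by simp
  have gc: "g x \<in> cyc X d j" if "x \<in> cyc Y e j" for x using ** that by simp
  interpret GX1: graded_left_module S "X (Suc j)" by (rule X_graded)
  interpret d: add_map "X (Suc j)" "X j" "d j" by (rule d_add_map)
  interpret f: add_map "X j" "Y j" f
   by (rule lin_maps_add_map[OF X_left Y_left graded_mapsD(1)[OF f]])
  interpret g: add_map "Y j" "X j" g
   by (rule lin_maps_add_map[OF Y_left X_left graded_mapsD(1)[OF g]])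
  obtain cY where cY: "graded_group (Y j) (homog (Y j)) cY"
   using graded_left_module.graded_group_exists[OF Y_graded] ..
  obtain cY1 where cY1: "graded_group (Y (Suc j)) (homog (Y (Suc j))) cY1"
   using graded_left_module.graded_group_exists[OF Y_graded] ..
  interpret cY: graded_group "Y j" "homog (Y j)" cY by fact
  interpret cY1: graded_group "Y (Suc j)" "homog (Y (Suc j))" cY1 by fact
  have fe_h: "fe S i \<in> homog (X (Suc j)) (int j)" if "i < m j" for i
   unfolding X_free by (rule fe_homog[OF that])
  have "\<exists>y. y \<in> homog (Y (Suc j)) (int j) \<and> e j y = f (d j (fe S i))" if i: "i < m j" for i
  proof -
   let ?z = "f (d j (fe S i))"
   have zh: "?z \<in> homog (Y j) (int j)"
    by (rule graded_mapsD(2)[OF f graded_mapsD(2)[OF d_graded fe_h[OF i]]])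
   have "?z \<in> cyc Y e j" by (intro fc d_cyc X_homog_carrier[OF fe_h[OF i]])
   then obtain y where y: "y \<in> carrier (Y (Suc j))" "?z = e j y" using Y_exact by blast
   have "e j (cY1 (int j) y) = cY (int j + 0) (e j y)"
    by (rule deg_map_cmp[OF cY1 cY, symmetric])
     (use y graded_mapsD(2)[OF e_graded] lin_maps_add_map[OF Y_left Y_left e_lin] in auto)
   also have "\<dots> = ?z" using y cY.cmp_same[OF zh] by simp
   finally show ?thesis using cY1.cmp_H[OF y(1)] by blast
  qed
  then obtain y where y: "\<And>i. i < m j \<Longrightarrow> y i \<in> homog (Y (Suc j)) (int j)"
   "\<And>i. i < m j \<Longrightarrow> e j (y i) = f (d j (fe S i))" by metis
  define f' where "f' = lcomb (m j) (Y (Suc j)) y"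
  have f': "f' \<in> graded_maps S (X (Suc j)) (Y (Suc j))"
   unfolding f'_def X_free by (rule lcomb_graded[OF Y_graded y(1)])
  have fd: "(\<lambda>x. f (d j x)) \<in> lin_maps S (X (Suc j)) (Y j)"
   by (rule lin_maps_comp[OF d_lin graded_mapsD(1)[OF f]])
  have ef': "e j (f' x) = f (d j x)" if "x \<in> carrier (X (Suc j))" for x
   unfolding f'_def
   by (rule free_lift[OF ring_axioms Y_left Y_left e_lin fd[unfolded X_free]])
    (use y cY1.H_sub that in \<open>auto simp: X_free\<close>)
  have ge: "(\<lambda>x. g (e j x)) \<in> graded_maps S (Y (Suc j)) (X j)"
   using lin_maps_comp[OF e_lin graded_mapsD(1)[OF g]] graded_mapsD(2)[OF e_graded[of j]] graded_mapsD(2)[OF g]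
   by (auto simp: graded_maps_def)
  have "\<exists>h\<in>graded_maps S (Y (Suc j)) (X (Suc j)). \<forall>x\<in>carrier (Y (Suc j)). d j (h x) = g (e j x)"
  proof (rule graded_lift[OF graded_ring_axioms Y_graded Y_proj X_graded X_graded d_graded ge])
   fix x assume "x \<in> carrier (Y (Suc j))"
   then have "e j x \<in> cyc Y e j" using Y_exact by blast
   then show "g (e j x) \<in> d j ` carrier (X (Suc j))" using ex[OF Suc] gc by blast
  qed
  then obtain g' where g': "g' \<in> graded_maps S (Y (Suc j)) (X (Suc j))"
   and dg': "\<And>x. x \<in> carrier (Y (Suc j)) \<Longrightarrow> d j (g' x) = g (e j x)" by blast
  note f'D = lin_mapsD[OF graded_mapsD(1)[OF f']] and g'D = lin_mapsD[OF graded_mapsD(1)[OF g']]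
  have g'f': "g' (f' x) = x" if x: "x \<in> carrier (X (Suc j))" for x
  proof (rule free_lin_ext[OF ring_axioms X_left[of "Suc j"] _ _ _ x[unfolded X_free]])
   show "(\<lambda>x. g' (f' x)) \<in> lin_maps S (free_mod S (m j) (int j)) (X (Suc j))"
    using lin_maps_comp[OF graded_mapsD(1)[OF f'] graded_mapsD(1)[OF g']] by (simp add: X_free)
   show "(\<lambda>x. x) \<in> lin_maps S (free_mod S (m j) (int j)) (X (Suc j))"
    by (simp add: X_free lin_maps_id)
   fix i assume i: "i < m j"
   interpret cX: graded_group "X (Suc j)" "homog (X (Suc j))" "\<lambda>n x i. cmp (n - int j) (x i)"
    unfolding X_free by (rule free_graded_group)
   let ?e = "fe S i" and ?z = "g' (f' (fe S i)) \<ominus>\<^bsub>X (Suc j)\<^esub> fe S i"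
   have ec: "?e \<in> carrier (X (Suc j))" by (rule X_homog_carrier[OF fe_h[OF i]])
   have gh: "g' (f' ?e) \<in> homog (X (Suc j)) (int j)"
    by (rule graded_mapsD(2)[OF g' graded_mapsD(2)[OF f' fe_h[OF i]]])
   have zh: "?z \<in> homog (X (Suc j)) (int j)"
    unfolding a_minus_def by (intro cX.H_add cX.H_minus gh fe_h i)
   have "d j ?z = d j (g' (f' ?e)) \<ominus>\<^bsub>X j\<^esub> d j ?e"
    by (rule d.diff) (use ec f'D g'D in auto)
   also have "d j (g' (f' ?e)) = d j ?e"
    using ec f'D dg' ef' gf d.closed by simp
   also have "d j ?e \<ominus>\<^bsub>X j\<^esub> d j ?e = \<zero>\<^bsub>X j\<^esub>" using ec d.closed by (simp add: d.N.r_neg a_minus_def)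
   finally have z0: "?z = \<zero>\<^bsub>X (Suc j)\<^esub>" by (rule inj[OF zh])
   show "g' (f' ?e) = ?e" by (rule GX1.M.diff_zero_eq[OF g'D(1)[OF f'D(1)[OF ec]] ec z0])
  qed
  have "\<forall>x\<in>cyc X d (Suc j). f' x \<in> cyc Y e (Suc j)"
   using f'D(1) ef' f.zero by simp
  moreover have "\<forall>x\<in>cyc Y e (Suc j). g' x \<in> cyc X d (Suc j)"
   using g'D(1) dg' g.zero by simp
  ultimately show ?case unfolding good_def using g'f'
   by (intro bexI[OF _ f'] bexI[OF _ g'] conjI) simp_all
 qed
 then show ?thesis by (rule ex)
qed

text \<open>The second resolution is neither graded nor linear, so the composite of f and g is only
  homotopic to the identity. Restricting the homotopy relation to cycles removes the term in which
  the homotopy is applied to the boundary of z, and what remains is still strong enough for the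
  induction.\<close>

theorem homotopy_on_cycles:
 fixes Y :: "nat \<Rightarrow> ('s, nat \<Rightarrow> 's, 'z) module_scheme"
 assumes X_exact: "\<And>j. cyc X d j = d j ` carrier (X (Suc j))"
  and Y_left: "\<And>j. left_module S (Y j)"
  and e_lin: "\<And>j. e j \<in> lin_maps S (Y (Suc j)) (Y j)"
  and Y_exact: "\<And>j. cyc Y e j = e j ` carrier (Y (Suc j))"
  and Y_proj: "\<And>j. projective S (Y (Suc j))"
  and id0: "(\<lambda>x. x) \<in> lin_maps S (X 0) (Y 0)" "(\<lambda>x. x) \<in> lin_maps S (Y 0) (X 0)"
 shows "\<exists>f\<in>lin_maps S (X j) (Y j). \<exists>g\<in>lin_maps S (Y j) (X j). \<exists>h\<in>lin_maps S (X j) (X (Suc j)).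
  (\<forall>x\<in>cyc X d j. f x \<in> cyc Y e j) \<and> (\<forall>x\<in>cyc Y e j. g x \<in> cyc X d j) \<and>
  (\<forall>z\<in>cyc X d j. g (f z) \<ominus>\<^bsub>X j\<^esub> z = d j (h z))"
proof (induction j)
 case 0
 interpret X0: left_module S "X 0" by (rule X_left)
 interpret X1: left_module S "X 1" by (rule X_left)
 interpret d: add_map "X (Suc 0)" "X 0" "d 0" by (rule d_add_map)
 have h: "(\<lambda>x. \<zero>\<^bsub>X (Suc 0)\<^esub>) \<in> lin_maps S (X 0) (X (Suc 0))"
  by (rule lin_mapsI) (auto simp: X1.smult_r_zero[simplified])
 show ?case
  by (rule bexI[OF _ id0(1)], rule bexI[OF _ id0(2)], rule bexI[OF _ h])
   (use lin_mapsD(1)[OF id0(1)] lin_mapsD(1)[OF id0(2)] d.zero in \<open>auto simp: a_minus_def X0.M.r_neg\<close>)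
next
 case (Suc j)
 let ?Q = "\<lambda>f g h. (\<forall>x\<in>cyc X d j. f x \<in> cyc Y e j) \<and> (\<forall>x\<in>cyc Y e j. g x \<in> cyc X d j) \<and>
  (\<forall>z\<in>cyc X d j. g (f z) \<ominus>\<^bsub>X j\<^esub> z = d j (h z))"
 from Suc obtain f where f: "f \<in> lin_maps S (X j) (Y j)"
  and *: "\<exists>g\<in>lin_maps S (Y j) (X j). \<exists>h\<in>lin_maps S (X j) (X (Suc j)). ?Q f g h" by (rule bexE)
 from * obtain g where g: "g \<in> lin_maps S (Y j) (X j)"
  and **: "\<exists>h\<in>lin_maps S (X j) (X (Suc j)). ?Q f g h" by (rule bexE)
 from ** obtain h where h: "h \<in> lin_maps S (X j) (X (Suc j))" and Q: "?Q f g h" by (rule bexE)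
 have fc: "f x \<in> cyc Y e j" if "x \<in> cyc X d j" for x using Q that by simp
 have gc: "g x \<in> cyc X d j" if "x \<in> cyc Y e j" for x using Q that by simp
 have gfh: "g (f z) \<ominus>\<^bsub>X j\<^esub> z = d j (h z)" if "z \<in> cyc X d j" for z using Q that by simp
 interpret X0: left_module S "X j" by (rule X_left)
 interpret X1: left_module S "X (Suc j)" by (rule X_left)
 interpret d: add_map "X (Suc j)" "X j" "d j" by (rule d_add_map)
 interpret f: add_map "X j" "Y j" f by (rule lin_maps_add_map[OF X_left Y_left f])
 interpret g: add_map "Y j" "X j" g by (rule lin_maps_add_map[OF Y_left X_left g])
 interpret h: add_map "X j" "X (Suc j)" h by (rule lin_maps_add_map[OF X_left X_left h])
 have X_proj: "projective S (X (Suc i))" for i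
  unfolding X_free by (rule free_projective[OF ring_axioms])
 have "\<exists>f'\<in>lin_maps S (X (Suc j)) (Y (Suc j)). \<forall>x\<in>carrier (X (Suc j)). e j (f' x) = f (d j x)"
  by (rule proj_lift[OF X_proj Y_left Y_left e_lin lin_maps_comp[OF d_lin f]])
   (use fc d_cyc Y_exact in blast)
 then obtain f' where f': "f' \<in> lin_maps S (X (Suc j)) (Y (Suc j))"
  and ef': "\<And>x. x \<in> carrier (X (Suc j)) \<Longrightarrow> e j (f' x) = f (d j x)" by blast
 have "\<exists>g'\<in>lin_maps S (Y (Suc j)) (X (Suc j)). \<forall>x\<in>carrier (Y (Suc j)). d j (g' x) = g (e j x)"
  by (rule proj_lift[OF Y_proj X_left X_left d_lin lin_maps_comp[OF e_lin g]])
   (use gc X_exact Y_exact in blast)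
 then obtain g' where g': "g' \<in> lin_maps S (Y (Suc j)) (X (Suc j))"
  and dg': "\<And>x. x \<in> carrier (Y (Suc j)) \<Longrightarrow> d j (g' x) = g (e j x)" by blast
 note f'D = lin_mapsD[OF f'] and g'D = lin_mapsD[OF g'] and hD = lin_mapsD[OF h]
 \<comment> \<open>The usual correction: by the relation already known at \<open>d j x\<close>, this
   map takes values in cycles, hence lifts through the next differential.\<close>
 let ?t = "\<lambda>x. g' (f' x) \<ominus>\<^bsub>X (Suc j)\<^esub> x \<ominus>\<^bsub>X (Suc j)\<^esub> h (d j x)"
 have t: "?t \<in> lin_maps S (X (Suc j)) (X (Suc j))"
  by (intro lin_maps_diff X_left lin_maps_id lin_maps_comp[OF f' g'] lin_maps_comp[OF d_lin h])
 have tc: "?t x \<in> cyc X d (Suc j)" if x: "x \<in> carrier (X (Suc j))" for x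
 proof -
  have c: "g' (f' x) \<in> carrier (X (Suc j))" "h (d j x) \<in> carrier (X (Suc j))"
   using x f'D g'D hD d.closed by auto
  have "d j (?t x) = d j (g' (f' x)) \<ominus>\<^bsub>X j\<^esub> d j x \<ominus>\<^bsub>X j\<^esub> d j (h (d j x))"
   using c x by (simp add: d.diff)
  also have "d j (g' (f' x)) = g (f (d j x))" using x f'D dg' ef' by simp
  also have "g (f (d j x)) \<ominus>\<^bsub>X j\<^esub> d j x = d j (h (d j x))" by (rule gfh[OF d_cyc[OF x]])
  also have "d j (h (d j x)) \<ominus>\<^bsub>X j\<^esub> d j (h (d j x)) = \<zero>\<^bsub>X j\<^esub>"
   using c d.closed by (simp add: a_minus_def X0.M.r_neg)
  finally show ?thesis using lin_mapsD(1)[OF t x] by simp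
 qed
 have "\<exists>h'\<in>lin_maps S (X (Suc j)) (X (Suc (Suc j))). \<forall>x\<in>carrier (X (Suc j)). d (Suc j) (h' x) = ?t x"
  by (rule proj_lift[OF X_proj X_left X_left d_lin t]) (use tc X_exact in blast)
 then obtain h' where h': "h' \<in> lin_maps S (X (Suc j)) (X (Suc (Suc j)))"
  and dh': "\<And>x. x \<in> carrier (X (Suc j)) \<Longrightarrow> d (Suc j) (h' x) = ?t x" by blast
 have "g' (f' z) \<ominus>\<^bsub>X (Suc j)\<^esub> z = d (Suc j) (h' z)" if z: "z \<in> cyc X d (Suc j)" for z
 proof -
  have zc: "z \<in> carrier (X (Suc j))" and dz: "d j z = \<zero>\<^bsub>X j\<^esub>" using z by auto
  have "g' (f' z) \<in> carrier (X (Suc j))" using zc f'D g'D by auto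
  then show ?thesis using dh'[OF zc] zc dz by (simp add: h.zero a_minus_def)
 qed
 moreover have "\<forall>x\<in>cyc X d (Suc j). f' x \<in> cyc Y e (Suc j)"
  using f'D(1) ef' f.zero by simp
 moreover have "\<forall>x\<in>cyc Y e (Suc j). g' x \<in> cyc X d (Suc j)"
  using g'D(1) dg' g.zero by simp
 ultimately show ?case
  by (intro bexI[OF _ f'] bexI[OF _ g'] bexI[OF _ h'] conjI) simp_all
qed

end

section \<open>The Koszul complex\<close>

definition prj :: "nat \<Rightarrow> ('n::finite list \<Rightarrow> 'k::field) \<Rightarrow> ('n list \<Rightarrow> 'k) \<Rightarrow> 'k" where
 "prj n \<Psi> u = (\<Sum>t | length t = n. \<Psi> t * u t)"

lemma prj_linear:
 "prj n \<Psi> (\<lambda>s. u s + v s) = prj n \<Psi> u + prj n \<Psi> v" "prj n \<Psi> (\<lambda>s. c * u s) = c * prj n \<Psi> u"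
 by (auto simp: prj_def algebra_simps sum.distrib sum_distrib_left)

lemma prj_sum: "prj n \<Psi> (\<lambda>s. \<Sum>i\<in>F. f i s) = (\<Sum>i\<in>F. prj n \<Psi> (f i))"
 unfolding prj_def by (simp add: sum_distrib_left) (rule sum.swap)

lemma vec_tensor2: "(vec_tensor v \<star> vec_tensor v') s = (case s of [x, y] \<Rightarrow> v x * v' y | _ \<Rightarrow> 0)"
 by (auto simp: vec_tensor_mult) (auto simp: vec_tensor_def split: list.splits)

text \<open>The window of two letters between a fixed prefix p and suffix q. A tensor lies in
  \<open>V^i \<otimes> R \<otimes> V^j\<close> exactly when all its windows with |p| = i and |q| = j
  lie in R.\<close>

definition slice :: "'n list \<Rightarrow> 'n list \<Rightarrow> ('n::finite list \<Rightarrow> 'k::field) \<Rightarrow> 'n list \<Rightarrow> 'k" where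
 "slice p q u s = (if length s = 2 then u (p @ s @ q) else 0)"

lemma slice_linear:
 "slice p q (\<lambda>s. u s + v s) = (\<lambda>s. slice p q u s + slice p q v s)"
 "slice p q (\<lambda>s. c * u s) = (\<lambda>s. c * slice p q u s)" "slice p q (\<lambda>s. 0) = (\<lambda>s. 0)"
 by (auto simp: slice_def)

section \<open>The spaces \<open>W n\<close> and their bases\<close>

context quad begin

text \<open>The intersection of all relation slots, in coordinates. For n < 2 there are no windows,
  so \<open>W 0\<close> and \<open>W 1\<close> consist of all tensors.\<close>

definition W :: "nat \<Rightarrow> ('n list \<Rightarrow> 'k) set" where
 "W n = {u \<in> tensors n. \<forall>p q. length p + 2 + length q = n \<longrightarrow> slice p q u \<in> R}"

lemma W_tensors: "u \<in> W n \<Longrightarrow> u \<in> tensors n"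
 by (simp add: W_def)

lemma W_slice: "u \<in> W n \<Longrightarrow> length p + 2 + length q = n \<Longrightarrow> slice p q u \<in> R"
 by (simp add: W_def)

lemma W_subsp: "subsp (W n)"
 using R_subsp tensors_subsp[of n] by (auto simp: subsp_def W_def slice_linear)

lemma W_left: "u \<in> W (Suc n) \<Longrightarrow> (\<lambda>s. u (x # s)) \<in> W n"
proof -
 assume u: "u \<in> W (Suc n)"
 have "slice p q (\<lambda>s. u (x # s)) \<in> R" if "length p + 2 + length q = n" for p q
  using W_slice[OF u, of "x # p" q] that by (simp add: slice_def[abs_def] cong: if_cong)
 then show ?thesis using u by (auto simp: W_def tensors_def)
qed

lemma W_right: "u \<in> W (Suc n) \<Longrightarrow> (\<lambda>s. u (s @ [x])) \<in> W n"
proof -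
 assume u: "u \<in> W (Suc n)"
 have "slice p q (\<lambda>s. u (s @ [x])) \<in> R" if "length p + 2 + length q = n" for p q
  using W_slice[OF u, of p "q @ [x]"] that by (simp add: slice_def[abs_def] cong: if_cong)
 then show ?thesis using u by (auto simp: W_def tensors_def)
qed

lemma W_SucI:
 assumes "u \<in> tensors (Suc n)" "\<And>x. (\<lambda>s. u (x # s)) \<in> W n"
  "\<And>q. Suc (length q) = n \<Longrightarrow> slice [] q u \<in> R"
 shows "u \<in> W (Suc n)"
 unfolding W_def
proof (intro CollectI conjI allI impI)
 fix p q :: "'n list" assume l: "length p + 2 + length q = Suc n"
 show "slice p q u \<in> R"
 proof (cases p)
  case Nil then show ?thesis using assms(3)[of q] l by simp
 next
  case (Cons x p')
  then show ?thesis using W_slice[OF assms(2)[of x], of p' q] l by (simp add: slice_def[abs_def] cong: if_cong)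
 qed
qed (rule assms)

text \<open>In degree 0 the basis is fixed as the empty word rather than chosen, so that
  \<open>K 0\<close> is A itself with the unit as generator and augmentations can be read off
  coordinate 0.\<close>

definition Wd :: "nat \<Rightarrow> nat \<times> (nat \<Rightarrow> 'n list \<Rightarrow> 'k) \<times> (nat \<Rightarrow> 'n list \<Rightarrow> 'k)" where
 "Wd n = (if n = 0 then (1, \<lambda>_. sgl [], \<lambda>_. sgl [])
  else SOME x. case x of (m, b, \<Psi>) \<Rightarrow> dual_basis {s. length s = n} (W n) m b \<Psi>)"

text \<open>\<open>wb n\<close> is a basis of \<^term>\<open>W n\<close> with dual functionals \<open>wp n\<close>. The vectors \<open>lam n i j\<close> and \<open>rho n i j\<close>
 below are the coordinates of the basis of \<open>W (n + 1)\<close> in \<open>V \<otimes> W n\<close> and \<open>W n \<otimes> V\<close>; they are the entries of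
 the differentials of the one-sided and of the bimodule Koszul complex.\<close>

definition wm :: "nat \<Rightarrow> nat" where "wm n = fst (Wd n)"
definition wb :: "nat \<Rightarrow> nat \<Rightarrow> 'n list \<Rightarrow> 'k" where "wb n = fst (snd (Wd n))"
definition wp :: "nat \<Rightarrow> nat \<Rightarrow> 'n list \<Rightarrow> 'k" where "wp n = snd (snd (Wd n))"

lemma Wd: "dual_basis {s. length s = n} (W n) (wm n) (wb n) (wp n)"
proof (cases "n = 0")
 case True
 have "dual_basis {s. length s = 0} (W 0) 1 (\<lambda>_. sgl []) (\<lambda>_. sgl [])"
  by (auto simp: dual_basis_def W_def tensors_def sgl_def)
 then show ?thesis using True by (simp add: wm_def wb_def wp_def Wd_def)
next
 case False
 have "\<exists>m b \<Psi>. dual_basis {s. length s = n} (W n) m b \<Psi>"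
  by (intro dual_basis_exists W_subsp) (auto simp: W_def tensors_def)
 then have "\<exists>x. case x of (m, b, \<Psi>) \<Rightarrow> dual_basis {s. length s = n} (W n) m b \<Psi>" by auto
 then have "case Wd n of (m, b, \<Psi>) \<Rightarrow> dual_basis {s. length s = n} (W n) m b \<Psi>"
  unfolding Wd_def using False by (simp add: someI_ex)
 then show ?thesis by (simp add: wm_def wb_def wp_def split: prod.splits)
qed

lemma wm_0: "wm 0 = 1" and wb_0: "wb 0 i = sgl []"
 by (simp_all add: wm_def wb_def Wd_def)

lemma wb_W: "i < wm n \<Longrightarrow> wb n i \<in> W n"
 using Wd[of n] by (auto simp: dual_basis_def)

lemma wb_tensors: "i < wm n \<Longrightarrow> wb n i \<in> tensors n"
 by (rule W_tensors[OF wb_W])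

lemma wp_tensors: "i < wm n \<Longrightarrow> wp n i \<in> tensors n"
 using Wd[of n] by (auto simp: dual_basis_def tensors_def)

lemma wp_wb: "i < wm n \<Longrightarrow> j < wm n \<Longrightarrow> prj n (wp n i) (wb n j) = (if i = j then 1 else 0)"
 using Wd[of n] by (auto simp: dual_basis_def prj_def)

lemma W_expand: "u \<in> W n \<Longrightarrow> u s = (\<Sum>i<wm n. prj n (wp n i) u * wb n i s)"
 using Wd[of n] by (auto simp: dual_basis_def prj_def)

lemma wb_coeff:
 assumes "i < wm n" shows "prj n (wp n i) (\<lambda>s. \<Sum>j<wm n. c j * wb n j s) = c i"
proof -
 have "prj n (wp n i) (\<lambda>s. \<Sum>j<wm n. c j * wb n j s) = (\<Sum>j<wm n. c j * prj n (wp n i) (wb n j))"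
  by (simp add: prj_sum prj_linear)
 also have "\<dots> = (\<Sum>j<wm n. if j = i then c j else 0)"
  using assms by (intro sum.cong) (auto simp: wp_wb)
 also have "\<dots> = c i" using assms by simp
 finally show ?thesis .
qed

lemma wb_indep:
 assumes "\<And>s. length s = n \<Longrightarrow> (\<Sum>j<wm n. c j * wb n j s) = (\<Sum>j<wm n. c' j * wb n j s)" "i < wm n"
 shows "c i = c' i"
proof -
 have "prj n (wp n i) (\<lambda>s. \<Sum>j<wm n. c j * wb n j s) = prj n (wp n i) (\<lambda>s. \<Sum>j<wm n. c' j * wb n j s)"
  unfolding prj_def using assms(1) by (intro sum.cong) auto
 then show ?thesis using wb_coeff[OF assms(2)] by metis
qed

definition lam :: "nat \<Rightarrow> nat \<Rightarrow> nat \<Rightarrow> 'n \<Rightarrow> 'k" where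
 "lam n i j x = prj n (wp n j) (\<lambda>s. wb (Suc n) i (x # s))"
definition rho :: "nat \<Rightarrow> nat \<Rightarrow> nat \<Rightarrow> 'n \<Rightarrow> 'k" where
 "rho n i j x = prj n (wp n j) (\<lambda>s. wb (Suc n) i (s @ [x]))"

lemma wb_left: "i < wm (Suc n) \<Longrightarrow> wb (Suc n) i (x # s) = (\<Sum>j<wm n. lam n i j x * wb n j s)"
 unfolding lam_def by (rule W_expand[OF W_left[OF wb_W]])

lemma wb_right: "i < wm (Suc n) \<Longrightarrow> wb (Suc n) i (s @ [x]) = (\<Sum>j<wm n. rho n i j x * wb n j s)"
 unfolding rho_def by (rule W_expand[OF W_right[OF wb_W]])

lemma wb_left2:
 assumes "i < wm (Suc (Suc n))"
 shows "wb (Suc (Suc n)) i (x # y # s) = (\<Sum>k<wm n. (\<Sum>j<wm (Suc n). lam (Suc n) i j x * lam n j k y) * wb n k s)"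
proof -
 have "wb (Suc (Suc n)) i (x # y # s) =
   (\<Sum>j<wm (Suc n). \<Sum>k<wm n. lam (Suc n) i j x * lam n j k y * wb n k s)"
  by (subst wb_left[OF assms]) (auto simp: wb_left sum_distrib_left mult.assoc intro!: sum.cong)
 also have "\<dots> = (\<Sum>k<wm n. (\<Sum>j<wm (Suc n). lam (Suc n) i j x * lam n j k y) * wb n k s)"
  by (subst sum.swap) (simp add: sum_distrib_right)
 finally show ?thesis .
qed

lemma wb_right2:
 assumes "i < wm (Suc (Suc n))"
 shows "wb (Suc (Suc n)) i (s @ [y, x]) = (\<Sum>k<wm n. (\<Sum>j<wm (Suc n). rho (Suc n) i j x * rho n j k y) * wb n k s)"
proof -
 have "wb (Suc (Suc n)) i ((s @ [y]) @ [x]) =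
   (\<Sum>j<wm (Suc n). \<Sum>k<wm n. rho (Suc n) i j x * rho n j k y * wb n k s)"
  by (subst wb_right[OF assms]) (auto simp: wb_right sum_distrib_left mult.assoc intro!: sum.cong)
 also have "\<dots> = (\<Sum>k<wm n. (\<Sum>j<wm (Suc n). rho (Suc n) i j x * rho n j k y) * wb n k s)"
  by (subst sum.swap) (simp add: sum_distrib_right)
 finally show ?thesis by simp
qed

text \<open>Both sides are the coordinates of the tensor left after stripping x on the left and y on
  the right; the two strippings commute. This is the cancellation of mixed terms in the bimodule
  complex.\<close>

lemma lam_rho:
 assumes i: "i < wm (Suc (Suc n))" and k: "k < wm n"
 shows "(\<Sum>j<wm (Suc n). lam (Suc n) i j x * rho n j k y) = (\<Sum>j<wm (Suc n). rho (Suc n) i j y * lam n j k x)"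
proof (rule wb_indep[OF _ k])
 fix s :: "'n list"
 have "(\<Sum>k<wm n. (\<Sum>j<wm (Suc n). lam (Suc n) i j x * rho n j k y) * wb n k s) =
   wb (Suc (Suc n)) i (x # s @ [y])"
  by (subst wb_left[OF i]) (simp add: wb_right sum_distrib_left sum_distrib_right mult.assoc, rule sum.swap)
 also have "\<dots> = (\<Sum>k<wm n. (\<Sum>j<wm (Suc n). rho (Suc n) i j y * lam n j k x) * wb n k s)"
  using wb_right[OF i, of "x # s" y]
  by (simp add: wb_left sum_distrib_left sum_distrib_right mult.assoc, subst sum.swap) simp
 finally show "(\<Sum>k<wm n. (\<Sum>j<wm (Suc n). lam (Suc n) i j x * rho n j k y) * wb n k s) =
  (\<Sum>k<wm n. (\<Sum>j<wm (Suc n). rho (Suc n) i j y * lam n j k x) * wb n k s)" .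
qed

text \<open>The quadratic tensors occurring in the square of the differentials are contractions of elements of
 \<^term>\<open>W (Suc (Suc n))\<close>, hence relations.\<close>

lemma lam_lam_R:
 assumes i: "i < wm (Suc (Suc n))" and k: "k < wm n"
 shows "(\<lambda>s. \<Sum>j<wm (Suc n). (vec_tensor (lam (Suc n) i j) \<star> vec_tensor (lam n j k)) s) \<in> R"
proof -
 let ?u = "wb (Suc (Suc n)) i"
 have "(\<lambda>s. \<Sum>q | length q = n. wp n k q * slice [] q ?u s) \<in> R"
  using W_slice[OF wb_W[OF i]] R_subsp by (intro subsp_sum) (auto simp: subsp_def)
 also have "(\<lambda>s. \<Sum>q | length q = n. wp n k q * slice [] q ?u s) =
  (\<lambda>s. \<Sum>j<wm (Suc n). (vec_tensor (lam (Suc n) i j) \<star> vec_tensor (lam n j k)) s)"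
 proof
  fix s :: "'n list"
  show "(\<Sum>q | length q = n. wp n k q * slice [] q ?u s) =
   (\<Sum>j<wm (Suc n). (vec_tensor (lam (Suc n) i j) \<star> vec_tensor (lam n j k)) s)"
  proof (cases "length s = 2")
   case True
   then obtain x y where s: "s = [x, y]" by (auto simp: length_Suc_conv numeral_2_eq_2)
   have "(\<Sum>q | length q = n. wp n k q * ?u (s @ q)) = prj n (wp n k) (\<lambda>q. ?u (x # y # q))"
    by (simp add: prj_def s)
   also have "\<dots> = (\<Sum>j<wm (Suc n). lam (Suc n) i j x * lam n j k y)"
    unfolding wb_left2[OF i] by (rule wb_coeff[OF k])
   finally show ?thesis using True by (simp add: vec_tensor2 s slice_def)
  next
   case False
   then show ?thesis by (auto simp: vec_tensor2 slice_def split: list.splits intro!: sum.neutral)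
  qed
 qed
 finally show ?thesis .
qed

lemma rho_rho_R:
 assumes i: "i < wm (Suc (Suc n))" and k: "k < wm n"
 shows "(\<lambda>s. \<Sum>j<wm (Suc n). (vec_tensor (rho n j k) \<star> vec_tensor (rho (Suc n) i j)) s) \<in> R"
proof -
 let ?u = "wb (Suc (Suc n)) i"
 have "(\<lambda>s. \<Sum>q | length q = n. wp n k q * slice q [] ?u s) \<in> R"
  using W_slice[OF wb_W[OF i]] R_subsp by (intro subsp_sum) (auto simp: subsp_def)
 also have "(\<lambda>s. \<Sum>q | length q = n. wp n k q * slice q [] ?u s) =
  (\<lambda>s. \<Sum>j<wm (Suc n). (vec_tensor (rho n j k) \<star> vec_tensor (rho (Suc n) i j)) s)"
 proof
  fix s :: "'n list"
  show "(\<Sum>q | length q = n. wp n k q * slice q [] ?u s) =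
   (\<Sum>j<wm (Suc n). (vec_tensor (rho n j k) \<star> vec_tensor (rho (Suc n) i j)) s)"
  proof (cases "length s = 2")
   case True
   then obtain x y where s: "s = [y, x]" by (auto simp: length_Suc_conv numeral_2_eq_2)
   have "(\<Sum>q | length q = n. wp n k q * ?u (q @ s)) = prj n (wp n k) (\<lambda>q. ?u (q @ [y, x]))"
    by (simp add: prj_def s)
   also have "\<dots> = (\<Sum>j<wm (Suc n). rho (Suc n) i j x * rho n j k y)"
    unfolding wb_right2[OF i] by (rule wb_coeff[OF k])
   finally show ?thesis using True by (simp add: vec_tensor2 s slice_def mult.commute)
  next
   case False
   then show ?thesis by (auto simp: vec_tensor2 slice_def split: list.splits intro!: sum.neutral)
  qed
 qed
 finally show ?thesis .
qed

section \<open>Vectors in A and the one-sided Koszul complex\<close>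

definition vc :: "('n \<Rightarrow> 'k) \<Rightarrow> ('n list \<Rightarrow> 'k) set" where "vc v = cls (vec_tensor v)"

lemma vec_TT: "vec_tensor v \<in> \<T>"
 by (rule tensors_TT[OF vec_tensor_tensors])

lemma vc_homog: "vc v \<in> homog A 1"
 using homog_A_1 by (auto simp: vc_def)

lemma vc_closed [simp]: "vc v \<in> \<A>"
 by (simp add: vc_def cls_closed vec_TT)

lemma vc_smult: "c *\<^sub>A vc v = vc (\<lambda>x. c * v x)"
 by (auto simp: vc_def cls_smult vec_tensor_def intro!: arg_cong[where f = cls] split: list.splits)

lemma vc_finsum: "finite F \<Longrightarrow> (\<Oplus>\<^bsub>A\<^esub>i\<in>F. vc (v i)) = vc (\<lambda>x. \<Sum>i\<in>F. v i x)"
 unfolding vc_def by (subst cls_finsum)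
  (auto simp: vec_TT vec_tensor_def intro!: arg_cong[where f = cls] split: list.splits)

lemma vc_eq: "vc v = vc v' \<longleftrightarrow> v = v'"
 by (simp add: vc_def cls_vec_eq)

lemma vc_zero: "vc (\<lambda>x. 0) = 0\<^sub>A"
 by (auto simp: vc_def cls_hom vec_tensor_def intro!: arg_cong[where f = cls] split: list.splits)

lemma vc_add: "vc v +\<^sub>A vc v' = vc (\<lambda>x. v x + v' x)"
 by (auto simp: vc_def cls_hom vec_TT vec_tensor_def intro!: arg_cong[where f = cls] split: list.splits)

lemma vc_mult_sum:
 assumes "finite F"
 shows "(\<Oplus>\<^bsub>A\<^esub>i\<in>F. vc (v i) \<cdot> vc (v' i)) = cls (\<lambda>s. \<Sum>i\<in>F. (vec_tensor (v i) \<star> vec_tensor (v' i)) s)"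
 unfolding vc_def using assms
 by (subst cls_finsum[symmetric]) (auto simp: cls_hom vec_TT TT_closed)

text \<open>Products of two vectors live in degree 2, where I is exactly R. Membership in R thereby
  becomes an equation in A and conversely.\<close>

lemma vc_mult_sum_zero:
 assumes "finite F"
 shows "(\<Oplus>\<^bsub>A\<^esub>i\<in>F. vc (v i) \<cdot> vc (v' i)) = 0\<^sub>A \<longleftrightarrow>
  (\<lambda>s. \<Sum>i\<in>F. (vec_tensor (v i) \<star> vec_tensor (v' i)) s) \<in> R"
proof -
 let ?u = "\<lambda>s. \<Sum>i\<in>F. (vec_tensor (v i) \<star> vec_tensor (v' i)) s"
 have "?u \<in> tensors 2"
  by (auto simp: tensors_def vec_tensor2 split: list.splits intro!: sum.neutral)
 moreover have "cls ?u = 0\<^sub>A \<longleftrightarrow> ?u \<in> I" by (simp add: cls_hom cls_eq)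
 ultimately show ?thesis using I_tensors2 unfolding vc_mult_sum[OF assms] by blast
qed

abbreviation K :: "nat \<Rightarrow> (('n list \<Rightarrow> 'k) set, nat \<Rightarrow> ('n list \<Rightarrow> 'k) set) graded_module" where
 "K n \<equiv> free_mod A (wm n) (int n)"

definition krow :: "nat \<Rightarrow> nat \<Rightarrow> nat \<Rightarrow> ('n list \<Rightarrow> 'k) set" where
 "krow n i j = (if j < wm n then vc (lam n i j) else 0\<^sub>A)"

text \<open>The map \<open>A \<otimes> W (n + 1) \<rightarrow> A \<otimes> W n\<close> that detaches
  the first letter of the tensor and multiplies it onto the coefficient from the right.\<close>

definition kd :: "nat \<Rightarrow> (nat \<Rightarrow> ('n list \<Rightarrow> 'k) set) \<Rightarrow> nat \<Rightarrow> ('n list \<Rightarrow> 'k) set" where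
 "kd n = lcomb (wm (Suc n)) (K n) (krow n)"

lemma K_left: "left_module A (K n)" by (rule free_left_module[OF A_ring])

lemma krow_homog: "krow n i \<in> homog (K n) (int (Suc n))"
 by (auto simp: free_homog krow_def vc_homog)

lemma krow_closed: "krow n i \<in> carrier (K n)"
 by (auto simp: free_carrier krow_def)

lemma kd_graded: "kd n \<in> graded_maps A (K (Suc n)) (K n)"
 unfolding kd_def by (rule G.lcomb_graded[OF G.free_graded krow_homog])

lemmas kd_lin = graded_mapsD(1)[OF kd_graded]

lemma K_coord: "x \<in> carrier (K n) \<Longrightarrow> x i \<in> \<A>"
 by (rule free_coord[OF A_ring])

lemma kd_coord:
 assumes "x \<in> carrier (K (Suc n))"
 shows "kd n x j = (if j < wm n then \<Oplus>\<^bsub>A\<^esub>i\<in>{..<wm (Suc n)}. x i \<cdot> vc (lam n i j) else 0\<^sub>A)"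
proof -
 interpret Kn: left_module A "K n" by (rule K_left)
 have "kd n x = (\<lambda>j. \<Oplus>\<^bsub>A\<^esub>i\<in>{..<wm (Suc n)}. x i \<cdot> krow n i j)"
  unfolding kd_def lcomb_def
  by (subst free_finsum[OF A_ring]) (use Kn.smult_closed krow_closed K_coord[OF assms] in auto)
 moreover have "(\<Oplus>\<^bsub>A\<^esub>i\<in>{..<wm (Suc n)}. x i \<cdot> krow n i j) = (\<Oplus>\<^bsub>A\<^esub>i\<in>{..<wm (Suc n)}. 0\<^sub>A)" if "\<not> j < wm n"
  using that K_coord[OF assms] by (intro A.finsum_cong') (auto simp: krow_def)
 moreover have "(\<Oplus>\<^bsub>A\<^esub>i\<in>{..<wm (Suc n)}. x i \<cdot> krow n i j) = (\<Oplus>\<^bsub>A\<^esub>i\<in>{..<wm (Suc n)}. x i \<cdot> vc (lam n i j))" if "j < wm n"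
  using that K_coord[OF assms] by (intro A.finsum_cong') (auto simp: krow_def)
 ultimately show ?thesis by simp
qed

lemma kd_fe: "i < wm (Suc n) \<Longrightarrow> kd n (fe A i) = krow n i"
 unfolding kd_def by (rule lcomb_fe[OF A_ring K_left krow_closed])

lemma kd_kd: "x \<in> carrier (K (Suc (Suc n))) \<Longrightarrow> kd n (kd (Suc n) x) = \<zero>\<^bsub>K n\<^esub>"
proof -
 assume x: "x \<in> carrier (K (Suc (Suc n)))"
 have z: "(\<lambda>x. \<zero>\<^bsub>K n\<^esub>) \<in> lin_maps A (K (Suc (Suc n))) (K n)"
 proof -
  interpret Kn: left_module A "K n" by (rule K_left)
  show ?thesis using Kn.smult_r_zero by (intro lin_mapsI) (auto simp: free_carrier)
 qed
 show ?thesis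
 proof (rule free_lin_ext[OF A_ring K_left lin_maps_comp[OF kd_lin kd_lin] z _ x])
  fix i assume i: "i < wm (Suc (Suc n))"
  show "kd n (kd (Suc n) (fe A i)) = \<zero>\<^bsub>K n\<^esub>"
  proof
   fix k
   have "kd n (krow (Suc n) i) k = 0\<^sub>A"
   proof (cases "k < wm n")
    case True
    have "(\<Oplus>\<^bsub>A\<^esub>j\<in>{..<wm (Suc n)}. krow (Suc n) i j \<cdot> vc (lam n j k)) =
      (\<Oplus>\<^bsub>A\<^esub>j\<in>{..<wm (Suc n)}. vc (lam (Suc n) i j) \<cdot> vc (lam n j k))"
     by (intro A.finsum_cong') (auto simp: krow_def)
    also have "\<dots> = 0\<^sub>A" by (subst vc_mult_sum_zero) (use lam_lam_R[OF i True] in auto)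
    finally show ?thesis using True by (simp add: kd_coord[OF krow_closed])
   qed (simp add: kd_coord[OF krow_closed])
   then show "kd n (kd (Suc n) (fe A i)) k = \<zero>\<^bsub>K n\<^esub> k" by (simp add: kd_fe[OF i])
  qed
 qed
qed

lemma kd_scalar:
 assumes "\<And>i. x i = (if i < wm (Suc n) then c i *\<^sub>A 1\<^sub>A else 0\<^sub>A)"
 shows "x \<in> carrier (K (Suc n))" "j < wm n \<Longrightarrow> kd n x j = vc (\<lambda>y. \<Sum>i<wm (Suc n). c i * lam n i j y)"
proof -
 show x: "x \<in> carrier (K (Suc n))" by (auto simp: free_carrier assms smult_A)
 assume j: "j < wm n"
 have "kd n x j = (\<Oplus>\<^bsub>A\<^esub>i\<in>{..<wm (Suc n)}. vc (\<lambda>y. c i * lam n i j y))"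
  unfolding kd_coord[OF x] using j
  by (simp, intro A.finsum_cong') (simp_all add: assms smult_A vc_smult)
 then show "kd n x j = vc (\<lambda>y. \<Sum>i<wm (Suc n). c i * lam n i j y)" by (simp add: vc_finsum)
qed

text \<open>In the generating degree the coefficients are scalars, and the image records the
  expansion in \<open>V \<otimes> W n\<close> of the tensor they define; a zero expansion forces a
  zero tensor.\<close>

lemma kd_inj:
 assumes x: "x \<in> homog (K (Suc n)) (int (Suc n))" and z: "kd n x = \<zero>\<^bsub>K n\<^esub>"
 shows "x = \<zero>\<^bsub>K (Suc n)\<^esub>"
proof -
 have "\<forall>i. \<exists>c. i < wm (Suc n) \<longrightarrow> x i = c *\<^sub>A 1\<^sub>A"
  using x homog_A_0 by (auto simp: free_homog)
 then obtain c where c: "\<And>i. i < wm (Suc n) \<Longrightarrow> x i = c i *\<^sub>A 1\<^sub>A" by metis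
 have xi: "x i = (if i < wm (Suc n) then c i *\<^sub>A 1\<^sub>A else 0\<^sub>A)" for i
  using c x by (auto simp: free_homog)
 have 1: "(\<Sum>i<wm (Suc n). c i * lam n i j y) = 0" if "j < wm n" for j y
 proof -
  have "vc (\<lambda>y. \<Sum>i<wm (Suc n). c i * lam n i j y) = vc (\<lambda>_. 0)"
   using kd_scalar(2)[OF xi that] z by (simp add: vc_zero)
  then show ?thesis unfolding vc_eq by (rule fun_cong)
 qed
 have "(\<Sum>i<wm (Suc n). c i * wb (Suc n) i s) = 0" if l: "length s = Suc n" for s
 proof -
  obtain y t where s: "s = y # t" using l by (cases s) auto
  have "(\<Sum>i<wm (Suc n). c i * wb (Suc n) i s) = (\<Sum>i<wm (Suc n). \<Sum>j<wm n. c i * lam n i j y * wb n j t)"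
   by (auto simp: s wb_left sum_distrib_left mult.assoc)
  also have "\<dots> = (\<Sum>j<wm n. (\<Sum>i<wm (Suc n). c i * lam n i j y) * wb n j t)"
   by (subst sum.swap) (simp add: sum_distrib_right)
  also have "\<dots> = 0" using 1 by simp
  finally show ?thesis .
 qed
 then have "c i = 0" if "i < wm (Suc n)" for i
  using wb_indep[of "Suc n" c "\<lambda>_. 0", OF _ that] by simp
 then show ?thesis using xi by (simp add: smult_A fun_eq_iff)
qed

text \<open>One degree above the generators an element of \<open>A \<otimes> W n\<close> is a tensor
  u in \<open>V \<otimes> W n\<close>. Being a cycle says that the windows of u at its left end lie
  in R, and this is all that is missing for u to lie in \<open>W (Suc n)\<close>.\<close>

lemma kd_low:
 assumes x: "x \<in> homog (K n) (int (Suc n))"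
  and z: "\<And>n'. n = Suc n' \<Longrightarrow> kd n' x = \<zero>\<^bsub>K n'\<^esub>"
 shows "x \<in> kd n ` carrier (K (Suc n))"
proof -
 have "\<forall>i. \<exists>v. i < wm n \<longrightarrow> x i = vc v"
  using x homog_A_1 by (auto simp: free_homog vc_def)
 then obtain v where v: "\<And>i. i < wm n \<Longrightarrow> x i = vc (v i)" by metis
 have xc: "x \<in> carrier (K n)" using x G.H_sub by (auto simp: free_homog free_carrier)
 define u where "u = (\<lambda>s. case s of [] \<Rightarrow> 0 | y # t \<Rightarrow> \<Sum>i<wm n. v i y * wb n i t)"
 have uW: "u \<in> W (Suc n)"
 proof (rule W_SucI)
  show "u \<in> tensors (Suc n)"
   using wb_tensors by (auto simp: tensors_def u_def split: list.splits intro!: sum.neutral)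
  show "(\<lambda>s. u (y # s)) \<in> W n" for y
   unfolding u_def list.case
   by (rule subsp_sum[OF W_subsp]) (use wb_W W_subsp in \<open>auto simp: subsp_def\<close>)
  fix q :: "'n list" assume "Suc (length q) = n"
  then obtain n' where n: "n = Suc n'" "length q = n'" by auto
  let ?r = "\<lambda>k s. \<Sum>i<wm n. (vec_tensor (v i) \<star> vec_tensor (lam n' i k)) s"
  have r: "?r k \<in> R" if k: "k < wm n'" for k
  proof -
   have "(\<Oplus>\<^bsub>A\<^esub>i\<in>{..<wm n}. x i \<cdot> vc (lam n' i k)) = 0\<^sub>A"
    using kd_coord[OF xc[unfolded n(1)], of k] z[OF n(1)] k n by simp
   moreover have "(\<Oplus>\<^bsub>A\<^esub>i\<in>{..<wm n}. x i \<cdot> vc (lam n' i k)) = (\<Oplus>\<^bsub>A\<^esub>i\<in>{..<wm n}. vc (v i) \<cdot> vc (lam n' i k))"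
    by (intro A.finsum_cong') (auto simp: v)
   ultimately show ?thesis using vc_mult_sum_zero[of "{..<wm n}" v "\<lambda>i. lam n' i k"] by simp
  qed
  have "(\<lambda>s. \<Sum>k<wm n'. wb n' k q * ?r k s) \<in> R"
   using r R_subsp by (intro subsp_sum) (auto simp: subsp_def)
  also have "(\<lambda>s. \<Sum>k<wm n'. wb n' k q * ?r k s) = slice [] q u"
  proof
   fix s :: "'n list"
   show "(\<Sum>k<wm n'. wb n' k q * ?r k s) = slice [] q u s"
   proof (cases "length s = 2")
    case True
    then obtain y y' where s: "s = [y, y']" by (auto simp: length_Suc_conv numeral_2_eq_2)
    have "u (s @ q) = (\<Sum>i<wm n. \<Sum>k<wm n'. v i y * (lam n' i k y' * wb n' k q))"
     by (auto simp: u_def s n wb_left sum_distrib_left)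
    also have "\<dots> = (\<Sum>k<wm n'. wb n' k q * ?r k s)"
     by (subst sum.swap) (auto simp: s vec_tensor2 sum_distrib_left algebra_simps intro!: sum.cong)
    finally show ?thesis using True by (simp add: slice_def)
   next
    case False
    then show ?thesis by (auto simp: vec_tensor2 slice_def split: list.splits intro!: sum.neutral)
   qed
  qed
  finally show "slice [] q u \<in> R" .
 qed
 \<comment> \<open>The preimage has scalar entries: the coordinates of u in the basis of
   \<open>W (Suc n)\<close>.\<close>
 define c where "c = (\<lambda>k. prj (Suc n) (wp (Suc n) k) u)"
 have v': "v i y = (\<Sum>k<wm (Suc n). c k * lam n k i y)" if i: "i < wm n" for i y
 proof (rule wb_indep[OF _ i])
  fix s :: "'n list"
  have "(\<Sum>j<wm n. v j y * wb n j s) = u (y # s)" by (simp add: u_def)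
  also have "\<dots> = (\<Sum>k<wm (Suc n). c k * wb (Suc n) k (y # s))" unfolding c_def by (rule W_expand[OF uW])
  also have "\<dots> = (\<Sum>k<wm (Suc n). \<Sum>j<wm n. c k * lam n k j y * wb n j s)"
   by (auto simp: wb_left sum_distrib_left mult.assoc)
  also have "\<dots> = (\<Sum>j<wm n. (\<Sum>k<wm (Suc n). c k * lam n k j y) * wb n j s)"
   by (subst sum.swap) (simp add: sum_distrib_right)
  finally show "(\<Sum>j<wm n. v j y * wb n j s) = (\<Sum>j<wm n. (\<Sum>k<wm (Suc n). c k * lam n k j y) * wb n j s)" .
 qed
 let ?y = "\<lambda>k. if k < wm (Suc n) then c k *\<^sub>A 1\<^sub>A else 0\<^sub>A"
 have y: "?y \<in> carrier (K (Suc n))" by (rule kd_scalar) (rule refl)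
 have "kd n ?y = x"
 proof
  fix i show "kd n ?y i = x i"
  proof (cases "i < wm n")
   case True
   then show ?thesis using kd_scalar(2)[of ?y n c i] v'[OF True, symmetric] v[OF True] by simp
  next
   case False
   then show ?thesis using kd_coord[OF y] xc by (simp add: free_carrier)
  qed
 qed
 then show ?thesis using y by blast
qed

end

section \<open>Ext and the top class\<close>

definition reg :: "('k, 's) graded_module \<Rightarrow> ('s, 's) graded_module" where
 "reg S = \<lparr>carrier = carrier S, mult = mult S, one = one S, zero = zero S, add = add S,
   smult = mult S, homog = homog S\<rparr>"

lemma reg_simps [simp]: "carrier (reg S) = carrier S" "zero (reg S) = zero S" "add (reg S) = add S"
 "smult (reg S) = mult S" "homog (reg S) = homog S"
 by (simp_all add: reg_def)

lemma reg_left: "ring S \<Longrightarrow> left_module S (reg S)"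
proof -
 assume "ring S"
 then interpret ring S .
 have "abelian_group (reg S)" by (rule abelian_group_cong[OF abelian_group_axioms]) simp_all
 then show ?thesis unfolding left_module_def left_module_axioms_def
  using ring_axioms by (simp add: l_distr r_distr m_assoc)
qed

lemma reg_finsum:
 assumes "ring S" "finite F" "\<And>i. i \<in> F \<Longrightarrow> f i \<in> carrier S"
 shows "(\<Oplus>\<^bsub>reg S\<^esub>i\<in>F. f i) = (\<Oplus>\<^bsub>S\<^esub>i\<in>F. f i)"
 using assms(2,3)
proof (induction F rule: finite_induct)
 interpret ring S by fact
 interpret M: left_module S "reg S" by (rule reg_left) fact
 {
  case empty show ?case by simp
 next
  case (insert x F)
  then have "(\<Oplus>\<^bsub>reg S\<^esub>i\<in>insert x F. f i) = f x \<oplus>\<^bsub>reg S\<^esub> (\<Oplus>\<^bsub>reg S\<^esub>i\<in>F. f i)"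
   by (intro M.M.finsum_insert) auto
  moreover have "(\<Oplus>\<^bsub>S\<^esub>i\<in>insert x F. f i) = f x \<oplus>\<^bsub>S\<^esub> (\<Oplus>\<^bsub>S\<^esub>i\<in>F. f i)"
   using insert by (intro finsum_insert) auto
  ultimately show ?case using insert by simp
 }
qed

lemma hom_deg_lin: "f \<in> hom_deg S P j \<Longrightarrow> f \<in> lin_maps S P (reg S)"
 by (auto simp: hom_deg_def lin_maps_def)

lemma hom_deg_dual: "ring S \<Longrightarrow> f \<in> hom_deg S P j \<Longrightarrow> f \<in> carrier (dual S P)"
proof -
 assume S: "ring S" and f: "f \<in> hom_deg S P j"
 interpret ring S by fact
 have "f = (\<lambda>x\<in>carrier P. \<Oplus>\<^bsub>S\<^esub>i\<in>{j}. f x)"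
  using f by (auto simp: hom_deg_def PiE_iff extensional_def fun_eq_iff)
 then show ?thesis using f unfolding dual_def
  by (simp del: restrict_apply) (intro exI[of _ "{j}"] exI[of _ "\<lambda>_. f"] conjI, auto)
qed

lemma dual_lin:
 assumes "left_module S P" "g \<in> carrier (dual S P)"
 shows "g \<in> lin_maps S P (reg S)"
proof -
 interpret left_module S P by fact
 obtain T F where g: "g = (\<lambda>x\<in>carrier P. \<Oplus>\<^bsub>S\<^esub>j\<in>T. F j x)" and T: "finite T" "\<And>j. j \<in> T \<Longrightarrow> F j \<in> hom_deg S P j"
  using assms(2) by (auto simp: dual_def)
 note F = lin_mapsD[OF hom_deg_lin[OF T(2)], simplified]
 show ?thesis
 proof (rule lin_mapsI)
  fix x y assume "x \<in> carrier P" "y \<in> carrier P"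
  moreover from this have "(\<Oplus>\<^bsub>S\<^esub>j\<in>T. F j (x \<oplus>\<^bsub>P\<^esub> y)) = (\<Oplus>\<^bsub>S\<^esub>j\<in>T. F j x \<oplus>\<^bsub>S\<^esub> F j y)"
   using F by (intro R.finsum_cong') auto
  moreover have "\<dots> = (\<Oplus>\<^bsub>S\<^esub>j\<in>T. F j x) \<oplus>\<^bsub>S\<^esub> (\<Oplus>\<^bsub>S\<^esub>j\<in>T. F j y)"
   using F calculation by (intro R.finsum_addf) auto
  ultimately show "g (x \<oplus>\<^bsub>P\<^esub> y) = g x \<oplus>\<^bsub>reg S\<^esub> g y" by (simp add: g)
 next
  fix a x assume "a \<in> carrier S" "x \<in> carrier P"
  then show "g (a \<odot>\<^bsub>P\<^esub> x) = a \<odot>\<^bsub>reg S\<^esub> g x" unfolding g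
   using F T(1) by (simp add: smult_closed, subst R.finsum_rdistr) (auto intro!: R.finsum_cong')
 qed (use F g in \<open>auto intro!: R.finsum_closed\<close>)
qed

definition fh :: "('k, 's) graded_module \<Rightarrow> nat \<Rightarrow> int \<Rightarrow> (nat \<Rightarrow> 's) \<Rightarrow> (nat \<Rightarrow> 's) \<Rightarrow> 's" where
 "fh S m c y = (\<lambda>x\<in>carrier (free_mod S m c). \<Oplus>\<^bsub>S\<^esub>i\<in>{..<m}. x i \<otimes>\<^bsub>S\<^esub> y i)"

lemma (in graded_ring) fh_hom_deg:
 assumes "\<And>i. i < m \<Longrightarrow> y i \<in> homog S (c + j)"
 shows "fh S m c y \<in> hom_deg S (free_mod S m c) j"
proof -
 interpret F: left_module S "free_mod S m c" by (rule free_left_module[OF ring_axioms])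
 interpret Rg: left_module S "reg S" by (rule reg_left[OF ring_axioms])
 have y: "i < m \<Longrightarrow> y i \<in> carrier S" for i using assms H_sub by blast
 have e: "fh S m c y x = lcomb m (reg S) y x" if "x \<in> carrier (free_mod S m c)" for x
  using that y free_coord[OF ring_axioms that]
  by (simp add: fh_def lcomb_def) (rule reg_finsum[OF ring_axioms, symmetric], auto)
 have l: "lcomb m (reg S) y \<in> lin_maps S (free_mod S m c) (reg S)"
  by (rule lcomb_lin[OF ring_axioms Rg.left_module_axioms]) (use y in auto)
 note lD = lin_mapsD[OF l]
 have "fh S m c y x \<in> homog S (n + j)" if x: "x \<in> homog (free_mod S m c) n" for x n
 proof -
  have "x \<in> carrier (free_mod S m c)" using x H_sub by (auto simp: free_homog free_carrier)
  moreover have "x i \<otimes> y i \<in> homog S (n + j)" if "i < m" for i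
   using homog_mult[OF _ assms[OF that], of "x i" "n - c"] x that by (simp add: free_homog)
  ultimately show ?thesis unfolding fh_def by (simp, intro H_finsum) auto
 qed
 then show ?thesis unfolding hom_deg_def
  using lD by (auto simp del: free_mod_simps simp: e F.smult_closed) (auto simp: fh_def)
qed

lemma fh_fe:
 assumes "ring S" "\<And>i. i < m \<Longrightarrow> y i \<in> carrier S" "i < m"
 shows "fh S m c y (fe S i) = y i"
proof -
 interpret ring S by fact
 have "fh S m c y (fe S i) = (\<Oplus>\<^bsub>S\<^esub>j\<in>{..<m}. fe S i j \<otimes>\<^bsub>S\<^esub> y j)"
  using fe_carrier[OF assms(1,3)] by (simp add: fh_def)
 also have "\<dots> = fe S i i \<otimes>\<^bsub>S\<^esub> y i" by (rule finsum_single) (use assms in \<open>auto simp: fe_def\<close>)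
 finally show ?thesis using assms by (simp add: fe_def)
qed

lemma dual_simps [simp]:
 "zero (dual S P) = (\<lambda>x\<in>carrier P. \<zero>\<^bsub>S\<^esub>)" "add (dual S P) = (\<lambda>f g. \<lambda>x\<in>carrier P. f x \<oplus>\<^bsub>S\<^esub> g x)"
 "smult (dual S P) = (\<lambda>a f. \<lambda>x\<in>carrier P. f x \<otimes>\<^bsub>S\<^esub> a)" "homog (dual S P) = hom_deg S P"
 by (simp_all add: dual_def)

lemma dual_ext: "g \<in> carrier (dual S P) \<Longrightarrow> x \<notin> carrier P \<Longrightarrow> g x = undefined"
 by (auto simp: dual_def)

lemma dual_zero: "(\<lambda>x\<in>carrier P. \<zero>\<^bsub>S\<^esub>) \<in> carrier (dual S P)" if "ring S"
proof -
 interpret ring S by fact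
 show ?thesis unfolding dual_def by simp (intro exI[of _ "{}"], simp)
qed

lemma coboundaries_zero:
 assumes "ring S" "\<And>i. d i \<in> lin_maps S (P (Suc i)) (P i)"
 shows "(\<lambda>x\<in>carrier (P i). \<zero>\<^bsub>S\<^esub>) \<in> coboundaries S P d i"
proof (cases i)
 case (Suc j)
 have "(\<lambda>x\<in>carrier (P (Suc j)). \<zero>\<^bsub>S\<^esub>) = (\<lambda>x\<in>carrier (P (Suc j)). (\<lambda>x\<in>carrier (P j). \<zero>\<^bsub>S\<^esub>) (d j x))"
  using lin_mapsD(1)[OF assms(2)] by (auto simp: fun_eq_iff)
 then show ?thesis unfolding Suc coboundaries.simps
  by (rule image_eqI[where x = "\<lambda>x\<in>carrier (P j). \<zero>\<^bsub>S\<^esub>"]) (rule dual_zero[OF assms(1)])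
qed simp

lemma Ext_zeroD:
 assumes "ring S" "left_module S (P i)" "\<And>i. d i \<in> lin_maps S (P (Suc i)) (P i)"
  and "carrier (Ext S P d i) = {\<zero>\<^bsub>Ext S P d i\<^esub>}" and z: "z \<in> cocycles S P d i"
 shows "z \<in> coboundaries S P d i"
proof -
 interpret ring S by fact
 let ?B = "coboundaries S P d i" and ?D = "dual S (P i)"
 have zD: "z \<in> carrier ?D" using z by (simp add: cocycles_def)
 note zl = lin_mapsD[OF dual_lin[OF assms(2) zD], simplified]
 have "?B +>\<^bsub>?D\<^esub> z \<in> carrier (Ext S P d i)" using z by (simp add: Ext_def subquotient_def)
 then have "?B +>\<^bsub>?D\<^esub> z = ?B" using assms(4) by (simp add: Ext_def subquotient_def)
 moreover have "(\<lambda>x\<in>carrier (P i). \<zero>\<^bsub>S\<^esub>) \<oplus>\<^bsub>?D\<^esub> z = z"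
  using zl dual_ext[OF zD] by (auto simp: fun_eq_iff)
 then have "z \<in> ?B +>\<^bsub>?D\<^esub> z" unfolding a_r_coset_def'
  using coboundaries_zero[where S = S and P = P and d = d and i = i] assms(1,3) by blast
 ultimately show ?thesis by simp
qed

text \<open>Two coboundaries appear because the action on cosets is a union: b comes from the choice
  of a representative of the generating class, \<open>b'\<close> from the coset formed after
  multiplying by the scalar.\<close>

lemma one_dimensionalD:
 assumes "ring S" "left_module S (P i)" "\<And>i. d i \<in> lin_maps S (P (Suc i)) (P i)"
  and "one_dimensional S (Ext S P d i)"
 shows "\<exists>z0\<in>cocycles S P d i. \<forall>z\<in>cocycles S P d i. \<exists>c. \<exists>b\<in>coboundaries S P d i. \<exists>b'\<in>coboundaries S P d i.
  \<forall>x\<in>carrier (P i). z x = b' x \<oplus>\<^bsub>S\<^esub> (b x \<oplus>\<^bsub>S\<^esub> z0 x) \<otimes>\<^bsub>S\<^esub> (c \<odot>\<^bsub>S\<^esub> \<one>\<^bsub>S\<^esub>)"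
proof -
 interpret ring S by fact
 let ?B = "coboundaries S P d i" and ?D = "dual S (P i)"
 obtain e where e: "e \<in> carrier (Ext S P d i)"
  "\<And>x. x \<in> carrier (Ext S P d i) \<Longrightarrow> \<exists>c. x = (c \<odot>\<^bsub>S\<^esub> \<one>\<^bsub>S\<^esub>) \<odot>\<^bsub>Ext S P d i\<^esub> e"
  using assms(4) unfolding one_dimensional_def by blast
 then obtain z0 where z0: "z0 \<in> cocycles S P d i" "e = ?B +>\<^bsub>?D\<^esub> z0"
  by (auto simp: Ext_def subquotient_def)
 have "\<exists>c. \<exists>b\<in>?B. \<exists>b'\<in>?B. \<forall>x\<in>carrier (P i). z x = b' x \<oplus>\<^bsub>S\<^esub> (b x \<oplus>\<^bsub>S\<^esub> z0 x) \<otimes>\<^bsub>S\<^esub> (c \<odot>\<^bsub>S\<^esub> \<one>\<^bsub>S\<^esub>)"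
  if z: "z \<in> cocycles S P d i" for z
 proof -
  have zD: "z \<in> carrier ?D" using z by (simp add: cocycles_def)
  note zl = lin_mapsD[OF dual_lin[OF assms(2) zD], simplified]
  have "?B +>\<^bsub>?D\<^esub> z \<in> carrier (Ext S P d i)" using z by (simp add: Ext_def subquotient_def)
  then obtain c where "?B +>\<^bsub>?D\<^esub> z = (c \<odot>\<^bsub>S\<^esub> \<one>\<^bsub>S\<^esub>) \<odot>\<^bsub>Ext S P d i\<^esub> e" using e(2) by blast
  then have c: "?B +>\<^bsub>?D\<^esub> z = (\<Union>x\<in>?B +>\<^bsub>?D\<^esub> z0. ?B +>\<^bsub>?D\<^esub> ((c \<odot>\<^bsub>S\<^esub> \<one>\<^bsub>S\<^esub>) \<odot>\<^bsub>?D\<^esub> x))"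
   by (simp add: Ext_def subquotient_def z0(2))
  have "(\<lambda>x\<in>carrier (P i). \<zero>\<^bsub>S\<^esub>) \<oplus>\<^bsub>?D\<^esub> z = z"
   using zl dual_ext[OF zD] by (auto simp: fun_eq_iff)
  then have "z \<in> ?B +>\<^bsub>?D\<^esub> z" unfolding a_r_coset_def'
   using coboundaries_zero[where S = S and P = P and d = d and i = i] assms(1,3) by blast
  then obtain x where x: "x \<in> ?B +>\<^bsub>?D\<^esub> z0" "z \<in> ?B +>\<^bsub>?D\<^esub> ((c \<odot>\<^bsub>S\<^esub> \<one>\<^bsub>S\<^esub>) \<odot>\<^bsub>?D\<^esub> x)"
   unfolding c by blast
  then obtain b b' where b: "b \<in> ?B" "x = b \<oplus>\<^bsub>?D\<^esub> z0" and b': "b' \<in> ?B"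
   "z = b' \<oplus>\<^bsub>?D\<^esub> ((c \<odot>\<^bsub>S\<^esub> \<one>\<^bsub>S\<^esub>) \<odot>\<^bsub>?D\<^esub> x)" unfolding a_r_coset_def' by blast
  have "\<forall>y\<in>carrier (P i). z y = b' y \<oplus>\<^bsub>S\<^esub> (b y \<oplus>\<^bsub>S\<^esub> z0 y) \<otimes>\<^bsub>S\<^esub> (c \<odot>\<^bsub>S\<^esub> \<one>\<^bsub>S\<^esub>)"
   unfolding b'(2) b(2) by simp
  then show ?thesis using b(1) b'(1) by blast
 qed
 then show ?thesis using z0(1) by blast
qed

section \<open>The augmentation and the augmented Koszul complex\<close>

context quad begin

definition aug :: "('n list \<Rightarrow> 'k) set \<Rightarrow> 'k" where "aug Y = co Y []"

lemma aug_cls: "u \<in> \<T> \<Longrightarrow> aug (cls u) = u []"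
 by (simp add: aug_def co_cls co_low)

lemma aug_simps:
 "Y \<in> \<A> \<Longrightarrow> Z \<in> \<A> \<Longrightarrow> aug (Y +\<^sub>A Z) = aug Y + aug Z"
 "Y \<in> \<A> \<Longrightarrow> Z \<in> \<A> \<Longrightarrow> aug (Y \<cdot> Z) = aug Y * aug Z"
 "Y \<in> \<A> \<Longrightarrow> aug (c *\<^sub>A Y) = c * aug Y"
 "aug 1\<^sub>A = 1" "aug 0\<^sub>A = 0" "aug (vc v) = 0"
 "Y \<in> \<A> \<Longrightarrow> aug (\<ominus>\<^bsub>A\<^esub> Y) = - aug Y"
proof -
 show "Y \<in> \<A> \<Longrightarrow> Z \<in> \<A> \<Longrightarrow> aug (Y \<cdot> Z) = aug Y * aug Z"
  by (elim A_cases) (simp add: cls_hom aug_cls TT_closed TT_mult_Nil)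
 show "Y \<in> \<A> \<Longrightarrow> aug (c *\<^sub>A Y) = c * aug Y" for c Y by (simp add: aug_def co_linear)
 from this[of Y "-1"] show "Y \<in> \<A> \<Longrightarrow> aug (\<ominus>\<^bsub>A\<^esub> Y) = - aug Y" by (simp add: smult_A_minus)
 show "aug 1\<^sub>A = 1" by (simp add: cls_hom aug_cls TT_closed) (simp add: sgl_def)
 show "aug (vc v) = 0" by (simp add: vc_def aug_cls vec_TT) (simp add: vec_tensor_def)
qed (simp_all add: aug_def co_linear)

lemma aug_finsum: "finite F \<Longrightarrow> (\<And>i. i \<in> F \<Longrightarrow> f i \<in> \<A>) \<Longrightarrow> aug (\<Oplus>\<^bsub>A\<^esub>i\<in>F. f i) = (\<Sum>i\<in>F. aug (f i))"
 by (simp add: aug_def co_finsum)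

lemma aug_homog: "Y \<in> homog A n \<Longrightarrow> n \<noteq> 0 \<Longrightarrow> aug Y = 0"
 unfolding aug_def by (rule co_homog) auto

lemma cmp_0: "Y \<in> \<A> \<Longrightarrow> cmp 0 Y = aug Y *\<^sub>A 1\<^sub>A"
proof (erule A_cases)
 fix u assume u: "u \<in> \<T>" "Y = cls u"
 have "dg 0 u = (\<lambda>s. u [] * sgl [] s)" by (auto simp: dg_def sgl_def)
 then show ?thesis using u by (simp add: cmp_cls aug_cls cls_hom cls_smult)
qed

lemma cmp_1_vc: "Y \<in> \<A> \<Longrightarrow> cmp 1 (vc v \<cdot> Y) = aug Y *\<^sub>A vc v"
proof -
 assume Y: "Y \<in> \<A>"
 have "add_map A A (\<lambda>Y. vc v \<cdot> Y)"
  by (rule add_mapI) (auto simp: A.r_distr A.abelian_group_axioms)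
 then have "cmp (0 + 1) (vc v \<cdot> Y) = vc v \<cdot> cmp 0 Y"
  using G.homog_mult[OF vc_homog] Y
  by (intro deg_map_cmp[OF G.graded_group_axioms G.graded_group_axioms]) (auto simp: add.commute)
 then show ?thesis using Y by (simp add: cmp_0 smult_A)
qed

text \<open>The ideal generated by positive degrees is the kernel of \<open>aug\<close>: one
  inclusion by minimality, the other by splitting an element of the kernel into components, whose
  term of degree 0 vanishes.\<close>

lemma augmentation_eq: "Y \<in> \<A> \<Longrightarrow> augmentation A Y = aug Y"
proof -
 assume Y: "Y \<in> \<A>"
 let ?X = "\<Union>n\<in>{0<..}. homog A n" and ?J = "{Y \<in> carrier A. aug Y = 0}"
 have Xs: "?X \<subseteq> \<A>" using G.H_sub by blast
 have J: "ideal ?J A"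
 proof (rule idealI[OF A_ring])
  show "subgroup ?J (add_monoid A)"
  proof (rule subgroup.intro)
   fix x assume "x \<in> ?J"
   then show "inv\<^bsub>add_monoid A\<^esub> x \<in> ?J" using aug_simps(7)[of x] by (simp add: a_inv_def[symmetric])
  qed (auto simp: aug_simps)
 qed (auto simp: aug_simps)
 interpret Id: ideal "Idl\<^bsub>A\<^esub> ?X" A by (rule A.genideal_ideal[OF Xs])
 have sub: "Idl\<^bsub>A\<^esub> ?X \<subseteq> ?J"
 proof (rule A.genideal_minimal[OF J])
  show "?X \<subseteq> ?J" using G.H_sub aug_homog by fastforce
 qed
 have sub2: "Z \<in> Idl\<^bsub>A\<^esub> ?X" if Z: "Z \<in> \<A>" "aug Z = 0" for Z
 proof -
  obtain N where N: "finite N" "\<And>n. n \<notin> N \<Longrightarrow> cmp n Z = 0\<^sub>A" "Z = (\<Oplus>\<^bsub>A\<^esub>n\<in>N. cmp n Z)"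
   using G.cmp_sum[OF Z(1)] by blast
  have z: "0\<^sub>A \<in> Idl\<^bsub>A\<^esub> ?X" by (rule additive_subgroup.zero_closed[OF Id.is_additive_subgroup])
  have c: "cmp n Z \<in> Idl\<^bsub>A\<^esub> ?X" for n
  proof (cases "n > 0")
   case True
   then have "cmp n Z \<in> ?X" using G.cmp_H[OF Z(1)] by blast
   then show ?thesis using A.genideal_self[OF Xs] by blast
  next
   case False
   then have "cmp n Z = 0\<^sub>A" using cmp_0[OF Z(1)] Z smult_A(6)[of "1\<^sub>A"] by (cases "n = 0") (auto simp: cmp_def)
   then show ?thesis using z by simp
  qed
  have "(\<Oplus>\<^bsub>A\<^esub>n\<in>N. cmp n Z) \<in> Idl\<^bsub>A\<^esub> ?X"
   using N(1)
  proof (induction N rule: finite_induct)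
   case (insert n N)
   then show ?case using c Z(1) additive_subgroup.a_closed[OF Id.is_additive_subgroup] by simp
  qed (use z in simp)
  then show ?thesis using N(3) by simp
 qed
 show ?thesis unfolding augmentation_def
 proof (rule the_equality)
  show "Y \<ominus>\<^bsub>A\<^esub> aug Y *\<^sub>A 1\<^sub>A \<in> Idl\<^bsub>A\<^esub> ?X"
   using Y by (intro sub2) (auto simp: a_minus_def aug_simps smult_A)
  fix c assume "Y \<ominus>\<^bsub>A\<^esub> c *\<^sub>A 1\<^sub>A \<in> Idl\<^bsub>A\<^esub> ?X"
  then have "aug (Y \<ominus>\<^bsub>A\<^esub> c *\<^sub>A 1\<^sub>A) = 0" using sub by blast
  then show "c = aug Y" using Y by (simp add: a_minus_def aug_simps smult_A)
 qed
qed

definition c2m :: "'k \<Rightarrow> nat \<Rightarrow> ('n list \<Rightarrow> 'k) set" where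
 "c2m c i = (if i = 0 then c *\<^sub>A 1\<^sub>A else 0\<^sub>A)"

lemma c2m_inj: "c2m c = c2m c' \<longleftrightarrow> c = c'"
 using scal_eq by (auto simp: c2m_def fun_eq_iff)

text \<open>A copy of the trivial module whose elements have the type of the terms of a resolution, so that
 an augmented resolution is a single sequence of modules.\<close>

definition M0 :: "(('n list \<Rightarrow> 'k) set, nat \<Rightarrow> ('n list \<Rightarrow> 'k) set) graded_module" where
 "M0 = \<lparr>carrier = range c2m, mult = undefined, one = undefined, zero = c2m 0,
   add = (\<lambda>x y i. x i +\<^sub>A y i), smult = (\<lambda>a x i. aug a *\<^sub>A x i),
   homog = (\<lambda>n. if n = 0 then range c2m else {c2m 0})\<rparr>"

lemma M0_simps: "carrier M0 = range c2m" "zero M0 = c2m 0"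
 "c2m c \<oplus>\<^bsub>M0\<^esub> c2m c' = c2m (c + c')" "a \<odot>\<^bsub>M0\<^esub> c2m c = c2m (aug a * c)"
 "homog M0 n = (if n = 0 then range c2m else {c2m 0})"
 by (auto simp: M0_def c2m_def smult_A smult_A_zero fun_eq_iff)

lemma M0_left: "left_module A M0"
proof -
 have "abelian_group M0"
 proof (rule abelian_groupI)
  fix x assume "x \<in> carrier M0"
  then obtain c where "x = c2m c" by (auto simp: M0_simps)
  then show "\<exists>y\<in>carrier M0. y \<oplus>\<^bsub>M0\<^esub> x = \<zero>\<^bsub>M0\<^esub>"
   by (intro bexI[of _ "c2m (- c)"]) (auto simp: M0_simps)
 qed (auto simp: M0_simps algebra_simps)
 then show ?thesis unfolding left_module_def left_module_axioms_def
  using A_ring by (auto simp: M0_simps aug_simps algebra_simps)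
qed

lemma M0_graded: "graded_left_module A M0"
proof -
 interpret left_module A M0 by (rule M0_left)
 interpret g: graded_group M0 "homog M0" "\<lambda>n x. if n = 0 then x else c2m 0"
 proof
  fix x assume x: "x \<in> carrier M0"
  show "\<exists>N. finite N \<and> (\<forall>n. n \<notin> N \<longrightarrow> (if n = 0 then x else c2m 0) = \<zero>\<^bsub>M0\<^esub>) \<and>
    x = (\<Oplus>\<^bsub>M0\<^esub>n\<in>N. if n = 0 then x else c2m 0)"
   using x by (intro exI[of _ "{0}"]) (simp add: M0_simps)
 qed (auto simp: M0_simps split: if_splits)
 show ?thesis unfolding graded_left_module_def graded_left_module_axioms_def
 proof (intro conjI allI impI left_module_axioms g.H_subgroup g.direct_sum)
  fix a i x j assume "a \<in> homog A i" "x \<in> homog M0 j"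
  then show "a \<odot>\<^bsub>M0\<^esub> x \<in> homog M0 (i + j)"
   using aug_homog[of a i] by (auto simp: M0_simps split: if_splits)
 qed
qed

definition KX where "KX n = (case n of 0 \<Rightarrow> M0 | Suc n \<Rightarrow> K n)"
definition kX where "kX n = (case n of 0 \<Rightarrow> (\<lambda>x. c2m (aug (x 0))) | Suc n \<Rightarrow> kd n)"

lemma KX_simps [simp]: "KX 0 = M0" "KX (Suc n) = K n" "kX 0 = (\<lambda>x. c2m (aug (x 0)))" "kX (Suc n) = kd n"
 by (simp_all add: KX_def kX_def)

lemma eps_lin: "(\<lambda>x. c2m (aug (x 0))) \<in> lin_maps A (K n) M0"
 by (rule lin_mapsI) (auto simp: M0_simps aug_simps K_coord)

lemma c2m_K0: "c2m c \<in> carrier (K 0)" "c2m c \<in> homog (K 0) 0"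
 using homog_A_0 by (auto simp: c2m_def free_carrier free_homog wm_0 smult_A)

sublocale KC: free_complex A cmp KX kX wm
proof (intro free_complex.intro free_complex_axioms.intro G.graded_ring_axioms)
 fix j
 show "graded_left_module A (KX j)"
  by (cases j) (simp_all add: M0_graded G.free_graded)
 show "KX (Suc j) = K j" by simp
 show "kX j \<in> graded_maps A (KX (Suc j)) (KX j)"
 proof (cases j)
  case 0
  have "c2m (aug (x 0)) \<in> homog M0 n" if "x \<in> homog (K 0) n" for x n
   using that aug_homog[of "x 0" n] by (auto simp: free_homog wm_0 M0_simps)
  then show ?thesis using 0 eps_lin[of 0] by (auto simp: graded_maps_def)
 qed (use kd_graded in \<open>simp_all\<close>)
next
 fix j x assume x: "x \<in> carrier (KX (Suc j))"
 show "kX j x \<in> cyc KX kX j"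
 proof (cases j)
  case 0 then show ?thesis by (simp add: M0_simps)
 next
  case (Suc i)
  then have xc: "x \<in> carrier (K (Suc i))" using x by simp
  show ?thesis
  proof (cases i)
   case 0
   have "kd 0 x 0 = (\<Oplus>\<^bsub>A\<^esub>i\<in>{..<wm (Suc 0)}. x i \<cdot> vc (lam 0 i 0))"
    using kd_coord[of x 0 0] xc 0 by (simp add: wm_0)
   then have "aug (kd 0 x 0) = 0"
    using K_coord[OF xc] by (simp add: aug_finsum aug_simps)
   then show ?thesis using Suc 0 xc lin_mapsD(1)[OF kd_lin[of 0]] by (simp add: M0_simps)
  next
   case (Suc k)
   then show ?thesis using \<open>j = Suc i\<close> xc kd_kd lin_mapsD(1)[OF kd_lin[of "Suc k"]] by simp
  qed
 qed
next
 fix j x assume x: "x \<in> homog (KX j) (int j)" "x \<in> cyc KX kX j"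
 show "x \<in> kX j ` carrier (KX (Suc j))"
 proof (cases j)
  case 0
  then obtain c where "x = c2m c" using x by (auto simp: M0_simps)
  then have "x = kX 0 (c2m c)" by (simp add: c2m_def aug_simps)
  then show ?thesis using c2m_K0 0 by auto
 next
  case (Suc n)
  have "x \<in> kd n ` carrier (K (Suc n))"
  proof (rule kd_low)
   show "x \<in> homog (K n) (int (Suc n))" using x Suc by simp
   show "kd n' x = \<zero>\<^bsub>K n'\<^esub>" if "n = Suc n'" for n' using x Suc that by simp
  qed
  then show ?thesis using Suc by simp
 qed
next
 fix j x assume x: "x \<in> homog (KX (Suc j)) (int j)" "kX j x = \<zero>\<^bsub>KX j\<^esub>"
 show "x = \<zero>\<^bsub>KX (Suc j)\<^esub>"
 proof (cases j)
  case 0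
  have x0: "x 0 \<in> homog A 0" "\<And>i. i > 0 \<Longrightarrow> x i = 0\<^sub>A" using x 0 by (auto simp: free_homog wm_0)
  then obtain c where c: "x 0 = c *\<^sub>A 1\<^sub>A" using homog_A_0 by auto
  have "c2m c = c2m 0" using x(2) 0 by (simp add: c aug_simps M0_simps)
  then have "c = 0" by (simp add: c2m_inj)
  then have "x i = 0\<^sub>A" for i using c x0(2)[of i] by (cases "i = 0") (simp_all add: smult_A)
  then have "x = (\<lambda>_. 0\<^sub>A)" by (rule ext)
  then show ?thesis using 0 by simp
 next
  case (Suc n)
  then show ?thesis using x kd_inj by simp
 qed
qed

lemma trivial_simps: "carrier (trivial_module A) = UNIV" "zero (trivial_module A) = 0"
 "add (trivial_module A) = (+)" "smult (trivial_module A) = (\<lambda>a c. augmentation A a * c)"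
 "homog (trivial_module A) n = (if n = 0 then UNIV else {0})"
 by (simp_all add: trivial_module_def)

text \<open>The terms of the given resolution are unknown; only their generating degrees enter.
  Prefixing it with \<open>M0\<close> shifts the index by one and gives it the shape that
  \<open>koszul_exact\<close> compares with the Koszul complex.\<close>

lemma koszul_complex_exact:
 assumes "koszul A"
 shows "cyc KX kX j = kX j ` carrier (KX (Suc j))"
proof -
 obtain P \<delta> \<epsilon> where P: "graded_projective_resolution A (trivial_module A) P \<delta> \<epsilon>"
  and gen: "\<And>n. generated_in_degree A (P n) (int n)"
  using assms unfolding koszul_def by blast
 have pr: "\<And>n. projective A (P n)" "\<And>n. \<delta> n \<in> lin_maps A (P (Suc n)) (P n)"
  "\<epsilon> \<in> lin_maps A (P 0) (trivial_module A)" "exact_resolution (trivial_module A) P \<delta> \<epsilon>"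
  and gr: "\<And>n. graded_left_module A (P n)" "\<And>n. \<delta> n \<in> graded_maps A (P (Suc n)) (P n)"
  "\<epsilon> \<in> graded_maps A (P 0) (trivial_module A)"
  using P by (auto simp: graded_projective_resolution_def projective_resolution_def)
 note \<epsilon> = lin_mapsD[OF pr(3), unfolded trivial_simps]
 define Y where "Y = (\<lambda>n. case n of 0 \<Rightarrow> M0 | Suc n \<Rightarrow> P n)"
 define e where "e = (\<lambda>n. case n of 0 \<Rightarrow> (\<lambda>x. c2m (\<epsilon> x)) | Suc n \<Rightarrow> \<delta> n)"
 have Ys [simp]: "Y 0 = M0" "\<And>n. Y (Suc n) = P n" "e 0 = (\<lambda>x. c2m (\<epsilon> x))" "\<And>n. e (Suc n) = \<delta> n"
  by (simp_all add: Y_def e_def)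
 show ?thesis
 proof (rule KC.koszul_exact)
  fix j
  show "graded_left_module A (Y j)" by (cases j) (simp_all add: M0_graded gr)
  show "e j \<in> graded_maps A (Y (Suc j)) (Y j)"
  proof (cases j)
   case 0
   have "(\<lambda>x. c2m (\<epsilon> x)) \<in> lin_maps A (P 0) M0"
    by (rule lin_mapsI) (auto simp: M0_simps \<epsilon> augmentation_eq)
   moreover have "c2m (\<epsilon> x) \<in> homog M0 n" if "x \<in> homog (P 0) n" for x n
    using graded_mapsD(2)[OF gr(3) that] by (auto simp: trivial_simps M0_simps split: if_splits)
   ultimately show ?thesis using 0 by (auto simp: graded_maps_def)
  qed (simp add: gr)
  show "projective A (Y (Suc j))" "generated_in_degree A (Y (Suc j)) (int j)"
   by (simp_all add: pr gen)
  show "cyc Y e j = e j ` carrier (Y (Suc j))"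
  proof (cases j)
   case 0
   have "\<epsilon> ` carrier (P 0) = UNIV" using pr(4) by (simp add: exact_resolution_def trivial_simps)
   then have "(\<lambda>x. c2m (\<epsilon> x)) ` carrier (P 0) = range c2m" by (simp only: image_image[symmetric])
   then show ?thesis using 0 by (simp add: M0_simps)
  next
   case (Suc i)
   show ?thesis
   proof (cases i)
    case 0
    have "cyc Y e 1 = {x \<in> carrier (P 0). \<epsilon> x = 0}" by (auto simp: cyc_def M0_simps c2m_inj)
    then show ?thesis using pr(4) Suc 0 by (simp add: exact_resolution_def trivial_simps)
   next
    case (Suc k)
    then show ?thesis using pr(4) \<open>j = Suc i\<close> by (auto simp: exact_resolution_def cyc_def)
   qed
  qed
 qed simp
qed

lemma koszul_resolution:
 assumes "koszul A"
 shows "graded_projective_resolution A (trivial_module A) K kd (\<lambda>x. aug (x 0))"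
proof -
 note ex = koszul_complex_exact[OF assms]
 have l: "(\<lambda>x. aug (x 0)) \<in> lin_maps A (K 0) (trivial_module A)"
  by (rule lin_mapsI) (auto simp: trivial_simps augmentation_eq aug_simps K_coord[of _ 0, simplified])
 have g: "aug (x 0) \<in> homog (trivial_module A) n" if "x \<in> homog (K 0) n" for x n
  using that aug_homog[of "x 0" n] by (auto simp: free_homog wm_0 trivial_simps)
 have onto: "(\<lambda>x. aug (x 0)) ` carrier (K 0) = UNIV"
 proof -
  have "c \<in> (\<lambda>x. aug (x 0)) ` carrier (K 0)" for c
   by (rule image_eqI[OF _ c2m_K0(1)]) (simp add: c2m_def aug_simps)
  then show ?thesis by blast
 qed
 have "{x \<in> carrier (K 0). aug (x 0) = 0} = cyc KX kX 1"
  by (auto simp: cyc_def M0_simps c2m_inj)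
 moreover have "{x \<in> carrier (K (Suc n)). kd n x = \<zero>\<^bsub>K n\<^esub>} = cyc KX kX (Suc (Suc n))" for n
  by (auto simp: cyc_def)
 ultimately have "exact_resolution (trivial_module A) K kd (\<lambda>x. aug (x 0))"
  unfolding exact_resolution_def trivial_simps using onto ex[of 1] ex[of "Suc (Suc _)"] by simp
 then show ?thesis
  unfolding graded_projective_resolution_def projective_resolution_def
  using l g free_projective[OF A_ring] kd_lin G.free_graded kd_graded
  by (intro conjI allI) (auto simp: graded_maps_def)
qed

text \<open>Suppose K has a generator in position d + 1 and let z be its boundary. For a resolution
  of length d the homotopy relation reduces to saying that \<open>- z\<close> is the boundary of
  \<open>h z\<close>, so the generator plus \<open>h z\<close> is killed by the differential. The
  entries of z have degree one, so \<open>h z\<close> has zero augmentation and cannot cancel the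
  generator, against injectivity in the generating degree.\<close>

lemma W_vanish:
 assumes kz: "koszul A" and gd: "has_global_dim A d"
 shows "wm (Suc d) = 0"
proof (rule ccontr)
 assume "wm (Suc d) \<noteq> 0"
 then have pos: "0 < wm (Suc d)" by simp
 \<comment> \<open>The global dimension quantifies over records without a grading field, so the
   trivial module is copied once more.\<close>
 define M0' :: "(('n list \<Rightarrow> 'k) set, nat \<Rightarrow> ('n list \<Rightarrow> 'k) set) module" where
  "M0' = \<lparr>carrier = carrier M0, mult = undefined, one = undefined, zero = zero M0, add = add M0, smult = smult M0\<rparr>"
 have M0'_left: "left_module A M0'" by (rule left_module_cong[OF M0_left]) (simp_all add: M0'_def)
 then have "proj_dim_le A M0' d" using gd unfolding has_global_dim_def by blast
 then obtain Q :: "nat \<Rightarrow> (('n list \<Rightarrow> 'k) set, nat \<Rightarrow> ('n list \<Rightarrow> 'k) set) module" and \<delta> \<epsilon>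
  where Q: "projective_resolution A M0' Q \<delta> \<epsilon>" "\<forall>n>d. carrier (Q n) = {\<zero>\<^bsub>Q n\<^esub>}"
  unfolding proj_dim_le_def by blast
 have pr: "\<And>n. projective A (Q n)" "\<And>n. \<delta> n \<in> lin_maps A (Q (Suc n)) (Q n)"
  "\<epsilon> \<in> lin_maps A (Q 0) M0'" "exact_resolution M0' Q \<delta> \<epsilon>"
  using Q by (auto simp: projective_resolution_def)
 define Y where "Y = (\<lambda>n. case n of 0 \<Rightarrow> M0' | Suc n \<Rightarrow> Q n)"
 define e where "e = (\<lambda>n. case n of 0 \<Rightarrow> \<epsilon> | Suc n \<Rightarrow> \<delta> n)"
 have Ys [simp]: "Y 0 = M0'" "\<And>n. Y (Suc n) = Q n" "e 0 = \<epsilon>" "\<And>n. e (Suc n) = \<delta> n"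
  by (simp_all add: Y_def e_def)
 have Yex: "cyc Y e j = e j ` carrier (Y (Suc j))" for j
 proof (cases j)
  case (Suc i)
  then show ?thesis using pr(4) by (cases i) (simp_all add: exact_resolution_def cyc_def)
 qed (use pr(4) in \<open>simp add: exact_resolution_def\<close>)
 have "\<exists>f\<in>lin_maps A (KX (Suc d)) (Y (Suc d)). \<exists>g\<in>lin_maps A (Y (Suc d)) (KX (Suc d)).
  \<exists>h\<in>lin_maps A (KX (Suc d)) (KX (Suc (Suc d))).
  (\<forall>x\<in>cyc KX kX (Suc d). f x \<in> cyc Y e (Suc d)) \<and> (\<forall>x\<in>cyc Y e (Suc d). g x \<in> cyc KX kX (Suc d)) \<and>
  (\<forall>z\<in>cyc KX kX (Suc d). g (f z) \<ominus>\<^bsub>KX (Suc d)\<^esub> z = kX (Suc d) (h z))"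
 proof (rule KC.homotopy_on_cycles[OF koszul_complex_exact[OF kz]])
  fix j
  show "left_module A (Y j)" using pr(1) by (cases j) (simp_all add: M0'_left projective_def)
  show "e j \<in> lin_maps A (Y (Suc j)) (Y j)" by (cases j) (simp_all add: pr)
  show "projective A (Y (Suc j))" by (simp add: pr)
  show "cyc Y e j = e j ` carrier (Y (Suc j))" by (rule Yex)
 qed (simp_all add: M0'_def lin_maps_def)
 then obtain f g h where f: "f \<in> lin_maps A (K d) (Q d)" and g: "g \<in> lin_maps A (Q d) (K d)"
  and h: "h \<in> lin_maps A (K d) (K (Suc d))"
  and fc: "\<forall>x\<in>cyc KX kX (Suc d). f x \<in> cyc Y e (Suc d)"
  and gfh: "\<forall>z\<in>cyc KX kX (Suc d). g (f z) \<ominus>\<^bsub>K d\<^esub> z = kd d (h z)"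
  by auto
 let ?z = "kd d (fe A 0)"
 have zc: "?z \<in> cyc KX kX (Suc d)"
  using KC.d_cyc[of "fe A 0" "Suc d"] fe_carrier[OF A_ring pos] by simp
 have zK: "?z \<in> carrier (K d)" using zc by simp
 have "f ?z \<in> cyc Y e (Suc d)" using fc zc by blast
 then have "f ?z \<in> \<delta> d ` carrier (Q (Suc d))" unfolding Yex by simp
 moreover have Ql: "left_module A (Q n)" for n using pr(1) by (simp add: projective_def)
 interpret \<delta>: add_map "Q (Suc d)" "Q d" "\<delta> d" by (rule lin_maps_add_map[OF Ql Ql pr(2)])
 have "\<delta> d ` carrier (Q (Suc d)) = {\<zero>\<^bsub>Q d\<^esub>}" using Q(2) \<delta>.zero by auto
 ultimately have fz: "f ?z = \<zero>\<^bsub>Q d\<^esub>" by simp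
 interpret K0: left_module A "K d" by (rule K_left)
 interpret K1: left_module A "K (Suc d)" by (rule K_left)
 interpret g: add_map "Q d" "K d" g by (rule lin_maps_add_map[OF Ql K_left g])
 interpret k: add_map "K (Suc d)" "K d" "kd d" by (rule lin_maps_add_map[OF K_left K_left kd_lin])
 have hz: "h ?z \<in> carrier (K (Suc d))" using lin_mapsD(1)[OF h zK] .
 have e: "\<ominus>\<^bsub>K d\<^esub> ?z = kd d (h ?z)"
 proof -
  have "g (f ?z) = \<zero>\<^bsub>K d\<^esub>" using fz g.zero by simp
  moreover have "g (f ?z) \<ominus>\<^bsub>K d\<^esub> ?z = kd d (h ?z)" using gfh zc by blast
  ultimately show ?thesis using zK K0.M.l_zero[OF K0.M.a_inv_closed[OF zK]] by (simp only: a_minus_def)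
 qed
 let ?x = "fe A 0 \<oplus>\<^bsub>K (Suc d)\<^esub> h ?z"
 have fe0: "fe A 0 \<in> carrier (K (Suc d))" by (rule fe_carrier[OF A_ring pos])
 have xc: "?x \<in> carrier (K (Suc d))" using K1.M.a_closed[OF fe0 hz] .
 have "kd d ?x = ?z \<oplus>\<^bsub>K d\<^esub> kd d (h ?z)" by (rule k.add[OF fe0 hz])
 also have "\<dots> = \<zero>\<^bsub>K d\<^esub>" unfolding e[symmetric] by (rule K0.M.r_neg[OF zK])
 finally have kx: "kd d ?x = \<zero>\<^bsub>K d\<^esub>" .
 have ah: "aug (h ?z i) = 0" for i
 proof -
  have "h ?z = lcomb (wm d) (K (Suc d)) (\<lambda>i. h (fe A i)) ?z"
   by (rule lin_free_eq[OF A_ring K_left h zK])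
  also have "\<dots> = (\<lambda>j. \<Oplus>\<^bsub>A\<^esub>i\<in>{..<wm d}. ?z i \<cdot> h (fe A i) j)"
   unfolding lcomb_def
   by (subst free_finsum[OF A_ring])
    (use K1.smult_closed lin_mapsD(1)[OF h fe_carrier[OF A_ring]] K_coord[OF zK] in auto)
  finally have "h ?z i = (\<Oplus>\<^bsub>A\<^esub>j\<in>{..<wm d}. ?z j \<cdot> h (fe A j) i)" by (rule fun_cong)
  moreover have "aug (?z j) = 0" for j
   using kd_fe[OF pos] by (simp add: krow_def aug_simps)
  ultimately show ?thesis
   using K_coord[OF zK] K_coord[OF lin_mapsD(1)[OF h fe_carrier[OF A_ring]]]
   by (simp, subst aug_finsum) (auto simp: aug_simps)
 qed
 interpret c1: graded_group "K (Suc d)" "homog (K (Suc d))" "\<lambda>n x i. cmp (n - int (Suc d)) (x i)"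
  by (rule G.free_graded_group)
 interpret c0: graded_group "K d" "homog (K d)" "\<lambda>n x i. cmp (n - int d) (x i)"
  by (rule G.free_graded_group)
 \<comment> \<open>The component in the generating degree of the cycle just found; its entry at 0
   has augmentation 1.\<close>
 let ?y = "\<lambda>i. cmp (int (Suc d) - int (Suc d)) (?x i)"
 have yh: "?y \<in> homog (K (Suc d)) (int (Suc d))" by (rule c1.cmp_H[OF xc])
 have "kd d ?y = (\<lambda>i. cmp (int (Suc d) + 0 - int d) (kd d ?x i))"
  by (rule deg_map_cmp[OF c1.graded_group_axioms c0.graded_group_axioms k.add_map_axioms _ xc, symmetric])
   (use graded_mapsD(2)[OF kd_graded] in simp)
 also have "\<dots> = \<zero>\<^bsub>K d\<^esub>" unfolding kx by simp
 finally have "?y = \<zero>\<^bsub>K (Suc d)\<^esub>" by (rule kd_inj[OF yh])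
 then have "cmp 0 (?x 0) = 0\<^sub>A" by (simp add: fun_eq_iff)
 moreover have "aug (?x 0) = 1" using ah[of 0] K_coord[OF hz] by (simp add: aug_simps fe_def)
 ultimately have "1 *\<^sub>A 1\<^sub>A = 0 *\<^sub>A 1\<^sub>A" using cmp_0[OF K_coord[OF xc, of 0]] smult_A(6)[of "1\<^sub>A"] by simp
 then show False by (simp add: scal_eq)
qed

end

section \<open>Coboundaries of the Koszul complex and the top class of Ext\<close>

lemma coboundaries_Suc:
 "b \<in> coboundaries S P \<delta> (Suc i) \<Longrightarrow>
  \<exists>g\<in>carrier (dual S (P i)). b = (\<lambda>x\<in>carrier (P (Suc i)). g (\<delta> i x))"
 by auto

context quad begin

lemma lin_reg_krow:
 assumes g: "g \<in> lin_maps A (K i) (reg A)"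
 shows "g (krow i j) = (\<Oplus>\<^bsub>A\<^esub>k\<in>{..<wm i}. vc (lam i j k) \<cdot> g (fe A k))"
proof -
 have gc: "g (fe A k) \<in> \<A>" if "k < wm i" for k
  using lin_mapsD(1)[OF g fe_carrier[OF A_ring that]] by simp
 have "g (krow i j) = lcomb (wm i) (reg A) (\<lambda>k. g (fe A k)) (krow i j)"
  by (rule lin_free_eq[OF A_ring reg_left[OF A_ring] g krow_closed])
 also have "\<dots> = (\<Oplus>\<^bsub>A\<^esub>k\<in>{..<wm i}. krow i j k \<cdot> g (fe A k))"
  unfolding lcomb_def
  by (simp, rule reg_finsum[OF A_ring]) (use gc K_coord[OF krow_closed] in auto)
 also have "\<dots> = (\<Oplus>\<^bsub>A\<^esub>k\<in>{..<wm i}. vc (lam i j k) \<cdot> g (fe A k))"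
  using gc by (intro A.finsum_cong') (auto simp: krow_def)
 finally show ?thesis .
qed

lemma coboundaryE:
 assumes "b \<in> coboundaries A K kd (Suc i)"
 obtains g where "g \<in> lin_maps A (K i) (reg A)"
  "\<forall>j<wm (Suc i). b (fe A j) = (\<Oplus>\<^bsub>A\<^esub>k\<in>{..<wm i}. vc (lam i j k) \<cdot> g (fe A k))"
proof -
 from coboundaries_Suc[OF assms] obtain g where g: "g \<in> carrier (dual A (K i))" "b = (\<lambda>x\<in>carrier (K (Suc i)). g (kd i x))" ..
 note gl = dual_lin[OF K_left g(1)]
 have "b (fe A j) = (\<Oplus>\<^bsub>A\<^esub>k\<in>{..<wm i}. vc (lam i j k) \<cdot> g (fe A k))" if j: "j < wm (Suc i)" for j
 proof -
  have "b (fe A j) = g (kd i (fe A j))" unfolding g(2) by (rule restrict_apply') (rule fe_carrier[OF A_ring j])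
  then show ?thesis by (simp add: kd_fe[OF j] lin_reg_krow[OF gl])
 qed
 then show ?thesis using gl that by blast
qed

text \<open>Minimality of the Koszul complex: the entries of the differential have degree one, so
  coboundaries vanish modulo positive degrees.\<close>

lemma coboundary_aug:
 assumes "b \<in> coboundaries A K kd (Suc i)" "j < wm (Suc i)"
 shows "b (fe A j) \<in> \<A>" "aug (b (fe A j)) = 0"
proof -
 from assms(1) obtain g where g: "g \<in> lin_maps A (K i) (reg A)"
  and b': "\<forall>j<wm (Suc i). b (fe A j) = (\<Oplus>\<^bsub>A\<^esub>k\<in>{..<wm i}. vc (lam i j k) \<cdot> g (fe A k))"
  by (rule coboundaryE)
 note b = b'[rule_format, OF assms(2)]
 have gc: "g (fe A k) \<in> \<A>" if "k < wm i" for k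
  using lin_mapsD(1)[OF g fe_carrier[OF A_ring that]] by simp
 show "b (fe A j) \<in> \<A>" unfolding b using gc by (intro A.finsum_closed) auto
 show "aug (b (fe A j)) = 0" unfolding b using gc by (subst aug_finsum) (auto simp: aug_simps)
qed

text \<open>In the component of degree one only the scalar parts of the values of g survive next to
  the linear entries of the differential.\<close>

lemma coboundary_linear:
 assumes "b \<in> coboundaries A K kd (Suc i)" "j < wm (Suc i)" "b (fe A j) = vc v"
  and "g \<in> lin_maps A (K i) (reg A)"
  and "b (fe A j) = (\<Oplus>\<^bsub>A\<^esub>k\<in>{..<wm i}. vc (lam i j k) \<cdot> g (fe A k))"
 shows "v = (\<lambda>x. \<Sum>k<wm i. aug (g (fe A k)) * lam i j k x)"
proof -
 have gc: "g (fe A k) \<in> \<A>" if "k < wm i" for k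
  using lin_mapsD(1)[OF assms(4) fe_carrier[OF A_ring that]] by simp
 have "vc v = cmp 1 (vc v)" using G.cmp_same[OF vc_homog] by simp
 also have "\<dots> = cmp 1 (\<Oplus>\<^bsub>A\<^esub>k\<in>{..<wm i}. vc (lam i j k) \<cdot> g (fe A k))"
  using assms(3,5) by simp
 also have "\<dots> = (\<Oplus>\<^bsub>A\<^esub>k\<in>{..<wm i}. cmp 1 (vc (lam i j k) \<cdot> g (fe A k)))"
  by (rule G.cmp_finsum) (use gc in auto)
 also have "\<dots> = (\<Oplus>\<^bsub>A\<^esub>k\<in>{..<wm i}. vc (\<lambda>x. aug (g (fe A k)) * lam i j k x))"
  using gc by (intro A.finsum_cong') (auto simp: cmp_1_vc vc_smult)
 also have "\<dots> = vc (\<lambda>x. \<Sum>k<wm i. aug (g (fe A k)) * lam i j k x)" by (simp add: vc_finsum)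
 finally show ?thesis by (simp add: vc_eq)
qed

lemma fh_dual:
 assumes "\<And>i. i < wm n \<Longrightarrow> y i \<in> homog A e"
 shows "fh A (wm n) (int n) y \<in> carrier (dual A (K n))"
 by (rule hom_deg_dual[OF A_ring G.fh_hom_deg[where j = "e - int n"]]) (use assms in auto)

lemma fh_lin:
 assumes "\<And>i. i < wm n \<Longrightarrow> y i \<in> homog A e"
 shows "fh A (wm n) (int n) y \<in> lin_maps A (K n) (reg A)"
 by (rule dual_lin[OF K_left fh_dual[OF assms]])

text \<open>The next term of the complex is zero, so there is no condition on a functional in top
  degree.\<close>

lemma top_cocycle:
 assumes "wm (Suc d) = 0" "\<And>i. i < wm d \<Longrightarrow> y i \<in> homog A e"
 shows "fh A (wm d) (int d) y \<in> cocycles A K kd d"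
proof -
 note l = fh_lin[OF assms(2)]
 interpret f: add_map "K d" "reg A" "fh A (wm d) (int d) y"
  by (rule lin_maps_add_map[OF K_left reg_left[OF A_ring] l])
 interpret k: add_map "K (Suc d)" "K d" "kd d" by (rule lin_maps_add_map[OF K_left K_left kd_lin])
 have "x = \<zero>\<^bsub>K (Suc d)\<^esub>" if "x \<in> carrier (K (Suc d))" for x
  using that assms(1) by (auto simp: free_carrier)
 then have "fh A (wm d) (int d) y (kd d x) = 0\<^sub>A" if "x \<in> carrier (K (Suc d))" for x
  using that k.zero f.zero by (metis reg_simps(2))
 then show ?thesis using fh_dual[OF assms(2)] by (simp add: cocycles_def)
qed

lemma scal_homog: "c *\<^sub>A 1\<^sub>A \<in> homog A 0"
 using homog_A_0 by blast

context
 fixes d :: nat and w :: "'n list \<Rightarrow> 'k"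
 assumes kz: "koszul A" and AS: "AS_regular A (Suc d)" and w: "w \<in> W (Suc d)" "w \<noteq> (\<lambda>_. 0)"
begin

lemma top_vanish: "wm (Suc (Suc d)) = 0"
 using W_vanish[OF kz] AS by (simp add: AS_regular_def)

lemma Ext_facts:
 "i \<noteq> Suc d \<Longrightarrow> carrier (Ext A K kd i) = {\<zero>\<^bsub>Ext A K kd i\<^esub>}" "one_dimensional A (Ext A K kd (Suc d))"
 using AS koszul_resolution[OF kz] unfolding AS_regular_def by blast+

text \<open>Coboundaries have zero augmentation, so the augmentations of a cocycle depend only on
  its class. As all classes are scalar multiples of one class, these vectors are multiples of one
  vector \<open>z0\<close>, and a cocycle with factor 0 is a coboundary.\<close>

lemma top_class:
 "\<exists>z0. \<forall>z\<in>cocycles A K kd (Suc d). \<exists>c. \<exists>b\<in>coboundaries A K kd (Suc d).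
  (\<forall>j<wm (Suc d). aug (z (fe A j)) = c * z0 j) \<and> (c = 0 \<longrightarrow> (\<forall>j<wm (Suc d). z (fe A j) = b (fe A j)))"
proof -
 obtain z0 where z0: "z0 \<in> cocycles A K kd (Suc d)" and
  z: "\<forall>z\<in>cocycles A K kd (Suc d). \<exists>c. \<exists>b\<in>coboundaries A K kd (Suc d). \<exists>b'\<in>coboundaries A K kd (Suc d).
   \<forall>x\<in>carrier (K (Suc d)). z x = b' x +\<^sub>A (b x +\<^sub>A z0 x) \<cdot> (c *\<^sub>A 1\<^sub>A)"
  using one_dimensionalD[where S = A and P = K and d = kd, OF A_ring K_left kd_lin Ext_facts(2)] by blast
 have z0c: "z0 (fe A j) \<in> \<A>" if "j < wm (Suc d)" for j
  using z0 lin_mapsD(1)[OF dual_lin[OF K_left, of z0 "Suc d"] fe_carrier[OF A_ring that]]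
  by (simp add: cocycles_def)
 have "\<exists>c. \<exists>b\<in>coboundaries A K kd (Suc d). (\<forall>j<wm (Suc d). aug (z (fe A j)) = c * aug (z0 (fe A j))) \<and>
   (c = 0 \<longrightarrow> (\<forall>j<wm (Suc d). z (fe A j) = b (fe A j)))" if zc: "z \<in> cocycles A K kd (Suc d)" for z
 proof -
  obtain c b b' where b: "b \<in> coboundaries A K kd (Suc d)" "b' \<in> coboundaries A K kd (Suc d)"
   and e: "\<forall>x\<in>carrier (K (Suc d)). z x = b' x +\<^sub>A (b x +\<^sub>A z0 x) \<cdot> (c *\<^sub>A 1\<^sub>A)"
   using bspec[OF z zc] by (elim exE bexE) (rule that)
  have "aug (z (fe A j)) = c * aug (z0 (fe A j))" "c = 0 \<longrightarrow> z (fe A j) = b' (fe A j)"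
   if j: "j < wm (Suc d)" for j
  proof -
   note bc = coboundary_aug[OF b(1) j] coboundary_aug[OF b(2) j]
   have zj: "z (fe A j) = b' (fe A j) +\<^sub>A (b (fe A j) +\<^sub>A z0 (fe A j)) \<cdot> (c *\<^sub>A 1\<^sub>A)"
    using e fe_carrier[OF A_ring j] by blast
   show "aug (z (fe A j)) = c * aug (z0 (fe A j))" "c = 0 \<longrightarrow> z (fe A j) = b' (fe A j)"
    unfolding zj using bc z0c[OF j] by (auto simp: aug_simps smult_A)
  qed
  then show ?thesis using b(2) by (intro exI[of _ c] bexI[of _ b'] conjI) auto
 qed
 then show ?thesis by (intro exI[of _ "\<lambda>j. aug (z0 (fe A j))"] ballI)
qed

text \<open>Two basis elements would give cocycles with augmentation vectors (1, 0, ...) and (0, 1,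
  ...), which are not multiples of a common vector; and w is a nonzero element of
  \<open>W (Suc d)\<close>.\<close>

lemma top_dim: "wm (Suc d) = 1"
proof -
 have "wm (Suc d) \<noteq> 0"
 proof
  assume "wm (Suc d) = 0"
  then have "w = (\<lambda>_. 0)" using W_expand[OF w(1)] by (simp add: fun_eq_iff)
  then show False using w(2) by simp
 qed
 moreover have "\<not> 1 < wm (Suc d)"
 proof
  assume two: "1 < wm (Suc d)"
  obtain z0 where z0: "\<forall>z\<in>cocycles A K kd (Suc d). \<exists>c. \<exists>b\<in>coboundaries A K kd (Suc d).
   (\<forall>j<wm (Suc d). aug (z (fe A j)) = c * z0 j) \<and> (c = 0 \<longrightarrow> (\<forall>j<wm (Suc d). z (fe A j) = b (fe A j)))"
   using top_class by (rule exE)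
  define z where "z = (\<lambda>i. fh A (wm (Suc d)) (int (Suc d)) (\<lambda>j. (if j = i then 1 else 0) *\<^sub>A 1\<^sub>A))"
  have zc: "z i \<in> cocycles A K kd (Suc d)" for i
   unfolding z_def by (rule top_cocycle[OF top_vanish scal_homog])
  have zv: "aug (z i (fe A j)) = (if j = i then 1 else 0)" if "j < wm (Suc d)" for i j
   unfolding z_def by (subst fh_fe[OF A_ring]) (use that in \<open>auto simp: smult_A aug_simps\<close>)
  obtain c where c: "\<forall>j<wm (Suc d). aug (z 0 (fe A j)) = c * z0 j"
   using bspec[OF z0 zc[of 0]] by (elim exE bexE conjE) (rule that)
  obtain c' where c': "\<forall>j<wm (Suc d). aug (z 1 (fe A j)) = c' * z0 j"
   using bspec[OF z0 zc[of 1]] by (elim exE bexE conjE) (rule that)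
  have "1 = c * z0 0" "0 = c * z0 1" "1 = c' * z0 1"
   using c c' zv[of 0 0] zv[of 1 0] zv[of 1 1] two by auto
  then show False by auto
 qed
 ultimately show ?thesis by linarith
qed

text \<open>The functional sending the top generator to v is a cocycle of augmentation 0. In a
  one-dimensional \<open>Ext\<close> spanned by a class of nonzero augmentation it must be a
  coboundary, and the degree one part of this is the required combination.\<close>

lemma top_span: "\<exists>\<phi>. v = (\<lambda>x. \<Sum>j<wm d. \<phi> j * lam d 0 j x)"
proof -
 obtain z0 where z0: "\<forall>z\<in>cocycles A K kd (Suc d). \<exists>c. \<exists>b\<in>coboundaries A K kd (Suc d).
  (\<forall>j<wm (Suc d). aug (z (fe A j)) = c * z0 j) \<and> (c = 0 \<longrightarrow> (\<forall>j<wm (Suc d). z (fe A j) = b (fe A j)))"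
  using top_class by (rule exE)
 have p: "0 < wm (Suc d)" by (simp add: top_dim)
 \<comment> \<open>The functional with value 1 shows that the augmentation vector \<open>z0\<close>
   is not zero.\<close>
 have "fh A (wm (Suc d)) (int (Suc d)) (\<lambda>j. 1 *\<^sub>A 1\<^sub>A) \<in> cocycles A K kd (Suc d)"
  by (rule top_cocycle[OF top_vanish scal_homog])
 from bspec[OF z0 this] obtain c where
  "\<forall>j<wm (Suc d). aug (fh A (wm (Suc d)) (int (Suc d)) (\<lambda>j. 1 *\<^sub>A 1\<^sub>A) (fe A j)) = c * z0 j"
  by (elim exE bexE conjE) (rule that)
 then have "aug (fh A (wm (Suc d)) (int (Suc d)) (\<lambda>j. 1 *\<^sub>A 1\<^sub>A) (fe A 0)) = c * z0 0" using p by blast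
 moreover have "aug (fh A (wm (Suc d)) (int (Suc d)) (\<lambda>j. 1 *\<^sub>A 1\<^sub>A) (fe A 0)) = 1"
  by (subst fh_fe[OF A_ring]) (use p in \<open>auto simp: smult_A aug_simps\<close>)
 ultimately have nz: "z0 0 \<noteq> 0" by auto
 let ?z = "fh A (wm (Suc d)) (int (Suc d)) (\<lambda>j. vc v)"
 have zc: "?z \<in> cocycles A K kd (Suc d)"
  by (rule top_cocycle[OF top_vanish vc_homog])
 have zv: "?z (fe A 0) = vc v" by (rule fh_fe[OF A_ring _ p]) simp
 obtain c b where b: "b \<in> coboundaries A K kd (Suc d)"
  and c: "\<forall>j<wm (Suc d). aug (?z (fe A j)) = c * z0 j" "c = 0 \<longrightarrow> (\<forall>j<wm (Suc d). ?z (fe A j) = b (fe A j))"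
  using bspec[OF z0 zc] by (elim exE bexE conjE) (rule that)
 have "c * z0 0 = aug (?z (fe A 0))" using c(1) p by metis
 then have "c * z0 0 = 0" unfolding zv by (simp add: aug_simps)
 then have bv: "b (fe A 0) = vc v" using c(2) p nz zv by simp
 from b obtain g where g: "g \<in> lin_maps A (K d) (reg A)"
  "\<forall>j<wm (Suc d). b (fe A j) = (\<Oplus>\<^bsub>A\<^esub>k\<in>{..<wm d}. vc (lam d j k) \<cdot> g (fe A k))"
  by (rule coboundaryE)
 show ?thesis by (rule exI) (rule coboundary_linear[OF b p bv g(1) g(2)[rule_format, OF p]])
qed

end

section \<open>Relations as contractions of the top tensor\<close>

context
 fixes d :: nat and w :: "'n list \<Rightarrow> 'k"
 assumes kz: "koszul A" and AS: "AS_regular A (Suc (Suc d))"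
  and w: "w \<in> W (Suc (Suc d))" "w \<noteq> (\<lambda>_. 0)"
begin

text \<open>Expanding the first letter of r by \<open>top_span\<close> writes r as the sum of
  \<open>lam (Suc d) 0 j\<close> \<otimes> \<open>v j\<close>. The vectors \<open>v j\<close> define
  a functional one step below the top; that r is a relation makes it a cocycle, and as
  \<open>Ext\<close> vanishes there it is a coboundary, which expresses each \<open>v j\<close>
  through the \<open>lam d j k\<close>.\<close>

lemma relation_contraction:
 assumes r: "r \<in> R"
 shows "\<exists>\<phi>. \<forall>x y. r [x, y] = (\<Sum>k<wm d. \<phi> k * (\<Sum>j<wm (Suc d). lam (Suc d) 0 j x * lam d j k y))"
proof -
 have one: "wm (Suc (Suc d)) = 1" by (rule top_dim[OF kz AS w])
 have "\<exists>\<phi>. \<forall>x. sgl z x = (\<Sum>j<wm (Suc d). \<phi> j * lam (Suc d) 0 j x)" for z :: 'n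
  using top_span[OF kz AS w, of "sgl z"] by (auto simp: fun_eq_iff)
 then obtain \<phi> where \<phi>: "\<And>z x. sgl z x = (\<Sum>j<wm (Suc d). \<phi> z j * lam (Suc d) 0 j x)" by metis
 \<comment> \<open>\<open>\<phi> z\<close> expresses the basis vector z of V through the rows
   \<open>lam\<close>, so these are the second letters that accompany the rows in r.\<close>
 define v where "v = (\<lambda>j y. \<Sum>z\<in>UNIV. \<phi> z j * r [z, y])"
 have rv: "r [x, y] = (\<Sum>j<wm (Suc d). lam (Suc d) 0 j x * v j y)" for x y
 proof -
  have "(\<Sum>z\<in>UNIV. sgl z x * r [z, y]) = (\<Sum>z\<in>UNIV. if z = x then r [z, y] else 0)"
   by (intro sum.cong) (auto simp: sgl_def)
  then have "r [x, y] = (\<Sum>z\<in>UNIV. sgl z x * r [z, y])" by simp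
  also have "\<dots> = (\<Sum>z\<in>UNIV. \<Sum>j<wm (Suc d). lam (Suc d) 0 j x * (\<phi> z j * r [z, y]))"
   by (simp add: \<phi> sum_distrib_right sum_distrib_left algebra_simps)
  also have "\<dots> = (\<Sum>j<wm (Suc d). lam (Suc d) 0 j x * v j y)"
   by (subst sum.swap) (simp add: v_def sum_distrib_left)
  finally show ?thesis .
 qed
 let ?F = "fh A (wm (Suc d)) (int (Suc d)) (\<lambda>j. vc (v j))"
 have Fl: "?F \<in> lin_maps A (K (Suc d)) (reg A)" by (rule fh_lin[OF vc_homog])
 have Fv: "?F (fe A j) = vc (v j)" if "j < wm (Suc d)" for j
  by (rule fh_fe[OF A_ring _ that]) simp
 have zl: "(\<lambda>x. \<zero>\<^bsub>reg A\<^esub>) \<in> lin_maps A (K (Suc (Suc d))) (reg A)" by (rule lin_mapsI) auto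
 have "?F (kd (Suc d) x) = 0\<^sub>A" if x: "x \<in> carrier (K (Suc (Suc d)))" for x
 proof -
  have "?F (kd (Suc d) x) = \<zero>\<^bsub>reg A\<^esub>"
  proof (rule free_lin_ext[OF A_ring reg_left[OF A_ring] lin_maps_comp[OF kd_lin Fl] zl _ x])
   fix i assume i: "i < wm (Suc (Suc d))"
   then have i0: "i = 0" using one by simp
   have "?F (kd (Suc d) (fe A i)) = (\<Oplus>\<^bsub>A\<^esub>j\<in>{..<wm (Suc d)}. vc (lam (Suc d) 0 j) \<cdot> ?F (fe A j))"
    unfolding kd_fe[OF i] unfolding i0 by (rule lin_reg_krow[OF Fl])
   also have "\<dots> = (\<Oplus>\<^bsub>A\<^esub>j\<in>{..<wm (Suc d)}. vc (lam (Suc d) 0 j) \<cdot> vc (v j))"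
    by (rule A.finsum_cong') (auto simp: Fv simp del: of_nat_Suc)
   also have "\<dots> = 0\<^sub>A"
   proof (subst vc_mult_sum_zero)
    have "r = (\<lambda>s. \<Sum>j<wm (Suc d). (vec_tensor (lam (Suc d) 0 j) \<star> vec_tensor (v j)) s)"
    proof
     fix s show "r s = (\<Sum>j<wm (Suc d). (vec_tensor (lam (Suc d) 0 j) \<star> vec_tensor (v j)) s)"
     proof (cases "length s = 2")
      case True
      then obtain x y where "s = [x, y]" by (auto simp: length_Suc_conv numeral_2_eq_2)
      then show ?thesis by (simp add: vec_tensor2 rv)
     next
      case False
      then have "r s = 0" using r R_tensors by (auto simp: tensors_def)
      then show ?thesis using False by (auto simp: vec_tensor2 split: list.splits intro!: sum.neutral)
     qed
    qed
    then show "(\<lambda>s. \<Sum>j<wm (Suc d). (vec_tensor (lam (Suc d) 0 j) \<star> vec_tensor (v j)) s) \<in> R"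
     using r by simp
   qed simp
   finally show "?F (kd (Suc d) (fe A i)) = \<zero>\<^bsub>reg A\<^esub>" by simp
  qed
  then show ?thesis by simp
 qed
 then have cF: "?F \<in> cocycles A K kd (Suc d)"
  using fh_dual[of "Suc d" "\<lambda>j. vc (v j)", OF vc_homog] by (simp add: cocycles_def)
 have b: "?F \<in> coboundaries A K kd (Suc d)"
  by (rule Ext_zeroD[where S = A and P = K and d = kd, OF A_ring K_left kd_lin _ cF])
   (rule Ext_facts(1)[OF kz AS w], simp)
 from b obtain g where g: "g \<in> lin_maps A (K d) (reg A)"
  "\<forall>j<wm (Suc d). ?F (fe A j) = (\<Oplus>\<^bsub>A\<^esub>k\<in>{..<wm d}. vc (lam d j k) \<cdot> g (fe A k))"
  by (rule coboundaryE)
 have vj: "v j y = (\<Sum>k<wm d. aug (g (fe A k)) * lam d j k y)" if "j < wm (Suc d)" for j y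
  using coboundary_linear[OF b that Fv[OF that] g(1) g(2)[rule_format, OF that]] by (rule fun_cong)
 have "r [x, y] = (\<Sum>k<wm d. aug (g (fe A k)) * (\<Sum>j<wm (Suc d). lam (Suc d) 0 j x * lam d j k y))" for x y
 proof -
  have "r [x, y] = (\<Sum>j<wm (Suc d). \<Sum>k<wm d. aug (g (fe A k)) * (lam (Suc d) 0 j x * lam d j k y))"
   unfolding rv by (intro sum.cong refl) (simp add: vj sum_distrib_left algebra_simps)
  also have "\<dots> = (\<Sum>k<wm d. aug (g (fe A k)) * (\<Sum>j<wm (Suc d). lam (Suc d) 0 j x * lam d j k y))"
   by (subst sum.swap) (simp add: sum_distrib_left)
  finally show ?thesis .
 qed
 then show ?thesis by (intro exI[of _ "\<lambda>k. aug (g (fe A k))"] allI)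
qed

lemma top_multiple: "\<exists>c. c \<noteq> 0 \<and> w = (\<lambda>s. c * wb (Suc (Suc d)) 0 s)"
proof -
 have "w s = prj (Suc (Suc d)) (wp (Suc (Suc d)) 0) w * wb (Suc (Suc d)) 0 s" for s
  using W_expand[OF w(1), of s] by (simp add: top_dim[OF kz AS w])
 then have e: "w = (\<lambda>s. prj (Suc (Suc d)) (wp (Suc (Suc d)) 0) w * wb (Suc (Suc d)) 0 s)" by (rule ext)
 then have "prj (Suc (Suc d)) (wp (Suc (Suc d)) 0) w \<noteq> 0" using w(2) by (metis mult_zero_left)
 then show ?thesis using e by blast
qed

text \<open>Contracting w leaves a combination of its windows at the left end, which lie in R.
  Conversely the coefficients from \<open>relation_contraction\<close>, carried by the functionals
  \<open>wp d\<close> dual to the basis of \<open>W d\<close>, form the contracting tensor.\<close>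

theorem relations_eq_contractions: "R = {contract d \<Psi> w | \<Psi>. \<Psi> \<in> tensors d}"
proof
 show "{contract d \<Psi> w | \<Psi>. \<Psi> \<in> tensors d} \<subseteq> R"
 proof clarify
  fix \<Psi> :: "'n list \<Rightarrow> 'k" assume "\<Psi> \<in> tensors d"
  have "contract d \<Psi> w = (\<lambda>s. \<Sum>t | length t = d. \<Psi> t * slice [] t w s)"
   using W_tensors[OF w(1)] by (auto simp: contract_def slice_def tensors_def fun_eq_iff intro!: sum.cong)
  also have "\<dots> \<in> R"
   using W_slice[OF w(1)] R_subsp by (intro subsp_sum) (auto simp: subsp_def)
  finally show "contract d \<Psi> w \<in> R" .
 qed
 show "R \<subseteq> {contract d \<Psi> w | \<Psi>. \<Psi> \<in> tensors d}"
 proof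
  fix r assume r: "r \<in> R"
  obtain \<phi> where \<phi>: "\<And>x y. r [x, y] = (\<Sum>k<wm d. \<phi> k * (\<Sum>j<wm (Suc d). lam (Suc d) 0 j x * lam d j k y))"
   using relation_contraction[OF r] by blast
  obtain c where c: "c \<noteq> 0" "w = (\<lambda>s. c * wb (Suc (Suc d)) 0 s)" using top_multiple by blast
  \<comment> \<open>The factor \<open>inverse c\<close> compensates for w being c times the chosen
    basis vector.\<close>
  define \<Psi> where "\<Psi> = (\<lambda>t. \<Sum>k<wm d. inverse c * \<phi> k * wp d k t)"
  have one: "0 < wm (Suc (Suc d))" by (simp add: top_dim[OF kz AS w])
  have "\<Psi> \<in> tensors d"
   using wp_tensors by (auto simp: \<Psi>_def tensors_def intro!: sum.neutral)
  moreover have "r = contract d \<Psi> w"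
  proof
   fix s show "r s = contract d \<Psi> w s"
   proof (cases "length s = 2")
    case True
    then obtain x y where s: "s = [x, y]" by (auto simp: length_Suc_conv numeral_2_eq_2)
    have "contract d \<Psi> w s = (\<Sum>k<wm d. \<phi> k * prj d (wp d k) (\<lambda>t. wb (Suc (Suc d)) 0 (x # y # t)))"
     unfolding contract_def \<Psi>_def c(2) prj_def
     by (simp add: s sum_distrib_left sum_distrib_right, subst sum.swap)
      (use c(1) in \<open>simp add: field_simps\<close>)
    also have "\<dots> = r s" unfolding s \<phi>
    proof (intro sum.cong refl, goal_cases)
     case (1 k)
     then show ?case unfolding wb_left2[OF one] by (subst wb_coeff) auto
    qed
    finally show ?thesis ..
   next
    case False
    then have "r s = 0" using r R_tensors by (auto simp: tensors_def)
    moreover have "contract d \<Psi> w s = 0"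
     using False W_tensors[OF w(1)] by (auto simp: contract_def tensors_def intro!: sum.neutral)
    ultimately show ?thesis by simp
   qed
  qed
  ultimately show "r \<in> {contract d \<Psi> w | \<Psi>. \<Psi> \<in> tensors d}" by blast
 qed
qed

end

text \<open>A product p r q has windows at position |p| that are scalar multiples of r, and the
  window condition is additive, so it holds on the group generated by such products.\<close>

lemma relation_slots_W:
 assumes "2 \<le> d" "w \<in> (\<Inter>i\<in>{0..d - 2}. relation_slot R i (d - 2 - i))"
 shows "w \<in> W d"
proof -
 have ts: "subsp (tensors d :: ('n list \<Rightarrow> 'k) set)" by (rule tensors_subsp)
 have slot: "u \<in> tensors d \<and> (\<forall>p q. length p = i \<and> i + 2 + length q = d \<longrightarrow> slice p q u \<in> R)"
  if i: "i \<le> d - 2" and u: "u \<in> relation_slot R i (d - 2 - i)" for i u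
 proof -
  let ?P = "\<lambda>u. u \<in> tensors d \<and> (\<forall>p q. length p = i \<and> i + 2 + length q = d \<longrightarrow> slice p q u \<in> R)"
  let ?G = "{p \<star> r \<star> q | p r q. p \<in> tensors i \<and> r \<in> R \<and> q \<in> tensors (d - 2 - i)}"
  have gen: "?P g" if "g \<in> ?G" for g
  proof -
   obtain p r q where g: "g = p \<star> r \<star> q" "p \<in> tensors i" "r \<in> R" "q \<in> tensors (d - 2 - i)"
    using \<open>g \<in> ?G\<close> by blast
   have r: "r \<in> tensors 2" using g R_tensors by blast
   have "slice p' q' g = (\<lambda>s. (p p' * q q') * r s)" if l: "length p' = i" "i + 2 + length q' = d" for p' q'
   proof
    fix s show "slice p' q' g s = (p p' * q q') * r s"
    proof (cases "length s = 2")
     case True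
     have "g ((p' @ s) @ q') = (p \<star> r) (p' @ s) * q q'"
      unfolding g(1) by (rule mult_tensors(2)[OF mult_tensors(1)[OF g(2) r] g(4)]) (use True l in simp)
     also have "(p \<star> r) (p' @ s) = p p' * r s" by (rule mult_tensors(2)[OF g(2) r l(1)])
     finally show ?thesis using True by (simp add: slice_def)
    next
     case False
     then show ?thesis using r by (simp add: slice_def tensors_def)
    qed
   qed
   then have "\<forall>p' q'. length p' = i \<and> i + 2 + length q' = d \<longrightarrow> slice p' q' g \<in> R"
    using g(3) R_subsp by (auto simp: subsp_def)
   moreover have "g \<in> tensors d"
   proof -
    have e: "i + 2 + (d - 2 - i) = d" using i assms(1) by simp
    show ?thesis using mult_tensors(1)[OF mult_tensors(1)[OF g(2) r] g(4)] unfolding g(1) e .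
   qed
   ultimately show ?thesis by blast
  qed
  have neg: "?P (\<lambda>s. - v s)" if "?P v" for v
  proof -
   have "?P (\<lambda>s. (-1) * v s)"
    using that R_subsp ts unfolding slice_linear subsp_def by blast
   then show ?thesis by simp
  qed
  have "u \<in> generate (add_monoid TT) ?G" using u by (simp add: relation_slot_def)
  then show ?thesis
  proof (induction rule: generate.induct)
   case one
   then show ?case using R_subsp ts by (simp add: slice_linear subsp_def)
  next
   case (incl h) then show ?case by (rule gen)
  next
   case (inv h)
   have "inv\<^bsub>add_monoid TT\<^esub> h = (\<lambda>s. - h s)"
    using TT_minus[OF tensors_TT[OF conjunct1[OF gen[OF inv]]]] by (simp add: a_inv_def)
   then show ?case using neg[OF gen[OF inv]] by simp
  next
   case (eng h1 h2)
   then show ?case using R_subsp ts by (simp add: slice_linear subsp_def)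
  qed
 qed
 show ?thesis unfolding W_def
 proof (intro CollectI conjI allI impI)
  have "w \<in> relation_slot R 0 (d - 2 - 0)" by (rule INT_D[OF assms(2)]) simp
  then show "w \<in> tensors d" using slot[of 0 w] by blast
  fix p q :: "'n list" assume l: "length p + 2 + length q = d"
  then have "w \<in> relation_slot R (length p) (d - 2 - length p)" using assms(2) by auto
  then show "slice p q w \<in> R" using slot[of "length p" w] l by simp
 qed
qed

end

section \<open>The enveloping algebra\<close>

text \<open>The pairing of a finitely supported f with an arbitrary function. Since pairings with
  delta functions recover f, identities in the algebra on symbols are checked by pairing, which
  makes products and sums easy to compute.\<close>

definition pr :: "('i \<Rightarrow> 'k::field) \<Rightarrow> ('i \<Rightarrow> 'k) \<Rightarrow> 'k" where
 "pr f \<phi> = (\<Sum>p | f p \<noteq> 0. f p * \<phi> p)"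

lemma pr_superset: "finite B \<Longrightarrow> {p. f p \<noteq> 0} \<subseteq> B \<Longrightarrow> pr f \<phi> = (\<Sum>p\<in>B. f p * \<phi> p)"
 unfolding pr_def by (rule sum.mono_neutral_left) auto

lemma pr_add:
 assumes "finite {p. f p \<noteq> 0}" "finite {p. g p \<noteq> 0}"
 shows "pr (\<lambda>p. f p + g p) \<phi> = pr f \<phi> + pr g \<phi>"
proof -
 let ?B = "{p. f p \<noteq> 0} \<union> {p. g p \<noteq> 0}"
 have "finite ?B" using assms by simp
 then show ?thesis
  by (subst (1 2 3) pr_superset[of ?B]) (auto simp: distrib_right sum.distrib)
qed

lemma pr_smult: "finite {p. f p \<noteq> 0} \<Longrightarrow> pr (\<lambda>p. c * f p) \<phi> = c * pr f \<phi>"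
 by (subst pr_superset[of "{p. f p \<noteq> 0}"]) (auto simp: pr_def sum_distrib_left mult.assoc)

lemma pr_diff:
 assumes "finite {p. f p \<noteq> 0}" "finite {p. g p \<noteq> 0}"
 shows "pr (\<lambda>p. f p - g p) \<phi> = pr f \<phi> - pr g \<phi>"
proof -
 have "finite {p. (- 1) * g p \<noteq> 0}" using assms by simp
 then have "pr (\<lambda>p. f p + (- 1) * g p) \<phi> = pr f \<phi> + pr (\<lambda>p. (- 1) * g p) \<phi>" by (rule pr_add[OF assms(1)])
 also have "\<dots> = pr f \<phi> + (- 1) * pr g \<phi>" by (simp only: pr_smult[OF assms(2)])
 finally show ?thesis by simp
qed

lemma pr_sgl: "pr (sgl p) \<phi> = \<phi> p"
 by (subst pr_superset[of "{p}"]) (auto simp: sgl_def)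

lemma pr_linear:
 "pr f (\<lambda>p. \<phi> p + \<psi> p) = pr f \<phi> + pr f \<psi>" "pr f (\<lambda>p. c * \<phi> p) = c * pr f \<phi>" "pr f (\<lambda>_. 0) = 0"
 by (auto simp: pr_def distrib_left sum.distrib sum_distrib_left mult.left_commute)

lemma pr_zero: "pr (\<lambda>_. 0) \<phi> = 0"
 by (simp add: pr_def)

lemma pr_cong: "(\<And>p. f p \<noteq> 0 \<Longrightarrow> \<phi> p = \<psi> p) \<Longrightarrow> pr f \<phi> = pr f \<psi>"
 by (auto simp: pr_def intro!: sum.cong)

lemma pr_delta: "pr f (\<lambda>q. if q = p then 1 else 0) = f p" if "finite {p. f p \<noteq> 0}"
proof -
 have "pr f (\<lambda>q. if q = p then 1 else 0) = (\<Sum>q\<in>{p. f p \<noteq> 0}. if q = p then f q else 0)"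
  unfolding pr_def by (intro sum.cong) auto
 then show ?thesis using that by simp
qed

lemma pr_ext:
 assumes "finite {p. f p \<noteq> 0}" "finite {p. g p \<noteq> 0}" "\<And>\<phi>. pr f \<phi> = pr g \<phi>" shows "f = g"
 using pr_delta[OF assms(1)] pr_delta[OF assms(2)] assms(3) by (metis ext)

lemma opp_simps [simp]: "carrier (opp A) = carrier A" "mult (opp A) x y = y \<otimes>\<^bsub>A\<^esub> x"
 "one (opp A) = one A" "zero (opp A) = zero A" "add (opp A) = add A" "smult (opp A) = smult A"
 "homog (opp A) = homog A"
 by (simp_all add: opp_def)

section \<open>The algebra on symbols (a, b) and its quotient by bilinearity\<close>

context quad begin

abbreviation PT where "PT \<equiv> pre_tensor A (opp A)"
abbreviation E where "E \<equiv> env A"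
abbreviation CC where "CC \<equiv> \<A> \<times> \<A>"
abbreviation PT_mult (infixl "\<cdot>\<^sub>T" 70) where "f \<cdot>\<^sub>T g \<equiv> mult PT f g"
abbreviation E_elems ("\<E>") where "\<E> \<equiv> carrier E"
abbreviation E_mult (infixl "\<cdot>\<^sub>E" 70) where "X \<cdot>\<^sub>E Y \<equiv> mult E X Y"
abbreviation E_add (infixl "+\<^sub>E" 65) where "X +\<^sub>E Y \<equiv> add E X Y"
abbreviation E_zero ("0\<^sub>E") where "0\<^sub>E \<equiv> zero E"

definition dot where "dot q r = (fst q \<cdot> fst r, snd r \<cdot> snd q)"

lemma dot_CC: "q \<in> CC \<Longrightarrow> r \<in> CC \<Longrightarrow> dot q r \<in> CC"
 by (auto simp: dot_def)

lemma PT_simps [simp]: "zero PT = (\<lambda>_. 0)" "one PT = sgl (1\<^sub>A, 1\<^sub>A)" "add PT = (\<lambda>f g p. f p + g p)"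
 "smult PT = (\<lambda>c f p. c * f p)"
 by (simp_all add: pre_tensor_def)

lemma PT_carrier: "f \<in> carrier PT \<longleftrightarrow> finite {p. f p \<noteq> 0} \<and> (\<forall>p. f p \<noteq> 0 \<longrightarrow> p \<in> CC)"
 by (auto simp: pre_tensor_def)

lemma PT_fin: "f \<in> carrier PT \<Longrightarrow> finite {p. f p \<noteq> 0}"
 by (simp add: PT_carrier)

lemma PT_supp: "f \<in> carrier PT \<Longrightarrow> f p \<noteq> 0 \<Longrightarrow> p \<in> CC"
 unfolding PT_carrier by blast

lemma PT_mult:
 assumes "f \<in> carrier PT" "g \<in> carrier PT"
 shows "(f \<cdot>\<^sub>T g) p = pr f (\<lambda>q. pr g (\<lambda>r. if p = dot q r then 1 else 0))"
proof -
 have "(f \<cdot>\<^sub>T g) p = (\<Sum>(q, r) \<in> {(q, r). f q \<noteq> 0 \<and> g r \<noteq> 0 \<and> p = dot q r}. f q * g r)"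
  by (simp add: pre_tensor_def dot_def)
 also have "\<dots> = (\<Sum>(q, r) \<in> {p. f p \<noteq> 0} \<times> {p. g p \<noteq> 0}. f q * (g r * (if p = dot q r then 1 else 0)))"
  using assms by (intro sum.mono_neutral_cong_left) (auto simp: PT_fin split: if_splits)
 also have "\<dots> = pr f (\<lambda>q. pr g (\<lambda>r. if p = dot q r then 1 else 0))"
  unfolding pr_def by (subst sum.cartesian_product[symmetric]) (simp add: sum_distrib_left)
 finally show ?thesis .
qed

lemma PT_mult_supp:
 assumes "f \<in> carrier PT" "g \<in> carrier PT"
 shows "{p. (f \<cdot>\<^sub>T g) p \<noteq> 0} \<subseteq> (\<lambda>(q, r). dot q r) ` ({p. f p \<noteq> 0} \<times> {p. g p \<noteq> 0})"
proof
 fix p assume p: "p \<in> {p. (f \<cdot>\<^sub>T g) p \<noteq> 0}"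
 show "p \<in> (\<lambda>(q, r). dot q r) ` ({p. f p \<noteq> 0} \<times> {p. g p \<noteq> 0})"
 proof (rule ccontr)
  assume n: "p \<notin> (\<lambda>(q, r). dot q r) ` ({p. f p \<noteq> 0} \<times> {p. g p \<noteq> 0})"
  have "pr g (\<lambda>r. if p = dot q r then 1 else 0) = pr g (\<lambda>_. 0)" if "f q \<noteq> 0" for q
   by (rule pr_cong) (use n that in auto)
  then have "pr f (\<lambda>q. pr g (\<lambda>r. if p = dot q r then 1 else 0)) = pr f (\<lambda>_. 0)"
   by (intro pr_cong) (simp add: pr_linear)
  then show False using p PT_mult[OF assms] by (simp add: pr_linear)
 qed
qed

lemma PT_mult_closed: "f \<in> carrier PT \<Longrightarrow> g \<in> carrier PT \<Longrightarrow> f \<cdot>\<^sub>T g \<in> carrier PT"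
proof -
 assume a: "f \<in> carrier PT" "g \<in> carrier PT"
 have "finite ((\<lambda>(q, r). dot q r) ` ({p. f p \<noteq> 0} \<times> {p. g p \<noteq> 0}))" using a by (simp add: PT_fin)
 then have "finite {p. (f \<cdot>\<^sub>T g) p \<noteq> 0}" by (rule finite_subset[OF PT_mult_supp[OF a]])
 moreover have "p \<in> CC" if "(f \<cdot>\<^sub>T g) p \<noteq> 0" for p
 proof -
  have "p \<in> (\<lambda>(q, r). dot q r) ` ({p. f p \<noteq> 0} \<times> {p. g p \<noteq> 0})"
   by (rule subsetD[OF PT_mult_supp[OF a]]) (simp add: that)
  then obtain z where z: "z \<in> {p. f p \<noteq> 0} \<times> {p. g p \<noteq> 0}" "p = (\<lambda>(q, r). dot q r) z" by (rule imageE)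
  then show ?thesis using dot_CC[OF PT_supp[OF a(1)] PT_supp[OF a(2)], of "fst z" "snd z"]
   by (simp add: case_prod_beta mem_Times_iff)
 qed
 ultimately show ?thesis by (simp add: PT_carrier)
qed

text \<open>An iterated pairing along \<open>dot\<close> replaces the convolution sum, so
  associativity, units and distributivity reduce to statements about single symbols.\<close>

lemma pr_mult:
 assumes "f \<in> carrier PT" "g \<in> carrier PT"
 shows "pr (f \<cdot>\<^sub>T g) \<phi> = pr f (\<lambda>q. pr g (\<lambda>r. \<phi> (dot q r)))"
proof -
 let ?F = "{p. f p \<noteq> 0}" and ?G = "{p. g p \<noteq> 0}"
 let ?B = "(\<lambda>(q, r). dot q r) ` (?F \<times> ?G)"
 have fin: "finite ?F" "finite ?G" "finite ?B" using assms by (simp_all add: PT_fin)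
 have "pr (f \<cdot>\<^sub>T g) \<phi> = (\<Sum>p\<in>?B. (f \<cdot>\<^sub>T g) p * \<phi> p)"
  by (rule pr_superset[OF fin(3) PT_mult_supp[OF assms]])
 also have "\<dots> = (\<Sum>p\<in>?B. \<Sum>q\<in>?F. \<Sum>r\<in>?G. f q * g r * (if p = dot q r then \<phi> p else 0))"
  by (intro sum.cong refl) (simp add: PT_mult[OF assms] pr_def sum_distrib_left sum_distrib_right mult.assoc, auto intro!: sum.cong)
 also have "\<dots> = (\<Sum>q\<in>?F. \<Sum>r\<in>?G. \<Sum>p\<in>?B. f q * g r * (if p = dot q r then \<phi> p else 0))"
  by (rule trans[OF sum.swap]) (intro sum.cong refl sum.swap)
 also have "\<dots> = (\<Sum>q\<in>?F. \<Sum>r\<in>?G. f q * g r * \<phi> (dot q r))"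
 proof (intro sum.cong refl)
  fix q r assume "q \<in> ?F" "r \<in> ?G"
  then have "dot q r \<in> ?B" by auto
  then show "(\<Sum>p\<in>?B. f q * g r * (if p = dot q r then \<phi> p else 0)) = f q * g r * \<phi> (dot q r)"
   using fin(3) by (simp add: sum_distrib_left[symmetric])
 qed
 also have "\<dots> = pr f (\<lambda>q. pr g (\<lambda>r. \<phi> (dot q r)))"
  by (simp add: pr_def sum_distrib_left mult.assoc)
 finally show ?thesis .
qed

lemma PT_closed:
 "(\<lambda>_. 0) \<in> carrier PT" "p \<in> CC \<Longrightarrow> sgl p \<in> carrier PT"
 "f \<in> carrier PT \<Longrightarrow> g \<in> carrier PT \<Longrightarrow> (\<lambda>p. f p + g p) \<in> carrier PT"
 "f \<in> carrier PT \<Longrightarrow> (\<lambda>p. c * f p) \<in> carrier PT" "f \<in> carrier PT \<Longrightarrow> (\<lambda>p. - f p) \<in> carrier PT"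
 "f \<in> carrier PT \<Longrightarrow> g \<in> carrier PT \<Longrightarrow> (\<lambda>p. f p - g p) \<in> carrier PT"
proof -
 show "p \<in> CC \<Longrightarrow> sgl p \<in> carrier PT" by (auto simp: PT_carrier sgl_def)
 assume f: "f \<in> carrier PT"
 have "{p. c * f p \<noteq> 0} \<subseteq> {p. f p \<noteq> 0}" for c by auto
 then show "(\<lambda>p. c * f p) \<in> carrier PT" "(\<lambda>p. - f p) \<in> carrier PT"
  using f by (auto simp: PT_carrier intro: finite_subset)
 assume g: "g \<in> carrier PT"
 have "{p. f p + g p \<noteq> 0} \<subseteq> {p. f p \<noteq> 0} \<union> {p. g p \<noteq> 0}"
  "{p. f p - g p \<noteq> 0} \<subseteq> {p. f p \<noteq> 0} \<union> {p. g p \<noteq> 0}" by auto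
 moreover have "finite ({p. f p \<noteq> 0} \<union> {p. g p \<noteq> 0})" using f g by (simp add: PT_fin)
 ultimately have "finite {p. f p + g p \<noteq> 0}" "finite {p. f p - g p \<noteq> 0}" by (auto intro: finite_subset)
 moreover have "p \<in> CC" if "f p + g p \<noteq> 0" for p
  using PT_supp[OF f, of p] PT_supp[OF g, of p] that by fastforce
 moreover have "p \<in> CC" if "f p - g p \<noteq> 0" for p
  using PT_supp[OF f, of p] PT_supp[OF g, of p] that by fastforce
 ultimately show "(\<lambda>p. f p + g p) \<in> carrier PT" "(\<lambda>p. f p - g p) \<in> carrier PT"
  unfolding PT_carrier by blast+
qed (simp add: PT_carrier)

lemma PT_eqI: "f \<in> carrier PT \<Longrightarrow> g \<in> carrier PT \<Longrightarrow> (\<And>\<phi>. pr f \<phi> = pr g \<phi>) \<Longrightarrow> f = g"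
 by (rule pr_ext) (simp_all add: PT_fin)

lemma PT_ring: "ring PT"
proof (rule ringI)
 show "abelian_group PT"
 proof (rule abelian_groupI)
  fix x assume "x \<in> carrier PT"
  then show "\<exists>y\<in>carrier PT. y \<oplus>\<^bsub>PT\<^esub> x = \<zero>\<^bsub>PT\<^esub>"
   by (intro bexI[of _ "\<lambda>p. - x p"]) (auto simp: PT_closed)
 qed (auto simp: PT_closed algebra_simps)
 have one: "sgl (1\<^sub>A, 1\<^sub>A) \<in> carrier PT" by (simp add: PT_closed)
 show "monoid PT"
 proof (rule monoidI)
  fix x y z assume c: "x \<in> carrier PT" "y \<in> carrier PT" "z \<in> carrier PT"
  show "x \<cdot>\<^sub>T y \<cdot>\<^sub>T z = x \<cdot>\<^sub>T (y \<cdot>\<^sub>T z)"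
  proof (rule PT_eqI)
   fix \<phi>
   have "pr (x \<cdot>\<^sub>T y \<cdot>\<^sub>T z) \<phi> = pr x (\<lambda>q. pr y (\<lambda>r. pr z (\<lambda>s. \<phi> (dot (dot q r) s))))"
    using c by (simp add: pr_mult PT_mult_closed)
   also have "\<dots> = pr x (\<lambda>q. pr y (\<lambda>r. pr z (\<lambda>s. \<phi> (dot q (dot r s)))))"
   proof (intro pr_cong)
    fix q r s assume "x q \<noteq> 0" "y r \<noteq> 0" "z s \<noteq> 0"
    then have "q \<in> CC" "r \<in> CC" "s \<in> CC" using c PT_supp by blast+
    then show "\<phi> (dot (dot q r) s) = \<phi> (dot q (dot r s))"
     by (auto simp: dot_def A.m_assoc)
   qed
   also have "\<dots> = pr (x \<cdot>\<^sub>T (y \<cdot>\<^sub>T z)) \<phi>" using c by (simp add: pr_mult PT_mult_closed)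
   finally show "pr (x \<cdot>\<^sub>T y \<cdot>\<^sub>T z) \<phi> = pr (x \<cdot>\<^sub>T (y \<cdot>\<^sub>T z)) \<phi>" .
  qed (use c in \<open>simp_all add: PT_mult_closed\<close>)
 next
  fix x assume c: "x \<in> carrier PT"
  have d: "dot (1\<^sub>A, 1\<^sub>A) r = r" "dot r (1\<^sub>A, 1\<^sub>A) = r" if "x r \<noteq> 0" for r
   using PT_supp[OF c that] by (auto simp: dot_def)
  show "\<one>\<^bsub>PT\<^esub> \<cdot>\<^sub>T x = x"
  proof (rule PT_eqI)
   show "pr (\<one>\<^bsub>PT\<^esub> \<cdot>\<^sub>T x) \<phi> = pr x \<phi>" for \<phi>
    using c one d(1) by (simp add: pr_mult pr_sgl) (rule pr_cong, simp)
  qed (use c one in \<open>simp_all add: PT_mult_closed\<close>)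
  show "x \<cdot>\<^sub>T \<one>\<^bsub>PT\<^esub> = x"
  proof (rule PT_eqI)
   show "pr (x \<cdot>\<^sub>T \<one>\<^bsub>PT\<^esub>) \<phi> = pr x \<phi>" for \<phi>
    using c one d(2) by (simp add: pr_mult pr_sgl) (rule pr_cong, simp)
  qed (use c one in \<open>simp_all add: PT_mult_closed\<close>)
 qed (use one in \<open>simp_all add: PT_mult_closed\<close>)
next
 fix x y z assume c: "x \<in> carrier PT" "y \<in> carrier PT" "z \<in> carrier PT"
 note cl = c PT_closed(3) PT_mult_closed PT_fin
 show "(x \<oplus>\<^bsub>PT\<^esub> y) \<cdot>\<^sub>T z = x \<cdot>\<^sub>T z \<oplus>\<^bsub>PT\<^esub> y \<cdot>\<^sub>T z"
  by (rule PT_eqI) (simp_all add: cl pr_mult pr_add)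
 show "z \<cdot>\<^sub>T (x \<oplus>\<^bsub>PT\<^esub> y) = z \<cdot>\<^sub>T x \<oplus>\<^bsub>PT\<^esub> z \<cdot>\<^sub>T y"
  by (rule PT_eqI) (simp_all add: cl pr_mult pr_add pr_linear)
qed

definition bilin where
 "bilin \<phi> \<longleftrightarrow> (\<forall>a\<in>carrier A. \<forall>a'\<in>carrier A. \<forall>b\<in>carrier A. \<phi> (a +\<^sub>A a', b) = \<phi> (a, b) + \<phi> (a', b)) \<and>
   (\<forall>a\<in>carrier A. \<forall>b\<in>carrier A. \<forall>b'\<in>carrier A. \<phi> (a, b +\<^sub>A b') = \<phi> (a, b) + \<phi> (a, b')) \<and>
   (\<forall>c. \<forall>a\<in>carrier A. \<forall>b\<in>carrier A. \<phi> (c *\<^sub>A a, b) = c * \<phi> (a, b)) \<and>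
   (\<forall>c. \<forall>a\<in>carrier A. \<forall>b\<in>carrier A. \<phi> (a, c *\<^sub>A b) = c * \<phi> (a, b))"

lemma bilinD:
 assumes "bilin \<phi>"
 shows "a \<in> \<A> \<Longrightarrow> a' \<in> \<A> \<Longrightarrow> b \<in> \<A> \<Longrightarrow> \<phi> (a +\<^sub>A a', b) = \<phi> (a, b) + \<phi> (a', b)"
  "a \<in> \<A> \<Longrightarrow> b \<in> \<A> \<Longrightarrow> b' \<in> \<A> \<Longrightarrow> \<phi> (a, b +\<^sub>A b') = \<phi> (a, b) + \<phi> (a, b')"
  "a \<in> \<A> \<Longrightarrow> b \<in> \<A> \<Longrightarrow> \<phi> (c *\<^sub>A a, b) = c * \<phi> (a, b)"
  "a \<in> \<A> \<Longrightarrow> b \<in> \<A> \<Longrightarrow> \<phi> (a, c *\<^sub>A b) = c * \<phi> (a, b)"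
 using assms unfolding bilin_def by blast+

definition Bil where "Bil = bilinear_ideal A (opp A)"

lemma rels_PT: "bilinear_relations A (opp A) \<subseteq> carrier PT"
 by (auto simp: bilinear_relations_def smult_A intro!: PT_closed)

lemma Bil_ideal: "ideal Bil PT"
 unfolding Bil_def bilinear_ideal_def by (rule ring.genideal_ideal[OF PT_ring rels_PT])

interpretation Bil: ideal Bil PT by (rule Bil_ideal)

lemma rels_Bil: "f \<in> bilinear_relations A (opp A) \<Longrightarrow> f \<in> Bil"
 unfolding Bil_def bilinear_ideal_def using ring.genideal_self[OF PT_ring rels_PT] by blast

text \<open>The elements annihilated by all bilinear functions form an ideal, because
  \<open>dot\<close> is bilinear in each argument. Thus bilinear functions descend to the tensor
  product, and this is what shows that \<open>A \<otimes> A\<close> has not collapsed.\<close>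

lemma Bil_pr: "f \<in> Bil \<Longrightarrow> bilin \<phi> \<Longrightarrow> pr f \<phi> = 0"
proof -
 let ?J = "{f \<in> carrier PT. \<forall>\<phi>. bilin \<phi> \<longrightarrow> pr f \<phi> = 0}"
 have "ideal ?J PT"
 proof (rule idealI[OF PT_ring])
  show "subgroup ?J (add_monoid PT)"
  proof (rule subgroup.intro)
   fix x assume x: "x \<in> ?J"
   then have xc: "x \<in> carrier PT" by simp
   have "(\<lambda>p. - x p) \<oplus>\<^bsub>PT\<^esub> x = \<zero>\<^bsub>PT\<^esub>" by simp
   then have "\<ominus>\<^bsub>PT\<^esub> x = (\<lambda>p. - x p)"
    using xc by (intro abelian_group.minus_equality[OF ring.is_abelian_group[OF PT_ring]]) (auto simp: PT_closed)
   then have "inv\<^bsub>add_monoid PT\<^esub> x = (\<lambda>p. (- 1) * x p)" by (simp add: a_inv_def)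
   then show "inv\<^bsub>add_monoid PT\<^esub> x \<in> ?J"
    using x PT_closed(4)[OF xc, of "- 1"] pr_smult[OF PT_fin[OF xc], of "- 1"] by simp
  qed (auto simp: PT_closed pr_add PT_fin pr_zero)
  fix f g assume f: "f \<in> ?J" and g: "g \<in> carrier PT"
  have fc: "f \<in> carrier PT" using f by simp
  have "pr (g \<cdot>\<^sub>T f) \<phi> = 0" if \<phi>: "bilin \<phi>" for \<phi>
  proof -
   have "pr f (\<lambda>r. \<phi> (dot q r)) = 0" if "g q \<noteq> 0" for q
   proof -
    have "q \<in> CC" by (rule PT_supp[OF g that])
    then have "bilin (\<lambda>r. \<phi> (dot q r))" unfolding bilin_def dot_def
     by (auto simp: A.r_distr A.l_distr bilinD[OF \<phi>] smult_A)
    then show ?thesis using f by blast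
   qed
   then have "pr g (\<lambda>q. pr f (\<lambda>r. \<phi> (dot q r))) = pr g (\<lambda>_. 0)" by (intro pr_cong)
   then show ?thesis by (simp add: pr_mult[OF g fc] pr_linear)
  qed
  then show "g \<cdot>\<^sub>T f \<in> ?J" using PT_mult_closed[OF g fc] by blast
  have "pr (f \<cdot>\<^sub>T g) \<phi> = 0" if \<phi>: "bilin \<phi>" for \<phi>
  proof -
   let ?\<psi> = "\<lambda>q. pr g (\<lambda>r. \<phi> (dot q r))"
   have cc: "r \<in> CC" if "g r \<noteq> 0" for r by (rule PT_supp[OF g that])
   have "bilin ?\<psi>" unfolding bilin_def
    by (intro conjI ballI allI; (subst pr_linear(1,2)[symmetric])?; rule pr_cong; drule cc)
     (auto simp: dot_def A.r_distr A.l_distr bilinD[OF \<phi>] smult_A)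
   then show ?thesis using f pr_mult[OF fc g] by simp
  qed
  then show "f \<cdot>\<^sub>T g \<in> ?J" using PT_mult_closed[OF fc g] by blast
 qed
 moreover have "bilinear_relations A (opp A) \<subseteq> ?J"
 proof
  fix f assume f: "f \<in> bilinear_relations A (opp A)"
  have fs: "a \<in> \<A> \<Longrightarrow> b \<in> \<A> \<Longrightarrow> finite {p. sgl (a, b) p \<noteq> (0::'k)}" for a b
   using PT_fin[OF PT_closed(2)] by simp
  have pr3: "pr (\<lambda>p. sgl x p - sgl y p - sgl z p) \<phi> = \<phi> x - \<phi> y - \<phi> z"
   if "x \<in> CC" "y \<in> CC" "z \<in> CC" for x y z and \<phi> :: "_ \<Rightarrow> 'k"
   using pr_diff[OF PT_fin[OF PT_closed(6)[OF PT_closed(2)[OF that(1)] PT_closed(2)[OF that(2)]]] PT_fin[OF PT_closed(2)[OF that(3)]], of \<phi>]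
    pr_diff[OF PT_fin[OF PT_closed(2)[OF that(1)]] PT_fin[OF PT_closed(2)[OF that(2)]], of \<phi>]
   by (simp add: pr_sgl)
  have "pr f \<phi> = 0" if "bilin \<phi>" for \<phi>
   using f that unfolding bilinear_relations_def
   by (elim UnE CollectE exE conjE)
    (simp_all add: pr3 pr_diff pr_smult pr_sgl fs PT_fin PT_closed smult_A bilinD)
  then show "f \<in> ?J" using f rels_PT by blast
 qed
 ultimately have "Bil \<subseteq> ?J" unfolding Bil_def bilinear_ideal_def
  by (rule ring.genideal_minimal[OF PT_ring])
 then show "f \<in> Bil \<Longrightarrow> bilin \<phi> \<Longrightarrow> pr f \<phi> = 0" by blast
qed

definition ecl where "ecl f = Bil +>\<^bsub>PT\<^esub> f"

lemma Bil_add: "f \<in> Bil \<Longrightarrow> g \<in> Bil \<Longrightarrow> (\<lambda>p. f p + g p) \<in> Bil"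
 using additive_subgroup.a_closed[OF Bil.is_additive_subgroup, of f g] by simp

lemma Bil_zero: "(\<lambda>_. 0) \<in> Bil"
 using additive_subgroup.zero_closed[OF Bil.is_additive_subgroup] by simp

lemma Bil_PT: "f \<in> Bil \<Longrightarrow> f \<in> carrier PT"
 by (rule Bil.Icarr)

lemma Bil_uminus: "f \<in> Bil \<Longrightarrow> (\<lambda>p. - f p) \<in> Bil"
proof -
 assume f: "f \<in> Bil"
 have "(\<lambda>p. - f p) \<oplus>\<^bsub>PT\<^esub> f = \<zero>\<^bsub>PT\<^esub>" by simp
 then have "\<ominus>\<^bsub>PT\<^esub> f = (\<lambda>p. - f p)"
  using Bil_PT[OF f] by (intro abelian_group.minus_equality[OF ring.is_abelian_group[OF PT_ring]]) (auto simp: PT_closed)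
 then show ?thesis using additive_subgroup.a_inv_closed[OF Bil.is_additive_subgroup f] by simp
qed

lemma ecl_iff: "g \<in> ecl f \<longleftrightarrow> (\<lambda>p. g p - f p) \<in> Bil"
proof
 assume "g \<in> ecl f"
 then obtain h where "h \<in> Bil" "g = (\<lambda>s. h s + f s)" by (auto simp: ecl_def a_r_coset_def')
 then show "(\<lambda>p. g p - f p) \<in> Bil" by simp
next
 assume "(\<lambda>s. g s - f s) \<in> Bil"
 moreover have "g = (\<lambda>s. (g s - f s) + f s)" by simp
 ultimately show "g \<in> ecl f" unfolding ecl_def a_r_coset_def' by fastforce
qed

lemma ecl_eqI: "(\<lambda>p. f p - g p) \<in> Bil \<Longrightarrow> ecl f = ecl g"
proof -
 assume fg: "(\<lambda>p. f p - g p) \<in> Bil"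
 have "(\<lambda>p. x p - f p) \<in> Bil \<longleftrightarrow> (\<lambda>p. x p - g p) \<in> Bil" for x
  using Bil_add[OF _ fg, of "\<lambda>p. x p - f p"] Bil_add[OF _ Bil_uminus[OF fg], of "\<lambda>p. x p - g p"] by auto
 then show ?thesis by (auto simp: ecl_iff)
qed

lemma E_carrier: "\<E> = ecl ` carrier PT"
 by (auto simp: env_def tensor_alg_def quot_alg_def FactRing_def A_RCOSETS_def' ecl_def Bil_def)

lemma ecl_hom:
 "f \<in> carrier PT \<Longrightarrow> g \<in> carrier PT \<Longrightarrow> ecl f \<cdot>\<^sub>E ecl g = ecl (f \<cdot>\<^sub>T g)"
 "f \<in> carrier PT \<Longrightarrow> g \<in> carrier PT \<Longrightarrow> ecl f +\<^sub>E ecl g = ecl (\<lambda>p. f p + g p)"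
 "\<one>\<^bsub>E\<^esub> = ecl (sgl (1\<^sub>A, 1\<^sub>A))" "0\<^sub>E = ecl (\<lambda>_. 0)"
proof -
 note h = Bil.rcos_ring_hom
 have f: "mult E = mult (PT Quot Bil)" "add E = add (PT Quot Bil)" "one E = one (PT Quot Bil)"
  "zero E = zero (PT Quot Bil)"
  by (simp_all add: env_def tensor_alg_def quot_alg_def Bil_def)
 show "f \<in> carrier PT \<Longrightarrow> g \<in> carrier PT \<Longrightarrow> ecl f \<cdot>\<^sub>E ecl g = ecl (f \<cdot>\<^sub>T g)"
  "f \<in> carrier PT \<Longrightarrow> g \<in> carrier PT \<Longrightarrow> ecl f +\<^sub>E ecl g = ecl (\<lambda>p. f p + g p)"
  "\<one>\<^bsub>E\<^esub> = ecl (sgl (1\<^sub>A, 1\<^sub>A))"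
  using ring_hom_mult[OF h] ring_hom_add[OF h] ring_hom_one[OF h] by (simp_all add: ecl_def f)
 have "0\<^sub>E = Bil" by (simp add: f FactRing_def)
 also have "Bil = ecl (\<lambda>_. 0)" by (auto simp: ecl_iff)
 finally show "0\<^sub>E = ecl (\<lambda>_. 0)" .
qed

lemma E_ring: "ring E"
 by (rule ring_cong[OF Bil.quotient_is_ring])
  (simp_all add: env_def tensor_alg_def quot_alg_def Bil_def)

sublocale E: ring E by (rule E_ring)

lemma homog_E: "homog E n = ecl ` {f \<in> carrier PT. \<forall>p. f p \<noteq> 0 \<longrightarrow> (\<exists>i. fst p \<in> homog A i \<and> snd p \<in> homog A (n - i))}"
proof -
 have "homog PT n = {f \<in> carrier PT. \<forall>p. f p \<noteq> 0 \<longrightarrow> (\<exists>i. fst p \<in> homog A i \<and> snd p \<in> homog A (n - i))}"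
 proof (intro equalityI subsetI)
  fix f assume f: "f \<in> homog PT n"
  have "\<exists>i. fst p \<in> homog A i \<and> snd p \<in> homog A (n - i)" if "f p \<noteq> 0" for p
   using f that by (cases p) (auto simp: pre_tensor_def)
  moreover from this have "p \<in> CC" if "f p \<noteq> 0" for p using that G.H_sub by (cases p) fastforce
  ultimately show "f \<in> {f \<in> carrier PT. \<forall>p. f p \<noteq> 0 \<longrightarrow> (\<exists>i. fst p \<in> homog A i \<and> snd p \<in> homog A (n - i))}"
   using f by (auto simp: PT_carrier) (simp add: pre_tensor_def)
 next
  fix f assume f: "f \<in> {f \<in> carrier PT. \<forall>p. f p \<noteq> 0 \<longrightarrow> (\<exists>i. fst p \<in> homog A i \<and> snd p \<in> homog A (n - i))}"
  then have "finite {p. f p \<noteq> 0}" by (simp add: PT_fin)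
  moreover have "{p. f p \<noteq> 0} \<subseteq> (\<Union>i. homog A i \<times> homog A (n - i))"
  proof
   fix p assume "p \<in> {p. f p \<noteq> 0}"
   then obtain i where "fst p \<in> homog A i" "snd p \<in> homog A (n - i)" using f by blast
   then show "p \<in> (\<Union>i. homog A i \<times> homog A (n - i))" by (cases p) auto
  qed
  ultimately show "f \<in> homog PT n" by (simp add: pre_tensor_def)
 qed
 then show ?thesis by (simp add: env_def tensor_alg_def quot_alg_def ecl_def Bil_def)
qed

section \<open>Pure tensors and coordinates in the right factor\<close>

abbreviation pt where "pt a b \<equiv> pure_tensor A (opp A) a b"

lemma pt_def: "pt a b = ecl (sgl (a, b))"
 by (simp add: pure_tensor_def ecl_def Bil_def)

lemma pt_closed [simp]: "a \<in> \<A> \<Longrightarrow> b \<in> \<A> \<Longrightarrow> pt a b \<in> \<E>"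
 by (simp add: pt_def E_carrier PT_closed)

lemma pt_bilinear:
 "a \<in> \<A> \<Longrightarrow> a' \<in> \<A> \<Longrightarrow> b \<in> \<A> \<Longrightarrow> pt (a +\<^sub>A a') b = pt a b +\<^sub>E pt a' b"
 "a \<in> \<A> \<Longrightarrow> b \<in> \<A> \<Longrightarrow> b' \<in> \<A> \<Longrightarrow> pt a (b +\<^sub>A b') = pt a b +\<^sub>E pt a b'"
 "a \<in> \<A> \<Longrightarrow> b \<in> \<A> \<Longrightarrow> ecl (\<lambda>p. c * sgl (a, b) p) = pt (c *\<^sub>A a) b"
 "a \<in> \<A> \<Longrightarrow> b \<in> \<A> \<Longrightarrow> ecl (\<lambda>p. c * sgl (a, b) p) = pt a (c *\<^sub>A b)"
proof -
 assume a: "a \<in> \<A>" and b: "b \<in> \<A>"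
 have "(\<lambda>p. sgl (c *\<^sub>A a, b) p - c * sgl (a, b) p) \<in> Bil"
  by (rule rels_Bil, unfold bilinear_relations_def opp_simps, rule UnI1, rule UnI2, rule CollectI, intro exI conjI, rule refl) (use a b in simp_all)
 then show "ecl (\<lambda>p. c * sgl (a, b) p) = pt (c *\<^sub>A a) b"
  unfolding pt_def by (rule ecl_eqI[symmetric])
 have "(\<lambda>p. sgl (a, c *\<^sub>A b) p - c * sgl (a, b) p) \<in> Bil"
  by (rule rels_Bil, unfold bilinear_relations_def opp_simps, rule UnI2, rule CollectI, intro exI conjI, rule refl) (use a b in simp_all)
 then show "ecl (\<lambda>p. c * sgl (a, b) p) = pt a (c *\<^sub>A b)"
  unfolding pt_def by (rule ecl_eqI[symmetric])
next
 assume a: "a \<in> \<A>" "a' \<in> \<A>" and b: "b \<in> \<A>"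
 have "(\<lambda>p. sgl (a +\<^sub>A a', b) p - sgl (a, b) p - sgl (a', b) p) \<in> Bil"
  by (rule rels_Bil, unfold bilinear_relations_def opp_simps, rule UnI1, rule UnI1, rule UnI1, rule CollectI, intro exI conjI, rule refl) (use a b in simp_all)
 then have "ecl (sgl (a +\<^sub>A a', b)) = ecl (\<lambda>p. sgl (a, b) p + sgl (a', b) p)"
  by (intro ecl_eqI) (simp add: diff_diff_eq)
 then show "pt (a +\<^sub>A a') b = pt a b +\<^sub>E pt a' b"
  using a b by (simp add: pt_def ecl_hom PT_closed)
next
 assume a: "a \<in> \<A>" and b: "b \<in> \<A>" "b' \<in> \<A>"
 have "(\<lambda>p. sgl (a, b +\<^sub>A b') p - sgl (a, b) p - sgl (a, b') p) \<in> Bil"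
  by (rule rels_Bil, unfold bilinear_relations_def opp_simps, rule UnI1, rule UnI1, rule UnI2, rule CollectI, intro exI conjI, rule refl) (use a b in simp_all)
 then have "ecl (sgl (a, b +\<^sub>A b')) = ecl (\<lambda>p. sgl (a, b) p + sgl (a, b') p)"
  by (intro ecl_eqI) (simp add: diff_diff_eq)
 then show "pt a (b +\<^sub>A b') = pt a b +\<^sub>E pt a b'"
  using a b by (simp add: pt_def ecl_hom PT_closed)
qed

lemma pt_smult: "a \<in> \<A> \<Longrightarrow> b \<in> \<A> \<Longrightarrow> pt (c *\<^sub>A a) b = pt a (c *\<^sub>A b)"
 using pt_bilinear(3,4) by metis

lemma pt_mult:
 assumes "a \<in> \<A>" "b \<in> \<A>" "a' \<in> \<A>" "b' \<in> \<A>"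
 shows "pt a b \<cdot>\<^sub>E pt a' b' = pt (a \<cdot> a') (b' \<cdot> b)"
proof -
 have "sgl (a, b) \<cdot>\<^sub>T sgl (a', b') = sgl (a \<cdot> a', b' \<cdot> b)"
  by (rule PT_eqI) (use assms in \<open>simp_all add: pr_mult PT_mult_closed PT_closed pr_sgl dot_def\<close>)
 then show ?thesis using assms by (simp add: pt_def ecl_hom PT_closed)
qed

lemma pt_one: "\<one>\<^bsub>E\<^esub> = pt 1\<^sub>A 1\<^sub>A"
 by (simp add: pt_def ecl_hom)

text \<open>Q transports a property of the symbols in the support to the pure tensors: the trivial
  one yields \<open>E_induct\<close>, homogeneity of both factors yields
  \<open>E_homog_induct\<close>. Coefficients are absorbed in the left factor.\<close>

lemma ecl_induct:
 assumes f: "f \<in> carrier PT" and fP: "\<And>p. f p \<noteq> 0 \<Longrightarrow> Q (fst p) (snd p)"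
  and z: "P 0\<^sub>E"
  and s: "\<And>a b c. a \<in> \<A> \<Longrightarrow> b \<in> \<A> \<Longrightarrow> Q a b \<Longrightarrow> P (pt (c *\<^sub>A a) b)"
  and a: "\<And>X Y. X \<in> \<E> \<Longrightarrow> Y \<in> \<E> \<Longrightarrow> P X \<Longrightarrow> P Y \<Longrightarrow> P (X +\<^sub>E Y)"
 shows "P (ecl f)"
proof -
 have fin: "finite {p. f p \<noteq> 0}" using f by (rule PT_fin)
 have "P (ecl (\<lambda>p. \<Sum>q\<in>F. f q * sgl q p)) \<and> (\<lambda>p. \<Sum>q\<in>F. f q * sgl q p) \<in> carrier PT"
  if "finite F" "F \<subseteq> {p. f p \<noteq> 0}" for F
  using that
 proof (induction F rule: finite_induct)
  case (insert q F)
  obtain a b where q: "q = (a, b)" by (cases q)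
  have ab: "a \<in> \<A>" "b \<in> \<A>" "Q a b" using insert.prems PT_supp[OF f, of q] fP[of q] q by auto
  have qc: "(\<lambda>p. f q * sgl q p) \<in> carrier PT" using ab q by (simp add: PT_closed)
  let ?g = "\<lambda>p. \<Sum>q\<in>F. f q * sgl q p"
  have g: "P (ecl ?g)" "?g \<in> carrier PT" using insert by auto
  have "P (ecl (\<lambda>p. f q * sgl q p))" unfolding q pt_bilinear(3)[OF ab(1,2)] by (rule s[OF ab])
  then have "P (ecl (\<lambda>p. f q * sgl q p) +\<^sub>E ecl ?g)"
   using a g qc by (auto simp: E_carrier)
  then show ?case using insert.hyps qc g by (simp add: ecl_hom PT_closed)
 qed (simp add: z[unfolded ecl_hom] PT_closed)
 from this[OF fin] have "P (ecl (\<lambda>p. \<Sum>q\<in>{p. f p \<noteq> 0}. f q * sgl q p))" by simp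
 moreover have "f = (\<lambda>p. \<Sum>q\<in>{p. f p \<noteq> 0}. f q * sgl q p)" (is "f = ?h")
 proof
  fix p show "f p = (\<Sum>q\<in>{p. f p \<noteq> 0}. f q * sgl q p)"
   using fin by (cases "f p = 0") (auto simp: sgl_def if_distrib cong: if_cong)
 qed
 ultimately show ?thesis by metis
qed

lemma E_induct [consumes 1, case_names zero pt add]:
 assumes "X \<in> \<E>" "P 0\<^sub>E" "\<And>a b. a \<in> \<A> \<Longrightarrow> b \<in> \<A> \<Longrightarrow> P (pt a b)"
  "\<And>X Y. X \<in> \<E> \<Longrightarrow> Y \<in> \<E> \<Longrightarrow> P X \<Longrightarrow> P Y \<Longrightarrow> P (X +\<^sub>E Y)"
 shows "P X"
proof -
 obtain f where f: "f \<in> carrier PT" "X = ecl f" using assms(1) by (auto simp: E_carrier)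
 show ?thesis unfolding f(2)
  by (rule ecl_induct[OF f(1), where Q = "\<lambda>_ _. True"]) (use assms(2-4) in \<open>auto simp: smult_A\<close>)
qed

lemma smult_homog: "a \<in> homog A i \<Longrightarrow> c *\<^sub>A a \<in> homog A i"
proof -
 assume a: "a \<in> homog A i"
 have "(c *\<^sub>A 1\<^sub>A) \<cdot> a \<in> homog A (0 + i)" by (rule G.homog_mult[OF scal_homog a])
 then show ?thesis using G.H_sub[OF a] by (simp add: smult_A)
qed

lemma E_homog_induct [consumes 1, case_names zero pt add]:
 assumes "X \<in> homog E n" "P 0\<^sub>E" "\<And>a b i. a \<in> homog A i \<Longrightarrow> b \<in> homog A (n - i) \<Longrightarrow> P (pt a b)"
  "\<And>X Y. X \<in> \<E> \<Longrightarrow> Y \<in> \<E> \<Longrightarrow> P X \<Longrightarrow> P Y \<Longrightarrow> P (X +\<^sub>E Y)"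
 shows "P X"
proof -
 obtain f where f: "f \<in> carrier PT" "X = ecl f"
  "\<And>p. f p \<noteq> 0 \<Longrightarrow> \<exists>i. fst p \<in> homog A i \<and> snd p \<in> homog A (n - i)"
  using assms(1) unfolding homog_E by blast
 show ?thesis unfolding f(2)
 proof (rule ecl_induct[OF f(1), where Q = "\<lambda>a b. \<exists>i. a \<in> homog A i \<and> b \<in> homog A (n - i)"])
  fix a b c assume "\<exists>i. a \<in> homog A i \<and> b \<in> homog A (n - i)"
  then obtain i where "a \<in> homog A i" "b \<in> homog A (n - i)" by (elim exE conjE)
  then show "P (pt (c *\<^sub>A a) b)" by (intro assms(3) smult_homog)
 qed (rule f(3) assms(2,4); assumption)+
qed

text \<open>For bilinear \<open>\<phi>\<close> this is the induced functional on
  \<open>A \<otimes> A\<close>; it does not depend on the chosen representative.\<close>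

definition ev where "ev \<phi> X = pr (SOME f. f \<in> X) \<phi>"

lemma ecl_rep: assumes "f \<in> carrier PT"
 shows "(SOME g. g \<in> ecl f) \<in> carrier PT" "bilin \<phi> \<Longrightarrow> pr (SOME g. g \<in> ecl f) \<phi> = pr f \<phi>"
proof -
 let ?g = "SOME g. g \<in> ecl f"
 have "f \<in> ecl f" by (simp add: ecl_iff Bil_zero)
 then have "?g \<in> ecl f" by (rule someI[where P = "\<lambda>g. g \<in> ecl f"])
 then have d: "(\<lambda>p. ?g p - f p) \<in> Bil" by (simp add: ecl_iff)
 have "(\<lambda>p. (?g p - f p) + f p) \<in> carrier PT" using Bil_PT[OF d] assms by (rule PT_closed)
 then show gc: "?g \<in> carrier PT" by simp
 assume "bilin \<phi>"
 then have "pr (\<lambda>p. ?g p - f p) \<phi> = 0" by (rule Bil_pr[OF d])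
 then show "pr ?g \<phi> = pr f \<phi>" using pr_diff[OF PT_fin[OF gc] PT_fin[OF assms]] by simp
qed

lemma ev_ecl: "f \<in> carrier PT \<Longrightarrow> bilin \<phi> \<Longrightarrow> ev \<phi> (ecl f) = pr f \<phi>"
 unfolding ev_def by (rule ecl_rep)

lemma ev_simps:
 assumes "bilin \<phi>"
 shows "X \<in> \<E> \<Longrightarrow> Y \<in> \<E> \<Longrightarrow> ev \<phi> (X +\<^sub>E Y) = ev \<phi> X + ev \<phi> Y"
  "a \<in> \<A> \<Longrightarrow> b \<in> \<A> \<Longrightarrow> ev \<phi> (pt a b) = \<phi> (a, b)"
 using assms by (auto simp: E_carrier ecl_hom ev_ecl PT_closed pr_add PT_fin pt_def pr_sgl)

lemma co_bilin: "bilin (\<lambda>p. co (fst p) s * co (snd p) t)"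
 by (auto simp: bilin_def co_linear smult_A algebra_simps)

text \<open>The coordinate of \<^term>\<open>X\<close> in \<open>A \<otimes> A\<close> at the word \<^term>\<open>t\<close> in the right factor.\<close>

definition th where "th t X = cls (\<lambda>s. ev (\<lambda>p. co (fst p) s * co (snd p) t) X)"

lemma th_TT: "X \<in> \<E> \<Longrightarrow> (\<lambda>s. ev (\<lambda>p. co (fst p) s * co (snd p) t) X) \<in> \<T>"
proof -
 assume "X \<in> \<E>"
 then obtain f where f: "f \<in> carrier PT" "X = ecl f" by (auto simp: E_carrier)
 have "(\<lambda>s. \<Sum>p\<in>{p. f p \<noteq> 0}. (f p * co (snd p) t) * co (fst p) s) \<in> \<T>"
  using PT_supp[OF f(1)] PT_fin[OF f(1)] by (intro TT_sum_closed TT_closed co_TT) (auto simp: mem_Times_iff)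
 then show ?thesis using f by (simp add: ev_ecl co_bilin pr_def mult.assoc mult.commute[of "co (snd _) t"])
qed

lemma th_closed [simp]: "X \<in> \<E> \<Longrightarrow> th t X \<in> \<A>"
 unfolding th_def by (intro cls_closed th_TT)

lemma th_add: "X \<in> \<E> \<Longrightarrow> Y \<in> \<E> \<Longrightarrow> th t (X +\<^sub>E Y) = th t X +\<^sub>A th t Y"
 by (simp add: th_def cls_hom th_TT ev_simps co_bilin)

lemma th_pt: "a \<in> \<A> \<Longrightarrow> b \<in> \<A> \<Longrightarrow> th t (pt a b) = co b t *\<^sub>A a"
proof -
 assume ab: "a \<in> \<A>" "b \<in> \<A>"
 have "th t (pt a b) = cls (\<lambda>s. co b t * co a s)"
  using ab by (simp add: th_def ev_simps co_bilin mult.commute)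
 also have "\<dots> = co b t *\<^sub>A cls (co a)" by (simp add: cls_smult)
 finally show ?thesis using ab by (simp add: cls_co)
qed

lemma th_map: "add_map E A (th t)"
 by (rule add_mapI) (auto simp: th_add E.abelian_group_axioms A.abelian_group_axioms)

lemmas th_zero = add_map.zero[OF th_map]
lemmas th_finsum = add_map.finsum[OF th_map]
lemmas th_diff = add_map.diff[OF th_map]

lemma pt_map_l: "b \<in> \<A> \<Longrightarrow> add_map A E (\<lambda>a. pt a b)"
 by (rule add_mapI) (auto simp: pt_bilinear E.abelian_group_axioms A.abelian_group_axioms)
lemma pt_map_r: "a \<in> \<A> \<Longrightarrow> add_map A E (\<lambda>b. pt a b)"
 by (rule add_mapI) (auto simp: pt_bilinear E.abelian_group_axioms A.abelian_group_axioms)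

lemmas pt_zero_l = add_map.zero[OF pt_map_l]
lemmas pt_zero_r = add_map.zero[OF pt_map_r]
lemmas pt_finsum_l = add_map.finsum[OF pt_map_l]
lemmas pt_finsum_r = add_map.finsum[OF pt_map_r]

lemma th_mult_l: "X \<in> \<E> \<Longrightarrow> a \<in> \<A> \<Longrightarrow> th t (X \<cdot>\<^sub>E pt a 1\<^sub>A) = th t X \<cdot> a"
proof (induction X rule: E_induct)
 case (add X Y) then show ?case by (simp add: E.l_distr th_add A.l_distr)
qed (simp_all add: th_zero pt_mult th_pt smult_A)

definition wd where "wd t = cls (sgl t)"

lemma wd_closed [simp]: "wd t \<in> \<A>"
 by (simp add: wd_def cls_closed TT_closed)

lemma sgl_tensors: "sgl t \<in> tensors (length t)"
 by (auto simp: tensors_def sgl_def)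

lemma wd_homog: "wd t \<in> homog A (int (length t))"
 using sgl_tensors by (auto simp: wd_def homog_A_nat)

lemma A_expand: "b \<in> \<A> \<Longrightarrow> \<exists>N. \<forall>M\<ge>N. b = (\<Oplus>\<^bsub>A\<^esub>t\<in>{t. length t \<le> M}. co b t *\<^sub>A wd t)"
proof -
 assume b: "b \<in> \<A>"
 obtain N where N: "\<forall>s. length s > N \<longrightarrow> co b s = 0" using co_TT[OF b] by (auto simp: TT_carrier_iff)
 have "b = (\<Oplus>\<^bsub>A\<^esub>t\<in>{t. length t \<le> M}. co b t *\<^sub>A wd t)" if M: "M \<ge> N" for M
 proof -
  have "co b = (\<lambda>s. \<Sum>t\<in>{t. length t \<le> M}. co b t * sgl t s)"
   by (rule sgl_expand) (use N M in auto)
  then have "cls (co b) = cls (\<lambda>s. \<Sum>t\<in>{t. length t \<le> M}. co b t * sgl t s)" by (rule arg_cong)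
  also have "\<dots> = (\<Oplus>\<^bsub>A\<^esub>t\<in>{t. length t \<le> M}. cls (\<lambda>s. co b t * sgl t s))"
   by (rule cls_finsum[symmetric]) (auto simp: TT_closed)
  finally show ?thesis using b by (simp add: cls_co wd_def cls_smult)
 qed
 then show ?thesis by blast
qed

text \<open>Every b is the sum of \<open>co b t\<close> times \<open>wd t\<close>, with coefficients
  linear in b although the classes \<open>wd t\<close> may be dependent; applying this to right
  factors gives the expansion. Asking for all large M lets the expansions of two elements be
  added.\<close>

lemma E_expand:
 "X \<in> \<E> \<Longrightarrow> \<exists>N. \<forall>M\<ge>N. X = (\<Oplus>\<^bsub>E\<^esub>t\<in>{t. length t \<le> M}. pt (th t X) (wd t))"
proof (induction X rule: E_induct)
 case zero
 show ?case by (simp add: th_zero pt_zero_l E.finsum_zero)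
next
 case (pt a b)
 obtain N where N: "\<And>M. M \<ge> N \<Longrightarrow> b = (\<Oplus>\<^bsub>A\<^esub>t\<in>{t. length t \<le> M}. co b t *\<^sub>A wd t)"
  using A_expand[OF pt(2)] by blast
 have "pt a b = (\<Oplus>\<^bsub>E\<^esub>t\<in>{t. length t \<le> M}. pt (th t (pt a b)) (wd t))" if "M \<ge> N" for M
 proof -
  have "pt a b = pt a (\<Oplus>\<^bsub>A\<^esub>t\<in>{t. length t \<le> M}. co b t *\<^sub>A wd t)" using N[OF that] by (rule arg_cong)
  also have "\<dots> = (\<Oplus>\<^bsub>E\<^esub>t\<in>{t. length t \<le> M}. pt a (co b t *\<^sub>A wd t))"
   by (rule pt_finsum_r) (use pt in \<open>auto simp: smult_A\<close>)
  also have "\<dots> = (\<Oplus>\<^bsub>E\<^esub>t\<in>{t. length t \<le> M}. pt (th t (pt a b)) (wd t))"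
   using pt by (intro E.finsum_cong') (simp_all add: th_pt pt_smult smult_A)
  finally show ?thesis .
 qed
 then show ?case by blast
next
 case (add X Y)
 then obtain N1 N2 where N1: "\<And>M. M \<ge> N1 \<Longrightarrow> X = (\<Oplus>\<^bsub>E\<^esub>t\<in>{t. length t \<le> M}. pt (th t X) (wd t))"
  and N2: "\<And>M. M \<ge> N2 \<Longrightarrow> Y = (\<Oplus>\<^bsub>E\<^esub>t\<in>{t. length t \<le> M}. pt (th t Y) (wd t))" by blast
 have "X +\<^sub>E Y = (\<Oplus>\<^bsub>E\<^esub>t\<in>{t. length t \<le> M}. pt (th t (X +\<^sub>E Y)) (wd t))" if M: "M \<ge> max N1 N2" for M
 proof -
  have "X +\<^sub>E Y = (\<Oplus>\<^bsub>E\<^esub>t\<in>{t. length t \<le> M}. pt (th t X) (wd t)) +\<^sub>E (\<Oplus>\<^bsub>E\<^esub>t\<in>{t. length t \<le> M}. pt (th t Y) (wd t))"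
   by (rule arg_cong2[where f = "add E"]) (use N1[of M] N2[of M] M in simp_all)
  also have "\<dots> = (\<Oplus>\<^bsub>E\<^esub>t\<in>{t. length t \<le> M}. pt (th t X) (wd t) +\<^sub>E pt (th t Y) (wd t))"
   by (rule E.finsum_addf[symmetric]) (use add in auto)
  also have "\<dots> = (\<Oplus>\<^bsub>E\<^esub>t\<in>{t. length t \<le> M}. pt (th t (X +\<^sub>E Y)) (wd t))"
   using add by (intro E.finsum_cong') (simp_all add: th_add pt_bilinear)
  finally show ?thesis .
 qed
 then show ?case by blast
qed

text \<open>By the expansion the coordinates \<open>th t\<close> are jointly injective; equations in
  \<open>A \<otimes> A\<close> are thereby reduced to equations in A.\<close>

lemma E_zeroI: "X \<in> \<E> \<Longrightarrow> (\<And>t. th t X = 0\<^sub>A) \<Longrightarrow> X = 0\<^sub>E"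
proof -
 assume X: "X \<in> \<E>" and z: "\<And>t. th t X = 0\<^sub>A"
 obtain N where N: "\<And>M. M \<ge> N \<Longrightarrow> X = (\<Oplus>\<^bsub>E\<^esub>t\<in>{t. length t \<le> M}. pt (th t X) (wd t))"
  using E_expand[OF X] by blast
 have "(\<Oplus>\<^bsub>E\<^esub>t\<in>{t. length t \<le> N}. pt (th t X) (wd t)) = 0\<^sub>E" by (simp add: z pt_zero_l E.finsum_zero)
 with N[OF order_refl] show "X = 0\<^sub>E" by (rule trans)
qed

lemma co_homog_zero: "b \<in> homog A j \<Longrightarrow> int (length t) \<noteq> j \<Longrightarrow> co b t *\<^sub>A a = 0\<^sub>A" if "a \<in> \<A>"
 using that by (simp add: co_homog smult_A)

section \<open>The grading of the enveloping algebra\<close>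

lemma homog_E_add: "X \<in> homog E n \<Longrightarrow> Y \<in> homog E n \<Longrightarrow> X +\<^sub>E Y \<in> homog E n"
proof -
 assume "X \<in> homog E n" "Y \<in> homog E n"
 then obtain f g where f: "f \<in> carrier PT" "X = ecl f" "\<forall>p. f p \<noteq> 0 \<longrightarrow> (\<exists>i. fst p \<in> homog A i \<and> snd p \<in> homog A (n - i))"
  and g: "g \<in> carrier PT" "Y = ecl g" "\<forall>p. g p \<noteq> 0 \<longrightarrow> (\<exists>i. fst p \<in> homog A i \<and> snd p \<in> homog A (n - i))"
  unfolding homog_E by blast
 have "\<exists>i. fst p \<in> homog A i \<and> snd p \<in> homog A (n - i)" if "f p + g p \<noteq> 0" for p
  using f(3)[rule_format, of p] g(3)[rule_format, of p] that by (cases "f p = 0") auto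
 with PT_closed(3)[OF f(1) g(1)] have "(\<lambda>p. f p + g p) \<in> {f \<in> carrier PT. \<forall>p. f p \<noteq> 0 \<longrightarrow> (\<exists>i. fst p \<in> homog A i \<and> snd p \<in> homog A (n - i))}"
  by blast
 then show ?thesis unfolding homog_E f(2) g(2) ecl_hom(2)[OF f(1) g(1)] by (rule imageI)
qed

lemma homog_E_zero: "0\<^sub>E \<in> homog E n"
 unfolding homog_E by (intro image_eqI[of _ _ "\<lambda>_. 0"]) (simp_all add: ecl_hom PT_closed)

lemma homog_E_pt: "a \<in> homog A i \<Longrightarrow> b \<in> homog A j \<Longrightarrow> i + j = n \<Longrightarrow> pt a b \<in> homog E n"
proof -
 assume a: "a \<in> homog A i" and b: "b \<in> homog A j" and n: "i + j = n"
 have "fst p \<in> homog A i \<and> snd p \<in> homog A (n - i)" if "sgl (a, b) p \<noteq> (0::'k)" for p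
  using that a b n by (auto simp: sgl_def split: if_splits)
 moreover have "sgl (a, b) \<in> carrier PT" using G.H_sub[OF a] G.H_sub[OF b] by (simp add: PT_closed)
 ultimately have "sgl (a, b) \<in> {f \<in> carrier PT. \<forall>p. f p \<noteq> 0 \<longrightarrow> (\<exists>i. fst p \<in> homog A i \<and> snd p \<in> homog A (n - i))}"
  by blast
 then show ?thesis unfolding homog_E pt_def by (rule imageI)
qed

lemma homog_E_closed: "X \<in> homog E n \<Longrightarrow> X \<in> \<E>"
 unfolding homog_E E_carrier by blast

lemma homog_E_finsum: "finite F \<Longrightarrow> (\<And>i. i \<in> F \<Longrightarrow> f i \<in> homog E n) \<Longrightarrow> (\<Oplus>\<^bsub>E\<^esub>i\<in>F. f i) \<in> homog E n"
proof (induction F rule: finite_induct)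
 case (insert x F)
 then have "f \<in> F \<rightarrow> \<E>" "f x \<in> \<E>" using homog_E_closed by blast+
 then show ?case using insert homog_E_add by (simp add: E.finsum_insert)
qed (simp add: homog_E_zero)

lemma E_gen_induct [consumes 1, case_names zero pt add]:
 assumes "X \<in> \<E>" and z: "P 0\<^sub>E"
  and p: "\<And>a b i j. a \<in> homog A i \<Longrightarrow> b \<in> homog A j \<Longrightarrow> P (pt a b)"
  and a: "\<And>X Y. X \<in> \<E> \<Longrightarrow> Y \<in> \<E> \<Longrightarrow> P X \<Longrightarrow> P Y \<Longrightarrow> P (X +\<^sub>E Y)"
 shows "P X"
proof -
 have fin: "P (\<Oplus>\<^bsub>E\<^esub>i\<in>F. f i)" if "finite F" "\<And>i. i \<in> F \<Longrightarrow> f i \<in> \<E>" "\<And>i. i \<in> F \<Longrightarrow> P (f i)" for F :: "int set" and f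
  using that
 proof (induction F rule: finite_induct)
  case (insert x F)
  then have "f \<in> F \<rightarrow> \<E>" "f x \<in> \<E>" "P (f x)" "P (\<Oplus>\<^bsub>E\<^esub>i\<in>F. f i)" by auto
  then show ?case using insert(1,2) a[of "f x"] E.finsum_closed[of f F] by (simp add: E.finsum_insert)
 qed (simp add: z)
 have half: "P (pt a b)" if aA: "a \<in> \<A>" and b: "b \<in> homog A j" for a b j
 proof -
  obtain N where N: "finite N" "a = (\<Oplus>\<^bsub>A\<^esub>n\<in>N. cmp n a)" using G.cmp_sum[OF aA] by (elim exE conjE)
  have bA: "b \<in> \<A>" using b by (rule G.H_sub)
  have "P (\<Oplus>\<^bsub>E\<^esub>n\<in>N. pt (cmp n a) b)"
   using N(1) by (rule fin) (use aA bA p[OF G.cmp_H[OF aA] b] in auto)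
  also have "(\<Oplus>\<^bsub>E\<^esub>n\<in>N. pt (cmp n a) b) = pt (\<Oplus>\<^bsub>A\<^esub>n\<in>N. cmp n a) b"
   by (rule pt_finsum_l[symmetric]) (use N aA bA in auto)
  finally show ?thesis using N(2) by (rule subst[OF sym, of _ _ "\<lambda>x. P (pt x b)", rotated])
 qed
 from \<open>X \<in> carrier E\<close> show ?thesis
 proof (induction X rule: E_induct)
  case (pt a b)
  obtain N where N: "finite N" "b = (\<Oplus>\<^bsub>A\<^esub>n\<in>N. cmp n b)" using G.cmp_sum[OF pt(2)] by (elim exE conjE)
  have "P (\<Oplus>\<^bsub>E\<^esub>n\<in>N. pt a (cmp n b))"
   using N(1) by (rule fin) (use pt half[OF pt(1) G.cmp_H[OF pt(2)]] in auto)
  also have "(\<Oplus>\<^bsub>E\<^esub>n\<in>N. pt a (cmp n b)) = pt a (\<Oplus>\<^bsub>A\<^esub>n\<in>N. cmp n b)"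
   by (rule pt_finsum_r[symmetric]) (use N pt in auto)
  finally show ?case using N(2) by (rule subst[OF sym, of _ _ "\<lambda>x. P (pt a x)", rotated])
 qed (use z a in auto)
qed

text \<open>A right factor \<open>wd t\<close> has degree |t|, so the left coordinate contributes
  its component of degree n - |t|; this vanishes for |t| > n, hence the finite range.\<close>

definition cmpE where
 "cmpE n X = (\<Oplus>\<^bsub>E\<^esub>t\<in>{t. length t \<le> nat n}. pt (cmp (n - int (length t)) (th t X)) (wd t))"

lemma cmpE_closed [simp]: "X \<in> \<E> \<Longrightarrow> cmpE n X \<in> \<E>"
 unfolding cmpE_def by (intro E.finsum_closed) auto

lemma cmpE_zero: "cmpE n 0\<^sub>E = 0\<^sub>E"
 by (simp add: cmpE_def th_zero pt_zero_l)

lemma cmpE_add: "X \<in> \<E> \<Longrightarrow> Y \<in> \<E> \<Longrightarrow> cmpE n (X +\<^sub>E Y) = cmpE n X +\<^sub>E cmpE n Y"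
 unfolding cmpE_def
 by (subst E.finsum_addf[symmetric]) (auto simp: th_add G.cmp_add pt_bilinear intro!: E.finsum_cong')

lemma cmpE_pt:
 assumes a: "a \<in> homog A i" and b: "b \<in> homog A j"
 shows "cmpE n (pt a b) = (if n = i + j then pt a b else 0\<^sub>E)"
proof -
 have ab: "a \<in> \<A>" "b \<in> \<A>" using a b G.H_sub by blast+
 have other: "pt (cmp (n - int (length t)) (th t (pt a b))) (wd t) = 0\<^sub>E" if "n \<noteq> i + j" for t
 proof (cases "int (length t) = j")
  case True
  then have "cmp (n - int (length t)) (co b t *\<^sub>A a) = 0\<^sub>A"
   using that by (intro G.cmp_other[OF smult_homog[OF a]]) auto
  then show ?thesis using ab by (simp add: th_pt pt_zero_l)
 qed (use ab b in \<open>simp add: th_pt co_homog_zero pt_zero_l\<close>)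
 show ?thesis
 proof (cases "n = i + j")
  case False then show ?thesis by (simp add: cmpE_def other)
 next
  case n: True
  show ?thesis
  proof (cases "i < 0 \<or> j < 0")
   case True
   then have "pt a b = 0\<^sub>E" using a b ab homog_neg by (auto simp: pt_zero_l pt_zero_r)
   then show ?thesis using n by (simp add: cmpE_zero)
  next
   case False
   have t: "pt (cmp (n - int (length t)) (th t (pt a b))) (wd t) = pt (th t (pt a b)) (wd t)" for t
   proof (cases "int (length t) = j")
    case True
    then have "cmp (n - int (length t)) (co b t *\<^sub>A a) = co b t *\<^sub>A a"
     using n by (intro G.cmp_same) (simp add: smult_homog[OF a])
    then show ?thesis using ab by (simp add: th_pt)
   qed (use ab b in \<open>simp add: th_pt co_homog_zero\<close>)
   obtain N where N: "\<And>M. M \<ge> N \<Longrightarrow> pt a b = (\<Oplus>\<^bsub>E\<^esub>t\<in>{t. length t \<le> M}. pt (th t (pt a b)) (wd t))"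
    using E_expand[OF pt_closed[OF ab]] by (elim exE) auto
   have "cmpE n (pt a b) = (\<Oplus>\<^bsub>E\<^esub>t\<in>{t. length t \<le> nat n}. pt (th t (pt a b)) (wd t))"
    by (simp add: cmpE_def t)
   also have "\<dots> = (\<Oplus>\<^bsub>E\<^esub>t\<in>{t. length t \<le> max N (nat n)}. pt (th t (pt a b)) (wd t))"
    using False n ab b
    by (intro E.finsum_superset) (auto simp: th_pt co_homog_zero pt_zero_l smult_A)
   also have "\<dots> = pt a b" by (rule N[symmetric]) simp
   finally show ?thesis using n by simp
  qed
 qed
qed

lemma th_homog: "X \<in> homog E n \<Longrightarrow> th t X \<in> homog A (n - int (length t))"
proof (induction X rule: E_homog_induct)
 case (pt a b i)
 then have ab: "a \<in> \<A>" "b \<in> \<A>" using G.H_sub by blast+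
 show ?case
 proof (cases "int (length t) = n - i")
  case True
  then show ?thesis using ab smult_homog[OF pt(1), of "co b t"] by (simp add: th_pt)
 qed (use ab pt G.H_zero in \<open>simp add: th_pt co_homog_zero\<close>)
qed (simp_all add: th_zero th_add G.H_zero G.H_add)

lemma E_graded: "graded_ring E cmpE"
proof (intro graded_ring.intro graded_group.intro graded_group_axioms.intro graded_ring_axioms.intro)
 show "ring E" "abelian_group E" by (rule E.ring_axioms E.abelian_group_axioms)+
 show "X \<in> \<E>" if "X \<in> homog E n" for X n using that by (rule homog_E_closed)
 show "cmpE n X \<in> homog E n" if X: "X \<in> \<E>" for X n
  unfolding cmpE_def
  by (intro homog_E_finsum finite_words_le homog_E_pt[OF G.cmp_H[OF th_closed[OF X]] wd_homog]) simp
 show "cmpE n (X +\<^sub>E Y) = cmpE n X +\<^sub>E cmpE n Y" if "X \<in> \<E>" "Y \<in> \<E>" for n X Y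
  using that by (rule cmpE_add)
 show "cmpE n X = X" if "X \<in> homog E n" for n X using that
  by (induction X rule: E_homog_induct) (simp_all add: cmpE_zero cmpE_add cmpE_pt)
 show "cmpE m X = 0\<^sub>E" if "X \<in> homog E n" "m \<noteq> n" for m n X using that
  by (induction X rule: E_homog_induct) (simp_all add: cmpE_zero cmpE_add cmpE_pt)
 show "\<exists>N. finite N \<and> (\<forall>n. n \<notin> N \<longrightarrow> cmpE n X = 0\<^sub>E) \<and> X = (\<Oplus>\<^bsub>E\<^esub>n\<in>N. cmpE n X)" if "X \<in> \<E>" for X using that
 proof (induction X rule: E_gen_induct)
  case zero
  show ?case by (intro exI[of _ "{}"]) (simp add: cmpE_zero)
 next
  case (pt a b i j)
  then have ab: "a \<in> \<A>" "b \<in> \<A>" using G.H_sub by blast+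
  show ?case by (intro exI[of _ "{i + j}"]) (use pt ab in \<open>simp add: cmpE_pt\<close>)
 next
  case (add X Y)
  from add(3) obtain N1 where N1: "finite N1" "\<forall>n. n \<notin> N1 \<longrightarrow> cmpE n X = 0\<^sub>E" "X = (\<Oplus>\<^bsub>E\<^esub>n\<in>N1. cmpE n X)" by (elim exE conjE)
  from add(4) obtain N2 where N2: "finite N2" "\<forall>n. n \<notin> N2 \<longrightarrow> cmpE n Y = 0\<^sub>E" "Y = (\<Oplus>\<^bsub>E\<^esub>n\<in>N2. cmpE n Y)" by (elim exE conjE)
  let ?N = "N1 \<union> N2"
  have fin: "finite ?N" using N1 N2 by simp
  have X: "X = (\<Oplus>\<^bsub>E\<^esub>n\<in>?N. cmpE n X)"
   by (rule trans[OF N1(3)], rule E.finsum_superset) (use fin N1 add in auto)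
  have Y: "Y = (\<Oplus>\<^bsub>E\<^esub>n\<in>?N. cmpE n Y)"
   by (rule trans[OF N2(3)], rule E.finsum_superset) (use fin N2 add in auto)
  have "X +\<^sub>E Y = (\<Oplus>\<^bsub>E\<^esub>n\<in>?N. cmpE n X) +\<^sub>E (\<Oplus>\<^bsub>E\<^esub>n\<in>?N. cmpE n Y)"
   by (rule arg_cong2[where f = "add E"], rule X, rule Y)
  also have "\<dots> = (\<Oplus>\<^bsub>E\<^esub>n\<in>?N. cmpE n (X +\<^sub>E Y))"
   using add by (simp add: cmpE_add E.finsum_addf)
  finally have s: "X +\<^sub>E Y = (\<Oplus>\<^bsub>E\<^esub>n\<in>?N. cmpE n (X +\<^sub>E Y))" .
  have "\<forall>n. n \<notin> ?N \<longrightarrow> cmpE n (X +\<^sub>E Y) = 0\<^sub>E"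
   using N1(2) N2(2) add(1,2) by (simp add: cmpE_add)
  with fin s show ?case by (intro exI[of _ ?N] conjI)
 qed
 show "X \<cdot>\<^sub>E Y \<in> homog E (i + j)" if X: "X \<in> homog E i" and Y: "Y \<in> homog E j" for X Y i j
  using X
 proof (induction X rule: E_homog_induct)
  case zero show ?case using homog_E_closed[OF Y] by (simp add: homog_E_zero)
 next
  case (pt a b p)
  show ?case using Y
  proof (induction Y rule: E_homog_induct)
   case zero show ?case using pt G.H_sub by (simp add: homog_E_zero)
  next
   case (pt a' b' q)
   have "pt (a \<cdot> a') (b' \<cdot> b) \<in> homog E (i + j)"
    by (rule homog_E_pt[OF G.homog_mult[OF \<open>a \<in> homog A p\<close> pt(1)] G.homog_mult[OF pt(2) \<open>b \<in> homog A (i - p)\<close>]]) simp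
   then show ?case using pt \<open>a \<in> homog A p\<close> \<open>b \<in> homog A (i - p)\<close> G.H_sub by (simp add: pt_mult)
  next
   case (add X Y)
   have "pt a b \<in> \<E>" using pt G.H_sub by simp
   then show ?case using add by (simp add: E.r_distr homog_E_add)
  qed
 next
  case (add X' Y')
  then show ?case using homog_E_closed[OF Y] by (simp add: E.l_distr homog_E_add)
 qed
 show "\<one>\<^bsub>E\<^esub> \<in> homog E 0" unfolding pt_one by (rule homog_E_pt[OF G.one_homog G.one_homog]) simp
qed

sublocale GE: graded_ring E cmpE by (rule E_graded)

section \<open>A as a module over its enveloping algebra\<close>

abbreviation M where "M \<equiv> env_regular A"
abbreviation act (infixr "\<rhd>" 70) where "X \<rhd> m \<equiv> smult M X m"

lemma M_simps [simp]: "carrier M = \<A>" "add M = add A" "zero M = zero A" "homog M = homog A"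
 by (simp_all add: env_regular_def)

lemma act_bilin: "m \<in> \<A> \<Longrightarrow> bilin (\<lambda>p. co (fst p \<cdot> m \<cdot> snd p) s)"
 by (auto simp: bilin_def A.l_distr A.r_distr co_linear smult_A)

text \<open>The action is computed from a chosen representative, but each coordinate of the result
  is the value of a bilinear function, and \<open>ev\<close> makes that independent of the
  choice.\<close>

lemma act_rep:
 assumes X: "X \<in> \<E>" and m: "m \<in> \<A>"
 shows "X \<rhd> m \<in> \<A>" "co (X \<rhd> m) s = ev (\<lambda>p. co (fst p \<cdot> m \<cdot> snd p) s) X"
proof -
 let ?f = "SOME f. f \<in> X"
 obtain f where f: "f \<in> carrier PT" "X = ecl f" using X by (auto simp: E_carrier)
 have fc: "?f \<in> carrier PT" unfolding f(2) by (rule ecl_rep[OF f(1)])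
 have c: "?f p *\<^sub>A (fst p \<cdot> m \<cdot> snd p) \<in> \<A>" if "?f p \<noteq> 0" for p
  using PT_supp[OF fc that] m by (auto simp: smult_A)
 have e: "X \<rhd> m = (\<Oplus>\<^bsub>A\<^esub>p\<in>{p. ?f p \<noteq> 0}. ?f p *\<^sub>A (fst p \<cdot> m \<cdot> snd p))"
  by (simp add: env_regular_def Let_def)
 show "X \<rhd> m \<in> \<A>" unfolding e by (rule A.finsum_closed) (use c in auto)
 have "co (X \<rhd> m) s = (\<Sum>p\<in>{p. ?f p \<noteq> 0}. co (?f p *\<^sub>A (fst p \<cdot> m \<cdot> snd p)) s)"
  unfolding e by (rule co_finsum) (use c PT_fin[OF fc] in auto)
 also have "\<dots> = (\<Sum>p\<in>{p. ?f p \<noteq> 0}. ?f p * co (fst p \<cdot> m \<cdot> snd p) s)"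
  by (intro sum.cong refl co_linear) (use PT_supp[OF fc] m in auto)
 finally show "co (X \<rhd> m) s = ev (\<lambda>p. co (fst p \<cdot> m \<cdot> snd p) s) X"
  by (simp add: ev_def pr_def)
qed

lemma act_add: "X \<in> \<E> \<Longrightarrow> Y \<in> \<E> \<Longrightarrow> m \<in> \<A> \<Longrightarrow> (X +\<^sub>E Y) \<rhd> m = X \<rhd> m +\<^sub>A Y \<rhd> m"
 by (rule co_inj) (simp_all add: act_rep co_linear ev_simps act_bilin)

lemma act_pt: "a \<in> \<A> \<Longrightarrow> b \<in> \<A> \<Longrightarrow> m \<in> \<A> \<Longrightarrow> pt a b \<rhd> m = a \<cdot> m \<cdot> b"
 by (rule co_inj) (simp_all add: act_rep ev_simps act_bilin)

lemma act_zero: "m \<in> \<A> \<Longrightarrow> 0\<^sub>E \<rhd> m = 0\<^sub>A"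
 using act_pt[of "0\<^sub>A" "0\<^sub>A" m] by (simp add: pt_zero_l)

lemma act_add_r: "X \<in> \<E> \<Longrightarrow> m \<in> \<A> \<Longrightarrow> m' \<in> \<A> \<Longrightarrow> X \<rhd> (m +\<^sub>A m') = X \<rhd> m +\<^sub>A X \<rhd> m'"
 by (induction X rule: E_induct)
  (simp_all add: act_zero act_pt act_add act_rep A.l_distr A.r_distr A.a_ac)

lemma act_mult: "X \<in> \<E> \<Longrightarrow> Y \<in> \<E> \<Longrightarrow> m \<in> \<A> \<Longrightarrow> (X \<cdot>\<^sub>E Y) \<rhd> m = X \<rhd> (Y \<rhd> m)"
proof (induction X rule: E_induct)
 case (pt a b)
 from pt(3,1,2,4) show ?case
 proof (induction Y rule: E_induct)
  case zero
  then show ?case using act_add_r[of "pt a b" "0\<^sub>A"] by (simp add: act_zero act_pt)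
 qed (simp_all add: pt_mult act_pt act_add act_add_r act_rep A.m_assoc E.r_distr)
qed (simp_all add: act_zero act_add act_rep E.l_distr)

lemma M_graded: "graded_left_module E M"
proof -
 have ab: "abelian_group M" by (rule abelian_group_cong[OF A.abelian_group_axioms]) simp_all
 then interpret M: abelian_group M .
 have l: "left_module E M" unfolding left_module_def left_module_axioms_def
  using E.ring_axioms ab by (simp add: act_rep act_add act_add_r act_mult pt_one act_pt)
 have fs: "(\<Oplus>\<^bsub>M\<^esub>i\<in>F. f i) = (\<Oplus>\<^bsub>A\<^esub>i\<in>F. f i)" if "finite F" "\<And>i. i \<in> F \<Longrightarrow> f i \<in> \<A>" for F :: "int set" and f
  using that
 proof (induction F rule: finite_induct)
  case (insert x F)
  then have "(\<Oplus>\<^bsub>M\<^esub>i\<in>insert x F. f i) = f x \<oplus>\<^bsub>M\<^esub> (\<Oplus>\<^bsub>M\<^esub>i\<in>F. f i)"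
   by (intro M.finsum_insert) auto
  moreover have "(\<Oplus>\<^bsub>A\<^esub>i\<in>insert x F. f i) = f x +\<^sub>A (\<Oplus>\<^bsub>A\<^esub>i\<in>F. f i)"
   using insert by (intro A.finsum_insert) auto
  ultimately show ?case using insert by simp
 qed simp
 have gg: "graded_group M (homog M) cmp"
 proof (intro graded_group.intro graded_group_axioms.intro ab)
  fix x assume x: "x \<in> carrier M"
  then obtain N where N: "finite N" "\<forall>n. n \<notin> N \<longrightarrow> cmp n x = 0\<^sub>A" "x = (\<Oplus>\<^bsub>A\<^esub>n\<in>N. cmp n x)"
   using G.cmp_sum[of x] unfolding M_simps by (elim meta_impE exE conjE) assumption+
  have "(\<Oplus>\<^bsub>M\<^esub>n\<in>N. cmp n x) = (\<Oplus>\<^bsub>A\<^esub>n\<in>N. cmp n x)" by (rule fs) (use N(1) x in auto)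
  with N(3) have "x = (\<Oplus>\<^bsub>M\<^esub>n\<in>N. cmp n x)" by (rule trans[OF _ sym])
  with N(1,2) show "\<exists>N. finite N \<and> (\<forall>n. n \<notin> N \<longrightarrow> cmp n x = \<zero>\<^bsub>M\<^esub>) \<and> x = (\<Oplus>\<^bsub>M\<^esub>n\<in>N. cmp n x)"
   unfolding M_simps by (intro exI[of _ N] conjI)
 qed (simp_all add: G.H_sub G.cmp_H G.cmp_add G.cmp_same G.cmp_other)
 then interpret MG: graded_group M "homog M" cmp .
 have h: "X \<rhd> x \<in> homog A (i + j)" if "X \<in> homog E i" and x: "x \<in> homog A j" for X x i j
  using that(1)
 proof (induction X rule: E_homog_induct)
  case (pt a b p)
  have "a \<cdot> x \<cdot> b \<in> homog A (p + j + (i - p))" by (intro G.homog_mult pt x)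
  then show ?case using pt x G.H_sub by (simp add: act_pt ac_simps)
 qed (use G.H_sub[OF x] in \<open>simp_all add: act_zero act_add G.H_zero G.H_add\<close>)
 show ?thesis unfolding graded_left_module_def graded_left_module_axioms_def
  using l h MG.H_subgroup MG.direct_sum by simp
qed

section \<open>The bimodule Koszul complex\<close>

lemma vc_minus: "\<ominus>\<^bsub>A\<^esub> vc v = vc (\<lambda>x. - v x)"
 using vc_smult[of "- 1" v] by (simp add: smult_A_minus)

lemma co_vc: "co (vc v) t = (case t of [y] \<Rightarrow> v y | _ \<Rightarrow> 0)"
proof (cases "length t < 2")
 case True
 then show ?thesis by (simp add: vc_def co_cls vec_TT co_low vec_tensor_def)
next
 case False
 then have "co (vc v) t = 0" by (intro co_homog[OF vc_homog]) auto
 then show ?thesis using False by (auto split: list.splits)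
qed

abbreviation KB where "KB n \<equiv> free_mod E (wm n) (int n)"

definition lfac where "lfac v = pt (vc v) 1\<^sub>A"
definition rfac where "rfac v = pt 1\<^sub>A (vc v)"

lemma fac_closed [simp]: "lfac v \<in> \<E>" "rfac v \<in> \<E>"
 by (simp_all add: lfac_def rfac_def)

lemma fac_homog: "lfac v \<in> homog E 1" "rfac v \<in> homog E 1"
 unfolding lfac_def rfac_def
 by (rule homog_E_pt[OF vc_homog G.one_homog] homog_E_pt[OF G.one_homog vc_homog], simp)+

lemma fac_mult: "lfac u \<cdot>\<^sub>E lfac v = pt (vc u \<cdot> vc v) 1\<^sub>A" "rfac u \<cdot>\<^sub>E rfac v = pt 1\<^sub>A (vc v \<cdot> vc u)"
 "lfac u \<cdot>\<^sub>E rfac v = pt (vc u) (vc v)" "rfac v \<cdot>\<^sub>E lfac u = pt (vc u) (vc v)"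
 by (simp_all add: lfac_def rfac_def pt_mult)

text \<open>The sign alternates with n, so the mixed terms in the square of the differential cancel;
  for n = 0 it gives the commutator \<open>x \<otimes> 1 - 1 \<otimes> x\<close>, which
  multiplication kills.\<close>

definition srho where "srho n i j = (\<lambda>x. (-1) ^ Suc n * rho n i j x)"

text \<open>Under \<open>A \<otimes> W n \<otimes> A = E \<otimes> W n\<close> the differential
  moves the first letter of a tensor into the left coefficient and, up to sign, the last letter into
  the right one.\<close>

definition brow where
 "brow n i j = (if j < wm n then lfac (lam n i j) +\<^sub>E rfac (srho n i j) else 0\<^sub>E)"

definition bd where "bd n = lcomb (wm (Suc n)) (KB n) (brow n)"

lemma KB_left: "left_module E (KB n)" by (rule free_left_module[OF E.ring_axioms])

lemma brow_homog: "brow n i \<in> homog (KB n) (int (Suc n))"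
 using fac_homog by (auto simp: free_homog brow_def homog_E_add)

lemma brow_closed: "brow n i \<in> carrier (KB n)"
 by (auto simp: free_carrier brow_def)

lemma bd_graded: "bd n \<in> graded_maps E (KB (Suc n)) (KB n)"
 unfolding bd_def by (rule GE.lcomb_graded[OF GE.free_graded brow_homog])

lemmas bd_lin = graded_mapsD(1)[OF bd_graded]

lemma KB_coord: "x \<in> carrier (KB n) \<Longrightarrow> x i \<in> \<E>"
 by (rule free_coord[OF E.ring_axioms])

lemma bd_coord:
 assumes x: "x \<in> carrier (KB (Suc n))" and j: "j < wm n"
 shows "bd n x j = (\<Oplus>\<^bsub>E\<^esub>i\<in>{..<wm (Suc n)}. x i \<cdot>\<^sub>E lfac (lam n i j) +\<^sub>E x i \<cdot>\<^sub>E rfac (srho n i j))"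
proof -
 interpret Kn: left_module E "KB n" by (rule KB_left)
 have "bd n x = (\<lambda>j. \<Oplus>\<^bsub>E\<^esub>i\<in>{..<wm (Suc n)}. x i \<cdot>\<^sub>E brow n i j)"
  unfolding bd_def lcomb_def
  by (subst free_finsum[OF E.ring_axioms]) (use Kn.smult_closed brow_closed KB_coord[OF x] in auto)
 then show ?thesis
  using j KB_coord[OF x] by (simp add: brow_def E.r_distr)
qed

lemma bd_fe: "i < wm (Suc n) \<Longrightarrow> bd n (fe E i) = brow n i"
 unfolding bd_def by (rule lcomb_fe[OF E.ring_axioms KB_left brow_closed])

lemma bd_out: "x \<in> carrier (KB (Suc n)) \<Longrightarrow> j \<ge> wm n \<Longrightarrow> bd n x j = 0\<^sub>E"
 using lin_mapsD(1)[OF bd_lin, of x n] by (simp add: free_carrier)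

text \<open>On one-letter words t the coordinate is, up to sign, the difference of the two sides of
  \<open>lam_rho\<close>, the signs of \<open>srho\<close> in consecutive degrees being opposite; on
  other words the right factors, being vectors, have coordinate zero.\<close>

lemma cross_zero:
 assumes i: "i < wm (Suc (Suc n))" and k: "k < wm n"
 shows "(\<Oplus>\<^bsub>E\<^esub>j\<in>{..<wm (Suc n)}. pt (vc (lam (Suc n) i j)) (vc (srho n j k)) +\<^sub>E
  pt (vc (lam n j k)) (vc (srho (Suc n) i j))) = 0\<^sub>E" (is "?X = _")
proof (rule E_zeroI)
 show "?X \<in> \<E>" by (intro E.finsum_closed) auto
 fix t
 have "th t ?X = (\<Oplus>\<^bsub>A\<^esub>j\<in>{..<wm (Suc n)}. vc (\<lambda>x. co (vc (srho n j k)) t * lam (Suc n) i j x +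
   co (vc (srho (Suc n) i j)) t * lam n j k x))"
  by (subst th_finsum) (auto simp: th_add th_pt vc_smult vc_add intro!: A.finsum_cong')
 also have "\<dots> = vc (\<lambda>x. \<Sum>j<wm (Suc n). co (vc (srho n j k)) t * lam (Suc n) i j x +
   co (vc (srho (Suc n) i j)) t * lam n j k x)"
  by (rule vc_finsum) simp
 also have "(\<lambda>x. \<Sum>j<wm (Suc n). co (vc (srho n j k)) t * lam (Suc n) i j x +
   co (vc (srho (Suc n) i j)) t * lam n j k x) = (\<lambda>x. 0)"
 proof (cases "\<exists>y. t = [y]")
  case True
  then obtain y where t: "t = [y]" by blast
  have "(\<Sum>j<wm (Suc n). co (vc (srho n j k)) t * lam (Suc n) i j x +
    co (vc (srho (Suc n) i j)) t * lam n j k x) =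
   (-1) ^ Suc n * ((\<Sum>j<wm (Suc n). lam (Suc n) i j x * rho n j k y) -
    (\<Sum>j<wm (Suc n). rho (Suc n) i j y * lam n j k x))" for x
   unfolding t co_vc srho_def
   by (simp add: sum_distrib_left sum_subtractf[symmetric] sum_negf[symmetric] algebra_simps sum.distrib[symmetric])
  then show ?thesis by (simp only: lam_rho[OF i k]) simp
 next
  case False
  then have "co (vc v) t = 0" for v by (auto simp: co_vc split: list.splits)
  then show ?thesis by simp
 qed
 finally show "th t ?X = 0\<^sub>A" by (simp add: vc_zero)
qed

text \<open>The product of two differentials has four parts: the two left letters and the two right
  letters give relations, by \<open>lam_lam_R\<close> and \<open>rho_rho_R\<close>, and the mixed
  parts cancel by \<open>cross_zero\<close>.\<close>

lemma brow_brow: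
 assumes i: "i < wm (Suc (Suc n))" and k: "k < wm n"
 shows "(\<Oplus>\<^bsub>E\<^esub>j\<in>{..<wm (Suc n)}. brow (Suc n) i j \<cdot>\<^sub>E brow n j k) = 0\<^sub>E"
proof -
 let ?J = "{..<wm (Suc n)}"
 have L: "(\<Oplus>\<^bsub>E\<^esub>j\<in>?J. lfac (lam (Suc n) i j) \<cdot>\<^sub>E lfac (lam n j k)) = 0\<^sub>E"
 proof -
  have "(\<Oplus>\<^bsub>E\<^esub>j\<in>?J. lfac (lam (Suc n) i j) \<cdot>\<^sub>E lfac (lam n j k)) =
    pt (\<Oplus>\<^bsub>A\<^esub>j\<in>?J. vc (lam (Suc n) i j) \<cdot> vc (lam n j k)) 1\<^sub>A"
   unfolding fac_mult by (rule pt_finsum_l[symmetric]) auto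
  also have "(\<Oplus>\<^bsub>A\<^esub>j\<in>?J. vc (lam (Suc n) i j) \<cdot> vc (lam n j k)) = 0\<^sub>A"
   by (subst vc_mult_sum_zero) (use lam_lam_R[OF i k] in auto)
  finally show ?thesis by (simp add: pt_zero_l)
 qed
 have R: "(\<Oplus>\<^bsub>E\<^esub>j\<in>?J. rfac (srho (Suc n) i j) \<cdot>\<^sub>E rfac (srho n j k)) = 0\<^sub>E"
 proof -
  have "(\<Oplus>\<^bsub>E\<^esub>j\<in>?J. rfac (srho (Suc n) i j) \<cdot>\<^sub>E rfac (srho n j k)) =
    pt 1\<^sub>A (\<Oplus>\<^bsub>A\<^esub>j\<in>?J. vc (srho n j k) \<cdot> vc (srho (Suc n) i j))"
   unfolding fac_mult by (rule pt_finsum_r[symmetric]) auto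
  also have "(\<Oplus>\<^bsub>A\<^esub>j\<in>?J. vc (srho n j k) \<cdot> vc (srho (Suc n) i j)) =
    (\<Oplus>\<^bsub>A\<^esub>j\<in>?J. vc (\<lambda>x. - rho n j k x) \<cdot> vc (rho (Suc n) i j))"
  proof (intro A.finsum_cong' refl)
   fix j
   have "srho n j k = (\<lambda>x. (-1) ^ Suc n * rho n j k x)" "srho (Suc n) i j = (\<lambda>x. (-1) ^ n * rho (Suc n) i j x)"
    by (simp_all add: srho_def)
   then have e: "vc (srho n j k) = (-1) ^ Suc n *\<^sub>A vc (rho n j k)" "vc (srho (Suc n) i j) = (-1) ^ n *\<^sub>A vc (rho (Suc n) i j)"
    by (simp_all only: vc_smult)
   have sg: "(-1) ^ n * (-1) ^ Suc n = (- 1 :: 'k)" by (simp add: power_mult_distrib[symmetric])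
   have "vc (srho n j k) \<cdot> vc (srho (Suc n) i j) = ((-1) ^ n * (-1) ^ Suc n) *\<^sub>A (vc (rho n j k) \<cdot> vc (rho (Suc n) i j))"
    unfolding e by (simp add: smult_A mult.commute del: power_Suc)
   also have "\<dots> = ((- 1) *\<^sub>A vc (rho n j k)) \<cdot> vc (rho (Suc n) i j)" unfolding sg by (simp add: smult_A)
   finally show "vc (srho n j k) \<cdot> vc (srho (Suc n) i j) = vc (\<lambda>x. - rho n j k x) \<cdot> vc (rho (Suc n) i j)"
    by (simp add: vc_smult)
  qed auto
  also have "\<dots> = 0\<^sub>A"
  proof (subst vc_mult_sum_zero)
   have "(\<lambda>s. \<Sum>j<wm (Suc n). (vec_tensor (\<lambda>x. - rho n j k x) \<star> vec_tensor (rho (Suc n) i j)) s) =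
     (\<lambda>s. (-1) * (\<Sum>j<wm (Suc n). (vec_tensor (rho n j k) \<star> vec_tensor (rho (Suc n) i j)) s))"
   proof -
    have "vec_tensor (\<lambda>x. - v x) = (\<lambda>s. (-1) * vec_tensor v s)" for v :: "'n \<Rightarrow> 'k"
     by (auto simp: vec_tensor_def fun_eq_iff split: list.splits)
    then show ?thesis by (simp only: TT_mult_linear(2) sum_distrib_left)
   qed
   moreover have "(\<lambda>s. (-1) * (\<Sum>j<wm (Suc n). (vec_tensor (rho n j k) \<star> vec_tensor (rho (Suc n) i j)) s)) \<in> R"
    by (rule R_subsp[unfolded subsp_def, THEN conjunct2, THEN conjunct2, rule_format, OF rho_rho_R[OF i k]])
   ultimately show "(\<lambda>s. \<Sum>j<wm (Suc n). (vec_tensor (\<lambda>x. - rho n j k x) \<star> vec_tensor (rho (Suc n) i j)) s) \<in> R"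
    by (simp only:)
  qed auto
  finally show ?thesis by (simp add: pt_zero_r)
 qed
 have "(\<Oplus>\<^bsub>E\<^esub>j\<in>?J. brow (Suc n) i j \<cdot>\<^sub>E brow n j k) =
   (\<Oplus>\<^bsub>E\<^esub>j\<in>?J. (lfac (lam (Suc n) i j) \<cdot>\<^sub>E lfac (lam n j k) +\<^sub>E rfac (srho (Suc n) i j) \<cdot>\<^sub>E rfac (srho n j k)) +\<^sub>E
    (pt (vc (lam (Suc n) i j)) (vc (srho n j k)) +\<^sub>E pt (vc (lam n j k)) (vc (srho (Suc n) i j))))"
 proof (intro E.finsum_cong' refl)
  fix j assume "j \<in> ?J"
  then show "brow (Suc n) i j \<cdot>\<^sub>E brow n j k = (lfac (lam (Suc n) i j) \<cdot>\<^sub>E lfac (lam n j k) +\<^sub>E rfac (srho (Suc n) i j) \<cdot>\<^sub>E rfac (srho n j k)) +\<^sub>E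
    (pt (vc (lam (Suc n) i j)) (vc (srho n j k)) +\<^sub>E pt (vc (lam n j k)) (vc (srho (Suc n) i j)))"
   using k by (simp add: brow_def E.l_distr E.r_distr E.a_ac fac_mult)
 qed auto
 also have "\<dots> = 0\<^sub>E" by (simp add: E.finsum_addf L R cross_zero[OF i k])
 finally show ?thesis .
qed

lemma bd_bd: "x \<in> carrier (KB (Suc (Suc n))) \<Longrightarrow> bd n (bd (Suc n) x) = \<zero>\<^bsub>KB n\<^esub>"
proof -
 assume x: "x \<in> carrier (KB (Suc (Suc n)))"
 have z: "(\<lambda>x. \<zero>\<^bsub>KB n\<^esub>) \<in> lin_maps E (KB (Suc (Suc n))) (KB n)"
 proof -
  interpret Kn: left_module E "KB n" by (rule KB_left)
  show ?thesis using Kn.smult_r_zero by (intro lin_mapsI) (auto simp: free_carrier)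
 qed
 show ?thesis
 proof (rule free_lin_ext[OF E.ring_axioms KB_left lin_maps_comp[OF bd_lin bd_lin] z _ x])
  fix i assume i: "i < wm (Suc (Suc n))"
  show "bd n (bd (Suc n) (fe E i)) = \<zero>\<^bsub>KB n\<^esub>"
  proof
   fix k
   have "bd n (brow (Suc n) i) k = 0\<^sub>E"
   proof (cases "k < wm n")
    case True
    have "bd n (brow (Suc n) i) k = (\<Oplus>\<^bsub>E\<^esub>j\<in>{..<wm (Suc n)}. brow (Suc n) i j \<cdot>\<^sub>E brow n j k)"
     unfolding bd_coord[OF brow_closed True]
     using KB_coord[OF brow_closed] True by (intro E.finsum_cong') (auto simp: brow_def[of n] E.r_distr)
    then show ?thesis using brow_brow[OF i True] by simp
   qed (simp add: bd_out[OF brow_closed])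
   then show "bd n (bd (Suc n) (fe E i)) k = \<zero>\<^bsub>KB n\<^esub> k" by (simp add: bd_fe[OF i])
  qed
 qed
qed

definition epsE where "epsE x = x 0 \<rhd> 1\<^sub>A"

lemma epsE_graded: "epsE \<in> graded_maps E (KB 0) M"
proof -
 interpret M: graded_left_module E M by (rule M_graded)
 have "epsE \<in> lin_maps E (KB 0) M"
  unfolding epsE_def by (rule lin_mapsI) (auto simp: act_rep act_add act_mult KB_coord[of _ 0, simplified])
 moreover have "epsE x \<in> homog M n" if "x \<in> homog (KB 0) n" for x n
  using that M.homog_smult[of "x 0" n "1\<^sub>A" 0] G.one_homog by (simp add: free_homog wm_0 epsE_def)
 ultimately show ?thesis by (auto simp: graded_maps_def)
qed

lemma epsE_bd: "x \<in> carrier (KB (Suc 0)) \<Longrightarrow> epsE (bd 0 x) = 0\<^sub>A"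
proof -
 assume x: "x \<in> carrier (KB (Suc 0))"
 interpret M: graded_left_module E M by (rule M_graded)
 have z: "(\<lambda>x. \<zero>\<^bsub>M\<^esub>) \<in> lin_maps E (KB (Suc 0)) M"
  using M.smult_r_zero by (intro lin_mapsI) auto
 have "epsE (bd 0 x) = \<zero>\<^bsub>M\<^esub>"
 proof (rule free_lin_ext[OF E.ring_axioms M.left_module_axioms lin_maps_comp[OF bd_lin graded_mapsD(1)[OF epsE_graded]] z _ x])
  fix i assume i: "i < wm (Suc 0)"
  have "lam 0 i 0 y = rho 0 i 0 y" for y
   using wb_left[OF i, of y "[]"] wb_right[OF i, of "[]" y] by (simp add: wm_0 wb_0)  (simp add: sgl_def)
  then have "srho 0 i 0 = (\<lambda>y. - lam 0 i 0 y)" by (simp add: srho_def)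
  then have "brow 0 i 0 \<rhd> 1\<^sub>A = vc (lam 0 i 0) +\<^sub>A vc (\<lambda>y. - lam 0 i 0 y)"
   by (simp add: brow_def wm_0 act_add act_pt lfac_def rfac_def)
  then show "epsE (bd 0 (fe E i)) = \<zero>\<^bsub>M\<^esub>" using i by (simp add: bd_fe epsE_def vc_add vc_zero)
 qed
 then show ?thesis by simp
qed

text \<open>Exactness of the bimodule complex is reduced to that of the one-sided Koszul complex by filtering
 \<open>A \<otimes> A\<close> by the degree of the right factor: the term of lowest such degree of a cycle consists of
 one-sided cycles, and correcting it by a boundary raises that degree.\<close>

definition ord_ge where "ord_ge q X \<longleftrightarrow> (\<forall>t. length t < q \<longrightarrow> th t X = 0\<^sub>A)"

lemma co_wd: "length s \<noteq> length t \<Longrightarrow> co (wd t) s = 0"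
 by (rule co_homog[OF wd_homog]) auto

text \<open>Apply \<open>th s\<close> to the expansion of X; only words of the length of s count. As
  the classes \<open>wd t\<close> may be dependent, the coordinates of an element satisfy this
  consistency condition, whereas arbitrary families need not.\<close>

lemma th_self:
 assumes X: "X \<in> \<E>"
 shows "th s X = (\<Oplus>\<^bsub>A\<^esub>t\<in>{t. length t = length s}. co (wd t) s *\<^sub>A th t X)"
proof -
 obtain N where N: "\<And>M. M \<ge> N \<Longrightarrow> X = (\<Oplus>\<^bsub>E\<^esub>t\<in>{t. length t \<le> M}. pt (th t X) (wd t))"
  using E_expand[OF X] by (elim exE) auto
 define L where "L = max N (length s)"
 have "th s X = th s (\<Oplus>\<^bsub>E\<^esub>t\<in>{t. length t \<le> L}. pt (th t X) (wd t))"
  by (rule arg_cong[where f = "th s"], rule N) (simp add: L_def)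
 also have "\<dots> = (\<Oplus>\<^bsub>A\<^esub>t\<in>{t. length t \<le> L}. co (wd t) s *\<^sub>A th t X)"
  using X by (subst th_finsum) (auto simp: th_pt smult_A intro!: A.finsum_cong')
 also have "\<dots> = (\<Oplus>\<^bsub>A\<^esub>t\<in>{t. length t = length s}. co (wd t) s *\<^sub>A th t X)"
  by (rule A.finsum_superset[symmetric]) (use X in \<open>auto simp: co_wd smult_A L_def\<close>)
 finally show ?thesis .
qed

text \<open>Multiplication by \<open>rfac v\<close> lengthens the right factor by one, so an element
  of order q contributes nothing up to length q. In lowest order only the left half of the bimodule
  differential is visible, which is \<open>kd\<close>.\<close>

lemma th_rfac:
 assumes X: "X \<in> \<E>" and o: "ord_ge q X" and t: "length t \<le> q"
 shows "th t (X \<cdot>\<^sub>E rfac v) = 0\<^sub>A"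
proof -
 obtain N where N: "\<And>M. M \<ge> N \<Longrightarrow> X = (\<Oplus>\<^bsub>E\<^esub>t\<in>{t. length t \<le> M}. pt (th t X) (wd t))"
  using E_expand[OF X] by (elim exE) auto
 have "X \<cdot>\<^sub>E rfac v = (\<Oplus>\<^bsub>E\<^esub>s\<in>{s. length s \<le> N}. pt (th s X) (wd s)) \<cdot>\<^sub>E rfac v"
  by (rule arg_cong[where f = "\<lambda>Y. Y \<cdot>\<^sub>E rfac v"], rule N) simp
 also have "\<dots> = (\<Oplus>\<^bsub>E\<^esub>s\<in>{s. length s \<le> N}. pt (th s X) (vc v \<cdot> wd s))"
  using X by (subst E.finsum_ldistr) (auto simp: rfac_def pt_mult intro!: E.finsum_cong')
 finally have "th t (X \<cdot>\<^sub>E rfac v) = (\<Oplus>\<^bsub>A\<^esub>s\<in>{s. length s \<le> N}. co (vc v \<cdot> wd s) t *\<^sub>A th s X)"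
  using X by (simp, subst th_finsum) (auto simp: th_pt smult_A intro!: A.finsum_cong')
 also have "\<dots> = (\<Oplus>\<^bsub>A\<^esub>s\<in>{s::'n list. length s \<le> N}. 0\<^sub>A)"
 proof (intro A.finsum_cong' refl)
  fix s
  show "co (vc v \<cdot> wd s) t *\<^sub>A th s X = 0\<^sub>A"
  proof (cases "length s < q")
   case True then show ?thesis using o by (simp add: ord_ge_def smult_A_zero)
  next
   case False
   have "co (vc v \<cdot> wd s) t = 0"
    by (rule co_homog[OF G.homog_mult[OF vc_homog wd_homog]]) (use False t in auto)
   then show ?thesis using X by (simp add: smult_A)
  qed
 qed auto
 finally show ?thesis by simp
qed

lemma kd_homog_preimage:
 assumes x: "x \<in> homog (K n) m" and im: "x \<in> kd n ` carrier (K (Suc n))"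
 shows "\<exists>y\<in>homog (K (Suc n)) m. kd n y = x"
proof -
 obtain u where u: "u \<in> carrier (K (Suc n))" "x = kd n u" using im by blast
 note gg = G.free_graded_group
 have "(\<lambda>i. cmp (m + 0 - int n) (kd n u i)) = kd n (\<lambda>i. cmp (m - int (Suc n)) (u i))"
  by (rule deg_map_cmp[OF gg gg lin_maps_add_map[OF K_left K_left kd_lin] _ u(1)])
   (use graded_mapsD(2)[OF kd_graded] in simp)
 moreover have "(\<lambda>i. cmp (m - int n) (x i)) = x" by (rule graded_group.cmp_same[OF gg x])
 ultimately show ?thesis using graded_group.cmp_H[OF gg u(1), of m] u(2)
  by (intro bexI[of _ "\<lambda>i. cmp (m - int (Suc n)) (u i)"]) auto
qed

lemma th_bd:
 assumes x: "x \<in> carrier (KB (Suc n))" and o: "\<And>i. ord_ge q (x i)" and s: "length s \<le> q" and j: "j < wm n"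
 shows "th s (bd n x j) = kd n (\<lambda>i. th s (x i)) j" "(\<lambda>i. th s (x i)) \<in> carrier (K (Suc n))"
proof -
 show c: "(\<lambda>i. th s (x i)) \<in> carrier (K (Suc n))" using x by (auto simp: free_carrier th_zero)
 have "th s (bd n x j) = (\<Oplus>\<^bsub>A\<^esub>i\<in>{..<wm (Suc n)}. th s (x i \<cdot>\<^sub>E lfac (lam n i j) +\<^sub>E x i \<cdot>\<^sub>E rfac (srho n i j)))"
  unfolding bd_coord[OF x j] by (rule th_finsum) (use KB_coord[OF x] in simp_all)
 also have "\<dots> = (\<Oplus>\<^bsub>A\<^esub>i\<in>{..<wm (Suc n)}. th s (x i) \<cdot> vc (lam n i j))"
  using KB_coord[OF x] o s
  by (intro A.finsum_cong') (simp_all add: th_add th_rfac[of _ q] lfac_def th_mult_l)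
 also have "\<dots> = kd n (\<lambda>i. th s (x i)) j" using j by (simp add: kd_coord[OF c])
 finally show "th s (bd n x j) = kd n (\<lambda>i. th s (x i)) j" .
qed

lemma descent_step:
 assumes x: "x \<in> homog (KB n) N" and o: "\<And>i. ord_ge q (x i)"
  and im: "\<And>t. length t = q \<Longrightarrow> (\<lambda>i. th t (x i)) \<in> kd n ` carrier (K (Suc n))"
 shows "\<exists>y\<in>homog (KB (Suc n)) N. \<forall>i. ord_ge (Suc q) (x i \<ominus>\<^bsub>E\<^esub> bd n y i)"
proof -
 let ?Q = "{t :: 'n list. length t = q}"
 have xc: "x \<in> carrier (KB n)" using x GE.H_sub by (auto simp: free_homog free_carrier)
 have "\<exists>y\<in>homog (K (Suc n)) (N - int q). kd n y = (\<lambda>i. th t (x i))" if "length t = q" for t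
 proof (rule kd_homog_preimage[OF _ im[OF that]])
  show "(\<lambda>i. th t (x i)) \<in> homog (K n) (N - int q)"
   using x that th_homog[of "x _" "N - int n" t] by (auto simp: free_homog th_zero algebra_simps)
 qed
 then obtain y where y: "\<And>t. length t = q \<Longrightarrow> y t \<in> homog (K (Suc n)) (N - int q)"
  "\<And>t. length t = q \<Longrightarrow> kd n (y t) = (\<lambda>i. th t (x i))" by metis
 have yc: "y t \<in> carrier (K (Suc n))" if "length t = q" for t
  using y(1)[OF that] G.H_sub by (auto simp: free_homog free_carrier)
 define Y where "Y i = (\<Oplus>\<^bsub>E\<^esub>t\<in>?Q. pt (y t i) (wd t))" for i
 have Yh: "Y \<in> homog (KB (Suc n)) N"
 proof -
  have "Y i \<in> homog E (N - int (Suc n))" if "i < wm (Suc n)" for i unfolding Y_def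
  proof (intro homog_E_finsum finite_words homog_E_pt[OF _ wd_homog])
   fix t assume t: "t \<in> ?Q"
   then show "y t i \<in> homog A (N - int q - int (Suc n))" using y(1)[of t] that by (simp add: free_homog)
   show "N - int q - int (Suc n) + int (length t) = N - int (Suc n)" using t by simp
  qed
  moreover have "Y i = 0\<^sub>E" if "i \<ge> wm (Suc n)" for i
  proof -
   have "Y i = (\<Oplus>\<^bsub>E\<^esub>t\<in>?Q. 0\<^sub>E)" unfolding Y_def
    using yc that by (intro E.finsum_cong') (auto simp: free_carrier pt_zero_l)
   then show ?thesis by simp
  qed
  ultimately show ?thesis by (simp add: free_homog)
 qed
 then have Yc: "Y \<in> carrier (KB (Suc n))" using GE.H_sub by (auto simp: free_homog free_carrier)
 note ycA = K_coord[OF yc]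
 \<comment> \<open>The preimages \<open>y t\<close> are chosen separately for each word, so Y built
   from them does not have them as coordinates: its coordinate at s is the combination
   \<open>u s\<close>. By \<open>th_self\<close> for x the boundary of \<open>u s\<close> is
   nevertheless the coordinate of x.\<close>
 define u where "u s = (\<Oplus>\<^bsub>K (Suc n)\<^esub>t\<in>?Q. (co (wd t) s *\<^sub>A 1\<^sub>A) \<odot>\<^bsub>K (Suc n)\<^esub> y t)" for s
 interpret KS: left_module A "K (Suc n)" by (rule K_left)
 interpret Kn: left_module A "K n" by (rule K_left)
 have sc: "(co (wd t) s *\<^sub>A 1\<^sub>A) \<odot>\<^bsub>K (Suc n)\<^esub> y t \<in> carrier (K (Suc n))" if "length t = q" for t s
  using yc[OF that] by (intro KS.smult_closed) (auto simp: smult_A)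
 have uc: "u s \<in> carrier (K (Suc n))" for s
  unfolding u_def by (rule KS.finsum_closed) (use sc in auto)
 have u: "u s i = (\<Oplus>\<^bsub>A\<^esub>t\<in>?Q. co (wd t) s *\<^sub>A y t i)" for s i
 proof -
  have "u s = (\<lambda>i. \<Oplus>\<^bsub>A\<^esub>t\<in>?Q. ((co (wd t) s *\<^sub>A 1\<^sub>A) \<odot>\<^bsub>K (Suc n)\<^esub> y t) i)"
   unfolding u_def by (rule free_finsum[OF A_ring]) (use sc in simp_all)
  then have "u s i = (\<Oplus>\<^bsub>A\<^esub>t\<in>?Q. ((co (wd t) s *\<^sub>A 1\<^sub>A) \<odot>\<^bsub>K (Suc n)\<^esub> y t) i)" by (rule fun_cong)
  also have "\<dots> = (\<Oplus>\<^bsub>A\<^esub>t\<in>?Q. co (wd t) s *\<^sub>A y t i)"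
   using ycA by (intro A.finsum_cong') (simp_all add: smult_A)
  finally show ?thesis .
 qed
 have thY: "th s (Y i) = u s i" for s i
 proof -
  have "th s (Y i) = (\<Oplus>\<^bsub>A\<^esub>t\<in>?Q. th s (pt (y t i) (wd t)))"
   unfolding Y_def by (rule th_finsum) (use ycA in simp_all)
  also have "\<dots> = u s i" unfolding u using ycA by (intro A.finsum_cong') (simp_all add: th_pt smult_A)
  finally show ?thesis .
 qed
 have Yo: "ord_ge q (Y i)" for i
  unfolding ord_ge_def
 proof (intro allI impI)
  fix s :: "'n list" assume "length s < q"
  then have "(\<Oplus>\<^bsub>A\<^esub>t\<in>?Q. co (wd t) s *\<^sub>A y t i) = (\<Oplus>\<^bsub>A\<^esub>t\<in>?Q. 0\<^sub>A)"
   using ycA by (intro A.finsum_cong') (auto simp: co_wd smult_A)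
  then show "th s (Y i) = 0\<^sub>A" by (simp add: thY u)
 qed
 have kdu: "kd n (u s) = (\<lambda>j. th s (x j))" if s: "length s = q" for s
 proof -
  have "kd n (u s) = (\<Oplus>\<^bsub>K n\<^esub>t\<in>?Q. (co (wd t) s *\<^sub>A 1\<^sub>A) \<odot>\<^bsub>K n\<^esub> kd n (y t))"
   unfolding u_def
   using lin_mapsD[OF kd_lin[of n]] yc sc
   by (subst add_map.finsum[OF lin_maps_add_map[OF K_left K_left kd_lin]])
    (auto intro!: Kn.finsum_cong' Kn.smult_closed lin_mapsD(3)[OF kd_lin] simp: smult_A simp del: free_mod_simps)
  also have "\<dots> = (\<lambda>j. \<Oplus>\<^bsub>A\<^esub>t\<in>?Q. ((co (wd t) s *\<^sub>A 1\<^sub>A) \<odot>\<^bsub>K n\<^esub> kd n (y t)) j)"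
   by (rule free_finsum[OF A_ring finite_words], rule Kn.smult_closed)
    (use lin_mapsD(1)[OF kd_lin[of n] yc] in \<open>simp_all add: smult_A del: free_mod_simps\<close>)
  also have "\<dots> = (\<lambda>j. \<Oplus>\<^bsub>A\<^esub>t\<in>?Q. co (wd t) s *\<^sub>A th t (x j))"
   by (intro ext A.finsum_cong') (use KB_coord[OF xc] in \<open>simp_all add: y(2) smult_A\<close>)
  also have "\<dots> = (\<lambda>j. th s (x j))"
   using th_self[OF KB_coord[OF xc], of s] s by simp
  finally show ?thesis .
 qed
 have "th s (x j \<ominus>\<^bsub>E\<^esub> bd n Y j) = 0\<^sub>A" if s: "length s < Suc q" for s j
 proof (cases "j < wm n")
  case False
  then show ?thesis using xc bd_out[OF Yc] by (simp add: free_carrier th_diff th_zero a_minus_def)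
 next
  case j: True
  have xj: "x j \<in> \<E>" and bj: "bd n Y j \<in> \<E>"
   by (rule KB_coord[OF xc], rule KB_coord[OF lin_mapsD(1)[OF bd_lin Yc]])
  have "th s (bd n Y j) = kd n (u s) j"
   using th_bd(1)[OF Yc Yo _ j, of s] s by (simp add: thY)
  also have "\<dots> = th s (x j)"
  proof (cases "length s = q")
   case False
   then have l: "length s < q" using s by simp
   then have "u s i = 0\<^sub>A" for i using Yo[of i] by (simp add: ord_ge_def thY)
   then have "kd n (u s) j = 0\<^sub>A" using kd_coord[OF uc, of s j] j by simp
   then show ?thesis using o l by (simp add: ord_ge_def)
  qed (simp add: kdu)
  finally show ?thesis using xj bj unfolding th_diff[OF xj bj] by (simp add: a_minus_def A.r_neg)
 qed
 then show ?thesis using Yh by (intro bexI[of _ Y]) (simp_all add: ord_ge_def)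
qed

end

lemma image_finsum:
 assumes "add_map M N f" "finite F" "\<And>i. i \<in> F \<Longrightarrow> y i \<in> f ` carrier M"
 shows "(\<Oplus>\<^bsub>N\<^esub>i\<in>F. y i) \<in> f ` carrier M"
proof -
 interpret add_map M N f by fact
 have "\<forall>i\<in>F. \<exists>x. x \<in> carrier M \<and> y i = f x" using assms(3) by blast
 then obtain x where x': "\<forall>i\<in>F. x i \<in> carrier M \<and> y i = f (x i)" by (rule bchoice[THEN exE])
 then have x: "\<And>i. i \<in> F \<Longrightarrow> x i \<in> carrier M" "\<And>i. i \<in> F \<Longrightarrow> y i = f (x i)" by blast+
 have "(\<Oplus>\<^bsub>N\<^esub>i\<in>F. y i) = (\<Oplus>\<^bsub>N\<^esub>i\<in>F. f (x i))"
  by (rule N.finsum_cong'[OF refl _ x(2)]) (use x(1) closed in blast)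
 also have "\<dots> = f (\<Oplus>\<^bsub>M\<^esub>i\<in>F. x i)" by (rule finsum[symmetric]) (use assms x in auto)
 finally show ?thesis using M.finsum_closed[of x F] x(1) by (auto intro!: image_eqI)
qed

section \<open>Exactness of the bimodule complex by descent\<close>

context quad begin

text \<open>An order above the total degree would leave a left factor of negative degree; this is
  where the descent stops.\<close>

lemma ord_top:
 assumes X: "X \<in> homog E m" and o: "ord_ge q X" and q: "m < int q" shows "X = 0\<^sub>E"
proof (rule E_zeroI[OF homog_E_closed[OF X]])
 fix t
 show "th t X = 0\<^sub>A"
 proof (cases "length t < q")
  case False
  then have "homog A (m - int (length t)) = {0\<^sub>A}" using q by (intro homog_neg) auto
  then show ?thesis using th_homog[OF X, of t] by simp
 qed (use o in \<open>simp add: ord_ge_def\<close>)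
qed

lemma KB_diff_homog:
 assumes x: "x \<in> homog (KB n) N" and y: "y \<in> homog (KB (Suc n)) N"
 shows "(\<lambda>i. x i \<ominus>\<^bsub>E\<^esub> bd n y i) \<in> homog (KB n) N"
 using x graded_mapsD(2)[OF bd_graded y] by (auto simp: free_homog a_minus_def homog_E_add GE.H_minus)

lemma KB_homog_carrier: "x \<in> homog (KB n) N \<Longrightarrow> x \<in> carrier (KB n)"
 using GE.H_sub by (auto simp: free_homog free_carrier)

text \<open>P is the cycle condition, which reads differently at the augmentation and elsewhere.
  Each step raises the order by one, and k bounds the number of steps left before the order exceeds
  the degree N.\<close>

lemma descent:
 assumes im: "\<And>x q t. x \<in> homog (KB n) N \<Longrightarrow> P x \<Longrightarrow> (\<And>i. ord_ge q (x i)) \<Longrightarrow> length t = q \<Longrightarrow>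
    (\<lambda>i. th t (x i)) \<in> kd n ` carrier (K (Suc n))"
  and st: "\<And>x y. x \<in> homog (KB n) N \<Longrightarrow> P x \<Longrightarrow> y \<in> homog (KB (Suc n)) N \<Longrightarrow> P (\<lambda>i. x i \<ominus>\<^bsub>E\<^esub> bd n y i)"
  and x: "x \<in> homog (KB n) N" "P x"
 shows "x \<in> bd n ` carrier (KB (Suc n))"
proof -
 interpret KS: left_module E "KB (Suc n)" by (rule KB_left)
 have "x \<in> bd n ` carrier (KB (Suc n))"
  if "N < int (q + k)" "\<And>i. ord_ge q (x i)" "x \<in> homog (KB n) N" "P x" for k q x
  using that
 proof (induction k arbitrary: q x)
  case 0
  have "x i = 0\<^sub>E" for i
  proof (cases "i < wm n")
   case True
   then show ?thesis using 0 by (intro ord_top[of "x i" "N - int n" q]) (auto simp: free_homog)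
  qed (use 0 in \<open>simp add: free_homog\<close>)
  then have "x = \<zero>\<^bsub>KB n\<^esub>" by (simp add: fun_eq_iff)
  also have "\<dots> = bd n \<zero>\<^bsub>KB (Suc n)\<^esub>"
   by (rule add_map.zero[OF lin_maps_add_map[OF KB_left KB_left bd_lin], symmetric])
  finally show ?case using KS.zero_closed by (rule image_eqI)
 next
  case (Suc k)
  obtain y where y: "y \<in> homog (KB (Suc n)) N" "\<forall>i. ord_ge (Suc q) (x i \<ominus>\<^bsub>E\<^esub> bd n y i)"
   using descent_step[OF Suc.prems(3,2) im[OF Suc.prems(3,4,2)]] by blast
  have yc: "y \<in> carrier (KB (Suc n))" by (rule KB_homog_carrier[OF y(1)])
  have "(\<lambda>i. x i \<ominus>\<^bsub>E\<^esub> bd n y i) \<in> bd n ` carrier (KB (Suc n))"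
   by (rule Suc.IH[of "Suc q"]) (use Suc.prems y st KB_diff_homog in auto)
  then obtain z where z: "z \<in> carrier (KB (Suc n))" "(\<lambda>i. x i \<ominus>\<^bsub>E\<^esub> bd n y i) = bd n z" by (rule imageE)
  have "x i = bd n z i +\<^sub>E bd n y i" for i
  proof -
   have c: "x i \<in> \<E>" "bd n y i \<in> \<E>"
    by (rule KB_coord[OF KB_homog_carrier[OF Suc.prems(3)]], rule KB_coord[OF lin_mapsD(1)[OF bd_lin yc]])
   have "bd n z i = x i \<ominus>\<^bsub>E\<^esub> bd n y i" using fun_cong[OF z(2), of i] by (rule sym)
   then show ?thesis using c by (simp add: a_minus_def E.a_assoc E.l_neg)
  qed
  then have "x = bd n (z \<oplus>\<^bsub>KB (Suc n)\<^esub> y)" unfolding lin_mapsD(2)[OF bd_lin z(1) yc] by (simp add: fun_eq_iff)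
  then show ?case using KS.a_closed[OF z(1) yc] by (rule image_eqI)
 qed
 \<comment> \<open>Order 0 is no condition, and N + 1 steps suffice in degree N.\<close>
 from this[of 0 "nat (N + 1)", OF _ _ x] show ?thesis by (simp add: ord_ge_def)
qed

lemma bd_exact_homog:
 assumes kz: "koszul A" and x: "x \<in> homog (KB (Suc n)) N" "bd n x = \<zero>\<^bsub>KB n\<^esub>"
 shows "x \<in> bd (Suc n) ` carrier (KB (Suc (Suc n)))"
proof (rule descent[where P = "\<lambda>x. bd n x = \<zero>\<^bsub>KB n\<^esub>", OF _ _ x])
 fix x q t assume a: "x \<in> homog (KB (Suc n)) N" "bd n x = \<zero>\<^bsub>KB n\<^esub>" "\<And>i. ord_ge q (x i)" "length (t :: 'n list) = q"
 have xc: "x \<in> carrier (KB (Suc n))" by (rule KB_homog_carrier[OF a(1)])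
 have c: "(\<lambda>i. th t (x i)) \<in> carrier (K (Suc n))" using xc by (auto simp: free_carrier th_zero)
 have "kd n (\<lambda>i. th t (x i)) j = 0\<^sub>A" for j
 proof (cases "j < wm n")
  case True
  then have "kd n (\<lambda>i. th t (x i)) j = th t (bd n x j)" using th_bd(1)[OF xc a(3) _ True] a(4) by simp
  then show ?thesis by (simp add: a(2) th_zero)
 qed (simp add: kd_coord[OF c])
 then have "(\<lambda>i. th t (x i)) \<in> cyc KX kX (Suc (Suc n))" using c by (simp add: fun_eq_iff)
 then show "(\<lambda>i. th t (x i)) \<in> kd (Suc n) ` carrier (K (Suc (Suc n)))"
  unfolding koszul_complex_exact[OF kz] by simp
next
 fix x y assume a: "x \<in> homog (KB (Suc n)) N" "bd n x = \<zero>\<^bsub>KB n\<^esub>" "y \<in> homog (KB (Suc (Suc n))) N"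
 interpret b: add_map "KB (Suc n)" "KB n" "bd n" by (rule lin_maps_add_map[OF KB_left KB_left bd_lin])
 have c: "x \<in> carrier (KB (Suc n))" "y \<in> carrier (KB (Suc (Suc n)))" using a KB_homog_carrier by blast+
 have d: "bd (Suc n) y \<in> carrier (KB (Suc n))" by (rule lin_mapsD(1)[OF bd_lin c(2)])
 have "bd n (x \<ominus>\<^bsub>KB (Suc n)\<^esub> bd (Suc n) y) = \<zero>\<^bsub>KB n\<^esub>"
  unfolding b.diff[OF c(1) d] a(2) bd_bd[OF c(2)] using b.N.r_neg[OF b.N.zero_closed] by (simp add: a_minus_def del: free_mod_simps)
 moreover have "x \<ominus>\<^bsub>KB (Suc n)\<^esub> bd (Suc n) y = (\<lambda>i. x i \<ominus>\<^bsub>E\<^esub> bd (Suc n) y i)"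
 proof -
  have "(\<ominus>\<^bsub>KB (Suc n)\<^esub> bd (Suc n) y) = (\<lambda>i. \<ominus>\<^bsub>E\<^esub> bd (Suc n) y i)"
  proof (rule b.M.minus_equality[OF _ d])
   show "(\<lambda>i. \<ominus>\<^bsub>E\<^esub> bd (Suc n) y i) \<oplus>\<^bsub>KB (Suc n)\<^esub> bd (Suc n) y = \<zero>\<^bsub>KB (Suc n)\<^esub>"
    using KB_coord[OF d] by (simp add: E.l_neg)
   show "(\<lambda>i. \<ominus>\<^bsub>E\<^esub> bd (Suc n) y i) \<in> carrier (KB (Suc n))" using d by (simp add: free_carrier)
  qed
  then show ?thesis by (simp add: a_minus_def)
 qed
 ultimately show "bd n (\<lambda>i. x i \<ominus>\<^bsub>E\<^esub> bd (Suc n) y i) = \<zero>\<^bsub>KB n\<^esub>" by simp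
qed

text \<open>By degree, the leading coordinate can have nonzero augmentation only if N = q. Then all
  coordinates are scalars, so \<open>x 0\<close> is of the form 1 \<otimes> b, and b =
  \<open>epsE x\<close> = 0.\<close>

lemma epsE_exact_homog:
 assumes kz: "koszul A" and x: "x \<in> homog (KB 0) N" "epsE x = 0\<^sub>A"
 shows "x \<in> bd 0 ` carrier (KB (Suc 0))"
proof (rule descent[where P = "\<lambda>x. epsE x = 0\<^sub>A", OF _ _ x])
 fix x q t assume a: "x \<in> homog (KB 0) N" "epsE x = 0\<^sub>A" "\<And>i. ord_ge q (x i)" "length (t :: 'n list) = q"
 have xc: "x \<in> carrier (KB 0)" by (rule KB_homog_carrier[OF a(1)])
 have x0: "x 0 \<in> homog E N" "x 0 \<in> \<E>" using a(1) KB_coord[OF xc] by (auto simp: free_homog wm_0)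
 have c: "(\<lambda>i. th t (x i)) \<in> carrier (K 0)" using xc by (auto simp: free_carrier th_zero)
 have "aug (th t (x 0)) = 0"
 proof (cases "N = int q")
  case False
  then show ?thesis using aug_homog[OF th_homog[OF x0(1), of t]] a(4) by simp
 next
  case N: True
  obtain L where L: "\<And>M. M \<ge> L \<Longrightarrow> x 0 = (\<Oplus>\<^bsub>E\<^esub>t\<in>{t. length t \<le> M}. pt (th t (x 0)) (wd t))"
   using E_expand[OF x0(2)] by (elim exE) auto
  have s: "th s (x 0) = aug (th s (x 0)) *\<^sub>A 1\<^sub>A" for s
  proof (cases "length s = q")
   case True
   then have "th s (x 0) \<in> homog A 0" using th_homog[OF x0(1), of s] N by simp
   then show ?thesis using cmp_0[of "th s (x 0)"] G.cmp_same[of "th s (x 0)" 0] x0 by simp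
  next
   case False
   have "th s (x 0) = 0\<^sub>A"
   proof (cases "length s < q")
    case True
    then show ?thesis using a(3)[of 0] by (simp add: ord_ge_def)
   next
    case F: False
    then have "homog A (N - int (length s)) = {0\<^sub>A}" using False N by (intro homog_neg) auto
    then show ?thesis using th_homog[OF x0(1), of s] by simp
   qed
   then show ?thesis by (simp add: aug_simps smult_A)
  qed
  let ?b = "\<Oplus>\<^bsub>A\<^esub>s\<in>{s. length s \<le> L}. aug (th s (x 0)) *\<^sub>A wd s"
  have "x 0 = (\<Oplus>\<^bsub>E\<^esub>s\<in>{s. length s \<le> L}. pt (th s (x 0)) (wd s))" by (rule L) simp
  also have "\<dots> = (\<Oplus>\<^bsub>E\<^esub>s\<in>{s. length s \<le> L}. pt 1\<^sub>A (aug (th s (x 0)) *\<^sub>A wd s))"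
  proof (intro E.finsum_cong' refl)
   fix r
   have "pt (th r (x 0)) (wd r) = pt (aug (th r (x 0)) *\<^sub>A 1\<^sub>A) (wd r)"
    by (rule arg_cong[where f = "\<lambda>a. pt a (wd r)", OF s])
   then show "pt (th r (x 0)) (wd r) = pt 1\<^sub>A (aug (th r (x 0)) *\<^sub>A wd r)" by (simp add: pt_smult)
  qed (auto simp: smult_A)
  also have "\<dots> = pt 1\<^sub>A ?b" by (rule pt_finsum_r[symmetric]) (auto simp: smult_A)
  finally have e: "x 0 = pt 1\<^sub>A ?b" .
  have bc: "?b \<in> \<A>" by (rule A.finsum_closed) (auto simp: smult_A)
  have "0\<^sub>A = pt 1\<^sub>A ?b \<rhd> 1\<^sub>A"
   using a(2) unfolding epsE_def by (rule subst[OF e, of "\<lambda>X. 0\<^sub>A = X \<rhd> 1\<^sub>A", OF sym])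
  then have "?b = 0\<^sub>A" using bc by (simp add: act_pt)
  with e have "x 0 = pt 1\<^sub>A 0\<^sub>A" by (simp only:)
  then show ?thesis by (simp add: pt_zero_r th_zero aug_simps)
 qed
 then have "(\<lambda>i. th t (x i)) \<in> cyc KX kX (Suc 0)" using c by (simp add: M0_simps)
 then show "(\<lambda>i. th t (x i)) \<in> kd 0 ` carrier (K (Suc 0))"
  unfolding koszul_complex_exact[OF kz] by simp
next
 fix x y assume a: "x \<in> homog (KB 0) N" "epsE x = 0\<^sub>A" "y \<in> homog (KB (Suc 0)) N"
 interpret M: graded_left_module E M by (rule M_graded)
 have c: "x 0 \<in> \<E>" "y \<in> carrier (KB (Suc 0))" using a KB_homog_carrier KB_coord by blast+
 have d: "bd 0 y 0 \<in> \<E>" by (rule KB_coord[OF lin_mapsD(1)[OF bd_lin c(2)]])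
 have "(x 0 \<ominus>\<^bsub>E\<^esub> bd 0 y 0) \<rhd> 1\<^sub>A = x 0 \<rhd> 1\<^sub>A \<ominus>\<^bsub>M\<^esub> bd 0 y 0 \<rhd> 1\<^sub>A"
  by (rule add_map.diff[OF M.smult_add_map_l]) (use c d in auto)
 also have "\<dots> = \<zero>\<^bsub>M\<^esub>" using a(2) epsE_bd[OF c(2)] M.r_neg[OF M.zero_closed] by (simp add: epsE_def a_minus_def)
 finally show "epsE (\<lambda>i. x i \<ominus>\<^bsub>E\<^esub> bd 0 y i) = 0\<^sub>A" by (simp add: epsE_def)
qed

end

section \<open>The Nakayama automorphism\<close>

lemma (in abelian_monoid) finsum_swap:
 assumes "finite S" "finite T" "\<And>i j. i \<in> S \<Longrightarrow> j \<in> T \<Longrightarrow> f i j \<in> carrier G"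
 shows "(\<Oplus>i\<in>S. \<Oplus>j\<in>T. f i j) = (\<Oplus>j\<in>T. \<Oplus>i\<in>S. f i j)"
 using assms(1,3)
proof (induction S rule: finite_induct)
 case (insert x S)
 have c: "(\<Oplus>j\<in>T. f i j) \<in> carrier G" if "i \<in> insert x S" for i using insert.prems that by (intro finsum_closed) auto
 have "(\<Oplus>i\<in>insert x S. \<Oplus>j\<in>T. f i j) = (\<Oplus>j\<in>T. f x j) \<oplus> (\<Oplus>j\<in>T. \<Oplus>i\<in>S. f i j)"
  using insert c by (subst finsum_insert) auto
 also have "\<dots> = (\<Oplus>j\<in>T. f x j \<oplus> (\<Oplus>i\<in>S. f i j))"
  using insert.prems by (intro finsum_addf[symmetric]) (auto intro!: finsum_closed)
 also have "\<dots> = (\<Oplus>j\<in>T. \<Oplus>i\<in>insert x S. f i j)"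
  using insert by (intro finsum_cong') (auto intro!: finsum_closed)
 finally show ?case .
qed simp

text \<open>A linear functional on a free module of finite rank is given by finitely many values,
  each with finitely many components, so it is a finite sum of homogeneous ones: the graded dual is
  the full dual.\<close>

lemma (in graded_ring) dual_free:
 "carrier (dual S (free_mod S m c)) = fh S m c ` {y. \<forall>i<m. y i \<in> carrier S}"
proof (intro equalityI subsetI)
 fix h assume h: "h \<in> carrier (dual S (free_mod S m c))"
 let ?y = "\<lambda>i. h (fe S i)"
 have l: "h \<in> lin_maps S (free_mod S m c) (reg S)" by (rule dual_lin[OF free_left_module[OF ring_axioms] h])
 have y: "?y i \<in> carrier S" if "i < m" for i using lin_mapsD(1)[OF l fe_carrier[OF ring_axioms that]] by simp
 have "h = fh S m c ?y"
 proof
  fix x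
  show "h x = fh S m c ?y x"
  proof (cases "x \<in> carrier (free_mod S m c)")
   case True
   have "h x = lcomb m (reg S) ?y x" by (rule lin_free_eq[OF ring_axioms reg_left[OF ring_axioms] l True])
   also have "\<dots> = (\<Oplus>i\<in>{..<m}. x i \<otimes> ?y i)"
    unfolding lcomb_def by (simp, rule reg_finsum[OF ring_axioms]) (use y free_coord[OF ring_axioms True] in auto)
   finally show ?thesis using True by (simp add: fh_def)
  qed (simp add: fh_def dual_ext[OF h])
 qed
 then show "h \<in> fh S m c ` {y. \<forall>i<m. y i \<in> carrier S}" by (rule image_eqI[where x = ?y]) (use y in simp)
next
 fix h assume "h \<in> fh S m c ` {y. \<forall>i<m. y i \<in> carrier S}"
 then obtain y where y: "\<And>i. i < m \<Longrightarrow> y i \<in> carrier S" and h: "h = fh S m c y" by blast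
 have "\<forall>i\<in>{..<m}. \<exists>N. finite N \<and> (\<forall>n. n \<notin> N \<longrightarrow> cmp n (y i) = \<zero>)" using cmp_sum y by blast
 then obtain NN where NN: "\<forall>i\<in>{..<m}. finite (NN i) \<and> (\<forall>n. n \<notin> NN i \<longrightarrow> cmp n (y i) = \<zero>)"
  by (rule bchoice[THEN exE])
 define N where "N = (\<Union>i<m. NN i)"
 have N: "finite N" "\<And>i n. i < m \<Longrightarrow> n \<notin> N \<Longrightarrow> cmp n (y i) = \<zero>" using NN by (auto simp: N_def)
 define J where "J = (\<lambda>n. n - c) ` N"
 define F where "F j = fh S m c (\<lambda>i. cmp (c + j) (y i))" for j
 have F: "F j \<in> hom_deg S (free_mod S m c) j" for j
  unfolding F_def by (rule fh_hom_deg) (use y cmp_H in blast)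
 have J: "finite J" using N by (simp add: J_def)
 have yJ: "y i = (\<Oplus>j\<in>J. cmp (c + j) (y i))" if i: "i < m" for i
 proof -
  have "y i = (\<Oplus>n\<in>N. cmp n (y i))" by (rule cmp_sum_superset[OF y[OF i] N(1) N(2)[OF i]])
  also have "\<dots> = (\<Oplus>j\<in>J. cmp (c + j) (y i))"
   unfolding J_def using y[OF i] by (subst finsum_reindex) (auto simp: inj_on_def)
  finally show ?thesis .
 qed
 have "h = (\<lambda>x\<in>carrier (free_mod S m c). \<Oplus>j\<in>J. F j x)"
 proof
  fix x
  show "h x = (\<lambda>x\<in>carrier (free_mod S m c). \<Oplus>j\<in>J. F j x) x"
  proof (cases "x \<in> carrier (free_mod S m c)")
   case True
   note xc = free_coord[OF ring_axioms True]
   have "(\<Oplus>j\<in>J. F j x) = (\<Oplus>j\<in>J. \<Oplus>i\<in>{..<m}. x i \<otimes> cmp (c + j) (y i))"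
    using True by (simp add: F_def fh_def)
   also have "\<dots> = (\<Oplus>i\<in>{..<m}. \<Oplus>j\<in>J. x i \<otimes> cmp (c + j) (y i))"
    by (rule finsum_swap) (use J xc y in auto)
   also have "\<dots> = (\<Oplus>i\<in>{..<m}. x i \<otimes> y i)"
   proof (intro finsum_cong' refl)
    fix i assume "i \<in> {..<m}"
    then have i: "i < m" by simp
    have "(\<Oplus>j\<in>J. x i \<otimes> cmp (c + j) (y i)) = x i \<otimes> (\<Oplus>j\<in>J. cmp (c + j) (y i))"
     by (rule finsum_rdistr[OF J xc, symmetric]) (use y i in auto)
    also have "\<dots> = x i \<otimes> y i" by (rule arg_cong[where f = "\<lambda>z. x i \<otimes> z"], rule yJ[OF i, symmetric])
    finally show "(\<Oplus>j\<in>J. x i \<otimes> cmp (c + j) (y i)) = x i \<otimes> y i" .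
   qed (use xc y in auto)
   finally show ?thesis using True by (simp add: h fh_def)
  qed (simp add: h fh_def)
 qed
 with J F have "\<exists>J F. h = (\<lambda>x\<in>carrier (free_mod S m c). \<Oplus>j\<in>J. F j x) \<and> finite J \<and>
   (\<forall>j\<in>J. F j \<in> hom_deg S (free_mod S m c) j)"
  by (intro exI[of _ J] exI[of _ F] conjI ballI)
 then show "h \<in> carrier (dual S (free_mod S m c))"
  unfolding dual_def partial_object.simps mem_Collect_eq .
qed

text \<open>As f preserves degrees it kills each component of a cycle, and preimages of the
  components add up.\<close>

lemma graded_exact:
 assumes P: "graded_group P HP cP" and Q: "graded_group Q HQ cQ" and f: "add_map P Q f" and g: "add_map P' P g"
  and deg: "\<And>n x. x \<in> HP n \<Longrightarrow> f x \<in> HQ n"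
  and ex: "\<And>n x. x \<in> HP n \<Longrightarrow> f x = \<zero>\<^bsub>Q\<^esub> \<Longrightarrow> x \<in> g ` carrier P'"
  and x: "x \<in> carrier P" "f x = \<zero>\<^bsub>Q\<^esub>"
 shows "x \<in> g ` carrier P'"
proof -
 interpret P: graded_group P HP cP by fact
 interpret Q: graded_group Q HQ cQ by fact
 obtain N where N: "finite N" "x = (\<Oplus>\<^bsub>P\<^esub>n\<in>N. cP n x)" using P.cmp_sum[OF x(1)] by (elim exE conjE)
 have "f (cP n x) = \<zero>\<^bsub>Q\<^esub>" for n
 proof -
  have "cQ (n + 0) (f x) = f (cP n x)"
   by (rule deg_map_cmp[OF P Q f _ x(1)]) (use deg in simp)
  then show ?thesis by (simp add: x(2))
 qed
 then have "(\<Oplus>\<^bsub>P\<^esub>n\<in>N. cP n x) \<in> g ` carrier P'"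
  by (intro image_finsum[OF g N(1)] ex[OF P.cmp_H[OF x(1)]])
 then show ?thesis by (rule subst[OF N(2)[symmetric], of "\<lambda>x. x \<in> g ` carrier P'"])
qed

section \<open>Ext of A over the enveloping algebra in top degree\<close>

context quad begin

lemma bd_resolution:
 assumes kz: "koszul A" shows "graded_projective_resolution E M KB bd epsE"
proof -
 interpret M: graded_left_module E M by (rule M_graded)
 obtain cM where cM: "graded_group M (homog M) cM" using M.graded_group_exists by blast
 note gg = GE.free_graded_group
 have am: "add_map (KB (Suc n)) (KB n) (bd n)" for n by (rule lin_maps_add_map[OF KB_left KB_left bd_lin])
 note el = graded_mapsD(1)[OF epsE_graded]
 have ae: "add_map (KB 0) M epsE" by (rule lin_maps_add_map[OF KB_left M.left_module_axioms el])
 have onto: "epsE ` carrier (KB 0) = carrier M"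
 proof (intro equalityI subsetI)
  fix m assume m: "m \<in> carrier M"
  let ?x = "\<lambda>i::nat. if i = 0 then pt m 1\<^sub>A else 0\<^sub>E"
  have "m = epsE ?x" using m by (simp add: epsE_def act_pt)
  moreover have "?x \<in> carrier (KB 0)" using m by (auto simp: free_carrier wm_0)
  ultimately show "m \<in> epsE ` carrier (KB 0)" by (rule image_eqI)
 qed (use lin_mapsD(1)[OF el] in blast)
 have e0: "{x \<in> carrier (KB 0). epsE x = \<zero>\<^bsub>M\<^esub>} = bd 0 ` carrier (KB 1)"
 proof (intro equalityI subsetI)
  fix x assume x: "x \<in> {x \<in> carrier (KB 0). epsE x = \<zero>\<^bsub>M\<^esub>}"
  have "x \<in> bd 0 ` carrier (KB (Suc 0))"
   by (rule graded_exact[OF gg cM ae am]) (use x epsE_exact_homog[OF kz] graded_mapsD(2)[OF epsE_graded] in auto)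
  then show "x \<in> bd 0 ` carrier (KB 1)" by simp
 next
  fix x assume "x \<in> bd 0 ` carrier (KB 1)"
  then obtain y where "y \<in> carrier (KB (Suc 0))" "x = bd 0 y" by auto
  then show "x \<in> {x \<in> carrier (KB 0). epsE x = \<zero>\<^bsub>M\<^esub>}"
   using lin_mapsD(1)[OF bd_lin[of 0]] epsE_bd by simp
 qed
 have en: "{x \<in> carrier (KB (Suc n)). bd n x = \<zero>\<^bsub>KB n\<^esub>} = bd (Suc n) ` carrier (KB (Suc (Suc n)))" for n
 proof (intro equalityI subsetI)
  fix x assume x: "x \<in> {x \<in> carrier (KB (Suc n)). bd n x = \<zero>\<^bsub>KB n\<^esub>}"
  show "x \<in> bd (Suc n) ` carrier (KB (Suc (Suc n)))"
   by (rule graded_exact[OF gg gg am am graded_mapsD(2)[OF bd_graded] bd_exact_homog[OF kz]])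
    (use x in \<open>simp_all del: free_mod_simps of_nat_Suc\<close>)
 next
  fix x assume "x \<in> bd (Suc n) ` carrier (KB (Suc (Suc n)))"
  then obtain y where "y \<in> carrier (KB (Suc (Suc n)))" "x = bd (Suc n) y" by auto
  then show "x \<in> {x \<in> carrier (KB (Suc n)). bd n x = \<zero>\<^bsub>KB n\<^esub>}"
   using lin_mapsD(1)[OF bd_lin[of "Suc n"]] bd_bd by (simp del: free_mod_simps of_nat_Suc)
 qed
 have "exact_resolution M KB bd epsE" unfolding exact_resolution_def using onto e0 en by (intro conjI allI)
 then show ?thesis unfolding graded_projective_resolution_def projective_resolution_def
  by (intro conjI allI free_projective[OF E.ring_axioms] bd_lin el GE.free_graded bd_graded epsE_graded)
qed

lemma homog_E_0: "X \<in> homog E 0 \<Longrightarrow> \<exists>c. X = pt (c *\<^sub>A 1\<^sub>A) 1\<^sub>A"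
proof (induction X rule: E_homog_induct)
 case zero
 show ?case by (rule exI[of _ 0]) (simp add: smult_A pt_zero_l)
next
 case (pt a b i)
 then have ab: "a \<in> \<A>" "b \<in> \<A>" using G.H_sub by blast+
 consider "i < 0" | "i > 0" | "i = 0" by linarith
 then show ?case
 proof cases
  case 3
  then obtain c c' where "a = c *\<^sub>A 1\<^sub>A" "b = c' *\<^sub>A 1\<^sub>A" using pt homog_A_0 by auto
  then have "pt a b = pt (c' *\<^sub>A (c *\<^sub>A 1\<^sub>A)) 1\<^sub>A" by (simp add: pt_smult smult_A)
  also have "c' *\<^sub>A (c *\<^sub>A 1\<^sub>A) = (c' * c) *\<^sub>A 1\<^sub>A" by (simp add: smult_A)
  finally show ?thesis by blast
 next
  case 1
  then have "a = 0\<^sub>A" using pt homog_neg by blast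
  then show ?thesis using ab by (intro exI[of _ 0]) (simp add: smult_A pt_zero_l)
 next
  case 2
  then have "homog A (0 - i) = {0\<^sub>A}" by (intro homog_neg) simp
  then have "b = 0\<^sub>A" using pt by blast
  then show ?thesis using ab by (intro exI[of _ 0]) (simp add: smult_A pt_zero_l pt_zero_r)
 qed
next
 case (add X Y)
 then obtain c c' where "X = pt (c *\<^sub>A 1\<^sub>A) 1\<^sub>A" "Y = pt (c' *\<^sub>A 1\<^sub>A) 1\<^sub>A" by blast
 then have "X +\<^sub>E Y = pt ((c + c') *\<^sub>A 1\<^sub>A) 1\<^sub>A"
  by (simp add: pt_bilinear smult_A)
 then show ?case by blast
qed

definition cob where
 "cob d y = (\<lambda>x\<in>carrier (KB (Suc d)). fh E (wm d) (int d) y (bd d x))"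

lemma coboundaries_cob: "coboundaries E KB bd (Suc d) = cob d ` {y. \<forall>i<wm d. y i \<in> \<E>}"
 unfolding coboundaries.simps GE.dual_free cob_def image_image ..

lemma cob_eq:
 assumes "x \<in> carrier (KB (Suc d))"
 shows "cob d y x = (\<Oplus>\<^bsub>E\<^esub>i\<in>{..<wm d}. bd d x i \<cdot>\<^sub>E y i)"
 using assms lin_mapsD(1)[OF bd_lin assms] by (simp add: cob_def fh_def)

lemma cob_add:
 assumes "\<forall>i<wm d. y i \<in> \<E>" "\<forall>i<wm d. y' i \<in> \<E>" and x: "x \<in> carrier (KB (Suc d))"
 shows "cob d y x +\<^sub>E cob d y' x = cob d (\<lambda>i. y i +\<^sub>E y' i) x"
proof -
 note c = KB_coord[OF lin_mapsD(1)[OF bd_lin x]]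
 have "cob d (\<lambda>i. y i +\<^sub>E y' i) x = (\<Oplus>\<^bsub>E\<^esub>i\<in>{..<wm d}. bd d x i \<cdot>\<^sub>E y i +\<^sub>E bd d x i \<cdot>\<^sub>E y' i)"
  unfolding cob_eq[OF x] using c assms by (intro E.finsum_cong') (auto simp: E.r_distr)
 also have "\<dots> = cob d y x +\<^sub>E cob d y' x"
  unfolding cob_eq[OF x] using c assms by (intro E.finsum_addf) auto
 finally show ?thesis by (rule sym)
qed

lemma cob_smult:
 assumes "\<forall>i<wm d. y i \<in> \<E>" "P \<in> \<E>" and x: "x \<in> carrier (KB (Suc d))"
 shows "cob d y x \<cdot>\<^sub>E P = cob d (\<lambda>i. y i \<cdot>\<^sub>E P) x"
proof -
 note c = KB_coord[OF lin_mapsD(1)[OF bd_lin x]]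
 have "cob d y x \<cdot>\<^sub>E P = (\<Oplus>\<^bsub>E\<^esub>i\<in>{..<wm d}. (bd d x i \<cdot>\<^sub>E y i) \<cdot>\<^sub>E P)"
  unfolding cob_eq[OF x] using c assms by (intro E.finsum_ldistr) auto
 also have "\<dots> = cob d (\<lambda>i. y i \<cdot>\<^sub>E P) x"
  unfolding cob_eq[OF x] using c assms by (intro E.finsum_cong') (auto simp: E.m_assoc)
 finally show ?thesis .
qed

lemma cob_uminus:
 assumes "\<forall>i<wm d. y i \<in> \<E>" and x: "x \<in> carrier (KB (Suc d))"
 shows "cob d (\<lambda>i. \<ominus>\<^bsub>E\<^esub> y i) x = \<ominus>\<^bsub>E\<^esub> cob d y x" "cob d y x \<in> \<E>"
proof -
 note c = KB_coord[OF lin_mapsD(1)[OF bd_lin x]]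
 show cl: "cob d y x \<in> \<E>" unfolding cob_eq[OF x] using c assms by (intro E.finsum_closed) auto
 have "cob d y x \<cdot>\<^sub>E (\<ominus>\<^bsub>E\<^esub> \<one>\<^bsub>E\<^esub>) = cob d (\<lambda>i. y i \<cdot>\<^sub>E (\<ominus>\<^bsub>E\<^esub> \<one>\<^bsub>E\<^esub>)) x"
  by (rule cob_smult[OF assms(1) _ x]) simp
 also have "\<dots> = cob d (\<lambda>i. \<ominus>\<^bsub>E\<^esub> y i) x"
  unfolding cob_eq[OF x] using c assms by (intro E.finsum_cong') (auto simp: E.r_minus)
 finally show "cob d (\<lambda>i. \<ominus>\<^bsub>E\<^esub> y i) x = \<ominus>\<^bsub>E\<^esub> cob d y x" using cl by (simp add: E.r_minus)
qed

context
 fixes d f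
 assumes f: "f \<in> carrier (dual E (KB (Suc d)))"
begin

abbreviation "D \<equiv> dual E (KB (Suc d))"
abbreviation "B \<equiv> coboundaries E KB bd (Suc d)"

lemma f_closed: "x \<in> carrier (KB (Suc d)) \<Longrightarrow> f x \<in> \<E>"
 using lin_mapsD(1)[OF dual_lin[OF KB_left f]] by simp

text \<open>The action on cosets is a union over representatives of scaled cosets; it collapses to
  one coset because coboundaries are stable under the action, by \<open>cob_smult\<close>.\<close>

lemma coset_smult:
 assumes P: "P \<in> \<E>"
 shows "P \<odot>\<^bsub>Ext E KB bd (Suc d)\<^esub> (B +>\<^bsub>D\<^esub> f) = B +>\<^bsub>D\<^esub> (P \<odot>\<^bsub>D\<^esub> f)"
proof (intro equalityI subsetI)
 fix h assume "h \<in> P \<odot>\<^bsub>Ext E KB bd (Suc d)\<^esub> (B +>\<^bsub>D\<^esub> f)"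
 then obtain b b' where "b \<in> B" "b' \<in> B" and h: "h = b' \<oplus>\<^bsub>D\<^esub> (P \<odot>\<^bsub>D\<^esub> (b \<oplus>\<^bsub>D\<^esub> f))"
  by (auto simp: Ext_def subquotient_def a_r_coset_def' simp del: coboundaries.simps dual_simps)
 then obtain y y' where y: "\<forall>i<wm d. y i \<in> \<E>" "\<forall>i<wm d. y' i \<in> \<E>" "b = cob d y" "b' = cob d y'"
  unfolding coboundaries_cob by blast
 let ?z = "\<lambda>i. y' i +\<^sub>E y i \<cdot>\<^sub>E P"
 have yP: "\<forall>i<wm d. y i \<cdot>\<^sub>E P \<in> \<E>" using y P by simp
 have "h x = (cob d ?z \<oplus>\<^bsub>D\<^esub> (P \<odot>\<^bsub>D\<^esub> f)) x" for x
 proof (cases "x \<in> carrier (KB (Suc d))")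
  case True
  then show ?thesis using y(1,2) P f_closed[OF True] cob_uminus(2)[OF y(1) True] cob_uminus(2)[OF y(2) True] cob_uminus(2)[OF yP True]
   by (simp add: h y(3,4) cob_add[OF y(2) yP True, symmetric] E.l_distr E.a_assoc cob_smult)
 qed (simp add: h)
 then have "h = cob d ?z \<oplus>\<^bsub>D\<^esub> (P \<odot>\<^bsub>D\<^esub> f)" by (rule ext)
 moreover have "cob d ?z \<in> B" unfolding coboundaries_cob using y P by blast
 ultimately show "h \<in> B +>\<^bsub>D\<^esub> (P \<odot>\<^bsub>D\<^esub> f)" unfolding a_r_coset_def' by blast
next
 fix h assume "h \<in> B +>\<^bsub>D\<^esub> (P \<odot>\<^bsub>D\<^esub> f)"
 then obtain b where b: "b \<in> B" "h = b \<oplus>\<^bsub>D\<^esub> (P \<odot>\<^bsub>D\<^esub> f)" unfolding a_r_coset_def' by blast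
 have z: "(\<lambda>x\<in>carrier (KB (Suc d)). 0\<^sub>E) \<in> B" by (rule coboundaries_zero[where P = KB and d = bd, OF E.ring_axioms bd_lin])
 have "f = (\<lambda>x\<in>carrier (KB (Suc d)). 0\<^sub>E) \<oplus>\<^bsub>D\<^esub> f"
 proof
  fix x show "f x = ((\<lambda>x\<in>carrier (KB (Suc d)). 0\<^sub>E) \<oplus>\<^bsub>D\<^esub> f) x"
   using f_closed[of x] dual_ext[OF f, of x] by simp
 qed
 then have "f \<in> B +>\<^bsub>D\<^esub> f" unfolding a_r_coset_def' using z by blast
 moreover have "h \<in> B +>\<^bsub>D\<^esub> (P \<odot>\<^bsub>D\<^esub> f)" unfolding a_r_coset_def' using b by blast
 ultimately show "h \<in> P \<odot>\<^bsub>Ext E KB bd (Suc d)\<^esub> (B +>\<^bsub>D\<^esub> f)"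
  unfolding Ext_def subquotient_def by (simp del: coboundaries.simps dual_simps) blast
qed

lemma coset_eqI:
 assumes y: "\<forall>i<wm d. y i \<in> \<E>" and g: "\<And>x. x \<in> carrier (KB (Suc d)) \<Longrightarrow> g x \<in> \<E>"
  and e: "\<And>x. x \<in> carrier (KB (Suc d)) \<Longrightarrow> g' x = cob d y x +\<^sub>E g x"
 shows "B +>\<^bsub>D\<^esub> g' = B +>\<^bsub>D\<^esub> g"
proof -
 have half: "B +>\<^bsub>D\<^esub> g' \<subseteq> B +>\<^bsub>D\<^esub> g"
  if y: "\<forall>i<wm d. y i \<in> \<E>" and g: "\<And>x. x \<in> carrier (KB (Suc d)) \<Longrightarrow> g x \<in> \<E>"
   and e: "\<And>x. x \<in> carrier (KB (Suc d)) \<Longrightarrow> g' x = cob d y x +\<^sub>E g x" for y g g'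
 proof
  fix h assume "h \<in> B +>\<^bsub>D\<^esub> g'"
  then obtain b where b: "b \<in> B" "h = b \<oplus>\<^bsub>D\<^esub> g'" unfolding a_r_coset_def' by blast
  then obtain y' where y': "\<forall>i<wm d. y' i \<in> \<E>" "b = cob d y'" unfolding coboundaries_cob by blast
  have "h x = (cob d (\<lambda>i. y' i +\<^sub>E y i) \<oplus>\<^bsub>D\<^esub> g) x" for x
  proof (cases "x \<in> carrier (KB (Suc d))")
   case True
   then show ?thesis using g[OF True] cob_uminus(2)[OF y True] cob_uminus(2)[OF y'(1) True]
    by (simp add: b(2) y'(2) e cob_add[OF y'(1) y True, symmetric] E.a_assoc)
  qed (simp add: b)
  then have "h = cob d (\<lambda>i. y' i +\<^sub>E y i) \<oplus>\<^bsub>D\<^esub> g" by (rule ext)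
  moreover have "cob d (\<lambda>i. y' i +\<^sub>E y i) \<in> B" unfolding coboundaries_cob using y y' by blast
  ultimately show "h \<in> B +>\<^bsub>D\<^esub> g" unfolding a_r_coset_def' by blast
 qed
 have "B +>\<^bsub>D\<^esub> g \<subseteq> B +>\<^bsub>D\<^esub> g'"
 proof (rule half[of "\<lambda>i. \<ominus>\<^bsub>E\<^esub> y i"])
  fix x assume x: "x \<in> carrier (KB (Suc d))"
  show "g' x \<in> \<E>" using e[OF x] g[OF x] cob_uminus(2)[OF y x] by simp
  show "g x = cob d (\<lambda>i. \<ominus>\<^bsub>E\<^esub> y i) x +\<^sub>E g' x"
   using g[OF x] cob_uminus[OF y x] by (simp add: e[OF x] E.r_neg1)
 qed (use y in simp)
 then show ?thesis using half[OF y g e] by blast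
qed

end

text \<open>A generator of \<open>Ext\<close> in degree \<open>-(d + 1)\<close> is represented by a scalar multiple of the dual basis element;
 the coboundary of the \<open>j\<close>-th dual basis element in the preceding degree compares the actions of
 \<open>lam d 0 j\<close> from the right and of \<open>\<plusminus> rho d 0 j\<close> from the left on it.\<close>

lemma nakayama_lam:
 assumes kz: "koszul A" and w1: "wm (Suc d) = 1" and nak: "nakayama_automorphism A (Suc d) \<xi>" and j: "j < wm d"
 shows "\<xi> (vc (lam d 0 j)) = vc (\<lambda>x. (-1) ^ d * rho d 0 j x)"
proof -
 let ?D = "dual E (KB (Suc d))" and ?B = "coboundaries E KB bd (Suc d)" and ?X = "Ext E KB bd (Suc d)"
 let ?n = "int (Suc d)"
 have iso: "\<xi> \<in> graded_alg_iso A A" and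
  "graded_bimodule_iso A (bimodule_of A ?X) (twisted_shift A \<xi> ?n) \<noteq> {}"
  using nak bd_resolution[OF kz] unfolding nakayama_automorphism_def by blast+
 then obtain \<theta> where th: "\<theta> \<in> graded_bimodule_iso A (bimodule_of A ?X) (twisted_shift A \<xi> ?n)" by blast
 have \<theta>: "\<And>a x. a \<in> \<A> \<Longrightarrow> x \<in> carrier ?X \<Longrightarrow> \<theta> (pt 1\<^sub>A a \<odot>\<^bsub>?X\<^esub> x) = a \<cdot> \<theta> x"
  "\<And>a x. a \<in> \<A> \<Longrightarrow> x \<in> carrier ?X \<Longrightarrow> \<theta> (pt a 1\<^sub>A \<odot>\<^bsub>?X\<^esub> x) = \<theta> x \<cdot> \<xi> a"
  and hm: "\<And>n. \<theta> ` homog ?X n = homog A (?n + n)"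
  using th unfolding graded_bimodule_iso_def by (simp_all add: bimodule_of_def twisted_shift_def)
 have "1\<^sub>A \<in> \<theta> ` homog ?X (- ?n)" unfolding hm using G.one_homog by simp
 \<comment> \<open>The shift places the unit of A in degree -(d + 1), so the class corresponding to
   it has a representative of this degree.\<close>
 then obtain f where fc: "f \<in> cocycles E KB bd (Suc d)" and fh: "f \<in> hom_deg E (KB (Suc d)) (- ?n)"
  and f1: "\<theta> (?B +>\<^bsub>?D\<^esub> f) = 1\<^sub>A"
  by (auto simp: Ext_def subquotient_def simp del: coboundaries.simps of_nat_Suc)
 have f: "f \<in> carrier ?D" using fc by (simp add: cocycles_def)
 have xX: "?B +>\<^bsub>?D\<^esub> f \<in> carrier ?X" using fc by (simp add: Ext_def subquotient_def)
 have "\<forall>n. f ` homog (KB (Suc d)) n \<subseteq> homog E (n + - ?n)" using fh unfolding hom_deg_def mem_Collect_eq by (elim conjE)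
 then have "f ` homog (KB (Suc d)) ?n \<subseteq> homog E (?n + - ?n)" by (rule spec)
 moreover have "fe E 0 \<in> homog (KB (Suc d)) ?n" by (rule GE.fe_homog) (simp add: w1)
 ultimately have "f (fe E 0) \<in> homog E (?n + - ?n)" by (rule subsetD[OF _ imageI])
 \<comment> \<open>The functional f lowers degrees by d + 1, so its value on the generator has
   degree 0 and is a scalar.\<close>
 then obtain c where c: "f (fe E 0) = pt (c *\<^sub>A 1\<^sub>A) 1\<^sub>A" using homog_E_0 by auto
 let ?c = "pt (c *\<^sub>A 1\<^sub>A) 1\<^sub>A" and ?v = "lam d 0 j" and ?r = "srho d 0 j"
 have cE: "?c \<in> \<E>" by (simp add: smult_A)
 have sing: "{..<wm (Suc d)} = {0}" using w1 by auto
 have fx: "f x = x 0 \<cdot>\<^sub>E ?c" if x: "x \<in> carrier (KB (Suc d))" for x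
 proof -
  have "f x = lcomb (wm (Suc d)) (reg E) (\<lambda>i. f (fe E i)) x"
   by (rule lin_free_eq[OF E.ring_axioms reg_left[OF E.ring_axioms] dual_lin[OF KB_left f] x])
  also have "\<dots> = (\<Oplus>\<^bsub>E\<^esub>i\<in>{..<wm (Suc d)}. x i \<cdot>\<^sub>E f (fe E i))"
   unfolding lcomb_def by (simp, rule reg_finsum[OF E.ring_axioms])
    (use w1 KB_coord[OF x] c cE in auto)
  finally show ?thesis using KB_coord[OF x] c cE by (simp add: sing)
 qed
 have comm: "?c \<cdot>\<^sub>E lfac v = lfac v \<cdot>\<^sub>E ?c" "?c \<cdot>\<^sub>E rfac v = rfac v \<cdot>\<^sub>E ?c" for v
  by (simp_all add: lfac_def rfac_def pt_mult smult_A)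
 have neg: "rfac (\<lambda>x. - ?r x) = \<ominus>\<^bsub>E\<^esub> rfac ?r"
  unfolding rfac_def vc_minus[symmetric] by (rule add_map.minus[OF pt_map_r]) auto
 define y where "y = (\<lambda>i. if i = j then ?c else 0\<^sub>E)"
 have y: "\<forall>i<wm d. y i \<in> \<E>" using cE by (simp add: y_def)
 \<comment> \<open>The coboundary of c times the j-th dual basis element is f times entry j of the
   differential; hence the two actions on f differ by a coboundary.\<close>
 have main: "f x \<cdot>\<^sub>E lfac ?v = cob d y x +\<^sub>E f x \<cdot>\<^sub>E rfac (\<lambda>x. - ?r x)" if x: "x \<in> carrier (KB (Suc d))" for x
 proof -
  have x0: "x 0 \<in> \<E>" by (rule KB_coord[OF x])
  have "cob d y x = bd d x j \<cdot>\<^sub>E y j" unfolding cob_eq[OF x]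
   using j KB_coord[OF lin_mapsD(1)[OF bd_lin x]] cE by (intro E.finsum_single) (auto simp: y_def)
  also have "bd d x j = x 0 \<cdot>\<^sub>E lfac ?v +\<^sub>E x 0 \<cdot>\<^sub>E rfac ?r"
   using bd_coord[OF x j] x0 by (simp add: sing)
  also have "(x 0 \<cdot>\<^sub>E lfac ?v +\<^sub>E x 0 \<cdot>\<^sub>E rfac ?r) \<cdot>\<^sub>E y j = f x \<cdot>\<^sub>E lfac ?v +\<^sub>E f x \<cdot>\<^sub>E rfac ?r"
   using x0 cE by (simp add: y_def fx[OF x] E.l_distr E.m_assoc comm)
  finally have "cob d y x = f x \<cdot>\<^sub>E lfac ?v +\<^sub>E f x \<cdot>\<^sub>E rfac ?r" .
  moreover have "f x \<in> \<E>" using fx[OF x] x0 cE by simp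
  ultimately show ?thesis by (simp add: neg E.r_minus E.a_assoc E.r_neg)
 qed
 have "?B +>\<^bsub>?D\<^esub> (lfac ?v \<odot>\<^bsub>?D\<^esub> f) = ?B +>\<^bsub>?D\<^esub> (rfac (\<lambda>x. - ?r x) \<odot>\<^bsub>?D\<^esub> f)"
  by (rule coset_eqI[OF f y]) (use main f_closed[OF f] in \<open>simp_all del: of_nat_Suc\<close>)
 then have "lfac ?v \<odot>\<^bsub>?X\<^esub> (?B +>\<^bsub>?D\<^esub> f) = rfac (\<lambda>x. - ?r x) \<odot>\<^bsub>?X\<^esub> (?B +>\<^bsub>?D\<^esub> f)"
  by (simp only: coset_smult[OF f fac_closed(1)] coset_smult[OF f fac_closed(2)])
 \<comment> \<open>The class of f corresponds to the unit, on which the right action of a vector v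
   is multiplication by \<xi>(v) and the left action is multiplication by the vector itself.\<close>
 then have "1\<^sub>A \<cdot> \<xi> (vc ?v) = vc (\<lambda>x. - ?r x) \<cdot> 1\<^sub>A"
  using \<theta>(1)[OF vc_closed xX, of "\<lambda>x. - ?r x"] \<theta>(2)[OF vc_closed xX, of ?v] f1
  by (simp only: lfac_def rfac_def)
 moreover have "\<xi> \<in> ring_hom A A" using iso unfolding graded_alg_iso_def graded_alg_hom_def by simp
 then have "\<xi> (vc ?v) \<in> \<A>" using vc_closed by (rule ring_hom_closed)
 ultimately show ?thesis by (simp add: srho_def)
qed

end

section \<open>Superpotentials\<close>

definition lin_end :: "(('n::finite \<Rightarrow> 'k::field) \<Rightarrow> ('n \<Rightarrow> 'k)) \<Rightarrow> bool" where
 "lin_end f \<longleftrightarrow> (\<forall>u v. f (\<lambda>x. u x + v x) = (\<lambda>x. f u x + f v x)) \<and> (\<forall>c u. f (\<lambda>x. c * u x) = (\<lambda>x. c * f u x))"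

lemma lin_end_sum: "lin_end f \<Longrightarrow> finite F \<Longrightarrow> f (\<lambda>x. \<Sum>i\<in>F. c i * v i x) y = (\<Sum>i\<in>F. c i * f (v i) y)"
proof -
 assume "finite F" "lin_end f"
 then show ?thesis
 proof (induction F arbitrary: y rule: finite_induct)
 case empty
 have "f (\<lambda>x. c * u x) = (\<lambda>x. c * f u x)" for u c using empty unfolding lin_end_def by blast
 from this[of 0 "\<lambda>_. 0"] have "f (\<lambda>_. 0) = (\<lambda>_. 0)" by simp
 then show ?case by (simp add: fun_eq_iff)
next
 case (insert i F)
 have l: "f (\<lambda>x. u x + v x) y = f u y + f v y" "f (\<lambda>x. c * u x) y = c * f u y" for u v c
  using insert.prems unfolding lin_end_def by simp_all
 show ?case using insert by (simp add: l)
 qed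
qed

lemma lin_end_expand: "lin_end f \<Longrightarrow> f v y = (\<Sum>x\<in>UNIV. v x * f (sgl x) y)"
proof -
 assume f: "lin_end f"
 have "v = (\<lambda>z. \<Sum>x\<in>UNIV. v x * sgl x z)" by (auto simp: sgl_def if_distrib cong: if_cong)
 then have "f v y = f (\<lambda>z. \<Sum>x\<in>UNIV. v x * sgl x z) y" by (rule arg_cong)
 also have "\<dots> = (\<Sum>x\<in>UNIV. v x * f (sgl x) y)" by (rule lin_end_sum[OF f]) simp
 finally show ?thesis .
qed

lemma tensor_map_Nil: "tensor_map [] u [] = u []" "tensor_map (f # fs) u [] = 0" "tensor_map [] u (x # s) = 0"
proof -
 have "{t :: 'a list. length t = 0} = {[]}" by auto
 then show "tensor_map [] u [] = u []" by (simp add: tensor_map_def)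
qed (simp_all add: tensor_map_def)

lemma tensor_map_Cons:
 fixes u :: "'n::finite list \<Rightarrow> 'k::field"
 shows "tensor_map (f # fs) u (x # s) = (\<Sum>y\<in>UNIV. f (sgl y) x * tensor_map fs (\<lambda>t. u (y # t)) s)"
proof (cases "length s = length fs")
 case True
 let ?n = "length fs"
 have e: "{t :: 'n list. length t = Suc ?n} = (\<lambda>(y, t). y # t) ` (UNIV \<times> {t. length t = ?n})"
  by (auto simp: length_Suc_conv image_iff)
 have "tensor_map (f # fs) u (x # s) =
   (\<Sum>t\<in>(\<lambda>(y, t). y # t) ` (UNIV \<times> {t. length t = ?n}). (\<Prod>k<Suc ?n. ((f # fs) ! k) (sgl (t ! k)) ((x # s) ! k)) * u t)"
  using True by (simp add: tensor_map_def e del: prod.lessThan_Suc)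
 also have "\<dots> = (\<Sum>(y, t)\<in>UNIV \<times> {t. length t = ?n}. (\<Prod>k<Suc ?n. ((f # fs) ! k) (sgl ((y # t) ! k)) ((x # s) ! k)) * u (y # t))"
  by (subst sum.reindex) (auto simp: inj_on_def intro!: sum.cong)
 also have "\<dots> = (\<Sum>y\<in>UNIV. \<Sum>t | length t = ?n. f (sgl y) x * ((\<Prod>k<?n. (fs ! k) (sgl (t ! k)) (s ! k)) * u (y # t)))"
  by (subst sum.cartesian_product[symmetric]) (simp add: prod.lessThan_Suc_shift mult.assoc del: prod.lessThan_Suc)
 also have "\<dots> = (\<Sum>y\<in>UNIV. f (sgl y) x * tensor_map fs (\<lambda>t. u (y # t)) s)"
  using True by (simp add: tensor_map_def sum_distrib_left)
 finally show ?thesis .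
qed (simp add: tensor_map_def)

lemma tensor_map_linear:
 "tensor_map fs (\<lambda>t. \<Sum>i\<in>F. c i * u i t) s = (\<Sum>i\<in>F. c i * tensor_map fs (u i) s)"
proof (cases "length s = length fs")
 case True
 have "tensor_map fs (\<lambda>t. \<Sum>i\<in>F. c i * u i t) s =
   (\<Sum>t | length t = length fs. \<Sum>i\<in>F. c i * ((\<Prod>k<length fs. (fs ! k) (sgl (t ! k)) (s ! k)) * u i t))"
  using True by (simp add: tensor_map_def sum_distrib_left mult.left_commute)
 also have "\<dots> = (\<Sum>i\<in>F. c i * tensor_map fs (u i) s)"
  using True by (subst sum.swap) (simp add: tensor_map_def sum_distrib_left)
 finally show ?thesis .
qed (simp add: tensor_map_def)

lemma tensor_map_id:
 fixes u :: "'n::finite list \<Rightarrow> 'k::field"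
 shows "length q = m \<Longrightarrow> length p = length fs \<Longrightarrow> tensor_map (fs @ replicate m id) u (p @ q) = tensor_map fs (\<lambda>t. u (t @ q)) p"
proof (induction fs arbitrary: p u)
 case Nil
 have "tensor_map (replicate (length q) id) u q = u q" for u :: "'n list \<Rightarrow> 'k"
 proof (induction q arbitrary: u)
  case (Cons x q)
  have "tensor_map (replicate (length (x # q)) id) u (x # q) = (\<Sum>y\<in>UNIV. sgl y x * u (y # q))"
   by (simp add: tensor_map_Cons Cons)
  also have "\<dots> = u (x # q)" by (simp add: sgl_def if_distrib[of "\<lambda>a. a * _"] cong: if_cong)
  finally show ?case .
 qed (simp add: tensor_map_Nil)
 then have "tensor_map (replicate m id) u q = u q" using Nil(1) by blast
 moreover have "p = []" using Nil(2) by simp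
 ultimately show ?case by (simp only: append_Nil tensor_map_Nil)
next
 case (Cons f fs)
 then obtain x p' where "p = x # p'" "length p' = length fs" by (auto simp: length_Suc_conv)
 then show ?case using Cons by (simp add: tensor_map_Cons)
qed

lemma tau_eq: "k < length s \<Longrightarrow> tau k u s = u (s ! k # take k s @ drop (Suc k) s)"
proof (induction k arbitrary: s)
 case 0
 then show ?case by (cases s) simp_all
next
 case (Suc k)
 let ?s = "s[k := s ! Suc k, Suc k := s ! k]"
 have "tau (Suc k) u s = tau k u ?s" using Suc.prems by (simp add: flip_at_def)
 also have "\<dots> = u (?s ! k # take k ?s @ drop (Suc k) ?s)" by (rule Suc.IH) (use Suc.prems in simp)
 also have "drop (Suc k) ?s = s ! k # drop (Suc (Suc k)) s"
  using Suc.prems by (intro nth_equalityI) (auto simp: nth_Cons nth_list_update split: nat.splits)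
 finally show ?case using Suc.prems by (simp add: take_Suc_conv_app_nth)
qed

text \<open>The coordinate form of a twisted superpotential of degree d + 1: \<tau> carries the
  first factor, after \<sigma> has acted on it, to the last place. Indexing by d + 1 keeps the
  length of s free of subtraction.\<close>

definition rotates where
 "rotates d \<sigma> w \<longleftrightarrow> w \<in> tensors (Suc d) \<and>
   (\<forall>s x. length s = d \<longrightarrow> w (s @ [x]) = (- 1) ^ d * (\<Sum>y\<in>UNIV. \<sigma> (sgl y) x * w (y # s)))"

lemma twisted_superpotential_iff:
 fixes w :: "'n::finite list \<Rightarrow> 'k::field"
 shows "twisted_superpotential (Suc d) \<sigma> w \<longleftrightarrow> rotates d \<sigma> w"
proof -
 have e: "tau d (tensor_map (\<sigma> # replicate d id) w) (s @ [x]) = (\<Sum>y\<in>UNIV. \<sigma> (sgl y) x * w (y # s))"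
  if "length s = d" for s x
 proof -
  have "tensor_map (replicate d id) u s = u s" for u :: "'n list \<Rightarrow> 'k"
   using that tensor_map_id[of s d "[]" "[]" u] by (simp add: tensor_map_Nil)
  then show ?thesis using that by (simp add: tau_eq nth_append tensor_map_Cons)
 qed
 have z: "tau d (tensor_map (\<sigma> # replicate d id) w) s = 0" if "length s \<noteq> Suc d" for s
 proof (cases "d < length s")
  case True
  then show ?thesis using that by (simp add: tau_eq tensor_map_def)
 next
  case False
  have "tau k v s = 0" if "k \<le> d" "\<And>t. length t = length s \<Longrightarrow> v t = 0" for k and v :: "_ \<Rightarrow> 'k"
  proof -
   have "\<forall>t. length t = length s \<longrightarrow> tau k v t = 0" using that by (induction k) (auto simp: flip_at_def)
   then show ?thesis by blast
  qed
  moreover have "tensor_map (\<sigma> # replicate d id) w t = 0" if "length t = length s" for t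
   using that \<open>length s \<noteq> Suc d\<close> by (simp add: tensor_map_def)
  ultimately show ?thesis by blast
 qed
 show ?thesis
 proof
  assume ts: "twisted_superpotential (Suc d) \<sigma> w"
  then have w: "w \<in> tensors (Suc d)" and
   eq: "w = (\<lambda>s. (-1) ^ d * tau d (tensor_map (\<sigma> # replicate d id) w) s)"
   by (simp_all add: twisted_superpotential_def)
  have "w (s @ [x]) = (- 1) ^ d * (\<Sum>y\<in>UNIV. \<sigma> (sgl y) x * w (y # s))" if "length s = d" for s x
   using fun_cong[OF eq, of "s @ [x]"] e[OF that] by (rule trans[OF _ arg_cong])
  then show "rotates d \<sigma> w" unfolding rotates_def using w by blast
 next
  assume r: "rotates d \<sigma> w"
  then have w: "w \<in> tensors (Suc d)" by (simp add: rotates_def)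
  have "w s = (-1) ^ d * tau d (tensor_map (\<sigma> # replicate d id) w) s" for s
  proof (cases "length s = Suc d")
   case True
   then obtain s' x where s: "s = s' @ [x]" "length s' = d" by (metis length_Suc_conv_rev)
   then show ?thesis using r e[OF s(2), of x] by (simp add: rotates_def)
  next
   case False
   then show ?thesis using w z by (simp add: tensors_def)
  qed
  then show "twisted_superpotential (Suc d) \<sigma> w"
   unfolding twisted_superpotential_def using w by auto
 qed
qed

text \<open>Rotating k times brings the last k letters to the front, with \<sigma> applied to each
  and the sign (-1)^d every time. The induction moves the first letter of q over to p and rotates
  that letter last.\<close>

lemma rotate_many:
 fixes w :: "'n::finite list \<Rightarrow> 'k::field"
 assumes "rotates d \<sigma> w" "length q = k" "length p + k = Suc d"
 shows "w (p @ q) = (- 1) ^ (d * k) * tensor_map (replicate k \<sigma>) (\<lambda>s. w (s @ p)) q"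
 using assms(2,3)
proof (induction k arbitrary: p q)
 case (Suc k)
 then obtain x q' where q: "q = x # q'" "length q' = k" by (auto simp: length_Suc_conv)
 have r: "w ((t @ p) @ [x]) = (- 1) ^ d * (\<Sum>y\<in>UNIV. \<sigma> (sgl y) x * w (y # t @ p))" if "length t = k" for t
  using assms(1) that Suc.prems unfolding rotates_def by (auto simp del: append_assoc)
 have tc: "tensor_map (replicate k \<sigma>) u q' = tensor_map (replicate k \<sigma>) v q'" if "\<And>t. length t = k \<Longrightarrow> u t = v t" for u v :: "'n list \<Rightarrow> 'k"
  unfolding tensor_map_def by (intro if_cong refl sum.cong) (use that in auto)
 have "w (p @ q) = w ((p @ [x]) @ q')" by (simp add: q)
 also have "\<dots> = (- 1) ^ (d * k) * tensor_map (replicate k \<sigma>) (\<lambda>s. w (s @ p @ [x])) q'"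
  by (rule Suc.IH) (use q Suc.prems in auto)
 also have "tensor_map (replicate k \<sigma>) (\<lambda>s. w (s @ p @ [x])) q' =
   tensor_map (replicate k \<sigma>) (\<lambda>s. \<Sum>y\<in>UNIV. ((- 1) ^ d * \<sigma> (sgl y) x) * w (y # s @ p)) q'"
  by (rule tc) (use r in \<open>simp add: sum_distrib_left mult.assoc\<close>)
 also have "\<dots> = (\<Sum>y\<in>UNIV. ((- 1) ^ d * \<sigma> (sgl y) x) * tensor_map (replicate k \<sigma>) (\<lambda>s. w (y # s @ p)) q')"
  by (rule tensor_map_linear)
 also have "\<dots> = (- 1) ^ d * tensor_map (replicate (Suc k) \<sigma>) (\<lambda>s. w (s @ p)) q"
  by (simp add: q tensor_map_Cons sum_distrib_left mult.assoc)
 finally show ?case by (simp add: power_add mult.assoc mult.commute mult.left_commute)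
qed (simp add: tensor_map_Nil)

section \<open>The tensor \<open>w_hat\<close> and its cyclic symmetry\<close>

lemma embed_W_map: "embed_W u (map Some s) = u s"
proof -
 have "map (the \<circ> Some) s = s" by (induction s) simp_all
 then show ?thesis by (auto simp: embed_W_def)
qed

lemma embed_W_None: "None \<in> set s \<Longrightarrow> embed_W u s = 0"
 by (simp add: embed_W_def)

lemma words_Some: "None \<notin> set s \<Longrightarrow> \<exists>t. s = map Some t"
proof (induction s)
 case (Cons a s)
 then obtain t where "s = map Some t" by auto
 moreover obtain x where "a = Some x" using Cons by (cases a) auto
 ultimately have "a # s = map Some (x # t)" by simp
 then show ?case by (rule exI)
qed simp

lemma tensor_map_extend:
 assumes "lin_end \<sigma>" "length p = i"
 shows "tensor_map (replicate i (extend_W \<sigma>)) (\<lambda>s. embed_W u (s @ q)) p =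
  (if None \<in> set p \<union> set q then 0 else tensor_map (replicate i \<sigma>) (\<lambda>s. u (s @ map the q)) (map the p))"
 using assms(2)
proof (induction i arbitrary: p u)
 case 0
 then show ?case by (auto simp: tensor_map_Nil embed_W_def)
next
 case (Suc i)
 then obtain a p' where p: "p = a # p'" "length p' = i" by (auto simp: length_Suc_conv)
 have U: "(\<Sum>y\<in>UNIV. g y) = g None + (\<Sum>j\<in>UNIV. g (Some j))" for g :: "'a option \<Rightarrow> 'b"
  by (simp add: UNIV_option_conv sum.reindex)
 have none: "tensor_map (replicate i (extend_W \<sigma>)) (\<lambda>t. embed_W u (None # t @ q)) p' = 0"
  using tensor_map_linear[of "replicate i (extend_W \<sigma>)" "\<lambda>_. 0" "\<lambda>_. undefined" "{}" p']
  by (simp add: embed_W_def)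
 have some: "(\<lambda>t. embed_W u (Some j # t @ q)) = (\<lambda>t. embed_W (\<lambda>s. u (j # s)) (t @ q))" for j
  by (auto simp: embed_W_def fun_eq_iff)
 have z: "\<sigma> (\<lambda>_. 0) = (\<lambda>_. 0)"
  using lin_end_sum[OF assms(1), of "{}"] by (simp add: fun_eq_iff)
 have e: "extend_W \<sigma> (sgl (Some j)) (Some k) = \<sigma> (sgl j) k" "extend_W \<sigma> (sgl (Some j)) None = 0" for j k
 proof -
  have "(\<lambda>i. sgl (Some j) (Some i)) = (sgl j :: 'a \<Rightarrow> 'b)" by (auto simp: sgl_def)
  then show "extend_W \<sigma> (sgl (Some j)) (Some k) = \<sigma> (sgl j) k" by (simp add: extend_W_def)
 qed (simp add: extend_W_def sgl_def)
 show ?case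
 proof (cases a)
  case None
  then show ?thesis by (simp add: p tensor_map_Cons U none e)
 next
  case (Some k)
  then show ?thesis using Suc.IH[OF p(2)]
   by (simp add: p tensor_map_Cons U none e some)
 qed
qed

text \<open>The i-th summand puts z at position i, so it is supported on words with their only z
  there; the factors \<sigma> act on the letters before z.\<close>

lemma w_hat_term:
 assumes "lin_end \<sigma>" "i \<le> d" "length s = Suc d"
 shows "tau i (tensor_map (id # replicate i (extend_W \<sigma>) @ replicate (d - i) id)
       (sgl [None] \<star> embed_W w)) s =
  (if s ! i = None \<and> None \<notin> set (take i s @ drop (Suc i) s)
   then tensor_map (replicate i \<sigma>) (\<lambda>t. w (t @ map the (drop (Suc i) s))) (map the (take i s)) else 0)"
proof -
 let ?v = "sgl [None] \<star> embed_W w" and ?p = "take i s" and ?q = "drop (Suc i) s"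
 have l: "length ?p = i" "length ?q = d - i" using assms by simp_all
 have "(\<lambda>t. ?v (y # t)) = (if y = None then embed_W w else (\<lambda>_. 0))" for y
  by (auto simp: sgl_Cons_mult fun_eq_iff)
 then have "tau i (tensor_map (id # replicate i (extend_W \<sigma>) @ replicate (d - i) id) ?v) s =
  (\<Sum>y\<in>UNIV. sgl y (s ! i) * tensor_map (replicate i (extend_W \<sigma>) @ replicate (d - i) id)
    (if y = None then embed_W w else (\<lambda>_. 0)) (?p @ ?q))"
  using assms by (simp add: tau_eq tensor_map_Cons)
 also have "\<dots> = (\<Sum>y\<in>UNIV. if y = s ! i then tensor_map (replicate i (extend_W \<sigma>) @ replicate (d - i) id)
    (if y = None then embed_W w else (\<lambda>_. 0)) (?p @ ?q) else 0)"
  by (rule sum.cong) (auto simp: sgl_def)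
 also have "\<dots> = tensor_map (replicate i (extend_W \<sigma>)) (\<lambda>t. (if s ! i = None then embed_W w else (\<lambda>_. 0)) (t @ ?q)) ?p"
  using l by (simp add: tensor_map_id)
 also have "\<dots> = (if s ! i = None then tensor_map (replicate i (extend_W \<sigma>)) (\<lambda>t. embed_W w (t @ ?q)) ?p else 0)"
  using tensor_map_linear[of "replicate i (extend_W \<sigma>)" "\<lambda>_. 0" "\<lambda>_. undefined" "{}" ?p] by simp
 finally show ?thesis using tensor_map_extend[OF assms(1) l(1), of w ?q] by simp
qed

text \<open>The twisted cyclic symmetry of \<open>w\<close> absorbs the automorphisms: the coefficient of \<open>w_hat\<close> at a word
 \<open>p z q\<close> is, up to sign, the coefficient of \<open>w\<close> at \<open>q p\<close>.\<close>

lemma w_hat_None: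
 assumes s: "rotates d \<sigma> w" "lin_end \<sigma>" "length p + length q = Suc d"
 shows "w_hat (Suc d) \<sigma> w (map Some p @ None # map Some q) = (- 1) ^ (Suc d * length p) * w (q @ p)"
proof -
 let ?s = "map Some p @ None # map Some q" and ?i = "length p"
 have len: "length ?s = Suc (Suc d)" using s(3) by simp
 have nth: "?s ! j = None \<longleftrightarrow> j = ?i" if "j \<le> Suc d" for j
  using that s(3) by (auto simp: nth_append nth_Cons split: nat.splits)
 have the: "map (the \<circ> Some) r = r" for r :: "'a list" by (induction r) simp_all
 have "w_hat (Suc d) \<sigma> w ?s = (\<Sum>i=0..Suc d. if i = ?i then (-1) ^ i * tensor_map (replicate i \<sigma>) (\<lambda>t. w (t @ q)) p else 0)"
  unfolding w_hat_def
 proof (intro sum.cong refl)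
  fix i assume i: "i \<in> {0..Suc d}"
  then have "i \<le> Suc d" by simp
  show "(-1) ^ i * tau i (tensor_map (id # replicate i (extend_W \<sigma>) @ replicate (Suc d - i) id)
       (sgl [None] \<star> embed_W w)) ?s =
    (if i = ?i then (-1) ^ i * tensor_map (replicate i \<sigma>) (\<lambda>t. w (t @ q)) p else 0)"
  proof (cases "i = ?i")
   case True
   have "take i ?s = map Some p" "drop (Suc i) ?s = map Some q" using True by simp_all
   then show ?thesis unfolding w_hat_term[OF s(2) \<open>i \<le> Suc d\<close> len] nth[OF \<open>i \<le> Suc d\<close>]
    using True by (simp add: the)
  next
   case False
   then show ?thesis unfolding w_hat_term[OF s(2) \<open>i \<le> Suc d\<close> len] nth[OF \<open>i \<le> Suc d\<close>] by simp
  qed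
 qed
 also have "\<dots> = (-1) ^ ?i * tensor_map (replicate ?i \<sigma>) (\<lambda>t. w (t @ q)) p" using s(3) by simp
 also have "tensor_map (replicate ?i \<sigma>) (\<lambda>t. w (t @ q)) p = (-1) ^ (d * ?i) * w (q @ p)"
 proof -
  have "w (q @ p) = (- 1) ^ (d * ?i) * tensor_map (replicate ?i \<sigma>) (\<lambda>s. w (s @ q)) p"
   by (rule rotate_many[OF s(1)]) (use s(3) in auto)
  then have "(-1) ^ (d * ?i) * w (q @ p) = ((-1) ^ (d * ?i) * (- 1) ^ (d * ?i)) * tensor_map (replicate ?i \<sigma>) (\<lambda>s. w (s @ q)) p"
   by (simp only: mult.assoc)
  then show ?thesis by (simp add: power_mult_distrib[symmetric])
 qed
 finally show ?thesis by (simp add: power_add)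
qed

lemma w_hat_other:
 assumes "lin_end \<sigma>" "\<And>p q. s = map Some p @ None # map Some q \<Longrightarrow> length p + length q \<noteq> Suc d"
 shows "w_hat (Suc d) \<sigma> w s = 0"
proof (cases "length s = Suc (Suc d)")
 case True
 have "\<not> (s ! i = None \<and> None \<notin> set (take i s @ drop (Suc i) s))" if i: "i \<le> Suc d" for i
 proof
  assume a: "s ! i = None \<and> None \<notin> set (take i s @ drop (Suc i) s)"
  then obtain p q where pq: "take i s = map Some p" "drop (Suc i) s = map Some q"
   using words_Some[of "take i s"] words_Some[of "drop (Suc i) s"] by auto
  have "s = take i s @ s ! i # drop (Suc i) s" using True i by (intro id_take_nth_drop) simp
  then have s: "s = map Some p @ None # map Some q" using a by (simp only: pq)
  then have "length p + length q = Suc d" using True by simp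
  then show False using assms(2)[OF s] by simp
 qed
 then have "tau i (tensor_map (id # replicate i (extend_W \<sigma>) @ replicate (Suc d - i) id)
       (sgl [None] \<star> embed_W w)) s = 0" if "i \<le> Suc d" for i
  unfolding w_hat_term[OF assms(1) that True] using that by (intro if_not_P)
 then show ?thesis unfolding w_hat_def by (intro sum.neutral ballI) simp
next
 case False
 have "tau k v s = 0" if "\<And>t. length t = length s \<Longrightarrow> v t = 0" for k and v :: "_ \<Rightarrow> 'b"
 proof -
  have "\<forall>t. length t = length s \<longrightarrow> tau k v t = 0" using that by (induction k) (auto simp: flip_at_def)
  then show ?thesis by blast
 qed
 then show ?thesis using False unfolding w_hat_def
  by (intro sum.neutral ballI) (simp add: tensor_map_def)
qed

text \<open>Rotating p z q by one letter either moves z from the front to the end or moves a letter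
  from the front of p to the end of q. In both cases the word q p is unchanged, so by
  \<open>w_hat_None\<close> only signs have to be compared; words of another shape have coefficient
  zero before and after.\<close>

lemma w_hat_superpotential:
 assumes s: "rotates d \<sigma> w" "lin_end \<sigma>"
 shows "superpotential (Suc (Suc d)) (w_hat (Suc d) \<sigma> w)"
 unfolding twisted_superpotential_iff rotates_def
proof (intro conjI allI impI)
 let ?w = "w_hat (Suc d) \<sigma> w"
 show "?w \<in> tensors (Suc (Suc d))"
  unfolding tensors_def by (auto intro!: w_hat_other[OF s(2)])
 fix t x assume t: "length (t :: 'a option list) = Suc d"
 have sum: "(\<Sum>y\<in>UNIV. id (sgl y) x * ?w (y # t)) = ?w (x # t)"
  by (simp add: sgl_def if_distrib[of "\<lambda>a. a * _"] cong: if_cong)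
 have "?w (t @ [x]) = (- 1) ^ Suc d * ?w (x # t)"
 proof (cases "\<exists>p q. x # t = map Some p @ None # map Some q")
  case True
  then obtain p q where pq: "x # t = map Some p @ None # map Some q" by blast
  have l: "length p + length q = Suc d" using arg_cong[OF pq, of length] t by simp
  have w1: "?w (x # t) = (- 1) ^ (Suc d * length p) * w (q @ p)" unfolding pq by (rule w_hat_None[OF s l])
  show ?thesis
  proof (cases p)
   case Nil
   then have x: "t @ [x] = map Some q @ None # map Some []" using pq by simp
   have "?w (t @ [x]) = (- 1) ^ (Suc d * length q) * w q"
    unfolding x using w_hat_None[OF s, of q "[]"] l Nil by simp
   then show ?thesis using w1 Nil l by (simp add: power_mult) (simp add: power_mult[symmetric] minus_one_power_iff)
  next
   case (Cons b p')
   then have x: "t @ [x] = map Some p' @ None # map Some (q @ [b])" using pq by simp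
   have "?w (t @ [x]) = (- 1) ^ (Suc d * length p') * w (q @ b # p')"
    unfolding x using w_hat_None[OF s, of p' "q @ [b]"] l Cons by simp
   then show ?thesis using w1 Cons by (simp add: power_add minus_one_power_iff)
  qed
 next
  case False
  then have "?w (x # t) = 0" by (intro w_hat_other[OF s(2)]) blast
  moreover have "?w (t @ [x]) = 0"
  proof (rule w_hat_other[OF s(2)])
   fix p q assume e: "t @ [x] = map Some p @ None # map Some q"
   show "length p + length q \<noteq> Suc d"
   proof (cases q rule: rev_cases)
    case Nil
    then have "x # t = map Some [] @ None # map Some p" using e by simp
    then show ?thesis using False by blast
   next
    case (snoc q' b)
    then have "x # t = map Some (b # p) @ None # map Some q'" using e by simp
    then show ?thesis using False by blast
   qed
  qed
  ultimately show ?thesis by simp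
 qed
 then show "?w (t @ [x]) = (- 1) ^ Suc d * (\<Sum>y\<in>UNIV. id (sgl y) x * ?w (y # t))" by (simp only: sum)
qed

lemma w_hat_zero:
 assumes "lin_end \<sigma>" "count_list s None \<noteq> 1 \<or> length s \<noteq> Suc (Suc d)"
 shows "w_hat (Suc d) \<sigma> w s = 0"
proof (rule w_hat_other[OF assms(1)])
 fix p q :: "'a list" assume s: "s = map Some p @ None # map Some q"
 have "count_list (map Some r) None = 0" for r :: "'a list" by (induction r) auto
 then have "count_list s None = 1" by (simp add: s)
 then have "length s \<noteq> Suc (Suc d)" using assms(2) by blast
 then show "length p + length q \<noteq> Suc d" by (simp add: s)
qed

section \<open>The automorphism on V and the rotation of the top tensor\<close>

locale quad_automorphism = quad R for R :: "('n::finite list \<Rightarrow> 'k::field) set" +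
 fixes \<xi> :: "('n list \<Rightarrow> 'k) set \<Rightarrow> ('n list \<Rightarrow> 'k) set"
 assumes xi: "\<xi> \<in> graded_alg_iso A A"
begin

abbreviation "\<sigma> \<equiv> restrict_V R \<xi>"

lemma xi_hom: "\<xi> \<in> ring_hom A A" "\<And>Y. Y \<in> \<A> \<Longrightarrow> \<xi> (c *\<^sub>A Y) = c *\<^sub>A \<xi> Y"
 "\<And>Y. Y \<in> homog A n \<Longrightarrow> \<xi> Y \<in> homog A n"
 using xi unfolding graded_alg_iso_def graded_alg_hom_def by (simp, simp, blast)

lemma xi_simps [simp]:
 "Y \<in> \<A> \<Longrightarrow> \<xi> Y \<in> \<A>" "\<xi> 1\<^sub>A = 1\<^sub>A"
 "Y \<in> \<A> \<Longrightarrow> Z \<in> \<A> \<Longrightarrow> \<xi> (Y \<cdot> Z) = \<xi> Y \<cdot> \<xi> Z"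
 "Y \<in> \<A> \<Longrightarrow> Z \<in> \<A> \<Longrightarrow> \<xi> (Y +\<^sub>A Z) = \<xi> Y +\<^sub>A \<xi> Z"
 using ring_hom_closed[OF xi_hom(1)] ring_hom_one[OF xi_hom(1)] ring_hom_mult[OF xi_hom(1)] ring_hom_add[OF xi_hom(1)]
 by auto

lemma xi_map: "add_map A A \<xi>"
 by (rule add_mapI) (auto simp: A.abelian_group_axioms)

text \<open>Degree one of A is a copy of V, so the description in \<open>restrict_V\<close> has
  exactly one solution.\<close>

lemma xi_vc: "\<xi> (vc v) = vc (\<sigma> v)"
proof -
 have "\<xi> (vc v) \<in> homog A 1" by (rule xi_hom(3)[OF vc_homog])
 then obtain u where u: "\<xi> (vc v) = vc u" unfolding homog_A_1 vc_def[symmetric] by blast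
 have "\<sigma> v = (THE u. \<xi> (vc v) = vc u)" by (simp add: restrict_V_def vc_def cls_def I_def)
 also have "\<dots> = u" by (rule the_equality) (use u vc_eq in auto)
 finally show ?thesis using u by simp
qed

lemma sigma_lin: "lin_end \<sigma>"
 unfolding lin_end_def
proof (intro conjI allI)
 fix u v :: "'n \<Rightarrow> 'k" and c
 have "vc (\<sigma> (\<lambda>x. u x + v x)) = \<xi> (vc u +\<^sub>A vc v)" by (simp only: xi_vc vc_add)
 also have "\<dots> = vc (\<lambda>x. \<sigma> u x + \<sigma> v x)" unfolding xi_simps(4)[OF vc_closed vc_closed] by (simp only: xi_vc vc_add)
 finally show "\<sigma> (\<lambda>x. u x + v x) = (\<lambda>x. \<sigma> u x + \<sigma> v x)" by (simp add: vc_eq)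
 have "vc (\<sigma> (\<lambda>x. c * u x)) = \<xi> (c *\<^sub>A vc u)" by (simp only: xi_vc vc_smult)
 also have "\<dots> = vc (\<lambda>x. c * \<sigma> u x)" unfolding xi_hom(2)[OF vc_closed] by (simp only: xi_vc vc_smult)
 finally show "\<sigma> (\<lambda>x. c * u x) = (\<lambda>x. c * \<sigma> u x)" by (simp add: vc_eq)
qed

text \<open>By \<open>nakayama_lam\<close>, \<sigma> sends the left coordinate vectors of w to
  signed right coordinate vectors; substituting this into the expansion of w along its first letter
  produces the expansion along its last.\<close>

lemma top_rotates:
 assumes kz: "koszul A" and w1: "wm (Suc d) = 1" and nak: "nakayama_automorphism A (Suc d) \<xi>"
  and w: "w = (\<lambda>s. c * wb (Suc d) 0 s)"
 shows "rotates d \<sigma> w"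
 unfolding rotates_def
proof (intro conjI allI impI)
 have i: "0 < wm (Suc d)" using w1 by simp
 show "w \<in> tensors (Suc d)" using wb_tensors[OF i] unfolding w tensors_def by simp
 fix s x assume "length (s :: 'n list) = d"
 have sr: "(\<Sum>y\<in>UNIV. lam d 0 j y * \<sigma> (sgl y) x) = (-1) ^ d * rho d 0 j x" if "j < wm d" for j
 proof -
  have "vc (\<sigma> (lam d 0 j)) = vc (\<lambda>x. (-1) ^ d * rho d 0 j x)"
   using nakayama_lam[OF kz w1 nak that] by (simp only: xi_vc)
  then have "\<sigma> (lam d 0 j) x = (-1) ^ d * rho d 0 j x" by (simp add: vc_eq)
  then show ?thesis by (simp add: lin_end_expand[OF sigma_lin, of "lam d 0 j" x])
 qed
 have "(\<Sum>y\<in>UNIV. \<sigma> (sgl y) x * w (y # s)) = (\<Sum>y\<in>UNIV. \<Sum>j<wm d. c * wb d j s * (lam d 0 j y * \<sigma> (sgl y) x))"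
  unfolding w wb_left[OF i] by (simp add: sum_distrib_left mult.assoc mult.commute mult.left_commute)
 also have "\<dots> = (\<Sum>j<wm d. c * wb d j s * ((-1) ^ d * rho d 0 j x))"
  by (subst sum.swap) (simp add: sum_distrib_left[symmetric] sr)
 also have "\<dots> = (-1) ^ d * w (s @ [x])"
  unfolding w wb_right[OF i] by (simp add: sum_distrib_left mult.assoc mult.commute mult.left_commute)
 finally have "(- 1) ^ d * (\<Sum>y\<in>UNIV. \<sigma> (sgl y) x * w (y # s)) = ((- 1) ^ d * (- 1) ^ d) * w (s @ [x])"
  by (simp only: mult.assoc)
 then show "w (s @ [x]) = (- 1) ^ d * (\<Sum>y\<in>UNIV. \<sigma> (sgl y) x * w (y # s))"
  by (simp add: power_mult_distrib[symmetric])
qed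

definition comm where
 "comm v = (\<lambda>s. (sgl [None] \<star> embed_W (vec_tensor v)) s - (embed_W (vec_tensor (\<sigma> v)) \<star> sgl [None]) s)"

lemma comm_eq: "comm v s = (case s of [None, Some b] \<Rightarrow> v b | [Some a, None] \<Rightarrow> - \<sigma> v a | _ \<Rightarrow> 0)"
proof -
 have e: "embed_W (vec_tensor u) = vec_tensor (\<lambda>y. case y of None \<Rightarrow> 0 | Some b \<Rightarrow> u b)" for u :: "'n \<Rightarrow> 'k"
  by (auto simp: embed_W_def vec_tensor_def fun_eq_iff split: list.splits option.splits)
 have z: "sgl [None] = (vec_tensor (sgl None) :: 'n option list \<Rightarrow> 'k)"
  by (auto simp: vec_tensor_def sgl_def fun_eq_iff split: list.splits)
 show ?thesis unfolding comm_def e z vec_tensor2 by (auto simp: sgl_def split: list.splits option.splits)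
qed

end

text \<open>All that the second statement takes from homological algebra: the rotation of w, its
  windows lying in R, R as the set of its contractions onto two letters, and V spanned by its
  contractions onto one. The degree of w is d + 2.\<close>

locale twisted_potential = quad_automorphism R \<xi>
 for R :: "('n::finite list \<Rightarrow> 'k::field) set" and \<xi> +
 fixes d :: nat and w :: "'n list \<Rightarrow> 'k"
 assumes rot: "rotates (Suc d) \<sigma> w" and wW: "w \<in> W (Suc (Suc d))"
  and rel: "R = {contract d \<Psi> w | \<Psi>. \<Psi> \<in> tensors d}"
  and span: "\<exists>\<phi>. v = (\<lambda>x. \<Sum>t | length t = Suc d. \<phi> t * w (x # t))"
begin

abbreviation "wh \<equiv> w_hat (Suc (Suc d)) \<sigma> w"

text \<open>Before a word t without z only \<open>z b\<close> and \<open>a z\<close> can stand. The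
  coefficient of \<open>a z t\<close> is, up to sign, that of w at the word \<open>t a\<close>,
  which rotation turns into minus \<sigma> of the contraction of w against t, evaluated at
  a.\<close>

lemma hat_slice_no_z:
 assumes "length t = Suc d"
 shows "(\<lambda>s. wh (s @ map Some t)) = comm (\<lambda>b. w (b # t))"
proof
 fix s
 let ?v = "\<lambda>b. w (b # t)"
 have cnt: "count_list (map Some r) None = 0" for r :: "'n list" by (induction r) auto
 show "wh (s @ map Some t) = comm ?v s"
 proof (cases "length s = 2 \<and> count_list s None = 1")
  case False
  have "wh (s @ map Some t) = 0"
   by (rule w_hat_zero[OF sigma_lin]) (use False assms in \<open>auto simp: cnt\<close>)
  moreover have "comm ?v s = 0" using False by (auto simp: comm_eq split: list.splits option.splits)
  ultimately show ?thesis by simp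
 next
  case True
  then obtain x y where s: "s = [x, y]" by (auto simp: length_Suc_conv numeral_2_eq_2)
  show ?thesis
  proof (cases x)
   case None
   then obtain b where y: "y = Some b" using True s by (cases y) auto
   have "wh (s @ map Some t) = wh (map Some [] @ None # map Some (b # t))" using s None y by simp
   also have "\<dots> = w (b # t)" using w_hat_None[OF rot sigma_lin, of "[]" "b # t"] assms by simp
   finally show ?thesis using s None y by (simp add: comm_eq)
  next
   case (Some a)
   then have y: "y = None" using True s by (cases y) auto
   have "\<sigma> ?v a = (\<Sum>y\<in>UNIV. \<sigma> (sgl y) a * w (y # t))"
    by (simp add: lin_end_expand[OF sigma_lin, of ?v a] mult.commute)
   then have r: "w (t @ [a]) = (- 1) ^ Suc d * \<sigma> ?v a"
    using rot assms unfolding rotates_def by simp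
   have "wh (s @ map Some t) = wh (map Some [a] @ None # map Some t)" using s Some y by simp
   also have "\<dots> = (- 1) ^ Suc (Suc d) * w (t @ [a])" using w_hat_None[OF rot sigma_lin, of "[a]" t] assms by simp
   also have "\<dots> = - \<sigma> ?v a" unfolding r by (simp add: power_mult_distrib[symmetric])
   finally show ?thesis using s Some y by (simp add: comm_eq)
  qed
 qed
qed

lemma hat_slice_z:
 assumes "length p + length q = d"
 shows "(\<lambda>s. wh (s @ map Some p @ None # map Some q)) = embed_W (\<lambda>s. (- 1) ^ (d * length p) * w (q @ s @ p))"
proof
 fix s
 show "wh (s @ map Some p @ None # map Some q) = embed_W (\<lambda>s. (- 1) ^ (d * length p) * w (q @ s @ p)) s"
 proof (cases "None \<in> set s")
  case True
  then have "count_list s None \<noteq> 0" by (simp add: count_list_0_iff)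
  then show ?thesis using True by (simp add: embed_W_None w_hat_zero[OF sigma_lin])
 next
  case False
  then obtain r where s: "s = map Some r" using words_Some by blast
  show ?thesis
  proof (cases "length r = 2")
   case True
   have "wh (map Some (r @ p) @ None # map Some q) = (- 1) ^ (Suc (Suc d) * length (r @ p)) * w (q @ r @ p)"
    by (rule w_hat_None[OF rot sigma_lin]) (use True assms in simp)
   then show ?thesis using True by (simp add: s embed_W_map power_add minus_one_power_iff)
  next
   case False
   then have "w (q @ r @ p) = 0" using rot assms unfolding rotates_def tensors_def by auto
   moreover have "wh (s @ map Some p @ None # map Some q) = 0"
    by (rule w_hat_zero[OF sigma_lin]) (use False assms s in auto)
   ultimately show ?thesis by (simp add: s embed_W_map)
  qed
 qed
qed

lemma slice_R: "length p + length q = d \<Longrightarrow> (\<lambda>s. c * w (q @ s @ p)) \<in> R"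
proof -
 assume l: "length p + length q = d"
 have "slice q p w \<in> R" by (rule W_slice[OF wW]) (use l in simp)
 moreover have "slice q p w = (\<lambda>s. w (q @ s @ p))"
  using W_tensors[OF wW] l by (auto simp: slice_def tensors_def fun_eq_iff)
 ultimately show ?thesis using R_subsp unfolding subsp_def by simp
qed

text \<open>Each word of \<open>w_hat\<close> contains z once. If z is among the two leading letters
  the slice is a commutation relation; if it is in t the slice is a window of w; if t contains z
  twice the slice is zero.\<close>

lemma hat_slice:
 assumes t: "length t = Suc d"
 shows "(\<lambda>s. wh (s @ t)) \<in> range comm \<union> embed_W ` R"
proof (cases "None \<in> set t")
 case False
 then obtain t' where "t = map Some t'" using words_Some by blast
 then show ?thesis using hat_slice_no_z[of t'] t by simp
next
 case True
 then obtain t1 t2 where t12: "t = t1 @ None # t2" "None \<notin> set t1" by (metis split_list_first)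
 then obtain p where p: "t1 = map Some p" using words_Some by blast
 show ?thesis
 proof (cases "None \<in> set t2")
  case True
  then have "count_list t2 None \<noteq> 0" by (simp add: count_list_0_iff)
  then have "wh (s @ t) = 0" for s by (intro w_hat_zero[OF sigma_lin]) (simp add: t12)
  then have "(\<lambda>s. wh (s @ t)) = embed_W (\<lambda>_. 0)" by (simp add: embed_W_def fun_eq_iff)
  moreover have "(\<lambda>_. 0) \<in> R" using R_subsp by (simp add: subsp_def)
  ultimately show ?thesis by blast
 next
  case False
  then obtain q where q: "t2 = map Some q" using words_Some by blast
  have l: "length p + length q = d" using t by (simp add: t12 p q)
  show ?thesis unfolding t12 p q hat_slice_z[OF l] using slice_R[OF l] by blast
 qed
qed

end

section \<open>Skew polynomial algebras\<close>

lemma embed_W_linear: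
 "embed_W (\<lambda>s. u s + v s) = (\<lambda>s. embed_W u s + embed_W v s)" "embed_W (\<lambda>s. c * u s) = (\<lambda>s. c * embed_W u s)"
 "embed_W (\<lambda>_. 0) = (\<lambda>_. 0)"
 by (auto simp: embed_W_def fun_eq_iff)

lemma embed_W_sgl: "embed_W (sgl s) = sgl (map Some s)"
proof
 fix t
 show "embed_W (sgl s) t = sgl (map Some s) t"
 proof (cases "None \<in> set t")
  case False
  then obtain r where "t = map Some r" using words_Some by blast
  then show ?thesis by (simp add: embed_W_map) (simp add: sgl_def)
 next
  case True
  then have "t \<noteq> map Some s" by auto
  then show ?thesis using True by (simp add: embed_W_None) (simp add: sgl_def)
 qed
qed

lemma embed_W_closed: "u \<in> \<T> \<Longrightarrow> embed_W u \<in> \<T>"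
proof -
 assume "u \<in> \<T>"
 then obtain N where "\<forall>s. length s > N \<longrightarrow> u s = 0" by (auto simp: TT_carrier_iff)
 then have "\<forall>s. length s > N \<longrightarrow> embed_W u s = 0" by (auto simp: embed_W_def)
 then show ?thesis unfolding TT_carrier_iff by blast
qed

lemma embed_W_tensors: "u \<in> tensors n \<Longrightarrow> embed_W u \<in> tensors n"
 by (auto simp: tensors_def embed_W_def)

lemma embed_W_mult: "embed_W (u \<star> v) = embed_W u \<star> embed_W v"
proof
 fix s
 have m: "(f \<star> g) r = (\<Sum>i\<le>length r. f (take i r) * g (drop i r))"
  for f g :: "'c::finite list \<Rightarrow> 'b" and r by (simp add: tensor_algebra_def)
 show "embed_W (u \<star> v) s = (embed_W u \<star> embed_W v) s"
 proof (cases "None \<in> set s")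
  case True
  have "embed_W u (take i s) * embed_W v (drop i s) = 0" for i
  proof -
   have "set s = set (take i s) \<union> set (drop i s)" by (metis append_take_drop_id set_append)
   then show ?thesis using True by (auto simp: embed_W_None)
  qed
  then show ?thesis using True unfolding m embed_W_None[OF True] by (intro sum.neutral[symmetric]) simp
 next
  case False
  then obtain r where s: "s = map Some r" using words_Some by blast
  show ?thesis unfolding s embed_W_map m by (simp add: take_map drop_map embed_W_map)
 qed
qed

context twisted_potential begin

text \<open>\<open>T(W)\<close> acts on sequences as on \<open>A[z; \<xi>]\<close> by left multiplication. The relations annihilate this
 module, which shows that normally ordered elements are independent modulo the relations, without
 verifying the associativity of the skew polynomial product.\<close>

definition gact :: "'n option \<Rightarrow> (nat \<Rightarrow> ('n list \<Rightarrow> 'k) set) \<Rightarrow> nat \<Rightarrow> ('n list \<Rightarrow> 'k) set" where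
 "gact a f n = (case a of Some x \<Rightarrow> vc (sgl x) \<cdot> f n | None \<Rightarrow> (case n of 0 \<Rightarrow> 0\<^sub>A | Suc m \<Rightarrow> \<xi> (f m)))"

definition "wact s f = foldr gact s f"

definition uact where "uact u f n = (\<Oplus>\<^bsub>A\<^esub>s\<in>{s. u s \<noteq> 0}. u s *\<^sub>A wact s f n)"

definition "seqs = {f :: nat \<Rightarrow> ('n list \<Rightarrow> 'k) set. \<forall>n. f n \<in> \<A>}"

lemma seqsD: "f \<in> seqs \<Longrightarrow> f n \<in> \<A>"
 by (simp add: seqs_def)

lemma xi_zero: "\<xi> 0\<^sub>A = 0\<^sub>A" by (rule add_map.zero[OF xi_map])

lemma gact_closed: "f \<in> seqs \<Longrightarrow> gact a f \<in> seqs"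
 by (auto simp: seqs_def gact_def split: option.splits nat.splits)

lemma wact_closed: "f \<in> seqs \<Longrightarrow> wact s f \<in> seqs"
 by (induction s) (simp_all add: wact_def gact_closed)

lemma wact_simps: "wact [] f = f" "wact (a # s) f = gact a (wact s f)" "wact (s @ t) f = wact s (wact t f)"
 by (simp_all add: wact_def)

lemma gact_linear:
 assumes "f \<in> seqs" "g \<in> seqs"
 shows "gact a (\<lambda>n. f n +\<^sub>A g n) n = gact a f n +\<^sub>A gact a g n" "gact a (\<lambda>n. c *\<^sub>A f n) n = c *\<^sub>A gact a f n"
 using seqsD[OF assms(1)] seqsD[OF assms(2)]
 by (auto simp: gact_def A.r_distr smult_A smult_A_zero xi_hom(2) split: option.splits nat.splits)

lemma seqs_linear: "f \<in> seqs \<Longrightarrow> g \<in> seqs \<Longrightarrow> (\<lambda>n. f n +\<^sub>A g n) \<in> seqs" "f \<in> seqs \<Longrightarrow> (\<lambda>n. c *\<^sub>A f n) \<in> seqs"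
 "(\<lambda>_. 0\<^sub>A) \<in> seqs"
 by (simp_all add: seqs_def smult_A)

lemma wact_linear:
 assumes "f \<in> seqs" "g \<in> seqs"
 shows "wact s (\<lambda>n. f n +\<^sub>A g n) = (\<lambda>n. wact s f n +\<^sub>A wact s g n)"
  "wact s (\<lambda>n. c *\<^sub>A f n) = (\<lambda>n. c *\<^sub>A wact s f n)"
proof -
 show "wact s (\<lambda>n. f n +\<^sub>A g n) = (\<lambda>n. wact s f n +\<^sub>A wact s g n)"
  by (induction s) (simp_all add: wact_simps gact_linear(1)[OF wact_closed[OF assms(1)] wact_closed[OF assms(2)]] ext)
 show "wact s (\<lambda>n. c *\<^sub>A f n) = (\<lambda>n. c *\<^sub>A wact s f n)"
  by (induction s) (simp_all add: wact_simps gact_linear(2)[OF wact_closed[OF assms(1)] wact_closed[OF assms(2)]] ext)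
qed

lemma uact_superset:
 assumes "f \<in> seqs" "finite F" "{s. u s \<noteq> 0} \<subseteq> F"
 shows "uact u f n = (\<Oplus>\<^bsub>A\<^esub>s\<in>F. u s *\<^sub>A wact s f n)"
 unfolding uact_def using assms(2,3) seqsD[OF wact_closed[OF assms(1)]]
 by (intro A.finsum_superset) (auto simp: smult_A)

lemma uact_closed: "f \<in> seqs \<Longrightarrow> uact u f \<in> seqs"
proof -
 assume f: "f \<in> seqs"
 have "uact u f n \<in> \<A>" for n
  unfolding uact_def using seqsD[OF wact_closed[OF f]] by (auto simp: smult_A intro!: A.finsum_closed)
 then show ?thesis by (simp add: seqs_def)
qed

lemma TT_fin: "u \<in> \<T> \<Longrightarrow> finite {s. u s \<noteq> 0}"
 by (simp add: tensor_algebra_def)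

lemma uact_zero: "uact (\<lambda>_. 0) f n = 0\<^sub>A"
 by (simp add: uact_def)

lemma uact_add:
 assumes f: "f \<in> seqs" and u: "u \<in> \<T>" and v: "v \<in> \<T>"
 shows "uact (\<lambda>s. u s + v s) f n = uact u f n +\<^sub>A uact v f n"
proof -
 let ?B = "{s. u s \<noteq> 0} \<union> {s. v s \<noteq> 0}"
 have B: "finite ?B" using TT_fin[OF u] TT_fin[OF v] by simp
 have c: "wact s f n \<in> \<A>" for s by (rule seqsD[OF wact_closed[OF f]])
 have "uact (\<lambda>s. u s + v s) f n = (\<Oplus>\<^bsub>A\<^esub>s\<in>?B. (u s + v s) *\<^sub>A wact s f n)"
  by (rule uact_superset[OF f B]) auto
 also have "\<dots> = (\<Oplus>\<^bsub>A\<^esub>s\<in>?B. u s *\<^sub>A wact s f n +\<^sub>A v s *\<^sub>A wact s f n)"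
  using c by (intro A.finsum_cong') (simp_all add: smult_A)
 also have "\<dots> = (\<Oplus>\<^bsub>A\<^esub>s\<in>?B. u s *\<^sub>A wact s f n) +\<^sub>A (\<Oplus>\<^bsub>A\<^esub>s\<in>?B. v s *\<^sub>A wact s f n)"
  using c by (intro A.finsum_addf) (auto simp: smult_A)
 also have "\<dots> = uact u f n +\<^sub>A uact v f n"
  by (subst (1 2) uact_superset[OF f B]) auto
 finally show ?thesis .
qed

lemma uact_sgl: "f \<in> seqs \<Longrightarrow> uact (\<lambda>s. c * sgl p s) f n = c *\<^sub>A wact p f n"
 by (subst uact_superset[of f "{p}"]) (auto simp: sgl_def smult_A seqsD[OF wact_closed])

lemma smult_commute: "Y \<in> \<A> \<Longrightarrow> c *\<^sub>A (c' *\<^sub>A Y) = c' *\<^sub>A (c *\<^sub>A Y)"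
 by (simp add: smult_A(4)[symmetric] mult.commute)

lemma uact_linear:
 assumes u: "u \<in> \<T>" and f: "f \<in> seqs" and g: "g \<in> seqs"
 shows "uact u (\<lambda>n. f n +\<^sub>A g n) n = uact u f n +\<^sub>A uact u g n"
  "uact u (\<lambda>n. c *\<^sub>A f n) n = c *\<^sub>A uact u f n"
proof -
 note cl = seqsD[OF wact_closed[OF f]] seqsD[OF wact_closed[OF g]] seqsD[OF uact_closed[OF f]] seqsD[OF uact_closed[OF g]]
 show "uact u (\<lambda>n. f n +\<^sub>A g n) n = uact u f n +\<^sub>A uact u g n"
  using u by (induction u rule: TT_induct)
   (simp_all add: uact_zero uact_sgl uact_add f g seqs_linear wact_linear smult_A cl A.a_ac)
 show "uact u (\<lambda>n. c *\<^sub>A f n) n = c *\<^sub>A uact u f n"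
  using u by (induction u rule: TT_induct)
   (simp_all add: uact_zero uact_sgl uact_add f g seqs_linear wact_linear(2)[OF f f] smult_A(2) cl smult_A_zero smult_commute)
qed

lemma mult_fun:
 "(\<lambda>s. u s + u' s) \<star> v = (\<lambda>s. (u \<star> v) s + (u' \<star> v) s)"
 "u \<star> (\<lambda>s. v s + v' s) = (\<lambda>s. (u \<star> v) s + (u \<star> v') s)"
 "(\<lambda>s. c * sgl p s) \<star> (\<lambda>s. c' * sgl q s) = (\<lambda>s. (c * c') * sgl (p @ q) s)"
 "(\<lambda>_. 0) \<star> v = (\<lambda>_. 0)" "u \<star> (\<lambda>_. 0) = (\<lambda>_. 0)"
 for u u' v v' :: "'m::finite list \<Rightarrow> 'b::field"
 by (simp_all add: fun_eq_iff TT_mult_linear sgl_mult_sgl)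

lemma uact_mult:
 assumes u: "u \<in> \<T>" and v: "v \<in> \<T>" and f: "f \<in> seqs"
 shows "uact (u \<star> v) f n = uact u (uact v f) n"
 using v
proof (induction v rule: TT_induct)
 case zero
 have "uact u (\<lambda>_. 0\<^sub>A) n = 0\<^sub>A"
  using uact_linear(2)[OF u seqs_linear(3) seqs_linear(3), of 0] seqsD[OF uact_closed[OF seqs_linear(3)]] by (simp add: smult_A)
 moreover have "uact (\<lambda>_. 0) f = (\<lambda>_. 0\<^sub>A)" by (rule ext) (rule uact_zero)
 ultimately show ?case by (simp add: mult_fun uact_zero)
next
 case (sgl c q)
 have e: "uact (\<lambda>s. c * sgl q s) f = (\<lambda>n. c *\<^sub>A wact q f n)" by (rule ext) (rule uact_sgl[OF f])
 show ?case unfolding e using u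
 proof (induction u rule: TT_induct)
  case (sgl c' p)
  show ?case using wact_linear(2)[OF wact_closed[OF f] wact_closed[OF f]] seqsD[OF wact_closed[OF wact_closed[OF f]]]
   by (simp add: mult_fun uact_sgl f seqs_linear wact_closed wact_simps smult_A)
 qed (simp_all add: mult_fun uact_zero uact_add f seqs_linear wact_closed TT_closed)
next
 case (add v v')
 have e: "uact (\<lambda>s. v s + v' s) f = (\<lambda>n. uact v f n +\<^sub>A uact v' f n)"
  by (rule ext) (rule uact_add[OF f add(1,2)])
 show ?case unfolding e using add u
  by (simp add: mult_fun uact_add f TT_closed uact_linear uact_closed)
qed

lemma uact_embed:
 assumes u: "u \<in> \<T>" and f: "f \<in> seqs"
 shows "uact (embed_W u) f n = cls u \<cdot> f n"
 using u
proof (induction u rule: TT_induct)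
 case zero
 show ?case using seqsD[OF f, of n] by (simp add: embed_W_linear uact_zero cls_hom(4)[symmetric])
next
 case (sgl c p)
 have v: "vec_tensor (sgl x) = sgl [x]" for x :: 'n
  by (auto simp: vec_tensor_def sgl_def fun_eq_iff split: list.splits)
 have "wact (map Some p) f n = cls (sgl p) \<cdot> f n"
 proof (induction p)
  case Nil
  show ?case using seqsD[OF f, of n] by (simp add: wact_simps cls_hom(3)[symmetric])
 next
  case (Cons x p)
  have "cls (sgl (x # p)) = vc (sgl x) \<cdot> cls (sgl p)"
   by (simp add: vc_def v cls_hom TT_closed sgl_mult_sgl)
  then show ?case using Cons seqsD[OF f, of n]
   by (simp add: wact_simps gact_def A.m_assoc cls_closed TT_closed)
 qed
 then show ?case using seqsD[OF f, of n]
  by (simp add: embed_W_linear embed_W_sgl uact_sgl f cls_smult[symmetric] smult_A cls_closed TT_closed)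
next
 case (add u v)
 then show ?case using seqsD[OF f, of n]
  by (simp add: embed_W_linear uact_add f embed_W_closed cls_hom(2)[symmetric] A.l_distr cls_closed)
qed

lemma uact_z: "f \<in> seqs \<Longrightarrow> uact (sgl (replicate k None)) f n = (if k \<le> n then (\<xi> ^^ k) (f (n - k)) else 0\<^sub>A)"
proof -
 assume f: "f \<in> seqs"
 have "wact (replicate k None) f n = (if k \<le> n then (\<xi> ^^ k) (f (n - k)) else 0\<^sub>A)"
 proof (induction k arbitrary: n)
  case (Suc k)
  then show ?case by (cases n) (auto simp: wact_simps gact_def xi_zero)
 qed (simp add: wact_simps)
 moreover have "uact (sgl (replicate k None)) f n = wact (replicate k None) f n"
  using uact_sgl[OF f, of 1 "replicate k None" n] by (simp add: smult_A(5)[OF seqsD[OF wact_closed[OF f]]])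
 ultimately show ?thesis by simp
qed

definition "Ann = {u \<in> carrier (TT :: ('k, 'n option list \<Rightarrow> 'k) graded_module). \<forall>f\<in>seqs. \<forall>n. uact u f n = 0\<^sub>A}"

lemma Ann_smult: "u \<in> Ann \<Longrightarrow> (\<lambda>s. c * u s) \<in> Ann"
proof -
 assume u: "u \<in> Ann"
 then have uc: "u \<in> \<T>" by (simp add: Ann_def)
 have e: "(\<lambda>s. c * u s) = (\<lambda>s. c * sgl [] s) \<star> u"
  by (simp add: fun_eq_iff TT_mult_linear TT_one_mult)
 have "uact (\<lambda>s. c * u s) f n = 0\<^sub>A" if f: "f \<in> seqs" for f n
  unfolding e using u f by (simp add: uact_mult TT_closed uc uact_sgl uact_closed wact_simps Ann_def smult_A_zero)
 then show ?thesis using uc by (simp add: Ann_def TT_closed)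
qed

lemma Ann_ideal: "ideal Ann (TT :: ('k, 'n option list \<Rightarrow> 'k) graded_module)"
proof (rule idealI[OF TT_ring])
 show "subgroup Ann (add_monoid (TT :: ('k, 'n option list \<Rightarrow> 'k) graded_module))"
 proof (rule subgroup.intro)
  fix u :: "'n option list \<Rightarrow> 'k" assume u: "u \<in> Ann"
  then have "u \<in> \<T>" by (simp add: Ann_def)
  then have "inv\<^bsub>add_monoid TT\<^esub> u = (\<lambda>s. (- 1) * u s)" using TT_minus[of u] by (simp add: a_inv_def)
  then show "inv\<^bsub>add_monoid TT\<^esub> u \<in> Ann" using Ann_smult[OF u, of "- 1"] by simp
 qed (auto simp: Ann_def TT_closed uact_add uact_zero)
 fix u v :: "'n option list \<Rightarrow> 'k" assume u: "u \<in> Ann" and v: "v \<in> \<T>"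
 then have uc: "u \<in> \<T>" by (simp add: Ann_def)
 have z: "uact v (\<lambda>_. 0\<^sub>A) n = 0\<^sub>A" for n
  using uact_linear(2)[OF v seqs_linear(3) seqs_linear(3), of 0] seqsD[OF uact_closed[OF seqs_linear(3)]] by (simp add: smult_A)
 have "uact (v \<star> u) f n = 0\<^sub>A" if f: "f \<in> seqs" for f n
 proof -
  have "uact u f = (\<lambda>_. 0\<^sub>A)" using u f by (auto simp: Ann_def)
  then show ?thesis by (simp add: uact_mult uc v f z)
 qed
 then show "v \<star> u \<in> Ann" using uc v by (simp add: Ann_def TT_closed)
 have "uact (u \<star> v) f n = 0\<^sub>A" if f: "f \<in> seqs" for f n
  using u by (simp add: uact_mult uc v f Ann_def uact_closed)
 then show "u \<star> v \<in> Ann" using uc v by (simp add: Ann_def TT_closed)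
qed

section \<open>The quotient of the tensor algebra on W by the contractions of
  \<open>w_hat\<close>\<close>

definition "hat_relations = {contract (Suc d) \<Psi> wh | \<Psi>. \<Psi> \<in> tensors (Suc d)}"

lemma hat_relations_TT: "hat_relations \<subseteq> \<T>"
proof
 fix u assume "u \<in> hat_relations"
 then obtain \<Psi> where u: "u = contract (Suc d) \<Psi> wh" unfolding hat_relations_def by blast
 have "u s = 0" if "length s > 2" for s unfolding u contract_def
 proof (intro sum.neutral ballI)
  fix t :: "'n option list" assume "t \<in> {t. length t = Suc d}"
  then have "wh (s @ t) = 0" using that by (intro w_hat_zero[OF sigma_lin]) auto
  then show "\<Psi> t * wh (s @ t) = 0" by simp
 qed
 then show "u \<in> \<T>" unfolding TT_carrier_iff by blast
qed

sublocale Q: pres hat_relations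
 by (rule pres.intro) (rule hat_relations_TT)

abbreviation Q_mult (infixl "\<cdot>\<^sub>Q" 70) where "a \<cdot>\<^sub>Q b \<equiv> mult Q.A a b"
abbreviation Q_add (infixl "+\<^sub>Q" 65) where "a +\<^sub>Q b \<equiv> add Q.A a b"
abbreviation Q_smult (infixl "*\<^sub>Q" 70) where "c *\<^sub>Q b \<equiv> smult Q.A c b"
abbreviation Q_zero ("0\<^sub>Q") where "0\<^sub>Q \<equiv> zero Q.A"
abbreviation Q_one ("1\<^sub>Q") where "1\<^sub>Q \<equiv> one Q.A"

text \<open>Acting with z v and with \<xi>(v) z agrees because \<xi> is multiplicative.\<close>

lemma comm_Ann: "comm v \<in> Ann"
proof -
 have vt: "vec_tensor u \<in> \<T>" for u :: "'n \<Rightarrow> 'k" by (rule vec_TT)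
 have c: "sgl [None] \<star> embed_W (vec_tensor v) \<in> \<T>" "embed_W (vec_tensor (\<sigma> v)) \<star> sgl [None] \<in> \<T>"
  by (simp_all add: TT_closed embed_W_closed vt)
 have e: "comm v = (\<lambda>s. (sgl [None] \<star> embed_W (vec_tensor v)) s + ((\<lambda>s. (- 1) * sgl [] s) \<star> (embed_W (vec_tensor (\<sigma> v)) \<star> sgl [None])) s)"
  by (simp add: comm_def fun_eq_iff TT_mult_linear TT_one_mult del: mult_minus1 mult_minus_left)
 have cc: "comm v \<in> \<T>" unfolding comm_def by (rule TT_closed(6)[OF c])
 have "uact (comm v) f n = 0\<^sub>A" if f: "f \<in> seqs" for f n
 proof -
  have z: "uact (sgl [None]) g m = (case m of 0 \<Rightarrow> 0\<^sub>A | Suc m \<Rightarrow> \<xi> (g m))" if "g \<in> seqs" for g m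
   using uact_z[OF that, of 1 m] by (auto split: nat.splits)
  have 1: "uact (sgl [None] \<star> embed_W (vec_tensor v)) f n = (case n of 0 \<Rightarrow> 0\<^sub>A | Suc m \<Rightarrow> vc (\<sigma> v) \<cdot> \<xi> (f m))"
   using seqsD[OF f]
   by (simp add: uact_mult TT_closed embed_W_closed vt f z uact_closed uact_embed vc_def[symmetric] xi_vc split: nat.splits)
  have 2: "uact (embed_W (vec_tensor (\<sigma> v)) \<star> sgl [None]) f n = (case n of 0 \<Rightarrow> 0\<^sub>A | Suc m \<Rightarrow> vc (\<sigma> v) \<cdot> \<xi> (f m))"
   by (simp add: uact_mult TT_closed embed_W_closed vt f z uact_closed uact_embed vc_def[symmetric] split: nat.splits)
  have b: "(case n of 0 \<Rightarrow> 0\<^sub>A | Suc m \<Rightarrow> vc (\<sigma> v) \<cdot> \<xi> (f m)) \<in> \<A>" using seqsD[OF f] by (simp split: nat.splits)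
  show ?thesis unfolding e uact_add[OF f c(1) TT_closed(7)[OF TT_closed(4)[OF TT_closed(2)] c(2)]]
    uact_mult[OF TT_closed(4)[OF TT_closed(2)] c(2) f] uact_sgl[OF uact_closed[OF f]] wact_simps 1 2
   using b by (simp add: smult_A_minus A.r_neg)
 qed
 then show ?thesis using cc by (simp add: Ann_def)
qed

lemma embed_R_Ann: "r \<in> R \<Longrightarrow> embed_W r \<in> Ann"
proof -
 assume r: "r \<in> R"
 then have rc: "r \<in> \<T>" using R_tensors tensors_TT by blast
 have "cls r = 0\<^sub>A" using X_I[OF r] cls_eq[of r "\<lambda>_. 0"] by (simp add: cls_hom)
 then show ?thesis using rc by (simp add: Ann_def embed_W_closed uact_embed seqsD)
qed

lemma Ann_sum: "finite F \<Longrightarrow> (\<And>t. t \<in> F \<Longrightarrow> u t \<in> Ann) \<Longrightarrow> (\<lambda>s. \<Sum>t\<in>F. c t * u t s) \<in> Ann"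
proof (induction F rule: finite_induct)
 case empty
 show ?case by (simp add: Ann_def TT_closed uact_zero)
next
 case (insert t F)
 then have "(\<lambda>s. c t * u t s) \<in> Ann" "(\<lambda>s. \<Sum>t\<in>F. c t * u t s) \<in> Ann" by (simp_all add: Ann_smult)
 then have "(\<lambda>s. c t * u t s + (\<Sum>t\<in>F. c t * u t s)) \<in> Ann"
  by (simp add: Ann_def TT_closed uact_add)
 then show ?case using insert.hyps by simp
qed

lemma hat_relations_Ann: "hat_relations \<subseteq> Ann"
proof
 fix u assume "u \<in> hat_relations"
 then obtain \<Psi> where u: "u = contract (Suc d) \<Psi> wh" unfolding hat_relations_def by blast
 have "range comm \<union> embed_W ` R \<subseteq> Ann"
  by (intro Un_least image_subsetI comm_Ann embed_R_Ann)
 then have s: "(\<lambda>s. wh (s @ t)) \<in> Ann" if "length t = Suc d" for t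
  using hat_slice[OF that] by (rule subsetD)
 have "u = (\<lambda>s. \<Sum>t | length t = Suc d. \<Psi> t * wh (s @ t))" by (simp add: u contract_def fun_eq_iff)
 also have "\<dots> \<in> Ann" by (rule Ann_sum[of _ "\<lambda>t s. wh (s @ t)"]) (use s in auto)
 finally show "u \<in> Ann" .
qed

lemma Q_Ann: "Q.I \<subseteq> Ann"
 by (rule Q.I_min[OF Ann_ideal hat_relations_Ann])

lemma embed_R_Q: "r \<in> R \<Longrightarrow> embed_W r \<in> Q.I"
proof -
 assume "r \<in> R"
 then obtain \<Psi> where \<Psi>: "r = contract d \<Psi> w" using rel by blast
 \<comment> \<open>Contraction against \<Psi> followed by the dual of z: on trailing words
   \<open>p z\<close> the coefficient of \<open>w_hat\<close> is (-1)^(d d) times that of w, and the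
   factor (-1)^d cancels this sign.\<close>
 define \<Phi> where "\<Phi> t = (if t \<noteq> [] \<and> last t = None then (- 1) ^ d * embed_W \<Psi> (butlast t) else 0)" for t :: "'n option list"
 have fin: "finite {t :: 'n option list. length t = Suc d}" by simp
 have "contract (Suc d) \<Phi> wh s = embed_W r s" for s
 proof -
  have "contract (Suc d) \<Phi> wh s = (\<Sum>t\<in>(\<lambda>p. map Some p @ [None]) ` {p. length p = d}. \<Phi> t * wh (s @ t))"
   unfolding contract_def
  proof (intro sum.mono_neutral_right ballI)
   fix t :: "'n option list" assume t: "t \<in> {t. length t = Suc d} - (\<lambda>p. map Some p @ [None]) ` {p. length p = d}"
   have "\<Phi> t = 0"
   proof (cases "t \<noteq> [] \<and> last t = None \<and> None \<notin> set (butlast t)")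
    case True
    then obtain p where p: "butlast t = map Some p" using words_Some by blast
    have "t = map Some p @ [None]" using True p by (metis append_butlast_last_id)
    then show ?thesis using t by auto
   qed (auto simp: \<Phi>_def embed_W_None)
   then show "\<Phi> t * wh (s @ t) = 0" by simp
  qed auto
  also have "\<dots> = (\<Sum>p | length p = d. (- 1) ^ d * \<Psi> p * wh (s @ map Some p @ [None]))"
   by (subst sum.reindex) (auto simp: inj_on_def \<Phi>_def embed_W_map inj_map_eq_map)
  also have "\<dots> = (\<Sum>p | length p = d. \<Psi> p * embed_W (\<lambda>s. w (s @ p)) s)"
  proof (intro sum.cong refl)
   fix p :: "'n list" assume "p \<in> {p. length p = d}"
   then have "(\<lambda>s. wh (s @ map Some p @ None # map Some [])) = embed_W (\<lambda>s. (- 1) ^ (d * length p) * w ([] @ s @ p))"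
    by (intro hat_slice_z) simp
   then have "wh (s @ map Some p @ None # map Some []) = embed_W (\<lambda>s. (- 1) ^ (d * length p) * w ([] @ s @ p)) s" by (rule fun_cong)
   then have "wh (s @ map Some p @ [None]) = (- 1) ^ (d * d) * embed_W (\<lambda>s. w (s @ p)) s"
    using \<open>p \<in> _\<close> by (simp add: embed_W_linear)
   then show "(- 1) ^ d * \<Psi> p * wh (s @ map Some p @ [None]) = \<Psi> p * embed_W (\<lambda>s. w (s @ p)) s"
    by (simp add: minus_one_power_iff)
  qed
  also have "\<dots> = embed_W r s" by (simp add: embed_W_def \<Psi> contract_def)
  finally show ?thesis .
 qed
 then have "embed_W r = contract (Suc d) \<Phi> wh" by (simp add: fun_eq_iff)
 moreover have "contract (Suc d) \<Phi> wh \<in> hat_relations"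
 proof -
  \<comment> \<open>Only the values on words of length d + 1 enter the contraction, so truncating
    turns it into a contraction by a tensor of that degree.\<close>
  let ?\<Phi> = "\<lambda>t. if length t = Suc d then \<Phi> t else 0"
  have "contract (Suc d) \<Phi> wh = contract (Suc d) ?\<Phi> wh" by (auto simp: contract_def fun_eq_iff intro!: sum.cong)
  moreover have "?\<Phi> \<in> tensors (Suc d)" by (simp add: tensors_def)
  ultimately show ?thesis unfolding hat_relations_def by blast
 qed
 ultimately show ?thesis using Q.X_I by simp
qed

text \<open>If v is the contraction of w against t, the relation is the contraction of
  \<open>w_hat\<close> against the dual of t; by \<open>span\<close> such vectors span V, and
  \<open>comm\<close> is linear.\<close>

lemma comm_Q: "comm v \<in> Q.I"
proof -
 obtain \<phi> where \<phi>: "v = (\<lambda>x. \<Sum>t | length t = Suc d. \<phi> t * w (x # t))" using span by blast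
 have c: "comm (\<lambda>b. w (b # t)) \<in> Q.I" if t: "length t = Suc d" for t
 proof -
  have "comm (\<lambda>b. w (b # t)) = contract (Suc d) (sgl (map Some t)) wh"
  proof
   fix s
   have "contract (Suc d) (sgl (map Some t)) wh s = (\<Sum>r | length r = Suc d. if r = map Some t then wh (s @ r) else 0)"
    unfolding contract_def by (intro sum.cong) (auto simp: sgl_def)
   also have "\<dots> = wh (s @ map Some t)" using t by simp
   finally show "comm (\<lambda>b. w (b # t)) s = contract (Suc d) (sgl (map Some t)) wh s"
    using fun_cong[OF hat_slice_no_z[OF t], of s] by simp
  qed
  moreover have "sgl (map Some t) \<in> tensors (Suc d)" using t by (auto simp: tensors_def sgl_def)
  ultimately have "comm (\<lambda>b. w (b # t)) \<in> hat_relations" unfolding hat_relations_def by blast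
  then show ?thesis by (rule Q.X_I)
 qed
 have "comm v = (\<lambda>s. \<Sum>t | length t = Suc d. \<phi> t * comm (\<lambda>b. w (b # t)) s)"
 proof
  fix s
  have "\<sigma> v a = (\<Sum>t | length t = Suc d. \<phi> t * \<sigma> (\<lambda>b. w (b # t)) a)" for a
   unfolding \<phi> by (rule lin_end_sum[OF sigma_lin]) simp
  then show "comm v s = (\<Sum>t | length t = Suc d. \<phi> t * comm (\<lambda>b. w (b # t)) s)"
   by (auto simp: comm_eq \<phi> sum_negf split: list.splits option.splits)
 qed
 also have "\<dots> \<in> Q.I"
 proof (rule subsp_sum[OF Q.I_subsp])
  fix t :: "'n list" assume "t \<in> {t. length t = Suc d}"
  then show "(\<lambda>s. \<phi> t * comm (\<lambda>b. w (b # t)) s) \<in> Q.I" using c Q.I_smult by simp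
 qed
 finally show ?thesis .
qed

lemma embed_I: "u \<in> I \<Longrightarrow> embed_W u \<in> Q.I"
proof -
 have "ideal {u \<in> carrier TT. embed_W u \<in> Q.I} TT"
 proof (rule idealI[OF TT_ring])
  show "subgroup {u \<in> carrier TT. embed_W u \<in> Q.I} (add_monoid TT)"
  proof (rule subgroup.intro)
   fix u :: "'n list \<Rightarrow> 'k" assume u: "u \<in> {u \<in> carrier TT. embed_W u \<in> Q.I}"
   then have "inv\<^bsub>add_monoid TT\<^esub> u = (\<lambda>s. (- 1) * u s)" using TT_minus[of u] by (simp add: a_inv_def)
   then show "inv\<^bsub>add_monoid TT\<^esub> u \<in> {u \<in> carrier TT. embed_W u \<in> Q.I}"
    using u Q.I_smult[of "embed_W u" "- 1"] TT_closed(4)[of u "- 1"] embed_W_linear(2)[of "- 1" u] by simp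
  qed (auto simp: TT_closed embed_W_linear Q.I_zero Q.I_add)
 qed (auto simp: TT_closed embed_W_mult embed_W_closed Q.I_lmult Q.I_rmult)
 then have "I \<subseteq> {u \<in> carrier TT. embed_W u \<in> Q.I}"
  by (rule I_min) (use embed_R_Q R_tensors tensors_TT in blast)
 then show "u \<in> I \<Longrightarrow> embed_W u \<in> Q.I" by blast
qed

text \<open>The map \<open>\<iota> : A \<rightarrow> T(W)/J\<close> induced by \<^const>\<open>embed_W\<close>.\<close>

definition emb where "emb Y = Q.cls (embed_W (co Y))"

lemma emb_cls: "u \<in> \<T> \<Longrightarrow> emb (cls u) = Q.cls (embed_W u)"
proof -
 assume u: "u \<in> \<T>"
 have "cls (co (cls u)) = cls u" by (rule cls_co) (rule cls_closed[OF u])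
 then have "(\<lambda>s. co (cls u) s - u s) \<in> I" by (simp only: cls_eq)
 then have "embed_W (\<lambda>s. co (cls u) s - u s) \<in> Q.I" by (rule embed_I)
 moreover have "embed_W (\<lambda>s. co (cls u) s - u s) = (\<lambda>s. embed_W (co (cls u)) s - embed_W u s)"
  by (auto simp: embed_W_def)
 ultimately show ?thesis unfolding emb_def Q.cls_eq by simp
qed

lemma emb_closed [simp]: "Y \<in> \<A> \<Longrightarrow> emb Y \<in> carrier Q.A"
 unfolding emb_def by (intro Q.cls_closed embed_W_closed co_TT)

lemma emb_simps:
 "Y \<in> \<A> \<Longrightarrow> Z \<in> \<A> \<Longrightarrow> emb (Y \<cdot> Z) = emb Y \<cdot>\<^sub>Q emb Z"
 "Y \<in> \<A> \<Longrightarrow> Z \<in> \<A> \<Longrightarrow> emb (Y +\<^sub>A Z) = emb Y +\<^sub>Q emb Z"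
 "emb 1\<^sub>A = 1\<^sub>Q" "emb 0\<^sub>A = 0\<^sub>Q" "Y \<in> \<A> \<Longrightarrow> emb (c *\<^sub>A Y) = c *\<^sub>Q emb Y"
proof -
 show "Y \<in> \<A> \<Longrightarrow> Z \<in> \<A> \<Longrightarrow> emb (Y \<cdot> Z) = emb Y \<cdot>\<^sub>Q emb Z"
  by (elim A_cases) (simp add: cls_hom emb_cls TT_closed embed_W_mult Q.cls_hom embed_W_closed)
 show "Y \<in> \<A> \<Longrightarrow> Z \<in> \<A> \<Longrightarrow> emb (Y +\<^sub>A Z) = emb Y +\<^sub>Q emb Z"
  by (elim A_cases) (simp add: cls_hom emb_cls TT_closed embed_W_linear Q.cls_hom embed_W_closed)
 show "emb 1\<^sub>A = 1\<^sub>Q" "emb 0\<^sub>A = 0\<^sub>Q"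
  by (simp_all add: cls_hom emb_cls TT_closed embed_W_linear embed_W_sgl Q.cls_hom)
 show "Y \<in> \<A> \<Longrightarrow> emb (c *\<^sub>A Y) = c *\<^sub>Q emb Y"
  by (elim A_cases) (simp add: cls_smult emb_cls TT_closed embed_W_linear Q.cls_smult)
qed

abbreviation "zpow k \<equiv> Q.cls (sgl (replicate k None))"

lemma zpow_closed [simp]: "zpow k \<in> carrier Q.A"
 by (intro Q.cls_closed TT_closed)

lemma z_zpow: "zpow 1 \<cdot>\<^sub>Q zpow k = zpow (Suc k)"
 by (simp add: Q.cls_hom TT_closed sgl_mult_sgl)

text \<open>By \<open>comm_Q\<close> the letter z passes one vector at a time, applying \<xi> to it;
  induction along words extends this to A.\<close>

lemma z_emb: "Y \<in> \<A> \<Longrightarrow> zpow 1 \<cdot>\<^sub>Q emb Y = emb (\<xi> Y) \<cdot>\<^sub>Q zpow 1"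
proof (erule A_cases)
 fix u assume u: "u \<in> \<T>" and Y: "Y = cls u"
 show ?thesis unfolding Y using u
 proof (induction u rule: TT_induct)
  case zero
  show ?case using emb_simps(4) by (simp add: cls_hom(4)[symmetric] xi_zero Q.cls_closed TT_closed)
 next
  case (sgl c p)
  have w: "zpow 1 \<cdot>\<^sub>Q emb (cls (sgl p)) = emb (\<xi> (cls (sgl p))) \<cdot>\<^sub>Q zpow 1"
  proof (induction p)
   case Nil
   show ?case by (simp add: cls_hom(3)[symmetric] emb_simps Q.cls_closed TT_closed)
  next
   case (Cons x p)
   have v: "vec_tensor (sgl x) = (sgl [x] :: 'n list \<Rightarrow> 'k)"
    by (auto simp: vec_tensor_def sgl_def fun_eq_iff split: list.splits)
   have s: "cls (sgl (x # p)) = vc (sgl x) \<cdot> cls (sgl p)"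
    by (simp add: vc_def v cls_hom TT_closed sgl_mult_sgl)
   have pA: "cls (sgl p) \<in> \<A>" by (intro cls_closed TT_closed)
   have "Q.cls (sgl [None] \<star> embed_W (vec_tensor (sgl x))) = Q.cls (embed_W (vec_tensor (\<sigma> (sgl x))) \<star> sgl [None])"
    using comm_Q[of "sgl x"] unfolding Q.cls_eq comm_def .
   then have zx: "zpow 1 \<cdot>\<^sub>Q emb (vc (sgl x)) = emb (vc (\<sigma> (sgl x))) \<cdot>\<^sub>Q zpow 1"
    by (simp add: vc_def emb_cls vec_TT Q.cls_hom TT_closed embed_W_closed)
   have "zpow 1 \<cdot>\<^sub>Q emb (cls (sgl (x # p))) = (zpow 1 \<cdot>\<^sub>Q emb (vc (sgl x))) \<cdot>\<^sub>Q emb (cls (sgl p))"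
    unfolding s using pA by (simp add: emb_simps Q.A.m_assoc del: replicate.simps One_nat_def)
   also have "\<dots> = emb (vc (\<sigma> (sgl x))) \<cdot>\<^sub>Q (zpow 1 \<cdot>\<^sub>Q emb (cls (sgl p)))"
    unfolding zx using pA by (simp add: Q.A.m_assoc del: replicate.simps One_nat_def)
   also have "\<dots> = (emb (vc (\<sigma> (sgl x))) \<cdot>\<^sub>Q emb (\<xi> (cls (sgl p)))) \<cdot>\<^sub>Q zpow 1"
    unfolding Cons using pA by (simp add: Q.A.m_assoc del: replicate.simps One_nat_def)
   also have "\<dots> = emb (\<xi> (cls (sgl (x # p)))) \<cdot>\<^sub>Q zpow 1"
    unfolding s using pA by (simp add: emb_simps xi_vc)
   finally show ?case .
  qed
  have pA: "cls (sgl p) \<in> \<A>" by (intro cls_closed TT_closed)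
  show ?case unfolding cls_smult[symmetric] using w pA
   by (simp add: emb_simps xi_hom(2) Q.smult_A smult_A del: replicate.simps One_nat_def)
 next
  case (add u v)
  show ?case unfolding cls_hom(2)[OF add(1,2), symmetric] using add cls_closed
   by (simp add: emb_simps Q.A.r_distr Q.A.l_distr del: replicate.simps One_nat_def)
 qed
qed

section \<open>Normal ordering and the isomorphism with the skew polynomial algebra\<close>

abbreviation "S \<equiv> skew_poly A \<xi>"

lemma S_carrier: "f \<in> carrier S \<longleftrightarrow> (\<forall>i. f i \<in> \<A>) \<and> finite {i. f i \<noteq> 0\<^sub>A}"
 by (simp add: skew_poly_def)

lemma S_seqs: "f \<in> carrier S \<Longrightarrow> f \<in> seqs" and S_fin: "f \<in> carrier S \<Longrightarrow> finite {i. f i \<noteq> 0\<^sub>A}"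
 by (simp_all add: S_carrier seqs_def)

definition "sone = (\<lambda>i::nat. if i = 0 then 1\<^sub>A else 0\<^sub>A)"

lemma S_simps: "one S = sone" "add S = (\<lambda>f g i. f i +\<^sub>A g i)" "smult S = (\<lambda>c f i. c *\<^sub>A f i)"
 "mult S = (\<lambda>f g n. \<Oplus>\<^bsub>A\<^esub>i\<in>{..n}. f i \<cdot> (\<xi> ^^ i) (g (n - i)))"
 "homog S n = {f. (\<forall>i. f i \<in> homog A (n - int i)) \<and> finite {i. f i \<noteq> 0\<^sub>A}}"
 by (simp_all add: skew_poly_def sone_def)

lemma sone_S: "sone \<in> carrier S"
 by (simp add: S_carrier sone_def)

text \<open>The normally ordered element \<open>\<Sum>\<^sub>k f\<^sub>k z\<^sup>k\<close> of \<open>T(W)\<close>.\<close>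

definition nord :: "(nat \<Rightarrow> ('n list \<Rightarrow> 'k) set) \<Rightarrow> 'n option list \<Rightarrow> 'k" where
 "nord f = (\<lambda>s. \<Sum>k\<in>{k. f k \<noteq> 0\<^sub>A}. (embed_W (co (f k)) \<star> sgl (replicate k None)) s)"

lemma co_zero: "co 0\<^sub>A = (\<lambda>_. 0)"
 by (simp add: co_linear fun_eq_iff)

lemma nord_term_closed: "f \<in> carrier S \<Longrightarrow> embed_W (co (f k)) \<star> sgl (replicate k None) \<in> \<T>"
 by (intro TT_closed embed_W_closed co_TT) (simp add: S_carrier)

lemma nord_closed: "f \<in> carrier S \<Longrightarrow> nord f \<in> \<T>"
 unfolding nord_def by (rule TT_sum_closed[OF S_fin nord_term_closed])

lemma nord_superset:
 assumes "finite F" "{k. f k \<noteq> 0\<^sub>A} \<subseteq> F"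
 shows "nord f = (\<lambda>s. \<Sum>k\<in>F. (embed_W (co (f k)) \<star> sgl (replicate k None)) s)"
 unfolding nord_def
 by (intro ext sum.mono_neutral_left) (use assms in \<open>auto simp: co_zero embed_W_linear TT_mult_linear\<close>)

lemma cls_nord:
 assumes f: "f \<in> carrier S" and F: "finite F" "{k. f k \<noteq> 0\<^sub>A} \<subseteq> F"
 shows "Q.cls (nord f) = (\<Oplus>\<^bsub>Q.A\<^esub>k\<in>F. emb (f k) \<cdot>\<^sub>Q zpow k)"
proof -
 have "f k \<in> \<A>" for k using f by (simp add: S_carrier)
 then have "emb (f k) \<cdot>\<^sub>Q zpow k = Q.cls (embed_W (co (f k)) \<star> sgl (replicate k None))" for k
  unfolding emb_def by (intro Q.cls_hom TT_closed embed_W_closed co_TT)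
 then show ?thesis unfolding nord_superset[OF F]
  by (simp add: Q.cls_finsum[OF F(1) nord_term_closed[OF f]])
qed

lemma uact_sum:
 "finite F \<Longrightarrow> f \<in> seqs \<Longrightarrow> (\<And>k. k \<in> F \<Longrightarrow> u k \<in> \<T>) \<Longrightarrow>
  uact (\<lambda>s. \<Sum>k\<in>F. u k s) f n = (\<Oplus>\<^bsub>A\<^esub>k\<in>F. uact (u k) f n)"
proof (induction F rule: finite_induct)
 case (insert k F)
 then have "uact (\<lambda>s. u k s + (\<Sum>k\<in>F. u k s)) f n = uact (u k) f n +\<^sub>A (\<Oplus>\<^bsub>A\<^esub>k\<in>F. uact (u k) f n)"
  by (subst uact_add) (auto intro!: TT_sum_closed)
 then show ?case using insert seqsD[OF uact_closed] by simp
qed (simp add: uact_zero)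

lemma xi_pow_closed: "Y \<in> \<A> \<Longrightarrow> (\<xi> ^^ k) Y \<in> \<A>"
 by (induction k) simp_all

lemma uact_nord:
 assumes f: "f \<in> carrier S" and g: "g \<in> seqs"
 shows "uact (nord f) g n = (\<Oplus>\<^bsub>A\<^esub>i\<in>{..n}. f i \<cdot> (\<xi> ^^ i) (g (n - i)))"
proof -
 let ?F = "{k. f k \<noteq> 0\<^sub>A} \<union> {..n}"
 have F: "finite ?F" "{k. f k \<noteq> 0\<^sub>A} \<subseteq> ?F" using S_fin[OF f] by auto
 have fA: "f k \<in> \<A>" for k using f by (simp add: S_carrier)
 have gA: "(\<xi> ^^ k) (g m) \<in> \<A>" for k m by (intro xi_pow_closed seqsD[OF g])
 have "uact (nord f) g n = (\<Oplus>\<^bsub>A\<^esub>k\<in>?F. uact (embed_W (co (f k)) \<star> sgl (replicate k None)) g n)"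
  unfolding nord_superset[OF F] by (rule uact_sum[OF F(1) g nord_term_closed[OF f]])
 also have "\<dots> = (\<Oplus>\<^bsub>A\<^esub>k\<in>?F. f k \<cdot> (if k \<le> n then (\<xi> ^^ k) (g (n - k)) else 0\<^sub>A))"
 proof (intro A.finsum_cong' refl)
  fix k
  show "uact (embed_W (co (f k)) \<star> sgl (replicate k None)) g n = f k \<cdot> (if k \<le> n then (\<xi> ^^ k) (g (n - k)) else 0\<^sub>A)"
   by (simp add: uact_mult TT_closed embed_W_closed co_TT fA g uact_embed uact_closed uact_z cls_co del: if_split_asm)
 qed (use fA gA in auto)
 also have "\<dots> = (\<Oplus>\<^bsub>A\<^esub>k\<in>{..n}. f k \<cdot> (if k \<le> n then (\<xi> ^^ k) (g (n - k)) else 0\<^sub>A))"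
  by (rule A.finsum_superset[symmetric]) (use F fA gA in auto)
 also have "\<dots> = (\<Oplus>\<^bsub>A\<^esub>k\<in>{..n}. f k \<cdot> (\<xi> ^^ k) (g (n - k)))"
  using fA gA by (intro A.finsum_cong') auto
 finally show ?thesis .
qed

lemma xi_pow_sone: "(\<xi> ^^ k) (sone m) = sone m"
 by (induction k) (auto simp: sone_def xi_zero)

lemma uact_nord_one: "f \<in> carrier S \<Longrightarrow> uact (nord f) sone n = f n"
proof -
 assume f: "f \<in> carrier S"
 have fA: "f k \<in> \<A>" for k using f by (simp add: S_carrier)
 have "uact (nord f) sone n = (\<Oplus>\<^bsub>A\<^esub>i\<in>{..n}. f i \<cdot> sone (n - i))"
  by (simp add: uact_nord f S_seqs sone_S xi_pow_sone)
 also have "\<dots> = f n \<cdot> sone (n - n)"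
  by (rule A.finsum_single) (use fA in \<open>auto simp: sone_def\<close>)
 finally show ?thesis using fA by (simp add: sone_def)
qed

lemma nord_linear:
 assumes f: "f \<in> carrier S" and g: "g \<in> carrier S"
 shows "Q.cls (nord (\<lambda>i. f i +\<^sub>A g i)) = Q.cls (nord f) +\<^sub>Q Q.cls (nord g)" "(\<lambda>i. f i +\<^sub>A g i) \<in> carrier S"
  "Q.cls (nord (\<lambda>i. c *\<^sub>A f i)) = c *\<^sub>Q Q.cls (nord f)" "(\<lambda>i. c *\<^sub>A f i) \<in> carrier S"
proof -
 have A: "f k \<in> \<A>" "g k \<in> \<A>" for k using f g by (simp_all add: S_carrier)
 let ?F = "{k. f k \<noteq> 0\<^sub>A} \<union> {k. g k \<noteq> 0\<^sub>A}"
 have F: "finite ?F" using S_fin[OF f] S_fin[OF g] by simp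
 have s1: "{k. f k +\<^sub>A g k \<noteq> 0\<^sub>A} \<subseteq> ?F" by auto
 show S1: "(\<lambda>i. f i +\<^sub>A g i) \<in> carrier S"
  using A finite_subset[OF s1 F] by (simp add: S_carrier)
 have "Q.cls (nord (\<lambda>i. f i +\<^sub>A g i)) = (\<Oplus>\<^bsub>Q.A\<^esub>k\<in>?F. emb (f k +\<^sub>A g k) \<cdot>\<^sub>Q zpow k)"
  by (rule cls_nord[OF S1 F s1])
 also have "\<dots> = (\<Oplus>\<^bsub>Q.A\<^esub>k\<in>?F. emb (f k) \<cdot>\<^sub>Q zpow k +\<^sub>Q emb (g k) \<cdot>\<^sub>Q zpow k)"
  using A by (intro Q.A.finsum_cong') (simp_all add: emb_simps Q.A.l_distr)
 also have "\<dots> = (\<Oplus>\<^bsub>Q.A\<^esub>k\<in>?F. emb (f k) \<cdot>\<^sub>Q zpow k) +\<^sub>Q (\<Oplus>\<^bsub>Q.A\<^esub>k\<in>?F. emb (g k) \<cdot>\<^sub>Q zpow k)"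
  using A by (intro Q.A.finsum_addf) auto
 also have "\<dots> = Q.cls (nord f) +\<^sub>Q Q.cls (nord g)"
  by (simp add: cls_nord[OF f F] cls_nord[OF g F])
 finally show "Q.cls (nord (\<lambda>i. f i +\<^sub>A g i)) = Q.cls (nord f) +\<^sub>Q Q.cls (nord g)" .
 have s2: "{k. c *\<^sub>A f k \<noteq> 0\<^sub>A} \<subseteq> {k. f k \<noteq> 0\<^sub>A}"
 proof (intro subsetI CollectI notI)
  fix k assume "k \<in> {k. c *\<^sub>A f k \<noteq> 0\<^sub>A}" "f k = 0\<^sub>A"
  then show False by (simp add: smult_A_zero)
 qed
 show S2: "(\<lambda>i. c *\<^sub>A f i) \<in> carrier S"
  using A finite_subset[OF s2 S_fin[OF f]] by (simp add: S_carrier smult_A)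
 have "nord (\<lambda>i. c *\<^sub>A f i) = (\<lambda>s. \<Sum>k\<in>{k. f k \<noteq> 0\<^sub>A}. (embed_W (co (c *\<^sub>A f k)) \<star> sgl (replicate k None)) s)"
  by (rule nord_superset[OF S_fin[OF f] s2])
 moreover have "co (c *\<^sub>A f k) = (\<lambda>s. c * co (f k) s)" for k using A by (simp add: co_linear fun_eq_iff)
 ultimately have "nord (\<lambda>i. c *\<^sub>A f i) = (\<lambda>s. c * nord f s)"
  by (simp add: nord_def embed_W_linear TT_mult_linear sum_distrib_left)
 then show "Q.cls (nord (\<lambda>i. c *\<^sub>A f i)) = c *\<^sub>Q Q.cls (nord f)" by (simp add: Q.cls_smult)
qed

lemma nord_one: "Q.cls (nord sone) = 1\<^sub>Q"
proof -
 have "Q.cls (nord sone) = (\<Oplus>\<^bsub>Q.A\<^esub>k\<in>{0}. emb (sone k) \<cdot>\<^sub>Q zpow k)"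
  by (rule cls_nord[OF sone_S]) (auto simp: sone_def)
 then show ?thesis by (simp add: sone_def emb_simps Q.cls_hom(3) TT_closed Q.cls_closed)
   (simp add: Q.cls_hom(3)[symmetric])
qed

text \<open>Words are built by prepending letters: a letter of V multiplies all coefficients from
  the left, and z applies \<xi> to the coefficients and raises every exponent, by
  \<open>z_emb\<close>.\<close>

lemma normal_ordering: "u \<in> \<T> \<Longrightarrow> \<exists>f\<in>carrier S. Q.cls u = Q.cls (nord f)"
proof (induction u rule: TT_induct)
 case zero
 have "(\<lambda>_. 0\<^sub>A) \<in> carrier S" by (simp add: S_carrier)
 moreover have "nord (\<lambda>_. 0\<^sub>A) = (\<lambda>_. 0)" by (simp add: nord_def)
 ultimately show ?case by metis
next
 case (add u v)
 then obtain f g where f: "f \<in> carrier S" "Q.cls u = Q.cls (nord f)" and g: "g \<in> carrier S" "Q.cls v = Q.cls (nord g)" by blast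
 have "Q.cls (\<lambda>s. u s + v s) = Q.cls u +\<^sub>Q Q.cls v" by (rule Q.cls_hom(2)[symmetric]) (rule add)+
 also have "\<dots> = Q.cls (nord (\<lambda>i. f i +\<^sub>A g i))" by (simp only: f(2) g(2) nord_linear(1)[OF f(1) g(1)])
 finally show ?case using nord_linear(2)[OF f(1) g(1)] by blast
next
 case (sgl c p)
 have "\<exists>f\<in>carrier S. Q.cls (sgl p) = Q.cls (nord f)"
 proof (induction p)
  case Nil
  have "Q.cls (sgl []) = Q.cls (nord sone)" by (simp only: nord_one Q.cls_hom(3))
  then show ?case using sone_S by blast
 next
  case (Cons a p)
  then obtain f where f: "f \<in> carrier S" "Q.cls (sgl p) = Q.cls (nord f)" by blast
  let ?F = "{k. f k \<noteq> 0\<^sub>A}"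
  have fA: "f k \<in> \<A>" for k using f by (simp add: S_carrier)
  have F: "finite ?F" by (rule S_fin[OF f(1)])
  have t: "emb (f k) \<cdot>\<^sub>Q zpow k \<in> carrier Q.A" for k using fA by simp
  have aC: "Q.cls (sgl [a]) \<in> carrier Q.A" by (intro Q.cls_closed TT_closed)
  have "Q.cls (sgl (a # p)) = Q.cls (sgl [a]) \<cdot>\<^sub>Q Q.cls (sgl p)"
   by (simp add: Q.cls_hom TT_closed sgl_mult_sgl)
  also have "\<dots> = Q.cls (sgl [a]) \<cdot>\<^sub>Q (\<Oplus>\<^bsub>Q.A\<^esub>k\<in>?F. emb (f k) \<cdot>\<^sub>Q zpow k)"
   unfolding f(2) cls_nord[OF f(1) F subset_refl] ..
  also have "\<dots> = (\<Oplus>\<^bsub>Q.A\<^esub>k\<in>?F. Q.cls (sgl [a]) \<cdot>\<^sub>Q (emb (f k) \<cdot>\<^sub>Q zpow k))"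
   by (rule Q.A.finsum_rdistr[OF F aC]) (use t in auto)
  finally have e: "Q.cls (sgl (a # p)) = (\<Oplus>\<^bsub>Q.A\<^esub>k\<in>?F. Q.cls (sgl [a]) \<cdot>\<^sub>Q (emb (f k) \<cdot>\<^sub>Q zpow k))" .
  show ?case
  proof (cases a)
   case (Some x)
   let ?g = "\<lambda>k. vc (sgl x) \<cdot> f k"
   have s: "{k. ?g k \<noteq> 0\<^sub>A} \<subseteq> ?F"
   proof (intro subsetI CollectI notI)
    fix k assume "k \<in> {k. ?g k \<noteq> 0\<^sub>A}" "f k = 0\<^sub>A"
    then show False by simp
   qed
   have gS: "?g \<in> carrier S" using fA finite_subset[OF s F] by (simp add: S_carrier)
   have v: "vec_tensor (sgl x) = (sgl [x] :: 'n list \<Rightarrow> 'k)"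
    by (auto simp: vec_tensor_def sgl_def fun_eq_iff split: list.splits)
   have "Q.cls (sgl [a]) = emb (vc (sgl x))"
    by (simp add: Some vc_def v emb_cls TT_closed embed_W_sgl)
   then have "Q.cls (sgl (a # p)) = (\<Oplus>\<^bsub>Q.A\<^esub>k\<in>?F. emb (?g k) \<cdot>\<^sub>Q zpow k)"
    unfolding e using fA by (intro Q.A.finsum_cong') (simp_all add: emb_simps Q.A.m_assoc)
   also have "\<dots> = Q.cls (nord ?g)" by (rule cls_nord[OF gS F s, symmetric])
   finally show ?thesis using gS by blast
  next
   case None
   let ?g = "\<lambda>k. case k of 0 \<Rightarrow> 0\<^sub>A | Suc m \<Rightarrow> \<xi> (f m)"
   have s: "{k. ?g k \<noteq> 0\<^sub>A} \<subseteq> Suc ` ?F"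
   proof
    fix k assume "k \<in> {k. ?g k \<noteq> 0\<^sub>A}"
    then obtain m where "k = Suc m" "\<xi> (f m) \<noteq> 0\<^sub>A" by (cases k) auto
    then show "k \<in> Suc ` ?F" using xi_zero by auto
   qed
   have F': "finite (Suc ` ?F)" using F by simp
   have gA: "?g k \<in> \<A>" for k using fA by (simp split: nat.splits)
   then have gS: "?g \<in> carrier S" using finite_subset[OF s F'] by (simp add: S_carrier)
   have z: "Q.cls (sgl [None]) = zpow 1" by simp
   have "Q.cls (sgl [a]) \<cdot>\<^sub>Q (emb (f k) \<cdot>\<^sub>Q zpow k) = emb (?g (Suc k)) \<cdot>\<^sub>Q zpow (Suc k)" for k
   proof -
    have "Q.cls (sgl [a]) \<cdot>\<^sub>Q (emb (f k) \<cdot>\<^sub>Q zpow k) = (zpow 1 \<cdot>\<^sub>Q emb (f k)) \<cdot>\<^sub>Q zpow k"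
     unfolding None z using fA by (intro Q.A.m_assoc[symmetric]) (auto simp del: replicate.simps One_nat_def)
    also have "\<dots> = emb (\<xi> (f k)) \<cdot>\<^sub>Q (zpow 1 \<cdot>\<^sub>Q zpow k)"
     unfolding z_emb[OF fA] using fA by (intro Q.A.m_assoc) (auto simp del: replicate.simps One_nat_def)
    finally show ?thesis by (simp only: z_zpow nat.case)
   qed
   then have "Q.cls (sgl (a # p)) = (\<Oplus>\<^bsub>Q.A\<^esub>k\<in>?F. emb (?g (Suc k)) \<cdot>\<^sub>Q zpow (Suc k))" unfolding e by simp
   also have "\<dots> = (\<Oplus>\<^bsub>Q.A\<^esub>k\<in>Suc ` ?F. emb (?g k) \<cdot>\<^sub>Q zpow k)"
    by (rule Q.A.finsum_reindex[symmetric, where h = Suc]) (use gA in \<open>auto simp del: replicate.simps\<close>)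
   also have "\<dots> = Q.cls (nord ?g)" by (rule cls_nord[OF gS F' s, symmetric])
   finally show ?thesis using gS by blast
  qed
 qed
 then obtain f where f: "f \<in> carrier S" "Q.cls (sgl p) = Q.cls (nord f)" by blast
 have "Q.cls (\<lambda>s. c * sgl p s) = c *\<^sub>Q Q.cls (sgl p)" by (rule Q.cls_smult[symmetric])
 also have "\<dots> = Q.cls (nord (\<lambda>i. c *\<^sub>A f i))" by (simp only: f(2) nord_linear(3)[OF f(1) f(1)])
 finally show ?case using nord_linear(4)[OF f(1) f(1)] by blast
qed

text \<open>The relations act as zero, so u and its normal form act alike on \<open>sone\<close>,
  and a normally ordered element applied to \<open>sone\<close> returns its own coefficients. This
  yields uniqueness of normal forms.\<close>

lemma cls_nord_act:
 assumes u: "u \<in> \<T>" and f: "f \<in> carrier S" and e: "Q.cls u = Q.cls (nord f)"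
 shows "f n = uact u sone n"
proof -
 have nc: "nord f \<in> \<T>" by (rule nord_closed[OF f])
 have "(\<lambda>s. u s - nord f s) \<in> Ann" using e Q_Ann unfolding Q.cls_eq by blast
 then have z: "uact (\<lambda>s. u s - nord f s) sone n = 0\<^sub>A" using S_seqs[OF sone_S] by (simp add: Ann_def)
 have "uact u sone n = uact (\<lambda>s. (u s - nord f s) + nord f s) sone n" by simp
 also have "\<dots> = uact (\<lambda>s. u s - nord f s) sone n +\<^sub>A uact (nord f) sone n"
  by (rule uact_add[OF S_seqs[OF sone_S] TT_closed(6)[OF u nc] nc])
 also have "\<dots> = f n" using f by (simp add: z uact_nord_one S_carrier)
 finally show ?thesis by (rule sym)
qed

text \<open>Both kinds of letters raise the sum of position and degree by one: z the position,
  letters of V the degree.\<close>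

lemma uact_homog:
 assumes u: "u \<in> tensors m" shows "uact u sone n \<in> homog A (int m - int n)"
proof -
 have w: "wact s sone n \<in> homog A (int (length s) - int n)" for s n
 proof (induction s arbitrary: n)
  case Nil
  show ?case using G.one_homog G.H_zero by (simp add: wact_simps sone_def)
 next
  case (Cons a s)
  show ?case
  proof (cases a)
   case None
   then show ?thesis using Cons G.H_zero xi_hom(3)
    by (cases n) (simp_all add: wact_simps gact_def)
  next
   case (Some x)
   have "vc (sgl x) \<cdot> wact s sone n \<in> homog A (1 + (int (length s) - int n))"
    by (rule G.homog_mult[OF vc_homog Cons])
   then show ?thesis using Some by (simp add: wact_simps gact_def algebra_simps)
  qed
 qed
 have len: "length s = m" if "u s \<noteq> 0" for s using u that unfolding tensors_def by blast
 have "u s *\<^sub>A wact s sone n \<in> homog A (int m - int n)" if "u s \<noteq> 0" for s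
  using smult_homog[OF w[of s n], of "u s"] len[OF that] by simp
 then show ?thesis unfolding uact_def using TT_fin[OF tensors_TT[OF u]] by (intro G.H_finsum) auto
qed

text \<open>Normal ordering gives surjectivity and the action on \<open>sone\<close> injectivity.
  The same action computes the normal form of a product and finds there the skew
  multiplication.\<close>

theorem skew_poly_iso: "(\<lambda>f. Q.cls (nord f)) \<in> graded_alg_iso S Q.A"
proof -
 let ?h = "\<lambda>f. Q.cls (nord f)"
 have closed: "?h f \<in> carrier Q.A" if "f \<in> carrier S" for f by (intro Q.cls_closed nord_closed that)
 have mult: "?h (f \<otimes>\<^bsub>S\<^esub> g) = ?h f \<cdot>\<^sub>Q ?h g" if f: "f \<in> carrier S" and g: "g \<in> carrier S" for f g
 proof -
  let ?u = "nord f \<star> nord g"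
  have u: "?u \<in> \<T>" using nord_closed[OF f] nord_closed[OF g] by (rule TT_closed(7))
  obtain k where k: "k \<in> carrier S" "Q.cls ?u = Q.cls (nord k)" using normal_ordering[OF u] by blast
  have g1: "uact (nord g) sone = g" by (rule ext) (rule uact_nord_one[OF g])
  have "k n = uact ?u sone n" for n by (rule cls_nord_act[OF u k])
  \<comment> \<open>The second factor sends \<open>sone\<close> to g, and by
    \<open>uact_nord\<close> acting with the first on g is the skew product.\<close>
  then have "k n = uact (nord f) g n" for n
   by (simp only: uact_mult[OF nord_closed[OF f] nord_closed[OF g] S_seqs[OF sone_S]] g1)
  then have "k n = (f \<otimes>\<^bsub>S\<^esub> g) n" for n by (simp add: uact_nord[OF f S_seqs[OF g]] S_simps)
  then have "k = f \<otimes>\<^bsub>S\<^esub> g" by (rule ext)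
  then have "?h (f \<otimes>\<^bsub>S\<^esub> g) = Q.cls ?u" by (simp only: k(2))
  also have "\<dots> = ?h f \<cdot>\<^sub>Q ?h g" by (rule Q.cls_hom(1)[symmetric]) (rule nord_closed[OF f] nord_closed[OF g])+
  finally show ?thesis .
 qed
 have hom: "?h \<in> ring_hom S Q.A"
 proof (rule ring_hom_memI)
  show "?h (f \<oplus>\<^bsub>S\<^esub> g) = ?h f +\<^sub>Q ?h g" if "f \<in> carrier S" "g \<in> carrier S" for f g
   using nord_linear(1)[OF that] by (simp add: S_simps)
  show "?h \<one>\<^bsub>S\<^esub> = 1\<^sub>Q" by (simp only: S_simps nord_one)
 qed (use closed mult in auto)
 have inj: "inj_on ?h (carrier S)"
 proof (rule inj_onI)
  fix f g assume f: "f \<in> carrier S" and g: "g \<in> carrier S" and e: "?h f = ?h g"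
  have "g n = f n" for n
   using cls_nord_act[OF nord_closed[OF f] g e, of n] by (simp only: uact_nord_one[OF f])
  then show "f = g" by (simp add: fun_eq_iff)
 qed
 have "?h ` carrier S = carrier Q.A"
 proof (intro equalityI subsetI)
  fix Y assume "Y \<in> carrier Q.A"
  then obtain u where u: "u \<in> \<T>" "Y = Q.cls u" by (rule Q.A_cases)
  then show "Y \<in> ?h ` carrier S" using normal_ordering[OF u(1)] by blast
 qed (use closed in auto)
 then have iso: "?h \<in> ring_iso S Q.A" using hom inj by (simp add: ring_iso_def bij_betw_def)
 have hS: "f \<in> carrier S" if "f \<in> homog S n" for f n using that G.H_sub by (auto simp: S_simps S_carrier)
 have hg: "?h ` homog S n = homog Q.A n" for n
 proof (intro equalityI subsetI)
  fix Y assume "Y \<in> ?h ` homog S n"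
  then obtain f where f: "f \<in> homog S n" "Y = ?h f" by blast
  have fi: "f i \<in> homog A (n - int i)" for i using f(1) by (simp add: S_simps)
  have "nord f \<in> homog TT n"
  proof (cases "n < 0")
   case True
   then have "f i = 0\<^sub>A" for i using fi[of i] homog_neg[of "n - int i"] by simp
   then show ?thesis using True by (simp add: Q.homog_TT nord_def)
  next
   case False
   have "nord f s = 0" if l: "length s \<noteq> nat n" for s unfolding nord_def
   proof (intro sum.neutral ballI)
    fix k assume k: "k \<in> {k. f k \<noteq> 0\<^sub>A}"
    \<comment> \<open>A nonzero coefficient forces the exponent to be at most n, so
      \<open>nat (n - int k) + k\<close> below really equals \<open>nat n\<close>.\<close>
    then have kn: "int k \<le> n" using fi[of k] homog_neg[of "n - int k"] by force
    have "co (f k) \<in> tensors (nat (n - int k))"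
     unfolding tensors_def using co_homog[OF fi[of k]] kn by auto
    moreover have "sgl (replicate k None) \<in> tensors k" by (auto simp: tensors_def sgl_def)
    ultimately have "embed_W (co (f k)) \<star> sgl (replicate k None) \<in> tensors (nat (n - int k) + k)"
     by (intro mult_tensors(1) embed_W_tensors)
    then show "(embed_W (co (f k)) \<star> sgl (replicate k None)) s = 0"
     using l kn by (simp add: tensors_def)
   qed
   then have "nord f \<in> tensors (nat n)" by (simp add: tensors_def)
   then show ?thesis using False by (simp add: tensor_algebra_def)
  qed
  then show "Y \<in> homog Q.A n" unfolding Q.homog_A f(2) by (rule imageI)
 next
  fix Y assume Y: "Y \<in> homog Q.A n"
  then obtain u where u: "u \<in> homog TT n" "Y = Q.cls u" unfolding Q.homog_A by blast
  have uc: "u \<in> \<T>" using u(1) tensors_TT TT_closed(1) by (auto simp: Q.homog_TT split: if_splits)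
  obtain f where f: "f \<in> carrier S" "Q.cls u = ?h f" using normal_ordering[OF uc] by blast
  have "f i \<in> homog A (n - int i)" for i
  proof (cases "n < 0")
   case True
   then have "u = (\<lambda>_. 0)" using u(1) by (simp add: Q.homog_TT)
   then have "f i = 0\<^sub>A" using cls_nord_act[OF uc f, of i] by (simp add: uact_zero)
   then show ?thesis using G.H_zero by simp
  next
   case False
   then have "u \<in> tensors (nat n)" using u(1) by (simp add: Q.homog_TT)
   from uact_homog[OF this, of i] show ?thesis using False cls_nord_act[OF uc f, of i] by simp
  qed
  then have "f \<in> homog S n" using S_fin[OF f(1)] by (simp add: S_simps)
  then show "Y \<in> ?h ` homog S n" using f(2) u(2) by blast
 qed
 have sm: "?h (c \<odot>\<^bsub>S\<^esub> f) = c *\<^sub>Q ?h f" if "f \<in> carrier S" for c f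
  using nord_linear(3)[OF that that] by (simp add: S_simps)
 show ?thesis unfolding graded_alg_iso_def graded_alg_hom_def
  using hom iso hg sm by blast
qed

end

section \<open>Assembling the two isomorphisms\<close>

lemma graded_alg_iso_id: "(\<lambda>x. x) \<in> graded_alg_iso A A"
 by (auto simp: graded_alg_iso_def graded_alg_hom_def ring_iso_def ring_hom_def bij_betw_def)

text \<open>The functionals \<open>wp d j\<close>, divided by the factor c between w and the basis
  vector, turn combinations of the rows \<open>lam\<close> into contractions of w with
  words.\<close>

lemma (in quad) top_span_words:
 assumes kz: "koszul A" and AS: "AS_regular A (Suc d)" and w: "w \<in> W (Suc d)" "w \<noteq> (\<lambda>_. 0)"
  and c: "c \<noteq> 0" "w = (\<lambda>s. c * wb (Suc d) 0 s)"
 shows "\<exists>\<phi>. v = (\<lambda>x. \<Sum>t | length t = d. \<phi> t * w (x # t))"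
proof -
 obtain \<psi> where \<psi>: "v = (\<lambda>x. \<Sum>j<wm d. \<psi> j * lam d 0 j x)" using top_span[OF kz AS w] by blast
 have "(\<Sum>t | length t = d. (\<Sum>j<wm d. \<psi> j / c * wp d j t) * w (x # t)) = (\<Sum>j<wm d. \<psi> j * lam d 0 j x)" for x
 proof -
  have "(\<Sum>t | length t = d. (\<Sum>j<wm d. \<psi> j / c * wp d j t) * w (x # t)) =
    (\<Sum>j<wm d. \<psi> j * (\<Sum>t | length t = d. wp d j t * wb (Suc d) 0 (x # t)))"
   unfolding c(2) sum_distrib_right sum_distrib_left by (subst sum.swap) (use c(1) in simp)
  then show ?thesis by (simp add: lam_def prj_def)
 qed
 then show ?thesis unfolding \<psi> by (intro exI[of _ "\<lambda>t. \<Sum>j<wm d. \<psi> j / c * wp d j t"]) simp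
qed

theorem theorem4p4:
  fixes R :: "('n::finite list \<Rightarrow> 'k::field_char_0) set"
    and \<xi> :: "('n list \<Rightarrow> 'k) set \<Rightarrow> ('n list \<Rightarrow> 'k) set"
    and w :: "'n list \<Rightarrow> 'k"
    and d :: nat
  assumes "quadratic_relations R"
    and "koszul (presented_alg R)"
    and "2 \<le> d"
    and "AS_regular (presented_alg R) d"
    and "nakayama_automorphism (presented_alg R) d \<xi>"
    and "w \<in> (\<Inter>i\<in>{0..d - 2}. relation_slot R i (d - 2 - i))"
    and "w \<noteq> (\<lambda>_. 0)"
  shows "(twisted_superpotential d (restrict_V R \<xi>) w \<and>
          graded_alg_iso (presented_alg R) (derivation_quotient d w) \<noteq> {}) \<and>
         (superpotential (d + 1) (w_hat d (restrict_V R \<xi>) w) \<and>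
          graded_alg_iso (skew_poly (presented_alg R) \<xi>)
            (derivation_quotient (d + 1) (w_hat d (restrict_V R \<xi>) w)) \<noteq> {})"
proof -
  interpret quad R by (rule quad.intro) fact
  have "\<xi> \<in> graded_alg_iso A A" using assms(5) by (simp add: nakayama_automorphism_def)
  then interpret quad_automorphism R \<xi> by unfold_locales
  obtain e where d: "d = Suc (Suc e)" using assms(3) by (metis add_2_eq_Suc le_Suc_ex)
  note kz = assms(2) and AS = assms(4)[unfolded d] and nak = assms(5)[unfolded d]
  have wW: "w \<in> W (Suc (Suc e))" using relation_slots_W[OF assms(3,6)] by (simp only: d)
  note w = wW assms(7)
  obtain c where c: "c \<noteq> 0" "w = (\<lambda>s. c * wb (Suc (Suc e)) 0 s)" using top_multiple[OF kz AS w] by blast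
  have rot: "rotates (Suc e) (restrict_V R \<xi>) w" by (rule top_rotates[OF kz top_dim[OF kz AS w] nak c(2)])
  have rel: "R = {contract e \<Psi> w | \<Psi>. \<Psi> \<in> tensors e}" by (rule relations_eq_contractions[OF kz AS w])
  interpret twisted_potential R \<xi> e w
    by unfold_locales (rule rot wW rel top_span_words[OF kz AS w c])+
  \<comment> \<open>R is the set of contractions itself, so both algebras are the same quotient and
    the identity is the isomorphism.\<close>
  have "derivation_quotient d w = A" unfolding derivation_quotient_def d using rel by simp
  then have "graded_alg_iso A (derivation_quotient d w) \<noteq> {}" using graded_alg_iso_id by auto
  moreover have "derivation_quotient (d + 1) (w_hat d (restrict_V R \<xi>) w) = Q.A"
    by (simp add: derivation_quotient_def d hat_relations_def)
  then have "graded_alg_iso (skew_poly A \<xi>) (derivation_quotient (d + 1) (w_hat d (restrict_V R \<xi>) w)) \<noteq> {}"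
    using skew_poly_iso by auto
  ultimately show ?thesis
    using rot w_hat_superpotential[OF rot sigma_lin] by (simp add: d twisted_superpotential_iff)
qed

end
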